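(* Let $\nu>0$. For any $\omega_0\in L^1(\mathbb R^2)$, the equation $$\partial_t\omega-\nu\Delta\omega+y\,\partial_x\omega+u\cdot\nabla\omega=0,\qquad u=\nabla^\perp\Delta^{-1}\omega,\qquad \omega|_{t=0}=\omega_0,\qquad (t,x,y)\in\mathbb R^+\times\mathbb R^2,$$ has a unique global mild solution $$\omega\in C\bigl([0,+\infty);L^1(\mathbb R^2)\bigr)\cap C\bigl((0,+\infty);L^\infty(\mathbb R^2)\bigr).$$ Moreover $t\mapsto\|\omega(t)\|_{L^1}$ is non-increasing, and there is a universal constant $C$ such that for all $1\le p\le+\infty$ and all $t>0$, $$\|\omega(t)\|_{L^p}\le C(\nu t)^{\frac1p-1}\|\omega_0\|_{L^1}.$$
   Context: $\nabla^\perp=(-\partial_y,\partial_x)$, and $u=\nabla^\perp\Delta^{-1}\omega$ is given by the Biot–Savart law $u(z)=\frac1{2\pi}\int_{\mathbb R^2}\frac{(z-z')^\perp}{|z-z'|^2}\omega(z')\,dz'$ with $(z_1,z_2)^\perp=(-z_2,z_1)$. The fundamental solution (with initial datum $\delta$ at the origin) of the linear equation $\partial_t\omega-\nu\Delta\omega+y\partial_x\omega=0$ is $$G_L(t,x,y)=\frac1{4\pi\nu t\,(1+\frac{t^2}{12})^{1/2}}\exp\Bigl(-\frac{x^2}{4\nu t(1+\frac{t^2}3)}-\frac{\bigl((1+\frac{t^2}3)y-\frac t2x\bigr)^2}{4\nu t(1+\frac{t^2}3)(1+\frac{t^2}{12})}\Bigr).$$ $S(t)$ denotes the associated solution semigroup: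 $[S(t)f](x,y)=\int_{\mathbb R^2}G_L(t,x-x'-ty',y-y')f(x',y')\,dx'dy'$. Mild solution on $(0,T)$ (global: $T=+\infty$): $\omega(t)=S(t-t_0)\omega(t_0)-\int_{t_0}^tS(t-s)\,\mathrm{div}(u(s)\omega(s))\,ds$ for all $0<t_0<t<T$, where $u(s)=\nabla^\perp\Delta^{-1}\omega(s)$; the initial condition means $\omega(0)=\omega_0$. *)

theory Defs
  imports "HOL-Analysis.Analysis" "HOL-Probability.Essential_Supremum"
begin

text \<open>
  The plane is \<open>real \<times> real\<close> with its Euclidean norm. Elements of \<open>L\<^sup>p\<close> are represented by Borel
  functions; every Lebesgue class has such a representative. Equality in \<open>L\<^sup>p\<close> is equality
  almost everywhere.
\<close>

definition Lp_norm :: "ennreal \<Rightarrow> (real \<times> real \<Rightarrow> real) \<Rightarrow> ennreal" where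
  "Lp_norm p f =
    (if p = \<infinity> then esssup lborel (\<lambda>z. ennreal \<bar>f z\<bar>)
     else let I = \<integral>\<^sup>+ z. ennreal (\<bar>f z\<bar> powr enn2real p) \<partial>lborel in
       if I = \<infinity> then \<infinity> else ennreal (enn2real I powr (1 / enn2real p)))"

definition in_Lp :: "ennreal \<Rightarrow> (real \<times> real \<Rightarrow> real) \<Rightarrow> bool" where
  "in_Lp p f \<longleftrightarrow> f \<in> borel_measurable lborel \<and> Lp_norm p f < \<infinity>"

definition continuous_on_Lp :: "ennreal \<Rightarrow> real set \<Rightarrow> (real \<Rightarrow> real \<times> real \<Rightarrow> real) \<Rightarrow> bool" where
  "continuous_on_Lp p J \<omega> \<longleftrightarrow>
    (\<forall>t\<in>J. in_Lp p (\<omega> t) \<and>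
      ((\<lambda>s. Lp_norm p (\<lambda>z. \<omega> s z - \<omega> t z)) \<longlongrightarrow> 0) (at t within J))"

definition perp :: "real \<times> real \<Rightarrow> real \<times> real" where
  "perp z = (- snd z, fst z)"

text \<open>The integrand takes the value 0 at the singular point \<open>z' = z\<close>, a null set.\<close>

definition biot_savart :: "(real \<times> real \<Rightarrow> real) \<Rightarrow> real \<times> real \<Rightarrow> real \<times> real" where
  "biot_savart \<omega> z =
    (1 / (2 * pi)) *\<^sub>R (LINT z'|lborel. (\<omega> z' / (norm (z - z'))\<^sup>2) *\<^sub>R perp (z - z'))"

definition G_L :: "real \<Rightarrow> real \<Rightarrow> real \<Rightarrow> real \<Rightarrow> real" where
  "G_L \<nu> t x y =
    1 / (4 * pi * \<nu> * t * sqrt (1 + t\<^sup>2 / 12)) *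
    exp (- x\<^sup>2 / (4 * \<nu> * t * (1 + t\<^sup>2 / 3))
         - ((1 + t\<^sup>2 / 3) * y - t / 2 * x)\<^sup>2 / (4 * \<nu> * t * (1 + t\<^sup>2 / 3) * (1 + t\<^sup>2 / 12)))"

definition S_kernel :: "real \<Rightarrow> real \<Rightarrow> real \<times> real \<Rightarrow> real \<times> real \<Rightarrow> real" where
  "S_kernel \<nu> t z z' = G_L \<nu> t (fst z - fst z' - t * snd z') (snd z - snd z')"

text \<open>Only used for positive times.\<close>

definition S :: "real \<Rightarrow> real \<Rightarrow> (real \<times> real \<Rightarrow> real) \<Rightarrow> real \<times> real \<Rightarrow> real" where
  "S \<nu> t f z = (LINT z'|lborel. S_kernel \<nu> t z z' * f z')"

definition grad :: "(real \<times> real \<Rightarrow> real) \<Rightarrow> real \<times> real \<Rightarrow> real \<times> real" where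
  "grad \<phi> z = (deriv (\<lambda>x. \<phi> (x, snd z)) (fst z), deriv (\<lambda>y. \<phi> (fst z, y)) (snd z))"

text \<open>
  \<open>S_div \<nu> t F\<close> is \<open>S(t) div F\<close>. The field \<open>F = u \<omega>\<close> need not be differentiable, so the divergence
  is the distributional one: it is paired with the kernel, a Schwartz function of \<open>z'\<close>, which
  moves the derivative onto the kernel and produces the sign.
\<close>

definition S_div :: "real \<Rightarrow> real \<Rightarrow> (real \<times> real \<Rightarrow> real \<times> real) \<Rightarrow> real \<times> real \<Rightarrow> real" where
  "S_div \<nu> t F z = - (LINT z'|lborel. grad (S_kernel \<nu> t z) z' \<bullet> F z')"

text \<open>
  For \<open>\<omega>\<close> in \<open>C((0,T); L\<^sup>1) \<inter> C((0,T); L\<^sup>\<infinity>)\<close> all integrals below converge absolutely at every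
  point \<open>z\<close>: \<open>u(s) \<omega>(s)\<close> is bounded in \<open>L\<^sup>\<infinity>\<close> for \<open>s \<in> [t0, t]\<close>, the gradient of the kernel has
  \<open>L\<^sup>1\<close> norm of order \<open>(t - s)\<^sup>-\<^sup>1\<^sup>/\<^sup>2\<close>, and the integrand is continuous in \<open>s\<close>. So the time integral
  can be taken pointwise in \<open>z\<close>.
\<close>

definition mild_solution :: "real \<Rightarrow> ereal \<Rightarrow> (real \<Rightarrow> real \<times> real \<Rightarrow> real) \<Rightarrow> bool" where
  "mild_solution \<nu> T \<omega> \<longleftrightarrow>
    (\<forall>t0 t. 0 < t0 \<and> t0 < t \<and> ereal t < T \<longrightarrow>
      (AE z in lborel. \<omega> t z =
        S \<nu> (t - t0) (\<omega> t0) z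
        - (LINT s:{t0<..<t}|lborel.
            S_div \<nu> (t - s) (\<lambda>z'. \<omega> s z' *\<^sub>R biot_savart (\<omega> s) z') z)))"

definition global_mild_solution ::
  "real \<Rightarrow> (real \<times> real \<Rightarrow> real) \<Rightarrow> (real \<Rightarrow> real \<times> real \<Rightarrow> real) \<Rightarrow> bool" where
  "global_mild_solution \<nu> \<omega>0 \<omega> \<longleftrightarrow>
    continuous_on_Lp 1 {0..} \<omega> \<and>
    continuous_on_Lp \<infinity> {0<..} \<omega> \<and>
    (AE z in lborel. \<omega> 0 z = \<omega>0 z) \<and>
    mild_solution \<nu> \<infinity> \<omega>"

end

(*
A vortex method with exact conservation laws. For bounded data the velocity field is replaced by random
jumps: every vortex z0 turns its surroundings by an area preserving twist, whose mean effect, divided by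
the jump intensity, is the transport by the Biot-Savart field. Each jump, like the semigroup S, is an
average of measure preserving maps, so by Jensen's inequality no convex functional of the vorticity grows:
the L^1 norm, the L^p norms and the excess integrals of max 0 (|w| - k). Nash's inequality for S, iterated
over the powers 2^k, gives |w(t)| <= 4 |w0|_1 / (nu t) with no use of the jumps.

The only norms needed besides L^1 and L^infinity are suprema of the potential of |w| with kernel 1/|z|.
Splitting w at a level k bounds this potential at time s by A + e / sqrt s, where e is as small as one
likes since the excess at high levels stays small uniformly in time. With such a bound the Duhamel
formula yields stability in L^1 by a singular Gronwall argument. Stability makes the schemes converge as
the jump size and the truncation of the data are removed together. For uniqueness, an arbitrary mild
solution coincides after any positive time t0 with the solution constructed from its value at t0, so it
inherits the decay and the excess bound; stability is then applied from t0 on, and t0 tends to 0.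
*)

theory Submission
  imports Defs "HOL-Probability.Distributions"
begin

text \<open>The obstacle is that the problem is critical in L^1. The gradient of the kernel costs
  \<open>1 / sqrt (t - s)\<close>, the velocity may grow like \<open>1 / sqrt s\<close>, and the
  time integral of the product does not shrink with the time interval. No weight and no short time
  makes it small; only a small coefficient \<open>e\<close> does, and for this reason the excess at
  high levels is propagated. Jumps can replace transport because consistency is tested by duality:
  the displacement of the vorticity is moved onto the kernel of \<open>S\<close>, so the vorticity
  is never differentiated. The price is the bound \<open>b\<close> of the data in the error. The
  kernel is expanded with exponent 3/2, between first and second order, since the second order error
  has the singularity 1 / (t - s), which is not integrable in time. To preserve area without polar
  coordinates or Jacobians, angular velocities are rounded to multiples of the jump size, so that a
  twist is piecewise one of countably many rotations, and rotations are written with rational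
  coefficients as three shears.\<close>

abbreviation nn_lborel :: "('a::euclidean_space => ennreal) => ennreal" (binder "NN " 10)
  where "nn_lborel f \<equiv> nn_integral lborel f"

abbreviation lborel_integral :: "('a::euclidean_space => 'b::{banach, second_countable_topology}) => 'b" (binder "LI " 10)
  where "lborel_integral f \<equiv> integral\<^sup>L lborel f"

abbreviation borel_fun :: "('a::topological_space => 'b::topological_space) => bool"
  where "borel_fun f \<equiv> f \<in> borel_measurable borel"

abbreviation joint_borel :: "'a measure => ('a => 'b::euclidean_space => 'c::topological_space) => bool"
  where "joint_borel M F \<equiv> (\<lambda>(x, z). F x z) \<in> borel_measurable (M \<Otimes>\<^sub>M lborel)"

section \<open>Gaussian densities\<close>

definition gauss :: "real => real => real" where
  "gauss v x = exp (- x\<^sup>2 / (2 * v)) / sqrt (2 * pi * v)"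

lemma gauss_eq_normal_density: "v > 0 ==> gauss v x = normal_density 0 (sqrt v) x"
  by (simp add: gauss_def normal_density_def)

lemma gauss_pos: "v > 0 ==> gauss v x > 0"
  by (simp add: gauss_def)

lemma gauss_nonneg [simp]: "v > 0 ==> gauss v x >= 0"
  using gauss_pos[of v x] by linarith

lemma gauss_minus [simp]: "gauss v (- x) = gauss v x"
  by (simp add: gauss_def)

lemma gauss_commute: "gauss v (x - y) = gauss v (y - x)"
  by (metis gauss_minus minus_diff_eq)

lemma gauss_le: "v > 0 ==> gauss v x <= 1 / sqrt (2 * pi * v)"
  unfolding gauss_def by (intro divide_right_mono) auto

lemma borel_measurable_gauss [measurable (raw)]:
  assumes [measurable]: "f \<in> borel_measurable M" "g \<in> borel_measurable M"
  shows "(%z. gauss (f z) (g z)) \<in> borel_measurable M"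
  unfolding gauss_def by measurable

lemma nn_integral_shift:
  fixes f :: "real => ennreal"
  assumes [measurable]: "borel_fun f"
  shows "(NN x. f (x + c)) = (NN x. f x)"
    "(NN x. f (x - c)) = (NN x. f x)"
    "(NN x. f (c - x)) = (NN x. f x)"
    "(NN x. f (c + x)) = (NN x. f x)"
  using nn_integral_real_affine[of f 1 c] nn_integral_real_affine[of f 1 "-c"]
    nn_integral_real_affine[of f "-1" c] by (auto simp: algebra_simps)

lemma nn_integral_gauss [simp]:
  assumes "v > 0" shows "(NN x. ennreal (gauss v x)) = 1"
proof -
  have "(NN x. ennreal (gauss v x)) = ennreal (LI x. normal_density 0 (sqrt v) x)"
    using assms by (subst nn_integral_eq_integral[symmetric]) (auto simp: gauss_eq_normal_density)
  then show ?thesis using assms by simp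
qed

lemma nn_integral_gauss_conv:
  assumes "v > 0" "w > 0"
  shows "(NN y. ennreal (gauss v (x - y) * gauss w (y - x'))) = ennreal (gauss (v + w) (x - x'))"
proof -
  have "(NN y. ennreal (gauss v (x - y) * gauss w (y - x')))
      = (NN y. ennreal (gauss v ((x - x') - y) * gauss w y))"
    using nn_integral_shift(2)[of "%y. ennreal (gauss v ((x - x') - y) * gauss w y)" x']
    by (simp add: algebra_simps)
  also have "... = ennreal (gauss (v + w) (x - x'))"
    using fun_cong[OF conv_normal_density_zero_mean[of "sqrt v" "sqrt w"], of "x - x'"] assms
    by (simp add: gauss_eq_normal_density)
  finally show ?thesis .
qed

lemma gauss_scale:
  assumes "v > 0" "k > 0"
  shows "gauss v (k * x) = gauss (v / k\<^sup>2) x / k"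
proof -
  have "sqrt (2 * pi * (v / k\<^sup>2)) = sqrt (2 * pi * v) / k"
    using assms by (simp add: real_sqrt_divide real_sqrt_mult)
  moreover have "- (k * x)\<^sup>2 / (2 * v) = - x\<^sup>2 / (2 * (v / k\<^sup>2))"
    using assms by (simp add: field_simps power_mult_distrib)
  ultimately show ?thesis
    using assms unfolding gauss_def by (simp add: field_simps)
qed

text \<open>Completing the square in \<open>y\<close>: the centre is the mean of \<open>a\<close>
  and \<open>b\<close> weighted by inverse variances. The identity isolates the dependence on
  \<open>y\<close>, which has to be integrated against a third Gaussian in
  \<open>kern_semigroup\<close>.\<close>

lemma gauss_mult:
  assumes "p > 0" "q > 0"
  shows "gauss p (a - y) * gauss q (y - b)
    = gauss (p + q) (a - b) * gauss (p * q / (p + q)) (y - (q * a + p * b) / (p + q))"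
proof -
  have pq: "p + q > 0" using assms by simp
  have key: "(a - y)\<^sup>2 / p + (y - b)\<^sup>2 / q
     = (a - b)\<^sup>2 / (p + q) + (y - (q * a + p * b) / (p + q))\<^sup>2 / (p * q / (p + q))"
  proof -
    have e1: "(y - (q * a + p * b) / (p + q)) = (y * (p + q) - (q * a + p * b)) / (p + q)"
      using pq by (simp add: field_simps)
    have e2: "(y - (q * a + p * b) / (p + q))\<^sup>2 / (p * q / (p + q))
       = (y * (p + q) - (q * a + p * b))\<^sup>2 / (p * q * (p + q))"
      unfolding e1 using pq assms by (simp add: power_divide power2_eq_square)
    have e3: "(a - y)\<^sup>2 * (q * (p + q)) + (y - b)\<^sup>2 * (p * (p + q)) =
      (a - b)\<^sup>2 * (p * q) + (y * (p + q) - (q * a + p * b))\<^sup>2"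
      by (simp add: power2_eq_square algebra_simps)
    have "(a - y)\<^sup>2 / p + (y - b)\<^sup>2 / q
      = ((a - y)\<^sup>2 * (q * (p + q)) + (y - b)\<^sup>2 * (p * (p + q))) / (p * q * (p + q))"
      using assms pq by (simp add: add_divide_distrib)
    also have "... = (a - b)\<^sup>2 / (p + q) + (y * (p + q) - (q * a + p * b))\<^sup>2 / (p * q * (p + q))"
      unfolding e3 using assms pq by (simp add: add_divide_distrib)
    finally show ?thesis unfolding e2 .
  qed
  have s: "sqrt (2 * pi * p) * sqrt (2 * pi * q) = sqrt (2 * pi * (p + q)) * sqrt (2 * pi * (p * q / (p + q)))"
    using pq by (simp add: real_sqrt_mult[symmetric])
  have "exp (- (a - y)\<^sup>2 / (2 * p)) * exp (- (y - b)\<^sup>2 / (2 * q))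
     = exp (- (a - b)\<^sup>2 / (2 * (p + q))) * exp (- (y - (q * a + p * b) / (p + q))\<^sup>2 / (2 * (p * q / (p + q))))"
    unfolding exp_add[symmetric]
  proof (rule arg_cong[where f = exp])
    show "- (a - y)\<^sup>2 / (2 * p) + - (y - b)\<^sup>2 / (2 * q) =
      - (a - b)\<^sup>2 / (2 * (p + q)) + - (y - (q * a + p * b) / (p + q))\<^sup>2 / (2 * (p * q / (p + q)))"
    proof -
      have h: "- u / (2 * c) = - (u / c) / 2" for u c :: real by simp
      have l: "X + Y = Z + U ==> - X / 2 + - Y / 2 = - Z / 2 + - U / 2" for X Y Z U :: real
        by simp
      show ?thesis unfolding h by (rule l[OF key])
    qed
  qed
  then show ?thesis unfolding gauss_def times_divide_times_eq s by simp
qed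

lemma exp_decay1: "u * exp (- u\<^sup>2 / 4) <= (1::real)"
proof -
  have "u <= 1 + u\<^sup>2 / 4" using zero_le_power2[of "u / 2 - 1"] by (simp add: power2_eq_square algebra_simps)
  also have "... <= exp (u\<^sup>2 / 4)" by (rule exp_ge_add_one_self)
  finally show ?thesis by (simp add: exp_minus field_simps)
qed

lemma exp_decay2: "(1 + u\<^sup>2) * exp (- u\<^sup>2 / 4) <= (4::real)"
proof -
  have "1 + u\<^sup>2 <= 4 * (1 + u\<^sup>2 / 4)" by simp
  also have "... <= 4 * exp (u\<^sup>2 / 4)" by (intro mult_left_mono exp_ge_add_one_self) simp
  finally show ?thesis by (simp add: exp_minus field_simps)
qed

text \<open>Doubling the variance splits off half of the exponent, and this half absorbs any
  polynomial factor at the cost of a constant. All bounds on moments and derivatives are therefore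
  stated with \<open>gauss (2 * v)\<close>, whose integral is again 1.\<close>

lemma gauss_double:
  assumes "v > 0"
  shows "gauss v x = sqrt 2 * gauss (2 * v) x * exp (- (x / sqrt v)\<^sup>2 / 4)"
proof -
  have "- x\<^sup>2 / (2 * v) = - x\<^sup>2 / (2 * (2 * v)) + - (x / sqrt v)\<^sup>2 / 4"
    using assms by (simp add: power_divide field_simps)
  then have e: "exp (- x\<^sup>2 / (2 * v)) = exp (- x\<^sup>2 / (2 * (2 * v))) * exp (- (x / sqrt v)\<^sup>2 / 4)"
    by (simp only: exp_add)
  have s: "sqrt (2 * pi * (2 * v)) = sqrt 2 * sqrt (2 * pi * v)"
    by (simp add: real_sqrt_mult)
  show ?thesis unfolding gauss_def e s using assms by (simp add: field_simps)
qed

lemma sqrt2_le: "sqrt 2 <= 3 / 2"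
  by (rule real_le_lsqrt) (auto simp: power2_eq_square)

lemma gauss_moment1:
  assumes "v > 0"
  shows "\<bar>x\<bar> * gauss v x <= 2 * sqrt v * gauss (2 * v) x"
proof -
  have g: "gauss (2 * v) x >= 0" using assms by simp
  have "\<bar>x\<bar> * gauss v x = sqrt 2 * sqrt v * gauss (2 * v) x * (\<bar>x / sqrt v\<bar> * exp (- \<bar>x / sqrt v\<bar>\<^sup>2 / 4))"
    using assms by (simp add: gauss_double[of v] power_divide)
  also have "... <= sqrt 2 * sqrt v * gauss (2 * v) x * 1"
    using assms g by (intro mult_left_mono exp_decay1) auto
  also have "... <= 2 * sqrt v * gauss (2 * v) x"
    using assms g sqrt2_le by (simp add: mult_right_mono)
  finally show ?thesis .
qed

lemma gauss_moment2:
  assumes "v > 0"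
  shows "(1 + x\<^sup>2 / v) * gauss v x <= 6 * gauss (2 * v) x"
proof -
  have g: "gauss (2 * v) x >= 0" using assms by simp
  have "(1 + x\<^sup>2 / v) * gauss v x = sqrt 2 * gauss (2 * v) x * ((1 + (x / sqrt v)\<^sup>2) * exp (- (x / sqrt v)\<^sup>2 / 4))"
    using assms by (simp add: gauss_double[of v] power_divide)
  also have "... <= sqrt 2 * gauss (2 * v) x * 4"
    using assms g by (intro mult_left_mono exp_decay2) auto
  also have "... = (sqrt 2 * 4) * gauss (2 * v) x" by simp
  also have "... <= 6 * gauss (2 * v) x"
    using g sqrt2_le by (intro mult_right_mono) auto
  finally show ?thesis .
qed

definition dgauss :: "real => real => real" where
  "dgauss v x = - (x / v) * gauss v x"

lemma borel_measurable_dgauss [measurable (raw)]: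
  assumes [measurable]: "f \<in> borel_measurable M" "g \<in> borel_measurable M"
  shows "(%z. dgauss (f z) (g z)) \<in> borel_measurable M"
  unfolding dgauss_def by measurable

lemma gauss_has_derivative [derivative_intros]:
  assumes "v > 0" "(f has_real_derivative f') (at x within A)"
  shows "((%x. gauss v (f x)) has_real_derivative dgauss v (f x) * f') (at x within A)"
proof -
  have "(gauss v has_real_derivative dgauss v y) (at y)" for y
  proof -
    have "((%x. exp (- x\<^sup>2 * (1 / (2 * v))) * (1 / sqrt (2 * pi * v))) has_real_derivative dgauss v y) (at y)"
      unfolding dgauss_def gauss_def
      by (rule derivative_eq_intros refl)+ (use assms(1) in \<open>simp add: field_simps\<close>)
    then show ?thesis unfolding gauss_def[abs_def] by simp
  qed
  from DERIV_chain2[OF this assms(2)] show ?thesis .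
qed

lemma dgauss_has_derivative [derivative_intros]:
  assumes "v > 0" "(f has_real_derivative f') (at x within A)"
  shows "((%x. dgauss v (f x)) has_real_derivative ((f x)\<^sup>2 / v - 1) / v * gauss v (f x) * f') (at x within A)"
proof -
  have "(dgauss v has_real_derivative (y\<^sup>2 / v - 1) / v * gauss v y) (at y)" for y
  proof -
    have "((%x. - (1 / v) * x * gauss v x) has_real_derivative (y\<^sup>2 / v - 1) / v * gauss v y) (at y)"
      by (rule derivative_eq_intros refl gauss_has_derivative assms(1))+
        (use assms(1) in \<open>simp add: dgauss_def field_simps power2_eq_square\<close>)
    then show ?thesis unfolding dgauss_def[abs_def] by simp
  qed
  from DERIV_chain2[OF this assms(2)] show ?thesis .
qed

lemma dgauss_le:
  assumes "v > 0" shows "\<bar>dgauss v x\<bar> <= 2 / sqrt v * gauss (2 * v) x"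
proof -
  have "\<bar>dgauss v x\<bar> = \<bar>x\<bar> * gauss v x / v" using assms by (simp add: dgauss_def abs_mult)
  also have "... <= 2 * sqrt v * gauss (2 * v) x / v"
    using assms by (intro divide_right_mono gauss_moment1) auto
  also have "... = 2 / sqrt v * gauss (2 * v) x"
    using assms real_div_sqrt[of v] by (simp add: field_simps)
  finally show ?thesis .
qed

lemma ddgauss_le:
  assumes "v > 0" shows "\<bar>(x\<^sup>2 / v - 1) / v * gauss v x\<bar> <= 6 / v * gauss (2 * v) x"
proof -
  have "\<bar>x\<^sup>2 / v - 1\<bar> <= 1 + x\<^sup>2 / v" using assms
    by (smt (verit) divide_nonneg_pos zero_le_power2)
  then have "\<bar>(x\<^sup>2 / v - 1) / v * gauss v x\<bar> <= (1 + x\<^sup>2 / v) * gauss v x / v"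
    using assms by (simp add: abs_mult divide_right_mono mult_right_mono)
  also have "... <= 6 * gauss (2 * v) x / v"
    using assms by (intro divide_right_mono gauss_moment2) auto
  finally show ?thesis by simp
qed

lemma nn_integral_dgauss:
  assumes "v > 0" shows "(NN x. ennreal \<bar>dgauss v x\<bar>) <= ennreal (2 / sqrt v)"
proof -
  have "(NN x. ennreal \<bar>dgauss v x\<bar>) <= (NN x. ennreal (2 / sqrt v) * ennreal (gauss (2 * v) x))"
    using assms dgauss_le[OF assms] by (intro nn_integral_mono) (simp add: ennreal_mult[symmetric])
  also have "... = ennreal (2 / sqrt v)" using assms by (subst nn_integral_cmult) auto
  finally show ?thesis .
qed

lemma nn_integral_ddgauss:
  assumes "v > 0" shows "(NN x. ennreal \<bar>(x\<^sup>2 / v - 1) / v * gauss v x\<bar>) <= ennreal (6 / v)"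
proof -
  have "(NN x. ennreal \<bar>(x\<^sup>2 / v - 1) / v * gauss v x\<bar>)
    <= (NN x. ennreal (6 / v) * ennreal (gauss (2 * v) x))"
    using assms ddgauss_le[OF assms] by (intro nn_integral_mono) (simp add: ennreal_mult[symmetric])
  also have "... = ennreal (6 / v)" using assms by (subst nn_integral_cmult) auto
  finally show ?thesis .
qed

text \<open>The average of the derivative over the segment is kept on the right, in
  \<open>ennreal\<close>, so that an integral in \<open>x\<close> can later be exchanged with it by
  Tonelli.\<close>

lemma abs_FTC_le:
  fixes f f' :: "real => real"
  assumes d: "!!x. (f has_real_derivative f' x) (at x)" and c: "continuous_on UNIV f'"
  shows "ennreal \<bar>f (x - a) - f x\<bar> <= (NN \<theta>. ennreal (\<bar>a\<bar> * \<bar>f' (x - \<theta> * a)\<bar>) * indicator {0..1} \<theta>)"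
proof -
  have cont: "continuous_on {0..1} (%\<theta>. - a * f' (x - \<theta> * a))"
    by (intro continuous_intros continuous_on_compose2[OF c]) auto
  have der: "((%\<theta>. f (x - \<theta> * a)) has_real_derivative - a * f' (x - \<theta> * a)) (at \<theta>)" for \<theta>
    by (rule DERIV_cong[OF DERIV_chain2[OF d]]) (auto intro!: derivative_eq_intros)
  have "(%\<theta>. indicator {0..1} \<theta> *\<^sub>R (- a * f' (x - \<theta> * a))) \<in> borel_measurable lborel"
    using borel_measurable_continuous_on_indicator[OF _ cont] by simp
  have F: "(LI \<theta>. indicator {0..1} \<theta> *\<^sub>R (- a * f' (x - \<theta> * a))) = f (x - 1 * a) - f (x - 0 * a)"
  proof (rule integral_FTC_Icc[where F = "%\<theta>. f (x - \<theta> * a)", OF _ _ cont])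
    show "((%\<theta>. f (x - \<theta> * a)) has_vector_derivative - a * f' (x - \<theta> * a)) (at \<theta> within {0..1})" for \<theta>
      using has_field_derivative_at_within[OF der] by (simp add: has_real_derivative_iff_has_vector_derivative)
  qed simp
  have "ennreal \<bar>f (x - a) - f x\<bar> = ennreal (norm (LI \<theta>. indicator {0..1} \<theta> *\<^sub>R (- a * f' (x - \<theta> * a))))"
    using F by simp
  also have "... <= (NN \<theta>. ennreal (norm (indicator {0..1} \<theta> *\<^sub>R (- a * f' (x - \<theta> * a)))))"
    by (rule integral_norm_bound_ennreal) (use borel_integrable_atLeastAtMost'[OF cont] in \<open>simp add: set_integrable_def\<close>)
  also have "... = (NN \<theta>. ennreal (\<bar>a\<bar> * \<bar>f' (x - \<theta> * a)\<bar>) * indicator {0..1} \<theta>)"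
    by (intro nn_integral_cong) (auto simp: abs_mult indicator_def)
  finally show ?thesis .
qed

text \<open>Minkowski's integral inequality: for each \<open>\<theta>\<close> the inner function is
  a translate of \<open>f'\<close> and has the same integral.\<close>

lemma translation_variation:
  fixes f f' :: "real => real"
  assumes d: "!!x. (f has_real_derivative f' x) (at x)" and c: "continuous_on UNIV f'"
    and b: "(NN x. ennreal \<bar>f' x\<bar>) <= ennreal B" "B >= 0"
  shows "(NN x. ennreal \<bar>f (x - a) - f x\<bar>) <= ennreal (\<bar>a\<bar> * B)"
proof -
  have [measurable]: "borel_fun f'"
    using c by (rule borel_measurable_continuous_onI)
  have "(NN x. ennreal \<bar>f (x - a) - f x\<bar>)
    <= (NN x. NN \<theta>. ennreal (\<bar>a\<bar> * \<bar>f' (x - \<theta> * a)\<bar>) * indicator {0..1} \<theta>)"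
    by (intro nn_integral_mono abs_FTC_le d c)
  also have "... = (NN \<theta>. NN x. ennreal (\<bar>a\<bar> * \<bar>f' (x - \<theta> * a)\<bar>) * indicator {0..1} \<theta>)"
    by (rule lborel_pair.Fubini') simp
  also have "... <= (NN \<theta>. ennreal (\<bar>a\<bar> * B) * indicator {0..1::real} \<theta>)"
  proof (intro nn_integral_mono)
    fix \<theta> :: real
    have "(NN x. ennreal (\<bar>a\<bar> * \<bar>f' (x - \<theta> * a)\<bar>) * indicator {0..1} \<theta>)
      = ennreal \<bar>a\<bar> * (NN x. ennreal \<bar>f' (x - \<theta> * a)\<bar>) * indicator {0..1} \<theta>"
      by (subst nn_integral_multc, simp) (simp add: ennreal_mult nn_integral_cmult)
    also have "... <= ennreal \<bar>a\<bar> * ennreal B * indicator {0..1} \<theta>"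
      using b nn_integral_shift(2)[of "%x. ennreal \<bar>f' x\<bar>" "\<theta> * a"]
      by (intro mult_mono) auto
    finally show "(NN x. ennreal (\<bar>a\<bar> * \<bar>f' (x - \<theta> * a)\<bar>) * indicator {0..1} \<theta>)
      <= ennreal (\<bar>a\<bar> * B) * indicator {0..1} \<theta>" using b(2) by (simp add: ennreal_mult)
  qed
  also have "... = ennreal (\<bar>a\<bar> * B)" by (simp add: nn_integral_cmult)
  finally show ?thesis .
qed

lemma continuous_on_gauss: "v > 0 ==> continuous_on A (gauss v)" "v > 0 ==> continuous_on A (dgauss v)"
  unfolding gauss_def[abs_def] dgauss_def[abs_def] by (auto intro!: continuous_intros)

lemma gauss_variation:
  assumes "v > 0"
  shows "(NN x. ennreal \<bar>gauss v (x - a) - gauss v x\<bar>) <= ennreal (2 * \<bar>a\<bar> / sqrt v)"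
proof -
  have "(gauss v has_real_derivative dgauss v x) (at x)" for x
    using gauss_has_derivative[OF assms DERIV_ident, of x UNIV] by simp
  from translation_variation[OF this continuous_on_gauss(2)[OF assms] nn_integral_dgauss[OF assms], of a]
  show ?thesis using assms by (simp add: mult.commute)
qed

lemma dgauss_variation:
  assumes "v > 0"
  shows "(NN x. ennreal \<bar>dgauss v (x - a) - dgauss v x\<bar>) <= ennreal (6 * \<bar>a\<bar> / v)"
proof -
  have "continuous_on UNIV (%x. (x\<^sup>2 / v - 1) / v * gauss v x)"
    using assms by (intro continuous_intros continuous_on_gauss) auto
  moreover have "(dgauss v has_real_derivative (x\<^sup>2 / v - 1) / v * gauss v x) (at x)" for x
    using dgauss_has_derivative[OF assms DERIV_ident, of x UNIV] by simp
  ultimately show ?thesis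
  using translation_variation[OF _ _ nn_integral_ddgauss[OF assms], of "dgauss v" a]
    assms by (simp add: mult.commute)
qed

lemma gauss_variation2:
  assumes v: "v > 0"
  shows "(NN x. ennreal \<bar>gauss v (x - a) - gauss v x + a * dgauss v x\<bar>) <= ennreal (6 * a\<^sup>2 / v)"
proof -
  have "ennreal \<bar>gauss v (x - a) - gauss v x + a * dgauss v x\<bar>
    <= (NN \<theta>. ennreal (\<bar>a\<bar> * \<bar>dgauss v (x - \<theta> * a) - dgauss v x\<bar>) * indicator {0..1} \<theta>)" for x
  proof -
    \<comment> \<open>Freezing \<open>x\<close> in the linear term makes the Taylor remainder an
      increment of one function of \<open>t\<close>, whose derivative is a difference of values of
      \<open>dgauss\<close>; \<open>dgauss_variation\<close> then supplies the second power of
      \<open>a\<close>.\<close>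
    have "((%t. gauss v t - t * dgauss v x) has_real_derivative dgauss v t - dgauss v x) (at t)" for t
      using v by (auto intro!: derivative_eq_intros)
    moreover have "continuous_on UNIV (%t. dgauss v t - dgauss v x)"
      by (intro continuous_intros continuous_on_gauss v)
    ultimately have "ennreal \<bar>(%t. gauss v t - t * dgauss v x) (x - a) - (%t. gauss v t - t * dgauss v x) x\<bar>
      <= (NN \<theta>. ennreal (\<bar>a\<bar> * \<bar>dgauss v (x - \<theta> * a) - dgauss v x\<bar>) * indicator {0..1} \<theta>)"
      by (rule abs_FTC_le)
    then show ?thesis by (simp add: algebra_simps)
  qed
  then have "(NN x. ennreal \<bar>gauss v (x - a) - gauss v x + a * dgauss v x\<bar>)
    <= (NN x. NN \<theta>. ennreal (\<bar>a\<bar> * \<bar>dgauss v (x - \<theta> * a) - dgauss v x\<bar>) * indicator {0..1} \<theta>)"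
    by (intro nn_integral_mono) auto
  also have "... = (NN \<theta>. NN x. ennreal (\<bar>a\<bar> * \<bar>dgauss v (x - \<theta> * a) - dgauss v x\<bar>) * indicator {0..1} \<theta>)"
    by (rule lborel_pair.Fubini') simp
  also have "... <= (NN \<theta>. ennreal (6 * a\<^sup>2 / v) * indicator {0..1::real} \<theta>)"
  proof (intro nn_integral_mono)
    fix \<theta> :: real
    have "(NN x. ennreal (\<bar>a\<bar> * \<bar>dgauss v (x - \<theta> * a) - dgauss v x\<bar>) * indicator {0..1} \<theta>)
      = ennreal \<bar>a\<bar> * (NN x. ennreal \<bar>dgauss v (x - \<theta> * a) - dgauss v x\<bar>) * indicator {0..1} \<theta>"
      by (subst nn_integral_multc, simp) (simp add: ennreal_mult nn_integral_cmult)
    also have "... <= ennreal \<bar>a\<bar> * ennreal (6 * \<bar>\<theta> * a\<bar> / v) * indicator {0..1} \<theta>"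
      by (intro mult_mono dgauss_variation v) auto
    also have "... <= ennreal (6 * a\<^sup>2 / v) * indicator {0..1} \<theta>"
    proof (cases "\<theta> \<in> {0..1}")
      case True
      have "\<bar>a\<bar> * (6 * \<bar>\<theta> * a\<bar> / v) = \<theta> * (6 * a\<^sup>2 / v)"
        using True by (simp add: abs_mult power2_eq_square)
      also have "... <= 1 * (6 * a\<^sup>2 / v)" using True v by (intro mult_right_mono) auto
      finally show ?thesis using True v by (simp add: ennreal_mult[symmetric])
    qed simp
    finally show "(NN x. ennreal (\<bar>a\<bar> * \<bar>dgauss v (x - \<theta> * a) - dgauss v x\<bar>) * indicator {0..1} \<theta>)
      <= ennreal (6 * a\<^sup>2 / v) * indicator {0..1} \<theta>" .
  qed
  also have "... = ennreal (6 * a\<^sup>2 / v)" by (simp add: nn_integral_cmult)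
  finally show ?thesis .
qed

section \<open>The kernel of the semigroup\<close>

lemma borel_measurable_fst_snd [measurable (raw)]:
  fixes f :: "_ => 'a::second_countable_topology \<times> 'b::second_countable_topology"
  assumes "f \<in> borel_measurable M"
  shows "(%x. fst (f x)) \<in> borel_measurable M" "(%x. snd (f x)) \<in> borel_measurable M"
  using assms measurable_fst'[of f M borel borel] measurable_snd'[of f M borel borel]
  by (simp_all add: borel_prod)

lemma nn_integral_plane:
  fixes f :: "real \<times> real => ennreal"
  assumes [measurable]: "borel_fun f"
  shows "(NN z. f z) = (NN y. NN x. f (x, y))"
    and "(NN z. f z) = (NN x. NN y. f (x, y))"
proof -
  have [measurable]: "f \<in> borel_measurable (lborel \<Otimes>\<^sub>M lborel)"
    by (simp add: lborel_prod)
  show "(NN z. f z) = (NN y. NN x. f (x, y))"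
    by (subst lborel_pair.nn_integral_snd) (simp_all add: lborel_prod)
  show "(NN z. f z) = (NN x. NN y. f (x, y))"
    by (subst lborel.nn_integral_fst) (simp_all add: lborel_prod)
qed

text \<open>Tonelli and translation invariance on each line. Every area preserving change of
  variables below, including rotations and vortex jumps, is reduced to these two identities.\<close>

lemma nn_integral_shear:
  fixes f :: "real \<times> real => ennreal"
  assumes [measurable]: "borel_fun f"
  shows "(NN z. f (fst z + k * snd z + c, snd z + d)) = (NN z. f z)" (is ?x)
    and "(NN z. f (fst z, snd z + k * fst z)) = (NN z. f z)" (is ?y)
proof -
  have "(NN z. f (fst z + k * snd z + c, snd z + d))
    = (NN y. NN x. f (x + (k * y + c), y + d))"
    by (subst nn_integral_plane(1)) (simp_all add: add.assoc)
  also have "... = (NN y. NN x. f (x, y + d))"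
    by (intro nn_integral_cong nn_integral_shift(1)) simp
  also have "... = (NN y. NN x. f (x, y))"
    by (rule nn_integral_shift(1)[of "%y. NN x. f (x, y)"]) simp
  finally show ?x by (simp add: nn_integral_plane(1))
  have "(NN z. f (fst z, snd z + k * fst z)) = (NN x. NN y. f (x, y + k * x))"
    by (subst nn_integral_plane(2)) simp_all
  also have "... = (NN x. NN y. f (x, y))"
    by (intro nn_integral_cong nn_integral_shift(1)) simp
  finally show ?y by (simp add: nn_integral_plane(2))
qed

lemma nn_integral_product:
  fixes A B :: "real => ennreal"
  assumes [measurable]: "borel_fun A" "borel_fun B"
  shows "(NN z. A (fst z) * B (snd z)) = (NN x. A x) * (NN y. B y)"
  by (subst nn_integral_plane(1)) (simp_all add: nn_integral_multc nn_integral_cmult)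

lemma nn_integral_sheared_product:
  fixes A B :: "real => real"
  assumes [measurable]: "borel_fun A" "borel_fun B"
    and "!!x. A x >= 0" "!!x. B x >= 0"
  shows "(NN z. ennreal (A (fst z + k * snd z + c) * B (snd z + d)))
    = (NN x. ennreal (A x)) * (NN y. ennreal (B y))"
  using nn_integral_shear(1)[of "%z. ennreal (A (fst z) * B (snd z))" k c d] assms
  by (simp add: nn_integral_product[symmetric] ennreal_mult)

text \<open>In probabilistic terms: given the heights \<open>y'\<close> and \<open>y\<close> at both
  ends, the vertical Brownian motion is a bridge whose time integral has mean
  \<open>t * (y + y') / 2\<close> and variance \<open>2 * nu * t ^ 3 / 12\<close>. Adding the
  horizontal noise \<open>2 * nu * t\<close> gives \<open>xvar\<close>, and subtracting the mean
  gives \<open>xdisp\<close>.\<close>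

definition xvar :: "real => real => real" where
  "xvar nu t = 2 * nu * t * (1 + t\<^sup>2 / 12)"

definition xdisp :: "real => real \<times> real => real \<times> real => real" where
  "xdisp t z z' = fst z - fst z' - t * (snd z + snd z') / 2"

definition ydisp :: "real \<times> real => real \<times> real => real" where
  "ydisp z z' = snd z - snd z'"

definition kern :: "real => real => real \<times> real => real \<times> real => real" where
  "kern nu t z z' = gauss (xvar nu t) (xdisp t z z') * gauss (2 * nu * t) (ydisp z z')"

lemma xvar_pos: "nu > 0 ==> t > 0 ==> xvar nu t > 0"
  by (simp add: xvar_def pos_add_strict)

lemma xvar_ge: "nu > 0 ==> t > 0 ==> 2 * nu * t <= xvar nu t"
  by (simp add: xvar_def)

text \<open>The quadratic form in \<open>G_L\<close> is diagonal in \<open>X - t / 2 * Y\<close> and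
  \<open>Y\<close>, that is, in \<open>xdisp\<close> and \<open>ydisp\<close>. The kernel becomes a
  product of two Gaussians on the line, and all kernel estimates below reduce to one
  dimension.\<close>

lemma S_kernel_eq:
  assumes "nu > 0" "t > 0"
  shows "S_kernel nu t z z' = kern nu t z z'"
proof -
  define u where "u = 1 + t\<^sup>2 / 3"
  define v where "v = 1 + t\<^sup>2 / 12"
  define X where "X = fst z - fst z' - t * snd z'"
  define Y where "Y = snd z - snd z'"
  have pos: "u > 0" "v > 0" by (auto simp: u_def v_def add_pos_nonneg)
  have uv: "u = v + t\<^sup>2 / 4" by (simp add: u_def v_def)
  have xd: "xdisp t z z' = X - t / 2 * Y"
    by (simp add: xdisp_def X_def Y_def algebra_simps add_divide_distrib diff_divide_distrib)
  have "X\<^sup>2 * v + ((v + T\<^sup>2) * Y - T * X)\<^sup>2 = (v + T\<^sup>2) * ((X - T * Y)\<^sup>2 + Y\<^sup>2 * v)" for T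
    by (simp add: power2_eq_square algebra_simps)
  from this[of "t / 2"]
  have alg: "X\<^sup>2 * v + (u * Y - t / 2 * X)\<^sup>2 = u * ((X - t / 2 * Y)\<^sup>2 + Y\<^sup>2 * v)"
    unfolding uv by (simp add: power_divide)
  have nz: "nu * t ~= 0" using assms by simp
  have "- X\<^sup>2 / (4 * nu * t * u) - (u * Y - t / 2 * X)\<^sup>2 / (4 * nu * t * u * v)
    = - (X\<^sup>2 * v + (u * Y - t / 2 * X)\<^sup>2) / (4 * nu * t * u * v)"
    using pos nz by (simp add: add_divide_distrib diff_divide_distrib)
  also have "... = - (X - t / 2 * Y)\<^sup>2 / (2 * xvar nu t) + - Y\<^sup>2 / (2 * (2 * nu * t))"
  proof -
    have "- (X - t / 2 * Y)\<^sup>2 / (2 * xvar nu t) + - Y\<^sup>2 / (2 * (2 * nu * t))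
      = - ((X - t / 2 * Y)\<^sup>2 + Y\<^sup>2 * v) / (4 * nu * t * v)"
      using pos nz unfolding xvar_def v_def[symmetric] by (simp add: add_divide_distrib diff_divide_distrib)
    moreover have "- (u * Z) / (4 * nu * t * u * v) = - Z / (4 * nu * t * v)" for Z
      using pos by simp
    ultimately show ?thesis unfolding alg by presburger
  qed
  finally have e: "- X\<^sup>2 / (4 * nu * t * u) - (u * Y - t / 2 * X)\<^sup>2 / (4 * nu * t * u * v)
    = - (X - t / 2 * Y)\<^sup>2 / (2 * xvar nu t) + - Y\<^sup>2 / (2 * (2 * nu * t))" .
  have "sqrt (2 * pi * xvar nu t) * sqrt (2 * pi * (2 * nu * t)) = sqrt ((4 * pi * nu * t)\<^sup>2 * v)"
    unfolding real_sqrt_mult[symmetric] by (simp add: xvar_def v_def power2_eq_square algebra_simps)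
  also have "... = 4 * pi * nu * t * sqrt v"
    using assms by (simp add: real_sqrt_mult)
  finally have s: "sqrt (2 * pi * xvar nu t) * sqrt (2 * pi * (2 * nu * t)) = 4 * pi * nu * t * sqrt v" .
  show ?thesis
    unfolding S_kernel_def G_L_def kern_def xd ydisp_def gauss_def X_def[symmetric] Y_def[symmetric]
      u_def[symmetric] v_def[symmetric] e exp_add times_divide_times_eq s by simp
qed

lemma borel_measurable_xdisp [measurable (raw)]:
  assumes [measurable]: "T \<in> borel_measurable M" "f \<in> borel_measurable M" "g \<in> borel_measurable M"
  shows "(%w. xdisp (T w) (f w) (g w)) \<in> borel_measurable M" "(%w. ydisp (f w) (g w)) \<in> borel_measurable M"
  unfolding xdisp_def ydisp_def by measurable

lemma borel_measurable_kern [measurable (raw)]: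
  assumes [measurable]: "T \<in> borel_measurable M" "f \<in> borel_measurable M" "g \<in> borel_measurable M"
  shows "(%w. kern nu (T w) (f w) (g w)) \<in> borel_measurable M"
  unfolding kern_def xvar_def by measurable

text \<open>As a function of either point the pair (\<open>xdisp\<close>, \<open>ydisp\<close>) is a
  shear followed by a translation, up to a sign for the second point; hence integrals over
  \<open>z\<close> and over \<open>z'\<close> both factorise.\<close>

lemma xdisp_alt: "xdisp t z z' = fst z + (- t / 2) * snd z + (- fst z' - t / 2 * snd z')"
  "- xdisp t z z' = fst z' + t / 2 * snd z' + (t / 2 * snd z - fst z)"
  by (auto simp: xdisp_def algebra_simps add_divide_distrib)

lemma ydisp_alt: "ydisp z z' = snd z + (- snd z')" "- ydisp z z' = snd z' + (- snd z)"
  by (auto simp: ydisp_def)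

lemma nn_integral_disp_left:
  fixes A B :: "real => real"
  assumes "borel_fun A" "borel_fun B" "!!x. A x >= 0" "!!x. B x >= 0"
  shows "(NN z. ennreal (A (xdisp t z z') * B (ydisp z z')))
    = (NN x. ennreal (A x)) * (NN y. ennreal (B y))"
  unfolding xdisp_alt(1) ydisp_alt(1) using assms by (rule nn_integral_sheared_product)

lemma nn_integral_disp_right:
  fixes A B :: "real => real"
  assumes "borel_fun A" "borel_fun B" "!!x. A x >= 0" "!!x. B x >= 0"
    and e: "!!x. A (- x) = A x" "!!x. B (- x) = B x"
  shows "(NN z'. ennreal (A (xdisp t z z') * B (ydisp z z')))
    = (NN x. ennreal (A x)) * (NN y. ennreal (B y))"
  using nn_integral_sheared_product[OF assms(1-4), of "t / 2" "t / 2 * snd z - fst z" "- snd z"]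
  unfolding xdisp_alt(2)[symmetric] ydisp_alt(2)[symmetric] e .

text \<open>The kernel with both variances doubled: the common integrable majorant for the gradient
  and the first moments of \<open>kern\<close>.\<close>

definition kern2 :: "real => real => real \<times> real => real \<times> real => real" where
  "kern2 nu t z z' = gauss (2 * xvar nu t) (xdisp t z z') * gauss (2 * (2 * nu * t)) (ydisp z z')"

lemma borel_measurable_kern2 [measurable (raw)]:
  assumes [measurable]: "T \<in> borel_measurable M" "f \<in> borel_measurable M" "g \<in> borel_measurable M"
  shows "(%w. kern2 nu (T w) (f w) (g w)) \<in> borel_measurable M"
  unfolding kern2_def xvar_def by measurable

text \<open>Gradient in the source argument. The term with \<open>t / 2\<close> comes from the
  shear: moving the source vertically also changes \<open>xdisp\<close>.\<close>

definition kgrad :: "real => real => real \<times> real => real \<times> real => real \<times> real" where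
  "kgrad nu t z z' =
    (- (dgauss (xvar nu t) (xdisp t z z') * gauss (2 * nu * t) (ydisp z z')),
     - (t / 2) * (dgauss (xvar nu t) (xdisp t z z') * gauss (2 * nu * t) (ydisp z z'))
     - gauss (xvar nu t) (xdisp t z z') * dgauss (2 * nu * t) (ydisp z z'))"

lemma borel_measurable_kgrad [measurable (raw)]:
  assumes [measurable]: "T \<in> borel_measurable M" "f \<in> borel_measurable M" "g \<in> borel_measurable M"
  shows "(%w. kgrad nu (T w) (f w) (g w)) \<in> borel_measurable M"
  unfolding kgrad_def xvar_def by measurable

definition grad_const :: "real => real => real" where
  "grad_const nu t = 3 * (2 + t / 2) / sqrt (2 * nu * t)"

context
  fixes nu :: real
  assumes nu: "nu > 0"
begin

lemma kern_nonneg [simp]: "t > 0 ==> kern nu t z z' >= 0"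
  by (simp add: kern_def xvar_pos nu)

lemma kern2_nonneg [simp]: "t > 0 ==> kern2 nu t z z' >= 0"
  by (simp add: kern2_def xvar_pos nu)

lemma nn_integral_kern:
  assumes t: "t > 0"
  shows "(NN z. ennreal (kern nu t z z')) = 1" "(NN z'. ennreal (kern nu t z z')) = 1"
    "(NN z. ennreal (kern2 nu t z z')) = 1" "(NN z'. ennreal (kern2 nu t z z')) = 1"
  unfolding kern_def kern2_def
  by (subst nn_integral_disp_left nn_integral_disp_right; use xvar_pos[OF nu t] nu t in simp)+

lemma kern_le:
  assumes t: "t > 0" shows "kern nu t z z' <= 1 / (4 * pi * nu * t)"
proof -
  have x: "1 / sqrt (2 * pi * xvar nu t) <= 1 / sqrt (2 * pi * (2 * nu * t))"
    using xvar_ge[OF nu t] nu t by (intro divide_left_mono) (auto simp: xvar_pos)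
  have "kern nu t z z' <= 1 / sqrt (2 * pi * xvar nu t) * (1 / sqrt (2 * pi * (2 * nu * t)))"
    unfolding kern_def using xvar_pos[OF nu t] nu t by (intro mult_mono gauss_le) auto
  also have "... <= 1 / sqrt (2 * pi * (2 * nu * t)) * (1 / sqrt (2 * pi * (2 * nu * t)))"
    using x nu t by (intro mult_right_mono) auto
  also have "... = 1 / (4 * pi * nu * t)" using nu t by simp
  finally show ?thesis .
qed

text \<open>Chapman-Kolmogorov. The horizontal coordinate of the intermediate point is integrated
  first: the two horizontal displacements add up to \<open>A - k * y\<close>, which leaves a
  Gaussian of variance \<open>W\<close> in the intermediate height \<open>y\<close>. It remains to
  integrate it against the product of the two vertical Gaussians.\<close>

lemma kern_semigroup:
  assumes t: "t > 0" and s: "s > 0"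
  shows "(NN w. ennreal (kern nu t z w * kern nu s w z')) = ennreal (kern nu (t + s) z z')"
proof -
  define p where "p = 2 * nu * t"
  define q where "q = 2 * nu * s"
  define W where "W = xvar nu t + xvar nu s"
  define A where "A = fst z - fst z' - t * snd z / 2 - s * snd z' / 2"
  define k where "k = (t + s) / 2"
  define \<mu> where "\<mu> = (q * snd z + p * snd z') / (p + q)"
  have pos: "p > 0" "q > 0" "W > 0" "k > 0" "p * q / (p + q) > 0" "p + q > 0"
    using nu t s xvar_pos[OF nu t] xvar_pos[OF nu s] by (auto simp: p_def q_def W_def k_def intro!: divide_pos_pos add_pos_pos mult_pos_pos)
  have inner: "(NN x. ennreal (kern nu t z (x, y) * kern nu s (x, y) z'))
     = ennreal (gauss W (A - k * y)) * ennreal (gauss p (snd z - y) * gauss q (y - snd z'))" for y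
  proof -
    have "(NN x. ennreal (kern nu t z (x, y) * kern nu s (x, y) z'))
      = (NN x. ennreal (gauss p (snd z - y) * gauss q (y - snd z')) *
          ennreal (gauss (xvar nu t) ((fst z - t * (snd z + y) / 2) - x) * gauss (xvar nu s) (x - (fst z' + s * (y + snd z') / 2))))"
      using pos nu s t by (intro nn_integral_cong)
        (simp add: kern_def xdisp_def ydisp_def p_def q_def ennreal_mult[symmetric] xvar_pos algebra_simps)
    also have "... = ennreal (gauss p (snd z - y) * gauss q (y - snd z')) *
        ennreal (gauss W ((fst z - t * (snd z + y) / 2) - (fst z' + s * (y + snd z') / 2)))"
      using xvar_pos[OF nu t] xvar_pos[OF nu s]
      by (subst nn_integral_cmult) (simp_all add: nn_integral_gauss_conv W_def)
    also have "(fst z - t * (snd z + y) / 2) - (fst z' + s * (y + snd z') / 2) = A - k * y"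
      by (simp add: A_def k_def algebra_simps add_divide_distrib)
    finally show ?thesis by (simp add: mult.commute)
  qed
  have "(NN w. ennreal (kern nu t z w * kern nu s w z'))
    = (NN y. ennreal (gauss W (A - k * y)) * ennreal (gauss p (snd z - y) * gauss q (y - snd z')))"
    by (subst nn_integral_plane(1)) (simp_all add: inner)
  also have "... = (NN y. ennreal (gauss (p + q) (snd z - snd z') / k) *
      ennreal (gauss (W / k\<^sup>2) (A / k - y) * gauss (p * q / (p + q)) (y - \<mu>)))"
  proof (intro nn_integral_cong)
    fix y
    have "gauss W (A - k * y) = gauss (W / k\<^sup>2) (A / k - y) / k"
      using gauss_scale[of W k "A / k - y"] pos by (simp add: algebra_simps)
    moreover have "gauss p (snd z - y) * gauss q (y - snd z')
       = gauss (p + q) (snd z - snd z') * gauss (p * q / (p + q)) (y - \<mu>)"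
      unfolding \<mu>_def by (rule gauss_mult) (use pos in auto)
    ultimately show "ennreal (gauss W (A - k * y)) * ennreal (gauss p (snd z - y) * gauss q (y - snd z')) =
      ennreal (gauss (p + q) (snd z - snd z') / k) *
      ennreal (gauss (W / k\<^sup>2) (A / k - y) * gauss (p * q / (p + q)) (y - \<mu>))"
      using pos by (simp add: ennreal_mult[symmetric])
  qed
  also have "... = ennreal (gauss (p + q) (snd z - snd z') / k) * ennreal (gauss (W / k\<^sup>2 + p * q / (p + q)) (A / k - \<mu>))"
    using pos by (subst nn_integral_cmult) (simp_all add: nn_integral_gauss_conv)
  also have "... = ennreal (gauss (W + k\<^sup>2 * (p * q / (p + q))) (A - k * \<mu>) * gauss (p + q) (snd z - snd z'))"
  proof -
    have "gauss (W + k\<^sup>2 * (p * q / (p + q))) (k * (A / k - \<mu>))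
       = gauss ((W + k\<^sup>2 * (p * q / (p + q))) / k\<^sup>2) (A / k - \<mu>) / k"
      by (rule gauss_scale) (use pos in \<open>auto intro!: add_pos_nonneg\<close>)
    moreover have "(W + k\<^sup>2 * (p * q / (p + q))) / k\<^sup>2 = W / k\<^sup>2 + p * q / (p + q)"
      using pos by (simp add: add_divide_distrib)
    moreover have "k * (A / k - \<mu>) = A - k * \<mu>" using pos by (simp add: algebra_simps)
    ultimately have "gauss (W + k\<^sup>2 * (p * q / (p + q))) (A - k * \<mu>) = gauss (W / k\<^sup>2 + p * q / (p + q)) (A / k - \<mu>) / k" by simp
    then show ?thesis using pos by (subst ennreal_mult[symmetric]) (auto simp: add_pos_pos)
  qed
  \<comment> \<open>The cubic terms match because \<open>(t + s) ^ 3 / 6\<close> exceeds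
    \<open>t ^ 3 / 6 + s ^ 3 / 6\<close> by \<open>t * s * (t + s) / 2\<close>; times
    \<open>nu\<close>, this is the variance contributed by the unknown intermediate height.\<close>
  also have "W + k\<^sup>2 * (p * q / (p + q)) = xvar nu (t + s)"
  proof -
    have "p * q / (p + q) = 2 * nu * (t * s) / (t + s)"
    proof -
      have "p * q / (p + q) = (2 * nu) * (2 * nu * (t * s)) / ((2 * nu) * (t + s))"
        unfolding p_def q_def by (simp add: algebra_simps)
      also have "... = 2 * nu * (t * s) / (t + s)"
        by (rule mult_divide_mult_cancel_left) (use nu in simp)
      finally show ?thesis .
    qed
    then have "k\<^sup>2 * (p * q / (p + q)) = nu * (t + s) * (t * s) / 2"
    proof -
      have "(u / 2)\<^sup>2 * (2 * nu * (t * s) / u) = nu * u * (t * s) / 2" if "u > 0" for u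
        using that by (simp add: power2_eq_square field_simps)
      from this[of "t + s"] show ?thesis using \<open>p * q / (p + q) = 2 * nu * (t * s) / (t + s)\<close> t s by (simp only: k_def)
    qed
    then show ?thesis by (simp add: W_def xvar_def algebra_simps power2_eq_square add_divide_distrib)
  qed
  also have "A - k * \<mu> = xdisp (t + s) z z'"
  proof -
    have "\<mu> = (s * snd z + t * snd z') / (t + s)"
    proof -
      have "\<mu> = (2 * nu) * (s * snd z + t * snd z') / ((2 * nu) * (t + s))"
        unfolding \<mu>_def p_def q_def by (simp add: algebra_simps)
      then show ?thesis using nu by simp
    qed
    moreover have "u / 2 * (X / u) = X / 2" if "u > 0" for u X :: real using that by simp
    ultimately have "k * \<mu> = (s * snd z + t * snd z') / 2" using t s by (simp only: k_def add_pos_pos)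
    then show ?thesis by (simp add: A_def xdisp_def algebra_simps add_divide_distrib)
  qed
  also have "p + q = 2 * nu * (t + s)" by (simp add: p_def q_def algebra_simps)
  finally show ?thesis by (simp add: kern_def ydisp_def)
qed

lemma gauss_le_double: "v > 0 ==> gauss v x <= 3 / 2 * gauss (2 * v) x"
proof -
  assume v: "v > 0"
  have "gauss v x = sqrt 2 * gauss (2 * v) x * exp (- (x / sqrt v)\<^sup>2 / 4)" using v by (rule gauss_double)
  also have "... <= sqrt 2 * gauss (2 * v) x * 1" using v by (intro mult_left_mono) auto
  also have "... = sqrt 2 * gauss (2 * v) x" by simp
  also have "... <= 3 / 2 * gauss (2 * v) x" using v by (intro mult_right_mono sqrt2_le) simp
  finally show ?thesis .
qed

lemma norm_kgrad_le:
  assumes t: "t > 0"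
  shows "norm (kgrad nu t z z') <= grad_const nu t * kern2 nu t z z'"
proof -
  let ?V = "xvar nu t" let ?r = "2 * nu * t" let ?x = "xdisp t z z'" let ?y = "ydisp z z'"
  have V: "?V > 0" "?r > 0" "?V >= ?r" using xvar_pos xvar_ge nu t by auto
  have g: "gauss (2 * ?V) ?x >= 0" "gauss (2 * ?r) ?y >= 0" using V by simp_all
  have i: "2 / sqrt ?V <= 2 / sqrt ?r" using V by (intro divide_left_mono) auto
  have 1: "\<bar>dgauss ?V ?x * gauss ?r ?y\<bar> <= 3 / sqrt ?r * kern2 nu t z z'"
  proof -
    have "\<bar>dgauss ?V ?x * gauss ?r ?y\<bar> <= (2 / sqrt ?V * gauss (2 * ?V) ?x) * (3 / 2 * gauss (2 * ?r) ?y)"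
      unfolding abs_mult abs_of_nonneg[OF gauss_nonneg[OF V(2)]]
      using V g by (intro mult_mono dgauss_le gauss_le_double) auto
    also have "... <= (2 / sqrt ?r * gauss (2 * ?V) ?x) * (3 / 2 * gauss (2 * ?r) ?y)"
      using g i by (intro mult_right_mono) auto
    finally show ?thesis by (simp add: kern2_def)
  qed
  have 2: "\<bar>gauss ?V ?x * dgauss ?r ?y\<bar> <= 3 / sqrt ?r * kern2 nu t z z'"
  proof -
    have "\<bar>gauss ?V ?x * dgauss ?r ?y\<bar> <= (3 / 2 * gauss (2 * ?V) ?x) * (2 / sqrt ?r * gauss (2 * ?r) ?y)"
      unfolding abs_mult abs_of_nonneg[OF gauss_nonneg[OF V(1)]]
      using V g by (intro mult_mono dgauss_le gauss_le_double) auto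
    then show ?thesis by (simp add: kern2_def)
  qed
  have "norm (kgrad nu t z z') <= norm (fst (kgrad nu t z z')) + norm (snd (kgrad nu t z z'))"
    by (metis norm_Pair_le prod.collapse)
  also have "... <= \<bar>dgauss ?V ?x * gauss ?r ?y\<bar> + (t / 2 * \<bar>dgauss ?V ?x * gauss ?r ?y\<bar> + \<bar>gauss ?V ?x * dgauss ?r ?y\<bar>)"
  proof -
    have "\<bar>- (t / 2) * X - Y\<bar> <= t / 2 * \<bar>X\<bar> + \<bar>Y\<bar>" for X Y :: real
    proof -
      have "\<bar>- (t / 2) * X\<bar> = t / 2 * \<bar>X\<bar>" using t by (simp add: abs_mult)
      then show ?thesis by linarith
    qed
    then show ?thesis by (simp add: kgrad_def del: abs_mult)
  qed
  also have "... <= 3 / sqrt ?r * kern2 nu t z z' + (t / 2 * (3 / sqrt ?r * kern2 nu t z z') + 3 / sqrt ?r * kern2 nu t z z')"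
    using 1 2 t by (intro add_mono mult_left_mono) auto
  also have "... = grad_const nu t * kern2 nu t z z'"
    by (simp add: grad_const_def algebra_simps add_divide_distrib)
  finally show ?thesis .
qed

lemma grad_S_kernel:
  assumes t: "t > 0"
  shows "grad (S_kernel nu t z) z' = kgrad nu t z z'"
proof -
  have V: "xvar nu t > 0" "2 * nu * t > 0" using xvar_pos nu t by auto
  have S: "S_kernel nu t = kern nu t" using S_kernel_eq[OF nu t] by blast
  have dx: "((%x. xdisp t z (x, snd z')) has_real_derivative - 1) (at (fst z'))"
    "((%x. ydisp z (x, snd z')) has_real_derivative 0) (at (fst z'))"
    unfolding xdisp_def ydisp_def by (auto intro!: derivative_eq_intros)
  have dy: "((%y. xdisp t z (fst z', y)) has_real_derivative - (t / 2)) (at (snd z'))"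
    "((%y. ydisp z (fst z', y)) has_real_derivative - 1) (at (snd z'))"
    unfolding xdisp_def ydisp_def by (auto intro!: derivative_eq_intros)
  have 1: "((%x. kern nu t z (x, snd z')) has_real_derivative fst (kgrad nu t z z')) (at (fst z'))"
    unfolding kern_def
    by (rule DERIV_cong[OF DERIV_mult[OF gauss_has_derivative[OF V(1) dx(1)] gauss_has_derivative[OF V(2) dx(2)]]])
      (simp add: kgrad_def)
  have 2: "((%y. kern nu t z (fst z', y)) has_real_derivative snd (kgrad nu t z z')) (at (snd z'))"
    unfolding kern_def
    by (rule DERIV_cong[OF DERIV_mult[OF gauss_has_derivative[OF V(1) dy(1)] gauss_has_derivative[OF V(2) dy(2)]]])
      (simp add: kgrad_def)
  show ?thesis unfolding grad_def S using DERIV_imp_deriv[OF 1] DERIV_imp_deriv[OF 2] by simp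
qed

lemma S_eq: "t > 0 ==> S nu t f z = (LINT z'|lborel. kern nu t z z' * f z')"
  by (simp add: S_def S_kernel_eq nu)

lemma S_div_eq: "t > 0 ==> S_div nu t F z = - (LINT z'|lborel. kgrad nu t z z' \<bullet> F z')"
  by (simp add: S_div_def grad_S_kernel)

end

section \<open>The semigroup on integrable functions\<close>

text \<open>Valued in \<open>ennreal\<close>, so that norm estimates and exchanges of integrals ask
  for measurability only.\<close>

definition L1n :: "(real \<times> real => real) => ennreal" where
  "L1n f = (NN z. ennreal \<bar>f z\<bar>)"

lemma norm_integral_le_nn_integral:
  fixes f :: "'a => 'b::{banach, second_countable_topology}"
  shows "ennreal (norm (integral\<^sup>L M f)) <= (\<integral>\<^sup>+ x. ennreal (norm (f x)) \<partial>M)"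
  by (cases "integrable M f") (simp_all add: integral_norm_bound_ennreal not_integrable_integral_eq)

lemma L1n_triangle:
  assumes [measurable]: "borel_fun f" "borel_fun g"
  shows "L1n (%z. f z + g z) <= L1n f + L1n g" "L1n (%z. f z - g z) <= L1n f + L1n g"
proof -
  have *: "L1n f + L1n g = (NN z. ennreal (\<bar>f z\<bar> + \<bar>g z\<bar>))"
    unfolding L1n_def by (subst nn_integral_add[symmetric]) simp_all
  show "L1n (%z. f z + g z) <= L1n f + L1n g"
    unfolding * unfolding L1n_def by (intro nn_integral_mono ennreal_leI abs_triangle_ineq)
  show "L1n (%z. f z - g z) <= L1n f + L1n g"
    unfolding * unfolding L1n_def by (intro nn_integral_mono ennreal_leI abs_triangle_ineq4)
qed

lemma L1n_minus_commute: "L1n (%z. f z - g z) = L1n (%z. g z - f z)"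
  unfolding L1n_def by (simp add: abs_minus_commute)

lemma L1n_diff_triangle:
  assumes [measurable]: "borel_fun f" "borel_fun g" "borel_fun h"
  shows "L1n (%z. f z - h z) <= L1n (%z. f z - g z) + L1n (%z. g z - h z)"
  using L1n_triangle(1)[of "%z. f z - g z" "%z. g z - h z"] by simp

lemma L1n_le_add:
  assumes [measurable]: "borel_fun f" "borel_fun g"
  shows "L1n f <= L1n g + L1n (%z. f z - g z)"
  using L1n_triangle(1)[of "%z. g z" "%z. f z - g z"] by simp

lemma L1n_cong_AE: "AE z in lborel. f z = g z ==> L1n f = L1n g"
  unfolding L1n_def by (rule nn_integral_cong_AE) auto

lemma L1n_mono_AE: "AE z in lborel. \<bar>f z\<bar> <= \<bar>g z\<bar> ==> L1n f <= L1n g"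
  unfolding L1n_def by (rule nn_integral_mono_AE) (auto intro: ennreal_leI)

lemma L1n_0_iff: "f \<in> borel_measurable borel ==> L1n f = 0 \<longleftrightarrow> (AE z in lborel. f z = 0)"
  unfolding L1n_def by (subst nn_integral_0_iff_AE) auto

lemma integrable_iff_L1n: "f \<in> borel_measurable borel ==> integrable lborel f \<longleftrightarrow> L1n f < \<infinity>"
  unfolding L1n_def by (simp add: integrable_iff_bounded)

lemma L1n_integral: "integrable lborel f ==> L1n f = ennreal (LI z. \<bar>f z\<bar>)"
  unfolding L1n_def by (subst nn_integral_eq_integral) auto

lemma borel_measurable_L1n [measurable (raw)]:
  assumes [measurable]: "joint_borel M F"
  shows "(%x. L1n (F x)) \<in> borel_measurable M"
  unfolding L1n_def by measurable

lemma borel_measurable_S [measurable (raw)]: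
  assumes [measurable]: "T \<in> borel_measurable M" "joint_borel M F"
    "Z \<in> borel_measurable M"
  shows "(%x. S nu (T x) (F x) (Z x)) \<in> borel_measurable M"
  unfolding S_def S_kernel_def G_L_def by measurable

context
  fixes nu :: real
  assumes nu: "nu > 0"
begin

lemma integrable_kern:
  assumes t: "t > 0"
  shows "integrable lborel (%z'. kern nu t z z')" "integrable lborel (%z'. kern2 nu t z z')"
    "integrable lborel (%z. kern nu t z z')"
  using nn_integral_kern[OF nu t] t nu by (auto simp: integrable_iff_bounded)

lemma integral_kern:
  assumes t: "t > 0"
  shows "(LI z'. kern nu t z z') = 1"
  using nn_integral_eq_integral[OF integrable_kern(1)[OF t]] nn_integral_kern(2)[OF nu t] t nu by simp

lemma integrable_kern_mult_bdd:
  assumes t: "t > 0" and [measurable]: "borel_fun f" and b: "!!z. \<bar>f z\<bar> <= (b::real)"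
  shows "integrable lborel (%z'. kern nu t z z' * f z')"
proof -
  have "b >= 0" using order_trans[OF abs_ge_zero b] .
  moreover have "integrable lborel (%z'. kern nu t z z' * b)" using integrable_kern(1)[OF t] by simp
  ultimately show ?thesis
    by (elim Bochner_Integration.integrable_bound) (use t nu b in \<open>auto simp: abs_mult intro!: mult_left_mono\<close>)
qed

lemma integrable_kern_mult_L1:
  assumes t: "t > 0" and f: "integrable lborel f"
  shows "integrable lborel (%z'. kern nu t z z' * f z')"
proof -
  have [measurable]: "borel_fun f" using f by simp
  show ?thesis
    by (rule Bochner_Integration.integrable_bound[OF integrable_mult_right[OF integrable_abs[OF f], of "1 / (4 * pi * nu * t)"]])
      (use t nu in \<open>auto simp: abs_mult simp del: times_divide_eq_left intro!: mult_right_mono kern_le[OF nu t]\<close>)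
qed

lemma S_abs_le: "t > 0 ==> ennreal \<bar>S nu t f z\<bar> <= (NN z'. ennreal (kern nu t z z' * \<bar>f z'\<bar>))"
  using norm_integral_le_nn_integral[of lborel "%z'. kern nu t z z' * f z'"] nu
  by (simp add: S_eq abs_mult)

lemma nn_integral_kern_mult:
  assumes t: "t > 0" and [measurable]: "borel_fun f" and p: "!!z. f z >= 0"
  shows "(NN z. NN z'. ennreal (kern nu t z z' * f z')) = (NN z. ennreal (f z))"
proof -
  have "(NN z. NN z'. ennreal (kern nu t z z' * f z'))
    = (NN z'. NN z. ennreal (kern nu t z z' * f z'))"
    by (rule lborel_pair.Fubini') simp
  also have "... = (NN z'. ennreal (f z'))"
    using t nu p nn_integral_kern(1)[OF nu t]
    by (intro nn_integral_cong) (simp add: ennreal_mult nn_integral_multc)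
  finally show ?thesis .
qed

lemma S_L1:
  assumes t: "t > 0" and [measurable]: "borel_fun f"
  shows "L1n (S nu t f) <= L1n f"
proof -
  have "L1n (S nu t f) <= (NN z. NN z'. ennreal (kern nu t z z' * \<bar>f z'\<bar>))"
    unfolding L1n_def by (intro nn_integral_mono S_abs_le t)
  also have "... = L1n f" unfolding L1n_def by (rule nn_integral_kern_mult[OF t]) simp_all
  finally show ?thesis .
qed

lemma S_bound:
  assumes t: "t > 0" and [measurable]: "borel_fun f" and b: "!!z. \<bar>f z\<bar> <= (b::real)"
  shows "\<bar>S nu t f z\<bar> <= b"
proof -
  have b0: "b >= 0" using order_trans[OF abs_ge_zero b] .
  have "ennreal \<bar>S nu t f z\<bar> <= (NN z'. ennreal (kern nu t z z' * \<bar>f z'\<bar>))" using t by (rule S_abs_le)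
  also have "... <= (NN z'. ennreal (kern nu t z z' * b))"
    using b t nu by (intro nn_integral_mono ennreal_leI mult_left_mono) auto
  also have "... = ennreal b"
    using t nu b0 nn_integral_kern(2)[OF nu t] by (simp add: ennreal_mult nn_integral_multc)
  finally show ?thesis using b0 by simp
qed

lemma S_smoothing:
  assumes t: "t > 0" and [measurable]: "borel_fun f"
  shows "ennreal \<bar>S nu t f z\<bar> <= ennreal (1 / (4 * pi * nu * t)) * L1n f"
proof -
  have "ennreal \<bar>S nu t f z\<bar> <= (NN z'. ennreal (kern nu t z z' * \<bar>f z'\<bar>))" using t by (rule S_abs_le)
  also have "... <= (NN z'. ennreal (1 / (4 * pi * nu * t) * \<bar>f z'\<bar>))"
    using kern_le[OF nu t] by (intro nn_integral_mono ennreal_leI mult_right_mono) auto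
  also have "... = ennreal (1 / (4 * pi * nu * t)) * L1n f"
    unfolding L1n_def using t nu by (subst nn_integral_cmult[symmetric]) (auto simp: ennreal_mult simp del: times_divide_eq_left)
  finally show ?thesis .
qed

lemma S_cong_AE:
  assumes "t > 0" "AE z in lborel. f z = g z" and [measurable]: "borel_fun f" "borel_fun g"
  shows "S nu t f z = S nu t g z"
  unfolding S_eq[OF nu assms(1)] using assms by (intro integral_cong_AE) auto

lemma S_diff_L1:
  assumes "t > 0" "integrable lborel f" "integrable lborel g"
  shows "S nu t (%z. f z - g z) z = S nu t f z - S nu t g z"
  using assms integrable_kern_mult_L1 by (simp add: S_eq nu right_diff_distrib)

lemma integrable_kern_kern_mult:
  assumes t: "t > 0" and s: "s > 0" and [measurable]: "borel_fun f" and b: "!!z. \<bar>f z\<bar> <= (b::real)"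
  shows "integrable (lborel \<Otimes>\<^sub>M lborel) (%(w, z'). kern nu t z w * kern nu s w z' * f z')"
proof (rule integrableI_bounded)
  have b0: "b >= 0" using order_trans[OF abs_ge_zero b] .
  have "(\<integral>\<^sup>+ p. ennreal (norm (case p of (w, z') => kern nu t z w * kern nu s w z' * f z')) \<partial>(lborel \<Otimes>\<^sub>M lborel))
     <= (\<integral>\<^sup>+ p. (case p of (w, z') => ennreal (kern nu t z w * kern nu s w z' * b)) \<partial>(lborel \<Otimes>\<^sub>M lborel))"
    using t s nu b by (intro nn_integral_mono) (auto simp: abs_mult intro!: ennreal_leI mult_left_mono)
  also have "... = (NN w. NN z'. ennreal (kern nu t z w * kern nu s w z' * b))"
    by (subst lborel.nn_integral_fst[symmetric]) auto
  also have "... = (NN w. ennreal (kern nu t z w) * ennreal b)"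
    using t s nu b0 nn_integral_kern(2)[OF nu s]
    by (intro nn_integral_cong) (simp add: ennreal_mult nn_integral_multc nn_integral_cmult mult.assoc)
  also have "... = ennreal b"
    using t nu nn_integral_kern(2)[OF nu t] by (simp add: nn_integral_multc)
  also have "ennreal b < \<infinity>" by simp
  finally show "(\<integral>\<^sup>+ p. ennreal (norm (case p of (w, z') => kern nu t z w * kern nu s w z' * f z')) \<partial>(lborel \<Otimes>\<^sub>M lborel)) < \<infinity>" .
qed measurable

lemma S_semigroup:
  assumes t: "t > 0" and s: "s > 0" and [measurable]: "borel_fun f" and b: "!!z. \<bar>f z\<bar> <= (b::real)"
  shows "S nu t (S nu s f) z = S nu (t + s) f z"
proof -
  have ts: "t + s > 0" using t s by simp
  have "S nu t (S nu s f) z = (LI w. LI z'. kern nu t z w * kern nu s w z' * f z')"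
    using t s by (simp add: S_eq nu mult.assoc)
  also have "... = (LI z'. LI w. kern nu t z w * kern nu s w z' * f z')"
    by (rule lborel_pair.Fubini_integral[symmetric]) (rule integrable_kern_kern_mult[OF t s assms(3) b])
  also have "... = (LI z'. kern nu (t + s) z z' * f z')"
  proof (intro Bochner_Integration.integral_cong refl)
    fix z'
    have "(LI w. kern nu t z w * kern nu s w z') = kern nu (t + s) z z'"
      using kern_semigroup[OF nu t s, of z z'] t s ts nu by (subst integral_eq_nn_integral) auto
    then show "(LI w. kern nu t z w * kern nu s w z' * f z') = kern nu (t + s) z z' * f z'"
      by simp
  qed
  also have "... = S nu (t + s) f z" using ts by (simp add: S_eq nu)
  finally show ?thesis .
qed

text \<open>Moving the source from \<open>q\<close> to \<open>p\<close> is a translation by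
  (\<open>\<alpha>\<close>, \<open>\<beta>\<close>) in the variables that separate the kernel, so
  differences of \<open>kern\<close> reduce to translation differences of Gaussians on the
  line.\<close>

lemma kern_displaced:
  assumes "\<alpha> = fst p - fst q + t / 2 * (snd p - snd q)" "\<beta> = snd p - snd q"
  shows "kern nu t z p = gauss (xvar nu t) (xdisp t z q - \<alpha>) * gauss (2 * nu * t) (ydisp z q - \<beta>)"
  unfolding kern_def assms by (rule arg_cong2[where f = "(*)"]; rule arg_cong2[where f = gauss])
    (auto simp: xdisp_def ydisp_def algebra_simps add_divide_distrib diff_divide_distrib)

text \<open>Bounds that translation in units of the standard deviations, both of which are at least
  \<open>sqrt (2 * nu * t)\<close>. It is the small parameter of the Taylor expansion of the kernel
  in L^1.\<close>

definition disp_size :: "real => real \<times> real => real" where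
  "disp_size t v = (2 + t / 2) * norm v / sqrt (2 * nu * t)"

lemma disp_size_ge:
  assumes t: "t > 0"
  shows "\<bar>fst v + t / 2 * snd v\<bar> / sqrt (xvar nu t) + \<bar>snd v\<bar> / sqrt (2 * nu * t) <= disp_size t v"
    and "disp_size t v >= 0"
proof -
  have V: "xvar nu t > 0" "2 * nu * t > 0" "2 * nu * t <= xvar nu t" using xvar_pos xvar_ge nu t by auto
  have n: "\<bar>fst v\<bar> <= norm v" "\<bar>snd v\<bar> <= norm v"
    using norm_fst_le[of "fst v" "snd v"] norm_snd_le[of "snd v" "fst v"] by simp_all
  have "\<bar>fst v + t / 2 * snd v\<bar> <= \<bar>fst v\<bar> + t / 2 * \<bar>snd v\<bar>"
    using t abs_triangle_ineq[of "fst v" "t / 2 * snd v"] by (simp add: abs_mult)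
  also have "... <= norm v + t / 2 * norm v" using n t by (intro add_mono mult_left_mono) auto
  finally have 1: "\<bar>fst v + t / 2 * snd v\<bar> <= (1 + t / 2) * norm v" by (simp add: algebra_simps)
  have "\<bar>fst v + t / 2 * snd v\<bar> / sqrt (xvar nu t) <= (1 + t / 2) * norm v / sqrt (2 * nu * t)"
    using V 1 t by (intro frac_le) auto
  moreover have "\<bar>snd v\<bar> / sqrt (2 * nu * t) <= norm v / sqrt (2 * nu * t)" using V n by (intro divide_right_mono) auto
  ultimately show "\<bar>fst v + t / 2 * snd v\<bar> / sqrt (xvar nu t) + \<bar>snd v\<bar> / sqrt (2 * nu * t) <= disp_size t v"
    by (simp add: disp_size_def algebra_simps add_divide_distrib)
  show "disp_size t v >= 0" using t V by (simp add: disp_size_def)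
qed

lemma kern_difference:
  assumes t: "t > 0"
  shows "(NN z. ennreal \<bar>kern nu t z p - kern nu t z q\<bar>) <= ennreal (2 * disp_size t (p - q))"
proof -
  define \<alpha> where "\<alpha> = fst p - fst q + t / 2 * (snd p - snd q)"
  define \<beta> where "\<beta> = snd p - snd q"
  let ?V = "xvar nu t" let ?r = "2 * nu * t"
  have V: "?V > 0" "?r > 0" using xvar_pos nu t by auto
  let ?A = "%z. \<bar>gauss ?V (xdisp t z q - \<alpha>) - gauss ?V (xdisp t z q)\<bar> * gauss ?r (ydisp z q - \<beta>)"
  let ?B = "%z. gauss ?V (xdisp t z q) * \<bar>gauss ?r (ydisp z q - \<beta>) - gauss ?r (ydisp z q)\<bar>"
  have "(NN z. ennreal \<bar>kern nu t z p - kern nu t z q\<bar>) <= (NN z. ennreal (?A z) + ennreal (?B z))"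
  proof (intro nn_integral_mono)
    fix z
    have e: "a' * b' - a * b = (a' - a) * b' + a * (b' - b)" for a b a' b' :: real by (simp add: algebra_simps)
    have "\<bar>kern nu t z p - kern nu t z q\<bar> <= ?A z + ?B z"
      unfolding kern_displaced[OF \<alpha>_def \<beta>_def] kern_def[of _ _ _ q] e
      by (rule order_trans[OF abs_triangle_ineq]) (use V in \<open>simp add: abs_mult\<close>)
    then show "ennreal \<bar>kern nu t z p - kern nu t z q\<bar> <= ennreal (?A z) + ennreal (?B z)"
      using V by (simp add: ennreal_plus[symmetric] del: ennreal_plus)
  qed
  also have "... = (NN z. ennreal (?A z)) + (NN z. ennreal (?B z))"
    by (rule nn_integral_add) simp_all
  also have "(NN z. ennreal (?A z))
      = (NN x. ennreal \<bar>gauss ?V (x - \<alpha>) - gauss ?V x\<bar>) * (NN x. ennreal (gauss ?r (x - \<beta>)))"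
    using V by (intro nn_integral_disp_left[of "%x. \<bar>gauss ?V (x - \<alpha>) - gauss ?V x\<bar>" "%x. gauss ?r (x - \<beta>)"]) auto
  also have "(NN x. ennreal (gauss ?r (x - \<beta>))) = 1"
    using nn_integral_shift(2)[of "%x. ennreal (gauss ?r x)" \<beta>] V by simp
  also have "(NN z. ennreal (?B z))
      = (NN x. ennreal (gauss ?V x)) * (NN x. ennreal \<bar>gauss ?r (x - \<beta>) - gauss ?r x\<bar>)"
    using V by (intro nn_integral_disp_left[of "%x. gauss ?V x" "%x. \<bar>gauss ?r (x - \<beta>) - gauss ?r x\<bar>"]) auto
  also have "(NN x. ennreal \<bar>gauss ?V (x - \<alpha>) - gauss ?V x\<bar>) * 1 +
     (NN x. ennreal (gauss ?V x)) * (NN x. ennreal \<bar>gauss ?r (x - \<beta>) - gauss ?r x\<bar>)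
     <= ennreal (2 * \<bar>\<alpha>\<bar> / sqrt ?V) + ennreal (2 * \<bar>\<beta>\<bar> / sqrt ?r)"
    using V gauss_variation[OF V(1), of \<alpha>] gauss_variation[OF V(2), of \<beta>]
    by (intro add_mono) simp_all
  also have "... = ennreal (2 * (\<bar>\<alpha>\<bar> / sqrt ?V + \<bar>\<beta>\<bar> / sqrt ?r))"
    using V by (simp add: ennreal_plus[symmetric] algebra_simps del: ennreal_plus)
  also have "... <= ennreal (2 * disp_size t (p - q))"
    using disp_size_ge(1)[OF t, of "p - q"] by (intro ennreal_leI mult_left_mono) (auto simp: \<alpha>_def \<beta>_def)
  finally show ?thesis .
qed

lemma kgrad_inner:
  "kgrad nu t z q \<bullet> v = - ((fst v + t / 2 * snd v) * (dgauss (xvar nu t) (xdisp t z q) * gauss (2 * nu * t) (ydisp z q)))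
     - snd v * (gauss (xvar nu t) (xdisp t z q) * dgauss (2 * nu * t) (ydisp z q))"
  by (cases v) (simp add: kgrad_def algebra_simps)

lemma nn_integral_kgrad_inner:
  assumes t: "t > 0"
  shows "(NN z. ennreal \<bar>kgrad nu t z q \<bullet> v\<bar>) <= ennreal (2 * disp_size t v)"
proof -
  define \<alpha> where "\<alpha> = fst v + t / 2 * snd v"
  define \<beta> where "\<beta> = snd v"
  let ?V = "xvar nu t" let ?r = "2 * nu * t"
  have V: "?V > 0" "?r > 0" using xvar_pos nu t by auto
  let ?A = "%z. \<bar>\<alpha>\<bar> * \<bar>dgauss ?V (xdisp t z q)\<bar> * gauss ?r (ydisp z q)"
  let ?B = "%z. gauss ?V (xdisp t z q) * (\<bar>\<beta>\<bar> * \<bar>dgauss ?r (ydisp z q)\<bar>)"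
  have "(NN z. ennreal \<bar>kgrad nu t z q \<bullet> v\<bar>) <= (NN z. ennreal (?A z) + ennreal (?B z))"
  proof (intro nn_integral_mono)
    fix z
    have "\<bar>- (x * y) - z * w\<bar> <= \<bar>x\<bar> * \<bar>y\<bar> + \<bar>z\<bar> * \<bar>w\<bar>" for x y z w :: real
      by (metis abs_minus abs_mult abs_triangle_ineq4)
    note * = this
    have ab: "fst v + t / 2 * \<beta> = \<alpha>" "snd v = \<beta>" by (simp_all add: \<alpha>_def \<beta>_def)
    from *[of \<alpha> "dgauss ?V (xdisp t z q) * gauss ?r (ydisp z q)" \<beta> "gauss ?V (xdisp t z q) * dgauss ?r (ydisp z q)"]
    have "\<bar>kgrad nu t z q \<bullet> v\<bar> <= ?A z + ?B z"
      unfolding kgrad_inner ab using V by (simp add: abs_mult algebra_simps)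
    then show "ennreal \<bar>kgrad nu t z q \<bullet> v\<bar> <= ennreal (?A z) + ennreal (?B z)"
      using V by (simp add: ennreal_plus[symmetric] del: ennreal_plus)
  qed
  also have "... = (NN z. ennreal (?A z)) + (NN z. ennreal (?B z))"
    by (rule nn_integral_add) simp_all
  also have "(NN z. ennreal (?A z))
      = (NN x. ennreal (\<bar>\<alpha>\<bar> * \<bar>dgauss ?V x\<bar>)) * (NN x. ennreal (gauss ?r x))"
    using V by (intro nn_integral_disp_left[of "%x. \<bar>\<alpha>\<bar> * \<bar>dgauss ?V x\<bar>" "%x. gauss ?r x"]) auto
  also have "(NN z. ennreal (?B z))
      = (NN x. ennreal (gauss ?V x)) * (NN x. ennreal (\<bar>\<beta>\<bar> * \<bar>dgauss ?r x\<bar>))"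
    using V by (intro nn_integral_disp_left[of "%x. gauss ?V x" "%x. \<bar>\<beta>\<bar> * \<bar>dgauss ?r x\<bar>"]) auto
  also have "(NN x. ennreal (\<bar>\<alpha>\<bar> * \<bar>dgauss ?V x\<bar>)) * (NN x. ennreal (gauss ?r x)) +
     (NN x. ennreal (gauss ?V x)) * (NN x. ennreal (\<bar>\<beta>\<bar> * \<bar>dgauss ?r x\<bar>))
     <= ennreal \<bar>\<alpha>\<bar> * ennreal (2 / sqrt ?V) + ennreal \<bar>\<beta>\<bar> * ennreal (2 / sqrt ?r)"
    using V by (simp add: ennreal_mult nn_integral_cmult del: ennreal_plus) (intro add_mono mult_left_mono nn_integral_dgauss; simp)
  also have "... = ennreal (2 * (\<bar>\<alpha>\<bar> / sqrt ?V + \<bar>\<beta>\<bar> / sqrt ?r))"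
    using V by (simp add: ennreal_mult[symmetric] ennreal_plus[symmetric] algebra_simps del: ennreal_plus)
  also have "... <= ennreal (2 * disp_size t v)"
    using disp_size_ge(1)[OF t, of v] by (intro ennreal_leI mult_left_mono) (auto simp: \<alpha>_def \<beta>_def)
  finally show ?thesis .
qed

lemma kern_difference2:
  assumes t: "t > 0"
  shows "(NN z. ennreal \<bar>kern nu t z p - kern nu t z q - kgrad nu t z q \<bullet> (p - q)\<bar>)
    <= ennreal (6 * (disp_size t (p - q))\<^sup>2)"
proof -
  define \<alpha> where "\<alpha> = fst p - fst q + t / 2 * (snd p - snd q)"
  define \<beta> where "\<beta> = snd p - snd q"
  let ?V = "xvar nu t" let ?r = "2 * nu * t"
  have V: "?V > 0" "?r > 0" using xvar_pos nu t by auto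
  let ?A = "%z. gauss ?V (xdisp t z q - \<alpha>) * \<bar>gauss ?r (ydisp z q - \<beta>) - gauss ?r (ydisp z q) + \<beta> * dgauss ?r (ydisp z q)\<bar>"
  let ?B = "%z. \<bar>gauss ?V (xdisp t z q - \<alpha>) - gauss ?V (xdisp t z q) + \<alpha> * dgauss ?V (xdisp t z q)\<bar> * gauss ?r (ydisp z q)"
  let ?C = "%z. \<bar>gauss ?V (xdisp t z q - \<alpha>) - gauss ?V (xdisp t z q)\<bar> * (\<bar>\<beta>\<bar> * \<bar>dgauss ?r (ydisp z q)\<bar>)"
  have "(NN z. ennreal \<bar>kern nu t z p - kern nu t z q - kgrad nu t z q \<bullet> (p - q)\<bar>)
    <= (NN z. (ennreal (?A z) + ennreal (?B z)) + ennreal (?C z))"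
  proof (intro nn_integral_mono)
    fix z
    \<comment> \<open>Second order telescoping of a product: the Taylor remainder of each factor,
      and an increment of one factor times the linear term of the other.\<close>
    have e: "a' * b' - a * b - (- (\<alpha> * (da * b)) - \<beta> * (a * db))
       = a' * (b' - b + \<beta> * db) + (a' - a + \<alpha> * da) * b - (a' - a) * (\<beta> * db)" for a b a' b' da db :: real
      by (simp add: algebra_simps)
    have tri: "\<bar>x + y - w\<bar> <= \<bar>x\<bar> + \<bar>y\<bar> + \<bar>w\<bar>" for x y w :: real by linarith
    have ab: "fst (p - q) + t / 2 * \<beta> = \<alpha>" "snd (p - q) = \<beta>" by (simp_all add: \<alpha>_def \<beta>_def)
    have "\<bar>kern nu t z p - kern nu t z q - kgrad nu t z q \<bullet> (p - q)\<bar> <= ?A z + ?B z + ?C z"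
      unfolding kern_displaced[OF \<alpha>_def \<beta>_def] kern_def[of _ _ _ q] kgrad_inner ab(2) ab(1) e
      by (rule order_trans[OF tri]) (use V in \<open>simp add: abs_mult\<close>)
    then show "ennreal \<bar>kern nu t z p - kern nu t z q - kgrad nu t z q \<bullet> (p - q)\<bar> <= ennreal (?A z) + ennreal (?B z) + ennreal (?C z)"
      using V by (simp add: ennreal_plus[symmetric] del: ennreal_plus)
  qed
  also have "... = (NN z. ennreal (?A z)) + (NN z. ennreal (?B z)) + (NN z. ennreal (?C z))"
    by (subst nn_integral_add, simp, simp)+ simp
  also have "... <= ennreal (6 * \<beta>\<^sup>2 / ?r) + ennreal (6 * \<alpha>\<^sup>2 / ?V) + ennreal (2 * \<bar>\<alpha>\<bar> / sqrt ?V) * (ennreal \<bar>\<beta>\<bar> * ennreal (2 / sqrt ?r))"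
  proof (intro add_mono)
    have "(NN z. ennreal (?A z)) = (NN x. ennreal (gauss ?V (x - \<alpha>))) * (NN x. ennreal \<bar>gauss ?r (x - \<beta>) - gauss ?r x + \<beta> * dgauss ?r x\<bar>)"
      using V by (intro nn_integral_disp_left[of "%x. gauss ?V (x - \<alpha>)" "%x. \<bar>gauss ?r (x - \<beta>) - gauss ?r x + \<beta> * dgauss ?r x\<bar>"]) auto
    also have "(NN x. ennreal (gauss ?V (x - \<alpha>))) = 1"
      using nn_integral_shift(2)[of "%x. ennreal (gauss ?V x)" \<alpha>] V by simp
    finally show "(NN z. ennreal (?A z)) <= ennreal (6 * \<beta>\<^sup>2 / ?r)" using gauss_variation2[OF V(2), of \<beta>] by simp
    have "(NN z. ennreal (?B z)) = (NN x. ennreal \<bar>gauss ?V (x - \<alpha>) - gauss ?V x + \<alpha> * dgauss ?V x\<bar>) * (NN x. ennreal (gauss ?r x))"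
      using V by (intro nn_integral_disp_left[of "%x. \<bar>gauss ?V (x - \<alpha>) - gauss ?V x + \<alpha> * dgauss ?V x\<bar>" "gauss ?r"]) auto
    then show "(NN z. ennreal (?B z)) <= ennreal (6 * \<alpha>\<^sup>2 / ?V)" using gauss_variation2[OF V(1), of \<alpha>] V by simp
    have "(NN z. ennreal (?C z)) = (NN x. ennreal \<bar>gauss ?V (x - \<alpha>) - gauss ?V x\<bar>) * (NN x. ennreal (\<bar>\<beta>\<bar> * \<bar>dgauss ?r x\<bar>))"
      using V by (intro nn_integral_disp_left[of "%x. \<bar>gauss ?V (x - \<alpha>) - gauss ?V x\<bar>" "%x. \<bar>\<beta>\<bar> * \<bar>dgauss ?r x\<bar>"]) auto
    also have "... <= ennreal (2 * \<bar>\<alpha>\<bar> / sqrt ?V) * (ennreal \<bar>\<beta>\<bar> * ennreal (2 / sqrt ?r))"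
      using V by (simp add: ennreal_mult nn_integral_cmult del: ennreal_mult'')
        (intro mult_mono gauss_variation nn_integral_dgauss; simp)
    finally show "(NN z. ennreal (?C z)) <= ennreal (2 * \<bar>\<alpha>\<bar> / sqrt ?V) * (ennreal \<bar>\<beta>\<bar> * ennreal (2 / sqrt ?r))" .
  qed
  also have "... = ennreal (6 * (\<bar>\<beta>\<bar> / sqrt ?r)\<^sup>2 + 6 * (\<bar>\<alpha>\<bar> / sqrt ?V)\<^sup>2 + 4 * (\<bar>\<alpha>\<bar> / sqrt ?V) * (\<bar>\<beta>\<bar> / sqrt ?r))"
    using V by (simp add: ennreal_mult[symmetric] ennreal_plus[symmetric] power_divide algebra_simps del: ennreal_plus)
  also have "... <= ennreal (6 * (\<bar>\<alpha>\<bar> / sqrt ?V + \<bar>\<beta>\<bar> / sqrt ?r)\<^sup>2)"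
  proof (rule ennreal_leI)
    have "6 * y\<^sup>2 + 6 * x\<^sup>2 + 4 * x * y <= 6 * (x + y)\<^sup>2" if "x >= 0" "y >= 0" for x y :: real
      using mult_nonneg_nonneg[OF that] by (simp add: power2_eq_square algebra_simps)
    then show "6 * (\<bar>\<beta>\<bar> / sqrt ?r)\<^sup>2 + 6 * (\<bar>\<alpha>\<bar> / sqrt ?V)\<^sup>2 + 4 * (\<bar>\<alpha>\<bar> / sqrt ?V) * (\<bar>\<beta>\<bar> / sqrt ?r)
      <= 6 * (\<bar>\<alpha>\<bar> / sqrt ?V + \<bar>\<beta>\<bar> / sqrt ?r)\<^sup>2"
      using V by (metis abs_ge_zero divide_nonneg_pos real_sqrt_gt_zero)
  qed
  also have "... <= ennreal (6 * (disp_size t (p - q))\<^sup>2)"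
    using disp_size_ge(1)[OF t, of "p - q"] V by (intro ennreal_leI mult_left_mono power_mono) (auto simp: \<alpha>_def \<beta>_def)
  finally show ?thesis .
qed

text \<open>The minimum of a linear and a quadratic bound lies below the power 3/2. For short times
  \<open>disp_size\<close> is of order \<open>1 / sqrt t\<close>, so this power costs
  \<open>t powr (-3/4)\<close>, which is integrable in time, whereas the quadratic bound would cost
  \<open>1 / t\<close>.\<close>

lemma kern_difference_interpolated:
  assumes t: "t > 0"
  shows "(NN z. ennreal \<bar>kern nu t z p - kern nu t z q - kgrad nu t z q \<bullet> (p - q)\<bar>)
    <= ennreal (6 * (disp_size t (p - q) * sqrt (disp_size t (p - q))))"
proof -
  let ?G = "disp_size t (p - q)"
  have G: "?G >= 0" using disp_size_ge(2)[OF t] .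
  show ?thesis
  proof (cases "?G <= 1")
    case True
    have "?G <= sqrt ?G" using True G by (metis real_sqrt_ge_0_iff real_sqrt_le_1_iff mult_left_le real_sqrt_mult_self abs_of_nonneg)
    then have "?G\<^sup>2 <= ?G * sqrt ?G" using G by (simp add: power2_eq_square mult_left_mono)
    then show ?thesis by (intro order_trans[OF kern_difference2[OF t]] ennreal_leI) simp
  next
    case False
    then have "1 <= sqrt ?G" by simp
    then have g: "?G <= ?G * sqrt ?G" using G by (metis mult.right_neutral mult_left_mono)
    have "(NN z. ennreal \<bar>kern nu t z p - kern nu t z q - kgrad nu t z q \<bullet> (p - q)\<bar>)
      <= (NN z. ennreal \<bar>kern nu t z p - kern nu t z q\<bar> + ennreal \<bar>kgrad nu t z q \<bullet> (p - q)\<bar>)"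
      by (intro nn_integral_mono) (auto simp: ennreal_plus[symmetric] simp del: ennreal_plus)
    also have "... = (NN z. ennreal \<bar>kern nu t z p - kern nu t z q\<bar>) + (NN z. ennreal \<bar>kgrad nu t z q \<bullet> (p - q)\<bar>)"
      by (rule nn_integral_add) simp_all
    also have "... <= ennreal (2 * ?G) + ennreal (2 * ?G)"
      by (intro add_mono kern_difference nn_integral_kgrad_inner t)
    also have "... <= ennreal (6 * (?G * sqrt ?G))"
      using g G by (subst ennreal_plus[symmetric]) (auto intro!: ennreal_leI)
    finally show ?thesis .
  qed
qed

end

section \<open>Divergence form and strong continuity\<close>

text \<open>\<open>S_div\<close> with the derivatives of the kernel evaluated. The explicit gradient
  gives joint measurability in time, field and point, as required for exchanging time and space
  integrals.\<close>

definition Sd :: "real => real => (real \<times> real => real \<times> real) => real \<times> real => real" where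
  "Sd nu t F z = - (LINT z'|lborel. kgrad nu t z z' \<bullet> F z')"

lemma borel_measurable_Sd [measurable (raw)]:
  assumes [measurable]: "T \<in> borel_measurable M" "joint_borel M F"
    "Z \<in> borel_measurable M"
  shows "(%x. Sd nu (T x) (F x) (Z x)) \<in> borel_measurable M"
  unfolding Sd_def by measurable

lemma ennreal_lincomb:
  "a >= 0 ==> x >= 0 ==> b >= 0 ==> y >= 0 ==>
    ennreal (a * x + b * y) = ennreal a * ennreal x + ennreal b * ennreal y"
  by (simp add: ennreal_mult)

lemma tendsto_0_le_ennreal:
  fixes f g :: "'a => ennreal"
  assumes "!!n. f n <= g n" "(g \<longlongrightarrow> 0) F"
  shows "(f \<longlongrightarrow> 0) F"
  using assms(1) by (intro tendsto_sandwich[OF _ _ tendsto_const[of 0] assms(2)] always_eventually) auto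

text \<open>If \<open>q 0\<close> exceeded the claimed value, then \<open>b = q 0 / Y\<close> would
  exceed \<open>1 / (1 + X)\<close>. Repeated squaring gives \<open>q n >= Y * b ^ (2 ^ n)\<close>,
  and the upper bound turns this into \<open>8 * pi * 2 ^ n * X < (1 + X) ^ (2 ^ n)\<close> for all
  \<open>n\<close>. This fails for the \<open>n\<close> with \<open>2 ^ n * X\<close> in [1, 2),
  where the right side is at most \<open>exp 2\<close>, and for \<open>n = 0\<close> if
  \<open>X >= 1\<close>.\<close>

lemma nash_real:
  fixes q :: "nat => real"
  assumes q: "!!n. q n >= 0" "!!n. (q n)\<^sup>2 <= Y * q (Suc n)" "!!n. q n <= Y / (8 * pi * 2 ^ n * X)"
    and Y: "Y > 0" and X: "X > 0"
  shows "q 0 <= Y / (1 + X)"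
proof (rule ccontr)
  assume "\<not> q 0 <= Y / (1 + X)"
  then have q0: "q 0 > Y / (1 + X)" by simp
  define b where "b = q 0 / Y"
  have "1 / (1 + X) < b" using q0 Y X by (simp add: b_def field_simps)
  then have b: "1 / (1 + X) < b" "0 < b" using X by (auto intro: less_trans[of 0 "1 / (1 + X)"])
  have ind: "Y * b ^ (2 ^ n) <= q n" for n
  proof (induction n)
    case 0
    have "Y * b = q 0" using Y by (simp add: b_def)
    then show ?case by simp
  next
    case (Suc n)
    have "Y * (Y * b ^ (2 ^ Suc n)) = (Y * b ^ (2 ^ n))\<^sup>2"
    proof -
      have "b ^ (2 ^ Suc n) = (b ^ (2 ^ n))\<^sup>2" by (simp only: power_Suc2 power_mult)
      then show ?thesis by (simp only: power2_eq_square mult_ac)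
    qed
    also have "... <= (q n)\<^sup>2" using Suc Y b by (intro power_mono) auto
    also have "... <= Y * q (Suc n)" by (rule q)
    finally show ?case using Y by simp
  qed
  have key: "8 * pi * 2 ^ n * X < (1 + X) ^ (2 ^ n)" for n
  proof -
    have "Y * b ^ (2 ^ n) <= Y * (1 / (8 * pi * 2 ^ n * X))" using order_trans[OF ind q(3)] by simp
    then have "b ^ (2 ^ n) <= 1 / (8 * pi * 2 ^ n * X)" using Y by (rule mult_left_le_imp_le)
    then have "8 * pi * 2 ^ n * X <= 1 / b ^ (2 ^ n)" using b X by (simp add: field_simps)
    also have "... = (1 / b) ^ (2 ^ n)" by (simp add: power_divide)
    also have "... < (1 + X) ^ (2 ^ n)"
      using b X by (intro power_strict_mono) (auto simp: field_simps)
    finally show ?thesis .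
  qed
  have pi3: "pi > 3" by (rule pi_gt3)
  show False
  proof (cases "X >= 1")
    case True
    have "3 * X <= pi * X" using pi3 X by (intro mult_right_mono) auto
    moreover have "8 * (pi * X) < 1 + X" using key[of 0] by (simp add: mult.assoc)
    ultimately show False using True by linarith
  next
    case False
    have "\<exists>n. 2 ^ n * X >= 1"
      using real_arch_pow[of 2 "1 / X"] X by (auto simp: field_simps intro: less_imp_le)
    define n where "n = (LEAST n. 2 ^ n * X >= 1)"
    have n1: "2 ^ n * X >= 1" unfolding n_def using \<open>\<exists>n. 2 ^ n * X >= 1\<close> by (rule LeastI_ex)
    have "n ~= 0" using n1 False by (intro notI) simp
    then obtain m where m: "n = Suc m" by (cases n) auto
    have "\<not> 2 ^ m * X >= 1" using not_less_Least[of m "%n. 2 ^ n * X >= 1"] m by (simp add: n_def)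
    then have n2: "2 ^ n * X < 2" using m by simp
    have "(1 + X) ^ (2 ^ n) <= exp X ^ (2 ^ n)"
      using X exp_ge_add_one_self[of X] by (intro power_mono) auto
    also have "... = exp (2 ^ n * X)" by (simp add: exp_of_nat_mult[symmetric])
    also have "... <= exp (1 + 1)" using n2 by simp
    also have "... = exp 1 * exp (1::real)" by (rule exp_add)
    also have "... <= 3 * 3" by (intro mult_mono exp_le) auto
    finally have "8 * pi * (2 ^ n * X) < 9" using key[of n] by (simp add: mult.assoc)
    moreover have "8 * pi * 1 <= 8 * pi * (2 ^ n * X)" using n1 by (intro mult_left_mono) auto
    ultimately show False using pi3 by linarith
  qed
qed

text \<open>For \<open>c = 2\<close> this is the kernel of the adjoint of \<open>S\<close> composed
  with \<open>S\<close>. In the coordinates (\<open>x + t / 2 * y\<close>, \<open>y\<close>) it is a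
  convolution kernel, and composing it with itself doubles \<open>c\<close>; this doubling takes the
  place of spectral calculus in the proof of Nash's inequality.\<close>

definition auto_kern :: "real => real => real => real \<times> real => real \<times> real => real" where
  "auto_kern nu t c z w = gauss (c * xvar nu t) ((fst z + t / 2 * snd z) - (fst w + t / 2 * snd w))
      * gauss (c * (2 * nu * t)) (snd z - snd w)"

lemma borel_measurable_auto_kern [measurable (raw)]:
  assumes [measurable]: "f \<in> borel_measurable M" "g \<in> borel_measurable M"
  shows "(%w. auto_kern nu t c (f w) (g w)) \<in> borel_measurable M"
  unfolding auto_kern_def by measurable

lemma auto_kern_commute: "auto_kern nu t c z w = auto_kern nu t c w z"
  unfolding auto_kern_def by (intro arg_cong2[where f = "(*)"] gauss_commute)

context
  fixes nu :: real
  assumes nu: "nu > 0"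
begin

lemma S_div_eq_Sd: "t > 0 ==> S_div nu t F z = Sd nu t F z"
  by (simp add: S_div_eq[OF nu] Sd_def)

lemma grad_const_nonneg: "t > 0 ==> grad_const nu t >= 0"
  using nu by (simp add: grad_const_def)

lemma Sd_abs_le:
  assumes t: "t > 0"
  shows "ennreal \<bar>Sd nu t F z\<bar> <= (NN z'. ennreal (grad_const nu t) * ennreal (kern2 nu t z z' * norm (F z')))"
proof -
  have "ennreal \<bar>Sd nu t F z\<bar> <= (NN z'. ennreal \<bar>kgrad nu t z z' \<bullet> F z'\<bar>)"
    using norm_integral_le_nn_integral[of lborel "%z'. kgrad nu t z z' \<bullet> F z'"] by (simp add: Sd_def)
  also have "... <= (NN z'. ennreal (grad_const nu t) * ennreal (kern2 nu t z z' * norm (F z')))"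
  proof (intro nn_integral_mono)
    fix z'
    have "\<bar>kgrad nu t z z' \<bullet> F z'\<bar> <= norm (kgrad nu t z z') * norm (F z')" by (rule Cauchy_Schwarz_ineq2)
    also have "... <= (grad_const nu t * kern2 nu t z z') * norm (F z')"
      by (intro mult_right_mono norm_kgrad_le nu t) simp
    finally show "ennreal \<bar>kgrad nu t z z' \<bullet> F z'\<bar> <= ennreal (grad_const nu t) * ennreal (kern2 nu t z z' * norm (F z'))"
      using grad_const_nonneg[OF t] t nu by (simp add: ennreal_mult[symmetric] ennreal_leI mult.assoc)
  qed
  finally show ?thesis .
qed

lemma Sd_L1:
  assumes t: "t > 0" and [measurable]: "borel_fun F"
  shows "L1n (Sd nu t F) <= ennreal (grad_const nu t) * L1n (%z. norm (F z))"
proof -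
  have "L1n (Sd nu t F) <= (NN z. NN z'. ennreal (grad_const nu t) * ennreal (kern2 nu t z z' * norm (F z')))"
    unfolding L1n_def by (intro nn_integral_mono Sd_abs_le t)
  also have "... = ennreal (grad_const nu t) * (NN z. NN z'. ennreal (kern2 nu t z z' * norm (F z')))"
    by (simp add: nn_integral_cmult)
  also have "(NN z. NN z'. ennreal (kern2 nu t z z' * norm (F z')))
    = (NN z'. NN z. ennreal (kern2 nu t z z' * norm (F z')))"
    by (rule lborel_pair.Fubini') simp
  also have "... = L1n (%z. norm (F z))"
    unfolding L1n_def using t nu nn_integral_kern(3)[OF nu t]
    by (intro nn_integral_cong) (simp add: ennreal_mult nn_integral_multc)
  finally show ?thesis .
qed

lemma Sd_bound:
  assumes t: "t > 0" and b: "!!z. norm (F z) <= (b::real)"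
  shows "\<bar>Sd nu t F z\<bar> <= grad_const nu t * b"
proof -
  have b0: "b >= 0" using order_trans[OF norm_ge_zero b] .
  have "ennreal \<bar>Sd nu t F z\<bar> <= (NN z'. ennreal (grad_const nu t) * ennreal (kern2 nu t z z' * norm (F z')))"
    using t by (rule Sd_abs_le)
  also have "... <= (NN z'. ennreal (grad_const nu t) * ennreal (kern2 nu t z z' * b))"
    using b t nu by (intro nn_integral_mono mult_left_mono ennreal_leI) auto
  also have "... = ennreal (grad_const nu t * b)"
    using t nu b0 nn_integral_kern(4)[OF nu t] grad_const_nonneg[OF t]
    by (simp add: ennreal_mult nn_integral_multc nn_integral_cmult)
  finally show ?thesis using b0 grad_const_nonneg[OF t] by simp
qed

lemma Sd_cong_AE:
  assumes "AE z in lborel. F z = G z" and [measurable]: "borel_fun F" "borel_fun G"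
  shows "Sd nu t F z = Sd nu t G z"
  unfolding Sd_def using assms by (intro arg_cong[where f = uminus] integral_cong_AE) auto

text \<open>Markov's inequality for the mean distance. The shear moves the point by
  \<open>t * \<bar>snd z\<bar>\<close>, so the bound is not uniform in \<open>z\<close>; strong
  continuity in L^1 is therefore built on pointwise convergence.\<close>

lemma kern_concentration:
  assumes t: "t > 0" and \<delta>: "\<delta> > 0"
  shows "(NN z'. ennreal (kern nu t z z') * indicator {z'. norm (z - z') >= \<delta>} z')
    <= ennreal ((3 * sqrt (xvar nu t) + t * \<bar>snd z\<bar> + (1 + t / 2) * (3 * sqrt (2 * nu * t))) / \<delta>)"
proof -
  let ?V = "xvar nu t" let ?r = "2 * nu * t"
  have V: "?V > 0" "?r > 0" using xvar_pos nu t by auto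
  have pt: "kern nu t z z' * norm (z - z') <= (3 * sqrt ?V + (1 + t / 2) * (3 * sqrt ?r)) * kern2 nu t z z' + t * \<bar>snd z\<bar> * kern nu t z z'" for z'
  proof -
    let ?x = "xdisp t z z'" let ?y = "ydisp z z'"
    have g: "gauss (2 * ?V) ?x >= 0" "gauss (2 * ?r) ?y >= 0" "gauss ?V ?x >= 0" "gauss ?r ?y >= 0" using V by simp_all
    have e: "fst z - fst z' = ?x + t * snd z + (- (t / 2)) * ?y"
      by (simp add: xdisp_def ydisp_def algebra_simps add_divide_distrib diff_divide_distrib)
    have "norm (z - z') <= \<bar>fst z - fst z'\<bar> + \<bar>?y\<bar>"
      using norm_Pair_le[of "fst (z - z')" "snd (z - z')"] by (simp add: ydisp_def minus_prod_def)
    also have "\<bar>fst z - fst z'\<bar> <= \<bar>?x\<bar> + \<bar>t * snd z\<bar> + \<bar>(- (t / 2)) * ?y\<bar>"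
      unfolding e by linarith
    also have "... = \<bar>?x\<bar> + t * \<bar>snd z\<bar> + t / 2 * \<bar>?y\<bar>" using t by (simp add: abs_mult)
    finally have n: "norm (z - z') <= \<bar>?x\<bar> + t * \<bar>snd z\<bar> + (1 + t / 2) * \<bar>?y\<bar>" by (simp add: algebra_simps)
    have 1: "\<bar>?x\<bar> * gauss ?V ?x * gauss ?r ?y <= 3 * sqrt ?V * kern2 nu t z z'"
    proof -
      have "\<bar>?x\<bar> * gauss ?V ?x * gauss ?r ?y <= (2 * sqrt ?V * gauss (2 * ?V) ?x) * (3 / 2 * gauss (2 * ?r) ?y)"
        using V g by (intro mult_mono gauss_moment1 gauss_le_double) auto
      then show ?thesis by (simp add: kern2_def)
    qed
    have 2: "\<bar>?y\<bar> * gauss ?r ?y * gauss ?V ?x <= 3 * sqrt ?r * kern2 nu t z z'"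
    proof -
      have "\<bar>?y\<bar> * gauss ?r ?y * gauss ?V ?x <= (2 * sqrt ?r * gauss (2 * ?r) ?y) * (3 / 2 * gauss (2 * ?V) ?x)"
        using V g by (intro mult_mono gauss_moment1 gauss_le_double) auto
      then show ?thesis by (simp add: kern2_def mult_ac)
    qed
    have "kern nu t z z' * norm (z - z') <= kern nu t z z' * (\<bar>?x\<bar> + t * \<bar>snd z\<bar> + (1 + t / 2) * \<bar>?y\<bar>)"
      using n t nu by (intro mult_left_mono) auto
    also have "... = \<bar>?x\<bar> * gauss ?V ?x * gauss ?r ?y + (1 + t / 2) * (\<bar>?y\<bar> * gauss ?r ?y * gauss ?V ?x) + t * \<bar>snd z\<bar> * kern nu t z z'"
      unfolding kern_def by (simp add: algebra_simps)
    also have "... <= 3 * sqrt ?V * kern2 nu t z z' + (1 + t / 2) * (3 * sqrt ?r * kern2 nu t z z') + t * \<bar>snd z\<bar> * kern nu t z z'"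
      using 1 2 t by (intro add_mono mult_left_mono order_refl) auto
    finally show ?thesis by (simp add: algebra_simps)
  qed
  let ?a = "3 * sqrt ?V + (1 + t / 2) * (3 * sqrt ?r)"
  have a: "?a >= 0" using V t by simp
  have "(NN z'. ennreal (kern nu t z z') * indicator {z'. norm (z - z') >= \<delta>} z')
    <= (NN z'. ennreal (?a / \<delta>) * ennreal (kern2 nu t z z') + ennreal (t * \<bar>snd z\<bar> / \<delta>) * ennreal (kern nu t z z'))"
  proof (intro nn_integral_mono)
    fix z'
    have "ennreal (kern nu t z z') * indicator {z'. norm (z - z') >= \<delta>} z' <= ennreal (kern nu t z z' * norm (z - z') / \<delta>)"
      using \<delta> t nu by (auto simp: indicator_def pos_le_divide_eq intro!: ennreal_leI mult_left_mono)
    also have "... <= ennreal ((?a * kern2 nu t z z' + t * \<bar>snd z\<bar> * kern nu t z z') / \<delta>)"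
      using pt[of z'] \<delta> by (intro ennreal_leI divide_right_mono) auto
    also have "... = ennreal (?a / \<delta>) * ennreal (kern2 nu t z z') + ennreal (t * \<bar>snd z\<bar> / \<delta>) * ennreal (kern nu t z z')"
    proof -
      have *: "(A * x + c * y) / \<delta> = A / \<delta> * x + c / \<delta> * y" for A x c y :: real
        by (simp add: add_divide_distrib)
      have "(?a * kern2 nu t z z' + t * \<bar>snd z\<bar> * kern nu t z z') / \<delta> = ?a / \<delta> * kern2 nu t z z' + t * \<bar>snd z\<bar> / \<delta> * kern nu t z z'"
        by (rule *)
      then show ?thesis using a \<delta> t nu by (simp only:) (rule ennreal_lincomb; simp)
    qed
    finally show "ennreal (kern nu t z z') * indicator {z'. norm (z - z') >= \<delta>} z' <=
       ennreal (?a / \<delta>) * ennreal (kern2 nu t z z') + ennreal (t * \<bar>snd z\<bar> / \<delta>) * ennreal (kern nu t z z')" .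
  qed
  also have "... = ennreal (?a / \<delta>) + ennreal (t * \<bar>snd z\<bar> / \<delta>)"
    using nn_integral_kern[OF nu t] by (simp add: nn_integral_add nn_integral_cmult)
  also have "... = ennreal ((3 * sqrt ?V + t * \<bar>snd z\<bar> + (1 + t / 2) * (3 * sqrt ?r)) / \<delta>)"
  proof -
    have "ennreal (?a / \<delta>) + ennreal (t * \<bar>snd z\<bar> / \<delta>) = ennreal (?a / \<delta> + t * \<bar>snd z\<bar> / \<delta>)"
      using a \<delta> t by (intro ennreal_plus[symmetric]) auto
    also have "?a / \<delta> + t * \<bar>snd z\<bar> / \<delta> = (3 * sqrt ?V + t * \<bar>snd z\<bar> + (1 + t / 2) * (3 * sqrt ?r)) / \<delta>"
      unfolding add_divide_distrib by (simp only: add_ac)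
    finally show ?thesis .
  qed
  finally show ?thesis .
qed

section \<open>Strong continuity of the semigroup on L^1\<close>

lemma S_indicator_bounds:
  assumes t: "t > 0" and [measurable]: "U \<in> sets borel"
  shows "0 <= S nu t (indicator U) z" "S nu t (indicator U) z <= 1"
proof -
  show "0 <= S nu t (indicator U) z"
    unfolding S_eq[OF nu t] using t nu by (intro Bochner_Integration.integral_nonneg) simp
  have "\<bar>S nu t (indicator U) z\<bar> <= 1"
    by (rule S_bound[OF nu t]) (simp_all add: indicator_def)
  then show "S nu t (indicator U) z <= 1" by simp
qed

lemma S_indicator_open_tendsto:
  assumes X: "!!n. X n > 0" "X \<longlonglongrightarrow> 0" and U: "open U" "z \<in> U"
  shows "(%n. S nu (X n) (indicator U) z) \<longlonglongrightarrow> 1"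
proof -
  obtain \<delta> where \<delta>: "\<delta> > 0" "ball z \<delta> \<subseteq> U" using U open_contains_ball by blast
  have Um[measurable]: "U \<in> sets borel" using U by simp
  let ?e = "%t. (3 * sqrt (xvar nu t) + t * \<bar>snd z\<bar> + (1 + t / 2) * (3 * sqrt (2 * nu * t))) / \<delta>"
  have lo: "1 - ?e t <= S nu t (indicator U) z" and hi: "S nu t (indicator U) z <= 1" if t: "t > 0" for t
  proof -
    show "S nu t (indicator U) z <= 1"
      by (rule S_indicator_bounds[OF t Um])
    have i: "integrable lborel (%z'. kern nu t z z' * indicator U z')"
      by (rule integrable_kern_mult_bdd[OF nu t, of _ 1]) (simp_all add: indicator_def)
    have e0: "?e t >= 0" using t nu \<delta> xvar_pos[OF nu t] by (intro divide_nonneg_pos add_nonneg_nonneg mult_nonneg_nonneg) auto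
    have "1 - S nu t (indicator U) z = (LI z'. kern nu t z z' - kern nu t z z' * indicator U z')"
      using i integrable_kern(1)[OF nu t] integral_kern[OF nu t] by (simp add: S_eq[OF nu t])
    also have "ennreal ... <= (NN z'. ennreal (norm (kern nu t z z' - kern nu t z z' * indicator U z')))"
      by (rule order_trans[OF ennreal_leI norm_integral_le_nn_integral]) simp
    also have "... <= (NN z'. ennreal (kern nu t z z') * indicator {z'. norm (z - z') >= \<delta>} z')"
      using \<delta>(2) t nu by (intro nn_integral_mono) (auto simp: indicator_def dist_norm subset_iff not_le)
    also have "... <= ennreal (?e t)" by (rule kern_concentration[OF t \<delta>(1)])
    finally show "1 - ?e t <= S nu t (indicator U) z" using e0 by simp
  qed
  have "(%n. ?e (X n)) \<longlonglongrightarrow> (3 * sqrt (2 * nu * 0 * (1 + 0\<^sup>2 / 12)) + 0 * \<bar>snd z\<bar> + (1 + 0 / 2) * (3 * sqrt (2 * nu * 0))) / \<delta>"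
    unfolding xvar_def using \<delta> by (intro tendsto_intros X) auto
  then have "(%n. ?e (X n)) \<longlonglongrightarrow> 0" by simp
  from tendsto_diff[OF tendsto_const[of 1] this]
  have l: "(%n. 1 - ?e (X n)) \<longlonglongrightarrow> 1" by simp
  show ?thesis
  proof (rule tendsto_sandwich[OF _ _ l tendsto_const[of 1]])
    show "\<forall>\<^sub>F n in sequentially. 1 - ?e (X n) <= S nu (X n) (indicator U) z"
      by (rule always_eventually) (rule allI, rule lo, rule X)
    show "\<forall>\<^sub>F n in sequentially. S nu (X n) (indicator U) z <= 1"
      by (rule always_eventually) (rule allI, rule hi, rule X)
  qed
qed

text \<open>\<open>S\<close> does not increase mass, so the mass that appears outside
  \<open>U\<close> is at most the mass missing inside. Convergence on \<open>U\<close> then controls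
  the whole plane, including the far region where the shear is fast.\<close>

lemma S_indicator_L1:
  assumes t: "t > 0" and U[measurable]: "U \<in> sets borel" and f: "emeasure lborel U < \<infinity>"
  shows "L1n (%z. S nu t (indicator U) z - indicator U z) <= 2 * (NN z. ennreal (1 - S nu t (indicator U) z) * indicator U z)"
proof -
  define s where "s = S nu t (indicator U)"
  have b: "0 <= s z" "s z <= 1" for z
    using S_indicator_bounds[OF t U] by (auto simp: s_def)
  have [measurable]: "borel_fun s" unfolding s_def by measurable
  let ?i = "NN z. ennreal (s z) * indicator U z"
  let ?o = "NN z. ennreal (s z) * indicator (- U) z"
  let ?d = "NN z. ennreal (1 - s z) * indicator U z"
  have "?i + ?o = (NN z. ennreal (s z) * indicator U z + ennreal (s z) * indicator (- U) z)"
    by (rule nn_integral_add[symmetric]) measurable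
  also have "... = L1n s"
    unfolding L1n_def by (intro nn_integral_cong) (simp add: indicator_def b)
  also have "... <= L1n (indicator U)" unfolding s_def by (rule S_L1[OF nu t]) simp
  also have "... = (NN z. indicator U z)"
    unfolding L1n_def by (intro nn_integral_cong) (simp add: indicator_def)
  finally have M: "?i + ?o <= emeasure lborel U" by simp
  have "?i + ?d = (NN z. ennreal (s z) * indicator U z + ennreal (1 - s z) * indicator U z)"
    by (rule nn_integral_add[symmetric]) measurable
  also have "... = (NN z. indicator U z)"
    by (intro nn_integral_cong) (simp add: indicator_def b ennreal_plus[symmetric] del: ennreal_plus)
  finally have I: "?i + ?d = emeasure lborel U" by simp
  have fin: "?i ~= \<infinity>" using f unfolding I[symmetric] by auto
  have "?i + ?o <= ?i + ?d" using M I by simp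
  then have le: "?o <= ?d" using fin by (simp add: ennreal_add_left_cancel_le)
  have "L1n (%z. s z - indicator U z) = (NN z. ennreal (1 - s z) * indicator U z + ennreal (s z) * indicator (- U) z)"
    unfolding L1n_def by (intro nn_integral_cong) (simp add: indicator_def b)
  also have "... = ?d + ?o"
    by (rule nn_integral_add) measurable
  also have "... <= 2 * ?d"
    using le by (simp add: mult_2)
  finally show ?thesis unfolding s_def .
qed

lemma S_open_indicator_continuous:
  assumes X: "!!n. X n > 0" "X \<longlonglongrightarrow> 0" and U: "open U" and f: "emeasure lborel U < \<infinity>"
  shows "(%n. L1n (%z. S nu (X n) (indicator U) z - indicator U z)) \<longlonglongrightarrow> 0"
proof -
  have Um[measurable]: "U \<in> sets borel" using U by simp
  define s where "s n = S nu (X n) (indicator U)" for n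
  have b: "0 <= s n z" "s n z <= 1" for n z
    using S_indicator_bounds[OF X(1) Um] by (auto simp: s_def)
  have [measurable]: "borel_fun (s n)" for n unfolding s_def by measurable
  have c: "(%n. s n z) \<longlonglongrightarrow> 1" if "z \<in> U" for z
    unfolding s_def by (rule S_indicator_open_tendsto[OF X U that])
  have l: "(%n. NN z. ennreal (1 - s n z) * indicator U z) \<longlonglongrightarrow> (\<integral>\<^sup>+ z. 0 \<partial>(lborel :: (real \<times> real) measure))"
  proof (rule nn_integral_dominated_convergence)
    show "(NN x. indicator U x) < \<infinity>" using f by simp
    show "AE x in lborel. ennreal (1 - s n x) * indicator U x <= indicator U x" for n
      using b(1)[of n] by (intro AE_I2) (simp add: indicator_def)
    show "AE x in lborel. (%n. ennreal (1 - s n x) * indicator U x) \<longlonglongrightarrow> 0"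
    proof (intro AE_I2)
      fix z
      show "(%n. ennreal (1 - s n z) * indicator U z) \<longlonglongrightarrow> 0"
      proof (cases "z \<in> U")
        case True
        have "(%n. ennreal (1 - s n z)) \<longlonglongrightarrow> ennreal (1 - 1)"
          by (intro tendsto_ennrealI tendsto_diff tendsto_const c True)
        then show ?thesis using True by simp
      qed simp
    qed
  qed measurable
  have l: "(%n. 2 * (NN z. ennreal (1 - s n z) * indicator U z)) \<longlonglongrightarrow> 0"
    using ennreal_tendsto_cmult[OF _ l, of 2] by simp
  have "(%n. L1n (%z. s n z - indicator U z)) \<longlonglongrightarrow> 0"
  proof (rule tendsto_sandwich[OF _ _ tendsto_const[of 0] l])
    show "\<forall>\<^sub>F n in sequentially. L1n (%z. s n z - indicator U z)
        <= 2 * (NN z. ennreal (1 - s n z) * indicator U z)"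
      unfolding s_def by (intro always_eventually allI S_indicator_L1 X f Um)
  qed simp
  then show ?thesis unfolding s_def .
qed

text \<open>By contraction, strong continuity passes to limits in L^1. Three errors of size
  \<open>r / 4\<close> leave room for the strict inequality.\<close>

lemma S_continuity_closed:
  assumes X: "!!n. X n > 0" and f: "integrable lborel f"
    and approx: "!!e. e > 0 ==> \<exists>g. integrable lborel g \<and> L1n (%z. f z - g z) <= ennreal e \<and>
      (%n. L1n (%z. S nu (X n) g z - g z)) \<longlonglongrightarrow> 0"
  shows "(%n. L1n (%z. S nu (X n) f z - f z)) \<longlonglongrightarrow> 0"
proof (rule tendsto_zero_ennreal)
  fix r :: real assume r: "0 < r"
  then obtain g where g: "integrable lborel g" "L1n (%z. f z - g z) <= ennreal (r / 4)"
      "(%n. L1n (%z. S nu (X n) g z - g z)) \<longlonglongrightarrow> 0"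
    using approx[of "r / 4"] by auto
  have [measurable]: "borel_fun f" "borel_fun g"
    using f g by simp_all
  have "\<forall>\<^sub>F n in sequentially. L1n (%z. S nu (X n) g z - g z) < ennreal (r / 4)"
    using order_tendstoD(2)[OF g(3), of "ennreal (r / 4)"] r by simp
  then show "\<forall>\<^sub>F n in sequentially. L1n (%z. S nu (X n) f z - f z) < ennreal r"
  proof eventually_elim
    case (elim n)
    have 1: "L1n (%z. S nu (X n) f z - f z) <= L1n (%z. S nu (X n) f z - S nu (X n) g z) + L1n (%z. S nu (X n) g z - f z)"
      by (rule L1n_diff_triangle) measurable
    have "(%z. S nu (X n) f z - S nu (X n) g z) = S nu (X n) (%z. f z - g z)"
      by (rule ext) (simp add: S_diff_L1[OF nu X f g(1)])
    then have 2: "L1n (%z. S nu (X n) f z - S nu (X n) g z) <= ennreal (r / 4)"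
      using order_trans[OF S_L1[OF nu X, of "%z. f z - g z" n] g(2)] by simp
    have 3: "L1n (%z. S nu (X n) g z - f z) <= L1n (%z. S nu (X n) g z - g z) + L1n (%z. g z - f z)"
      by (rule L1n_diff_triangle) measurable
    have 4: "... <= ennreal (r / 4) + ennreal (r / 4)"
      using elim g(2) by (intro add_mono) (auto simp: L1n_minus_commute[of g])
    have "L1n (%z. S nu (X n) f z - f z) <= ennreal (r / 4) + (ennreal (r / 4) + ennreal (r / 4))"
      using order_trans[OF 1 add_mono[OF 2 order_trans[OF 3 4]]] .
    also have "... = ennreal (3 / 4 * r)"
      using r by (simp add: ennreal_plus[symmetric] del: ennreal_plus)
    also have "... < ennreal r" using r by (simp add: ennreal_lessI)
    finally show ?case .
  qed
qed

text \<open>Induction over integrable functions. A measurable set is first replaced by an open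
  superset, using outer regularity, because \<open>S_indicator_open_tendsto\<close> gives the
  pointwise limit at the points of open sets.\<close>

lemma S_continuity_seq:
  assumes X: "!!n. X n > 0" "X \<longlonglongrightarrow> 0" and f: "integrable lborel f"
  shows "(%n. L1n (%z. S nu (X n) f z - f z)) \<longlonglongrightarrow> 0"
  using f
proof (induction rule: integrable_induct)
  case (base A c)
  then have A[measurable]: "A \<in> sets borel" by simp
  have iA: "integrable lborel (%z. indicator A z *\<^sub>R c)" using base by simp
  show ?case
  proof (rule S_continuity_closed[OF X(1) iA])
    fix e :: real assume e: "e > 0"
    have "e / (\<bar>c\<bar> + 1) > 0" using e by (simp add: add_pos_nonneg)
    then obtain U where U: "open U" "A \<subseteq> U" "emeasure lborel (U - A) < ennreal (e / (\<bar>c\<bar> + 1))"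
      using outer_regular_lborel[OF A] by blast
    have Um[measurable]: "U \<in> sets borel" using U by simp
    have "emeasure lborel U = emeasure lborel (A \<union> (U - A))" using U(2) by (simp add: Un_absorb1)
    also have "... <= emeasure lborel A + emeasure lborel (U - A)"
      by (rule emeasure_subadditive) simp_all
    also have "... < \<infinity>"
      using base(2) U(3) by (auto simp: less_top[symmetric] top_unique)
    finally have fU: "emeasure lborel U < \<infinity>" .
    have iU: "integrable lborel (%z. indicator U z *\<^sub>R c)" using fU by simp
    show "\<exists>g. integrable lborel g \<and> L1n (%z. indicator A z *\<^sub>R c - g z) <= ennreal e \<and>
      (%n. L1n (%z. S nu (X n) g z - g z)) \<longlonglongrightarrow> 0"
    proof (intro exI conjI)
      show "integrable lborel (%z. indicator U z *\<^sub>R c)" by (rule iU)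
      have "L1n (%z. indicator A z *\<^sub>R c - indicator U z *\<^sub>R c) = (NN z. ennreal \<bar>c\<bar> * indicator (U - A) z)"
        unfolding L1n_def using U(2) by (intro nn_integral_cong) (auto simp: indicator_def)
      also have "... = ennreal \<bar>c\<bar> * emeasure lborel (U - A)" by (rule nn_integral_cmult_indicator) simp
      also have "... <= ennreal \<bar>c\<bar> * ennreal (e / (\<bar>c\<bar> + 1))" using U(3) by (intro mult_left_mono) auto
      also have "... = ennreal (\<bar>c\<bar> * (e / (\<bar>c\<bar> + 1)))" using e by (intro ennreal_mult[symmetric]) auto
      also have "... <= ennreal e"
      proof (rule ennreal_leI)
        have "\<bar>c\<bar> / (\<bar>c\<bar> + 1) <= 1" by simp
        from mult_right_mono[OF this, of e] e show "\<bar>c\<bar> * (e / (\<bar>c\<bar> + 1)) <= e" by simp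
      qed
      finally show "L1n (%z. indicator A z *\<^sub>R c - indicator U z *\<^sub>R c) <= ennreal e" .
      have *: "L1n (%z. S nu (X n) (%z. indicator U z *\<^sub>R c) z - indicator U z *\<^sub>R c)
          = ennreal \<bar>c\<bar> * L1n (%z. S nu (X n) (indicator U) z - indicator U z)" for n
      proof -
        have "S nu (X n) (%z. indicator U z *\<^sub>R c) z = S nu (X n) (indicator U) z * c" for z
          unfolding S_def by (simp add: mult.assoc[symmetric])
        then have "\<bar>S nu (X n) (%z. indicator U z *\<^sub>R c) z - indicator U z *\<^sub>R c\<bar>
          = \<bar>c\<bar> * \<bar>S nu (X n) (indicator U) z - indicator U z\<bar>" for z
          by (simp only: left_diff_distrib[symmetric] abs_mult real_scaleR_def) (simp only: mult.commute)
        then show ?thesis unfolding L1n_def by (simp add: ennreal_mult nn_integral_cmult)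
      qed
      show "(%n. L1n (%z. S nu (X n) (%z. indicator U z *\<^sub>R c) z - indicator U z *\<^sub>R c)) \<longlonglongrightarrow> 0"
        unfolding * using ennreal_tendsto_cmult[OF _ S_open_indicator_continuous[OF X U(1) fU], of "ennreal \<bar>c\<bar>"] by simp
    qed
  qed
next
  case (add f g)
  have [measurable]: "borel_fun f" "borel_fun g" using add by simp_all
  have "L1n (%z. S nu (X n) (%z. f z + g z) z - (f z + g z))
    <= L1n (%z. S nu (X n) f z - f z) + L1n (%z. S nu (X n) g z - g z)" for n
  proof -
    have "S nu (X n) (%z. f z + g z) z - (f z + g z) = (S nu (X n) f z - f z) + (S nu (X n) g z - g z)" for z
      using integrable_kern_mult_L1[OF nu X(1)] add.hyps by (simp add: S_eq[OF nu X(1)] distrib_left)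
    then have e: "(%z. S nu (X n) (%z. f z + g z) z - (f z + g z)) = (%z. (S nu (X n) f z - f z) + (S nu (X n) g z - g z))"
      by (rule ext)
    show ?thesis unfolding e by (rule L1n_triangle(1)) measurable
  qed
  note le = this
  have "(%n. L1n (%z. S nu (X n) f z - f z) + L1n (%z. S nu (X n) g z - g z)) \<longlonglongrightarrow> 0"
    using tendsto_add[OF add.IH] by (simp only: add_0_right)
  then show ?case by (rule tendsto_0_le_ennreal[OF le])
next
  case (lim f s)
  show ?case
  proof (rule S_continuity_closed[OF X(1) lim.hyps(4)])
    fix e :: real assume e: "e > 0"
    have [measurable]: "borel_fun f" "!!i. s i \<in> borel_measurable borel" using lim.hyps(1,4) by simp_all
    have "(%i. NN z. ennreal (norm (f z - s i z))) \<longlonglongrightarrow> 0"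
    proof (rule nn_integral_dominated_convergence_norm[where w = "%z. 2 * norm (f z)"])
      show "AE x in lborel. norm (s j x) <= 2 * norm (f x)" for j using lim.hyps(3) by simp
      show "(NN x. ennreal (2 * norm (f x))) < \<infinity>"
        using lim.hyps(4) by (simp add: integrable_iff_bounded ennreal_mult nn_integral_cmult ennreal_mult_less_top)
      show "AE x in lborel. (%i. s i x) \<longlonglongrightarrow> f x" using lim.hyps(2) by simp
    qed simp_all
    then have "\<forall>\<^sub>F i in sequentially. (NN z. ennreal (norm (f z - s i z))) < ennreal e"
      using e by (intro order_tendstoD) auto
    then obtain i where "(NN z. ennreal (norm (f z - s i z))) < ennreal e"
      by (auto simp: eventually_sequentially)
    then show "\<exists>g. integrable lborel g \<and> L1n (%z. f z - g z) <= ennreal e \<and>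
      (%n. L1n (%z. S nu (X n) g z - g z)) \<longlonglongrightarrow> 0"
      using lim.hyps(1) lim.IH by (intro exI[of _ "s i"]) (auto simp: L1n_def abs_minus_commute)
  qed
qed

section \<open>Composition rules behind Nash's inequality\<close>

lemma auto_kern_nonneg [simp]: "t > 0 ==> c > 0 ==> auto_kern nu t c z w >= 0"
  using nu by (simp add: auto_kern_def xvar_pos)

lemma auto_kern_le:
  assumes t: "t > 0" and c: "c > 0"
  shows "auto_kern nu t c z w <= 1 / (4 * pi * c * (nu * t))"
proof -
  have V: "xvar nu t > 0" "2 * nu * t > 0" "2 * nu * t <= xvar nu t" using xvar_pos xvar_ge nu t by auto
  have i: "1 / sqrt (2 * pi * (c * xvar nu t)) <= 1 / sqrt (2 * pi * (c * (2 * nu * t)))"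
    using V c by (intro divide_left_mono) auto
  have "auto_kern nu t c z w <= 1 / sqrt (2 * pi * (c * xvar nu t)) * (1 / sqrt (2 * pi * (c * (2 * nu * t))))"
    unfolding auto_kern_def using V c by (intro mult_mono gauss_le) auto
  also have "... <= 1 / sqrt (2 * pi * (c * (2 * nu * t))) * (1 / sqrt (2 * pi * (c * (2 * nu * t))))"
    using i V c by (intro mult_right_mono) auto
  also have "... = 1 / (2 * pi * (c * (2 * nu * t)))" using V c by simp
  finally show ?thesis by (simp add: mult_ac)
qed

lemma auto_kern_conv:
  assumes t: "t > 0" and c: "c > 0"
  shows "(NN w. ennreal (auto_kern nu t c z w * auto_kern nu t c w z')) = ennreal (auto_kern nu t (2 * c) z z')"
proof -
  let ?V = "c * xvar nu t" let ?r = "c * (2 * nu * t)"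
  have V: "?V > 0" "?r > 0" using xvar_pos nu t c by auto
  let ?a = "fst z + t / 2 * snd z" let ?b = "fst z' + t / 2 * snd z'"
  let ?A = "%x. gauss ?V (?a - x) * gauss ?V (x - ?b)"
  let ?B = "%y. gauss ?r (snd z - y) * gauss ?r (y - snd z')"
  have "(NN w. ennreal (auto_kern nu t c z w * auto_kern nu t c w z'))
    = (NN w. ennreal (?A (fst w + t / 2 * snd w + 0) * ?B (snd w + 0)))"
    unfolding auto_kern_def by (simp add: mult_ac)
  also have "... = (NN x. ennreal (?A x)) * (NN y. ennreal (?B y))"
    by (rule nn_integral_sheared_product) (use V in auto)
  also have "... = ennreal (gauss (?V + ?V) (?a - ?b)) * ennreal (gauss (?r + ?r) (snd z - snd z'))"
    using V by (simp add: nn_integral_gauss_conv)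
  also have "... = ennreal (auto_kern nu t (2 * c) z z')"
    using V by (simp add: auto_kern_def ennreal_mult'' algebra_simps)
  finally show ?thesis .
qed

lemma kern_auto_kern:
  assumes t: "t > 0"
  shows "(NN w. ennreal (kern nu t w z * kern nu t w z')) = ennreal (auto_kern nu t 2 z z')"
proof -
  let ?V = "xvar nu t" let ?r = "2 * nu * t"
  have V: "?V > 0" "?r > 0" using xvar_pos nu t by auto
  let ?a = "fst z + t / 2 * snd z" let ?b = "fst z' + t / 2 * snd z'"
  let ?A = "%x. gauss ?V (?a - x) * gauss ?V (x - ?b)"
  let ?B = "%y. gauss ?r (snd z - y) * gauss ?r (y - snd z')"
  have "(NN w. ennreal (kern nu t w z * kern nu t w z'))
    = (NN w. ennreal (?A (fst w + (- t / 2) * snd w + 0) * ?B (snd w + 0)))"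
  proof (intro nn_integral_cong arg_cong[where f = ennreal])
    fix w
    let ?X = "fst w + (- t / 2) * snd w + 0"
    have x: "xdisp t w z = ?X - ?a" "xdisp t w z' = ?X - ?b"
      by (auto simp: xdisp_def algebra_simps add_divide_distrib)
    have y: "gauss ?V (?X - ?a) = gauss ?V (?a - ?X)" "gauss ?r (snd w - snd z) = gauss ?r (snd z - snd w)"
      by (rule gauss_commute)+
    show "kern nu t w z * kern nu t w z' = ?A (fst w + (- t / 2) * snd w + 0) * ?B (snd w + 0)"
      unfolding kern_def ydisp_def x y by (simp only: mult_ac add_0_right)
  qed
  also have "... = (NN x. ennreal (?A x)) * (NN y. ennreal (?B y))"
    by (rule nn_integral_sheared_product) (use V in auto)
  also have "... = ennreal (gauss (?V + ?V) (?a - ?b)) * ennreal (gauss (?r + ?r) (snd z - snd z'))"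
    using V by (simp add: nn_integral_gauss_conv)
  also have "... = ennreal (auto_kern nu t 2 z z')"
    using V by (simp add: auto_kern_def ennreal_mult'' algebra_simps)
  finally show ?thesis .
qed

text \<open>The squared norm of an integral operator as the quadratic form of its adjoint times
  itself. It serves twice: for \<open>S\<close>, where it produces \<open>auto_kern\<close> with
  \<open>c = 2\<close>, and for \<open>auto_kern\<close>, where it doubles \<open>c\<close>.\<close>

lemma nn_integral_square_kernel:
  fixes k :: "real \<times> real => real \<times> real => real" and g :: "real \<times> real => real"
  assumes [measurable]: "(%(z, w). k z w) \<in> borel_measurable borel" "borel_fun g"
    and p: "!!z w. k z w >= 0" "!!z. g z >= 0"
  shows "(NN w. (NN z. ennreal (k w z * g z))\<^sup>2)
    = (NN z. NN z'. ennreal (g z * g z') * (NN w. ennreal (k w z * k w z')))"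
proof -
  have [measurable]: "joint_borel lborel k"
    using assms(1) by (simp add: lborel_prod)
  have "(NN w. (NN z. ennreal (k w z * g z))\<^sup>2)
    = (NN w. NN z. NN z'. ennreal (g z * g z') * ennreal (k w z * k w z'))"
  proof (intro nn_integral_cong)
    fix w
    have "(NN z. ennreal (k w z * g z))\<^sup>2
       = (NN z. ennreal (k w z * g z) * (NN z'. ennreal (k w z' * g z')))"
      unfolding power2_eq_square by (rule nn_integral_multc[symmetric]) measurable
    also have "... = (NN z. NN z'. ennreal (k w z * g z) * ennreal (k w z' * g z'))"
      by (intro nn_integral_cong nn_integral_cmult[symmetric]) measurable
    also have "... = (NN z. NN z'. ennreal (g z * g z') * ennreal (k w z * k w z'))"
      by (intro nn_integral_cong) (simp add: p ennreal_mult[symmetric] mult_ac)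
    finally show "(NN z. ennreal (k w z * g z))\<^sup>2
      = (NN z. NN z'. ennreal (g z * g z') * ennreal (k w z * k w z'))" .
  qed
  also have "... = (NN z. NN w. NN z'. ennreal (g z * g z') * ennreal (k w z * k w z'))"
    by (rule lborel_pair.Fubini') measurable
  also have "... = (NN z. NN z'. NN w. ennreal (g z * g z') * ennreal (k w z * k w z'))"
    by (intro nn_integral_cong lborel_pair.Fubini') measurable
  also have "... = (NN z. NN z'. ennreal (g z * g z') * (NN w. ennreal (k w z * k w z')))"
    by (intro nn_integral_cong nn_integral_cmult) measurable
  finally show ?thesis .
qed

end

section \<open>Nash inequality\<close>

context
  fixes nu :: real
  assumes nu: "nu > 0"
begin

text \<open>With \<open>Q c\<close> the quadratic form of \<open>auto_kern nu t c\<close>, the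
  squared norm of \<open>S nu t g\<close> is at most \<open>Q 2\<close>. Cauchy-Schwarz and the
  doubling rule give \<open>(Q c)\<^sup>2 <= Y * Q (2 * c)\<close>, the supremum of the kernel gives
  decay like \<open>1 / c\<close>, and \<open>nash_real\<close> closes the recursion. The result
  says that the reciprocal of the squared norm grows by at least \<open>nu * t / P\<^sup>2\<close>,
  a form that composes well in time.\<close>

lemma S_nash:
  fixes g :: "real \<times> real => real"
  assumes t: "t > 0" and g[measurable]: "borel_fun g" and g0: "!!z. g z >= 0"
    and Y: "(NN z. ennreal ((g z)\<^sup>2)) <= ennreal Y" "Y > 0"
    and P: "(NN z. ennreal (g z)) <= ennreal P" "P > 0"
  shows "(NN z. ennreal ((S nu t g z)\<^sup>2)) <= ennreal (Y / (1 + nu * t * Y / P\<^sup>2))"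
proof -
  define Q where "Q c = (NN z. NN z'. ennreal (g z * g z') * ennreal (auto_kern nu t c z z'))" for c
  define X where "X = nu * t * Y / P\<^sup>2"
  have X: "X > 0" using nu t Y P by (simp add: X_def)
  have Qup: "Q c <= ennreal (P\<^sup>2 / (4 * pi * c * (nu * t)))" if c: "c > 0" for c
  proof -
    have pos: "1 / (4 * pi * c * (nu * t)) >= 0" using c nu t by simp
    have "Q c <= (NN z. NN z'. ennreal (g z) * ennreal (g z') * ennreal (1 / (4 * pi * c * (nu * t))))"
      unfolding Q_def using g0 by (intro nn_integral_mono mult_mono ennreal_leI auto_kern_le[OF nu t c]) (simp_all add: ennreal_mult)
    also have "... = (NN z. ennreal (g z)) * (NN z. ennreal (g z)) * ennreal (1 / (4 * pi * c * (nu * t)))"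
      by (simp add: nn_integral_multc nn_integral_cmult)
    also have "... <= ennreal P * ennreal P * ennreal (1 / (4 * pi * c * (nu * t)))"
      by (intro mult_mono P) auto
    also have "... = ennreal (P\<^sup>2 / (4 * pi * c * (nu * t)))"
      using P(2) pos by (simp add: ennreal_mult[symmetric] power2_eq_square)
    finally show ?thesis .
  qed
  have Qfin: "Q c < \<infinity>" if "c > 0" for c using Qup[OF that] by (rule le_less_trans) simp
  have Qdouble: "(Q c)\<^sup>2 <= ennreal Y * Q (2 * c)" if c: "c > 0" for c
  proof -
    have "Q c = (NN z. ennreal (g z) * (NN z'. ennreal (auto_kern nu t c z z' * g z')))"
      unfolding Q_def
    proof (intro nn_integral_cong)
      fix z
      have "(NN z'. ennreal (g z * g z') * ennreal (auto_kern nu t c z z'))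
        = (NN z'. ennreal (g z) * ennreal (auto_kern nu t c z z' * g z'))"
        by (intro nn_integral_cong) (simp add: g0 t c nu auto_kern_nonneg ennreal_mult mult_ac)
      then show "(NN z'. ennreal (g z * g z') * ennreal (auto_kern nu t c z z'))
        = ennreal (g z) * (NN z'. ennreal (auto_kern nu t c z z' * g z'))"
        by (simp add: nn_integral_cmult)
    qed
    then have "(Q c)\<^sup>2 <= (NN z. (ennreal (g z))\<^sup>2) * (NN z. (NN z'. ennreal (auto_kern nu t c z z' * g z'))\<^sup>2)"
      using Cauchy_Schwarz_nn_integral[of "%z. ennreal (g z)" lborel "%z. NN z'. ennreal (auto_kern nu t c z z' * g z')"] by simp
    also have "(NN z. (NN z'. ennreal (auto_kern nu t c z z' * g z'))\<^sup>2)
      = (NN z. NN z'. ennreal (g z * g z') * (NN w. ennreal (auto_kern nu t c w z * auto_kern nu t c w z')))"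
      using t c g0 nu by (intro nn_integral_square_kernel) (simp_all add: split_beta' auto_kern_nonneg)
    also have "... = Q (2 * c)"
    proof -
      have "(NN w. ennreal (auto_kern nu t c w z * auto_kern nu t c w z')) = ennreal (auto_kern nu t (2 * c) z z')" for z z'
        unfolding auto_kern_conv[OF nu t c, symmetric] auto_kern_commute[of nu t c _ z] ..
      then show ?thesis by (simp only: Q_def)
    qed
    also have "(NN z. (ennreal (g z))\<^sup>2) <= ennreal Y"
      using Y(1) g0 by (simp add: ennreal_power)
    finally show ?thesis by (simp add: mult_right_mono)
  qed
  define q where "q n = enn2real (Q (2 * 2 ^ n))" for n :: nat
  have Qq: "Q (2 * 2 ^ n) = ennreal (q n)" for n using Qfin[of "2 * 2 ^ n"] by (simp add: q_def)
  have "q 0 <= Y / (1 + X)"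
  proof (rule nash_real[OF _ _ _ Y(2) X])
    show q0: "q n >= 0" for n by (simp only: q_def enn2real_nonneg)
    show "(q n)\<^sup>2 <= Y * q (Suc n)" for n
    proof -
      have e: "2 * (2 * 2 ^ n) = 2 * (2::real) ^ Suc n" by simp
      have "(ennreal (q n))\<^sup>2 <= ennreal Y * ennreal (q (Suc n))"
        using Qdouble[of "2 * 2 ^ n"] unfolding e Qq by simp
      then have "ennreal ((q n)\<^sup>2) <= ennreal (Y * q (Suc n))"
        using q0 Y(2) by (simp only: ennreal_power ennreal_mult'')
      then show ?thesis using q0[of "Suc n"] Y(2) by (subst (asm) ennreal_le_iff) auto
    qed
    show "q n <= Y / (8 * pi * 2 ^ n * X)" for n
    proof -
      have "ennreal (q n) <= ennreal (P\<^sup>2 / (4 * pi * (2 * 2 ^ n) * (nu * t)))"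
        using Qup[of "2 * 2 ^ n"] unfolding Qq by simp
      moreover have "P\<^sup>2 / (4 * pi * (2 * 2 ^ n) * (nu * t)) = Y / (8 * pi * 2 ^ n * X)"
      proof -
        have "p / (4 * \<pi> * (2 * a) * n) = Y / (8 * \<pi> * a * (n * Y / p))" if "p > 0" for p \<pi> a n :: real
          using that Y(2) by (simp add: field_simps)
        then show ?thesis unfolding X_def using P(2) by simp
      qed
      moreover have "Y / (8 * pi * 2 ^ n * X) >= 0" using Y X by simp
      ultimately show ?thesis by (metis ennreal_le_iff)
    qed
  qed
  then have "Q 2 <= ennreal (Y / (1 + X))" using Qq[of 0] by (metis ennreal_leI mult.right_neutral power_0)
  moreover have "(NN z. ennreal ((S nu t g z)\<^sup>2)) <= Q 2"
  proof -
    have "(NN z. ennreal ((S nu t g z)\<^sup>2)) <= (NN z. (NN z'. ennreal (kern nu t z z' * g z'))\<^sup>2)"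
    proof (intro nn_integral_mono)
      fix z
      have "ennreal ((S nu t g z)\<^sup>2) = (ennreal \<bar>S nu t g z\<bar>)\<^sup>2" by (simp add: ennreal_power)
      also have "... <= (NN z'. ennreal (kern nu t z z' * g z'))\<^sup>2"
        using S_abs_le[OF nu t, of g z] g0 by (intro power_mono) auto
      finally show "ennreal ((S nu t g z)\<^sup>2) <= (NN z'. ennreal (kern nu t z z' * g z'))\<^sup>2" .
    qed
    also have "... = (NN z. NN z'. ennreal (g z * g z') * (NN w. ennreal (kern nu t w z * kern nu t w z')))"
      using t g0 nu by (intro nn_integral_square_kernel) (simp_all add: split_beta')
    also have "... = Q 2" unfolding Q_def kern_auto_kern[OF nu t] ..
    finally show ?thesis .
  qed
  ultimately show ?thesis unfolding X_def by simp
qed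

end

section \<open>Twists and the Biot-Savart kernel\<close>

text \<open>Rotation by the angle whose half has tangent \<open>m\<close>, in rational form. The
  decomposition into three shears, and with it the invariance of area, becomes a polynomial
  identity.\<close>

definition rot :: "real => real \<times> real => real \<times> real" where
  "rot m w = (((1 - m\<^sup>2) * fst w - 2 * m * snd w) / (1 + m\<^sup>2), (2 * m * fst w + (1 - m\<^sup>2) * snd w) / (1 + m\<^sup>2))"

lemma one_plus_square_pos: "1 + m\<^sup>2 > (0::real)"
  by (simp add: add_pos_nonneg)

lemma norm_plane: "(norm w)\<^sup>2 = (fst w)\<^sup>2 + (snd w)\<^sup>2" for w :: "real \<times> real"
  by (cases w) (simp add: norm_Pair)

lemma borel_measurable_rot [measurable (raw)]:
  assumes [measurable]: "f \<in> borel_measurable M" "g \<in> borel_measurable M"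
  shows "(%x. rot (f x) (g x)) \<in> borel_measurable M"
  unfolding rot_def by measurable

lemma rot_shears:
  fixes m :: real
  defines "s \<equiv> 2 * m / (1 + m\<^sup>2)"
  defines "x1 \<equiv> %w. fst w + (- m) * snd w"
  defines "y1 \<equiv> %w. snd w + s * x1 w"
  shows "rot m w = (x1 w + (- m) * y1 w, y1 w)"
proof -
  have D: "1 + m\<^sup>2 ~= 0" using one_plus_square_pos[of m] by simp
  have sD: "s * (1 + m\<^sup>2) = 2 * m" using D by (simp add: s_def)
  have y: "y1 w * (1 + m\<^sup>2) = 2 * m * fst w + (1 - m\<^sup>2) * snd w"
  proof -
    have "y1 w * (1 + m\<^sup>2) = snd w * (1 + m\<^sup>2) + (s * (1 + m\<^sup>2)) * x1 w"
      unfolding y1_def by (simp add: algebra_simps)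
    then show ?thesis unfolding sD by (simp add: x1_def algebra_simps power2_eq_square)
  qed
  have x: "(x1 w + (- m) * y1 w) * (1 + m\<^sup>2) = (1 - m\<^sup>2) * fst w - 2 * m * snd w"
  proof -
    have "(x1 w + (- m) * y1 w) * (1 + m\<^sup>2) = x1 w * (1 + m\<^sup>2) - m * (y1 w * (1 + m\<^sup>2))"
      by (simp add: algebra_simps)
    then show ?thesis unfolding y by (simp add: x1_def algebra_simps power2_eq_square)
  qed
  show ?thesis unfolding rot_def x[symmetric] y[symmetric] using D by simp
qed

lemma nn_integral_rot:
  fixes f :: "real \<times> real => ennreal"
  assumes [measurable]: "borel_fun f"
  shows "(NN w. f (rot m w)) = (NN w. f w)"
proof -
  define s where "s = 2 * m / (1 + m\<^sup>2)"
  define f1 where "f1 w = f (fst w + (- m) * snd w + 0, snd w + 0)" for w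
  define f2 where "f2 w = f1 (fst w, snd w + s * fst w)" for w
  have [measurable]: "borel_fun f1" unfolding f1_def by measurable
  have [measurable]: "borel_fun f2" unfolding f2_def by measurable
  have "(NN w. f (rot m w)) = (NN w. f2 (fst w + (- m) * snd w + 0, snd w + 0))"
    unfolding rot_shears f2_def f1_def s_def by simp
  also have "... = (NN w. f2 w)" by (rule nn_integral_shear(1)) simp
  also have "... = (NN w. f1 w)" unfolding f2_def by (rule nn_integral_shear(2)) simp
  also have "... = (NN w. f w)" unfolding f1_def by (rule nn_integral_shear(1)) simp
  finally show ?thesis .
qed

lemma norm_rot [simp]: "norm (rot m w) = norm w"
proof -
  have D: "1 + m\<^sup>2 ~= 0" using one_plus_square_pos[of m] by simp
  have "(norm (rot m w))\<^sup>2 = (((1 - m\<^sup>2) * fst w - 2 * m * snd w)\<^sup>2 + (2 * m * fst w + (1 - m\<^sup>2) * snd w)\<^sup>2) / (1 + m\<^sup>2)\<^sup>2"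
    unfolding norm_plane rot_def fst_conv snd_conv power_divide add_divide_distrib[symmetric] ..
  also have "((1 - m\<^sup>2) * fst w - 2 * m * snd w)\<^sup>2 + (2 * m * fst w + (1 - m\<^sup>2) * snd w)\<^sup>2 = (1 + m\<^sup>2)\<^sup>2 * (norm w)\<^sup>2"
    unfolding norm_plane by (simp add: power2_eq_square algebra_simps)
  also have "... / (1 + m\<^sup>2)\<^sup>2 = (norm w)\<^sup>2" using D by simp
  finally show ?thesis by simp
qed

lemma rot_inverse [simp]: "rot (- m) (rot m w) = w"
proof -
  have D: "1 + m\<^sup>2 ~= 0" using one_plus_square_pos[of m] by simp
  have e: "(p * (a / d) + q * (b / d)) / d = (p * a + q * b) / (d * d)" for p q a b d :: real
    by (simp add: add_divide_distrib)
  have "((1 - m\<^sup>2) * ((1 - m\<^sup>2) * fst w - 2 * m * snd w) + 2 * m * (2 * m * fst w + (1 - m\<^sup>2) * snd w))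
      = fst w * ((1 + m\<^sup>2) * (1 + m\<^sup>2))"
    "((- 2 * m) * ((1 - m\<^sup>2) * fst w - 2 * m * snd w) + (1 - m\<^sup>2) * (2 * m * fst w + (1 - m\<^sup>2) * snd w))
      = snd w * ((1 + m\<^sup>2) * (1 + m\<^sup>2))"
    by (simp_all add: power2_eq_square algebra_simps)
  note k = this
  have "fst (rot (- m) (rot m w)) = ((1 - m\<^sup>2) * ((1 - m\<^sup>2) * fst w - 2 * m * snd w) + 2 * m * (2 * m * fst w + (1 - m\<^sup>2) * snd w)) / ((1 + m\<^sup>2) * (1 + m\<^sup>2))"
    unfolding e[symmetric] by (simp add: rot_def)
  also have "... = fst w" unfolding k using D by simp
  finally have 1: "fst (rot (- m) (rot m w)) = fst w" .
  have "snd (rot (- m) (rot m w)) = ((- 2 * m) * ((1 - m\<^sup>2) * fst w - 2 * m * snd w) + (1 - m\<^sup>2) * (2 * m * fst w + (1 - m\<^sup>2) * snd w)) / ((1 + m\<^sup>2) * (1 + m\<^sup>2))"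
    unfolding e[symmetric] by (simp add: rot_def)
  also have "... = snd w" unfolding k using D by simp
  finally show ?thesis using 1 by (simp add: prod_eq_iff)
qed

lemma norm_rot_diff: "norm (rot m w - w) <= 2 * \<bar>m\<bar> * norm w"
proof -
  have D: "1 + m\<^sup>2 ~= 0" "1 + m\<^sup>2 >= 1" by (simp_all add: add_pos_nonneg order_less_imp_not_eq2)
  have e: "rot m w - w = ((- 2 * m\<^sup>2 * fst w - 2 * m * snd w) / (1 + m\<^sup>2), (2 * m * fst w - 2 * m\<^sup>2 * snd w) / (1 + m\<^sup>2))"
  proof -
    have c: "x / (1 + m\<^sup>2) - y = (x - y * (1 + m\<^sup>2)) / (1 + m\<^sup>2)" for x y
      using D(1) by (simp add: diff_divide_distrib)
    show ?thesis unfolding rot_def by (cases w) (simp add: c, simp add: algebra_simps)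
  qed
  have "(norm (rot m w - w))\<^sup>2 = ((- 2 * m\<^sup>2 * fst w - 2 * m * snd w)\<^sup>2 + (2 * m * fst w - 2 * m\<^sup>2 * snd w)\<^sup>2) / (1 + m\<^sup>2)\<^sup>2"
    unfolding e norm_plane fst_conv snd_conv power_divide add_divide_distrib[symmetric] ..
  also have "(- 2 * m\<^sup>2 * fst w - 2 * m * snd w)\<^sup>2 + (2 * m * fst w - 2 * m\<^sup>2 * snd w)\<^sup>2 = (1 + m\<^sup>2) * (4 * m\<^sup>2 * (norm w)\<^sup>2)"
    unfolding norm_plane by (simp add: power2_eq_square algebra_simps)
  also have "... / (1 + m\<^sup>2)\<^sup>2 = 4 * m\<^sup>2 * (norm w)\<^sup>2 / (1 + m\<^sup>2)"
    using D(1) by (simp add: power2_eq_square)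
  also have "... <= 4 * m\<^sup>2 * (norm w)\<^sup>2 / 1" by (rule divide_left_mono[OF D(2)]) (use one_plus_square_pos[of m] in simp_all)
  also have "... = (2 * \<bar>m\<bar> * norm w)\<^sup>2" by (simp add: power_mult_distrib)
  finally show ?thesis by (rule power2_le_imp_le) simp
qed

lemma norm_rot_linearization: "norm (rot m w - w - (2 * m) *\<^sub>R perp w) <= 2 * m\<^sup>2 * norm w"
proof -
  have D: "1 + m\<^sup>2 ~= 0" "1 + m\<^sup>2 >= 1" by (simp_all add: add_pos_nonneg order_less_imp_not_eq2)
  have q: "(2 * m - 2 * m * (1 + m\<^sup>2)) = - 2 * m\<^sup>2 * m" by (simp add: algebra_simps power2_eq_square)
  have "rot m w - w - (2 * m) *\<^sub>R perp w = ((- 2 * m\<^sup>2 * fst w + 2 * m\<^sup>2 * m * snd w) / (1 + m\<^sup>2), (- 2 * m\<^sup>2 * m * fst w - 2 * m\<^sup>2 * snd w) / (1 + m\<^sup>2))"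
  proof -
    have c: "x / (1 + m\<^sup>2) - y - z = (x - (y + z) * (1 + m\<^sup>2)) / (1 + m\<^sup>2)" for x y z
      using D(1) by (simp add: diff_divide_distrib)
    have c1: "fst (rot m w) - fst w - 2 * m * (- snd w) = (- 2 * m\<^sup>2 * fst w + 2 * m\<^sup>2 * m * snd w) / (1 + m\<^sup>2)"
      unfolding rot_def fst_conv c by (simp add: algebra_simps power2_eq_square)
    have c2: "snd (rot m w) - snd w - 2 * m * fst w = (- 2 * m\<^sup>2 * m * fst w - 2 * m\<^sup>2 * snd w) / (1 + m\<^sup>2)"
      unfolding rot_def snd_conv c by (simp add: algebra_simps power2_eq_square)
    show ?thesis by (rule prod_eqI) (use c1 c2 in \<open>simp_all add: perp_def\<close>)
  qed
  then have "(norm (rot m w - w - (2 * m) *\<^sub>R perp w))\<^sup>2 = ((- 2 * m\<^sup>2 * fst w + 2 * m\<^sup>2 * m * snd w)\<^sup>2 + (- 2 * m\<^sup>2 * m * fst w - 2 * m\<^sup>2 * snd w)\<^sup>2) / (1 + m\<^sup>2)\<^sup>2"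
    by (simp only: norm_plane fst_conv snd_conv power_divide add_divide_distrib[symmetric])
  also have "(- 2 * m\<^sup>2 * fst w + 2 * m\<^sup>2 * m * snd w)\<^sup>2 + (- 2 * m\<^sup>2 * m * fst w - 2 * m\<^sup>2 * snd w)\<^sup>2 = (1 + m\<^sup>2) * (2 * m\<^sup>2 * norm w)\<^sup>2"
    unfolding power_mult_distrib norm_plane by (simp add: power2_eq_square algebra_simps)
  also have "... / (1 + m\<^sup>2)\<^sup>2 = (2 * m\<^sup>2 * norm w)\<^sup>2 / (1 + m\<^sup>2)"
    using D(1) by (simp add: power2_eq_square)
  also have "... <= (2 * m\<^sup>2 * norm w)\<^sup>2 / 1" by (rule divide_left_mono[OF D(2)]) (use one_plus_square_pos[of m] in simp_all)
  finally have q: "(norm (rot m w - w - (2 * m) *\<^sub>R perp w))\<^sup>2 <= (2 * m\<^sup>2 * norm w)\<^sup>2" by simp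
  show ?thesis by (rule power2_le_imp_le[OF q]) simp
qed

text \<open>Integer part of the angular velocity \<open>1 / (2 * pi * r\<^sup>2)\<close> of a unit
  point vortex, in units of \<open>h\<close>. It depends on the radius only and is an integer, so
  \<open>twist\<close> is a fixed rotation on each of countably many rings. It is 0 far away, and
  also at the origin since division by zero gives 0.\<close>

definition level :: "real => real \<times> real => nat" where
  "level h w = nat \<lfloor>1 / (2 * pi * (norm w)\<^sup>2 * h)\<rfloor>"

text \<open>For small \<open>m\<close>, \<open>rot m\<close> turns by about \<open>2 * m\<close>, so
  this is approximately the flow of a vortex of strength \<open>\<sigma>\<close> during the time
  \<open>h\<close>.\<close>

definition twist :: "real => real => real \<times> real => real \<times> real" where
  "twist h \<sigma> w = rot (\<sigma> * (h\<^sup>2 * real (level h w) / 2)) w"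

definition bs_kernel :: "real \<times> real => real \<times> real" where
  "bs_kernel w = (1 / (2 * pi * (norm w)\<^sup>2)) *\<^sub>R perp w"

lemma borel_measurable_perp [measurable (raw)]:
  assumes [measurable]: "f \<in> borel_measurable M"
  shows "(%x. perp (f x)) \<in> borel_measurable M" "(%x. bs_kernel (f x)) \<in> borel_measurable M"
  unfolding bs_kernel_def perp_def by measurable

lemma measurable_level [measurable (raw)]:
  assumes [measurable]: "g \<in> borel_measurable M"
  shows "(%x. level h (g x)) \<in> measurable M (count_space UNIV)"
  unfolding level_def by measurable

lemma borel_measurable_twist [measurable (raw)]:
  assumes [measurable]: "f \<in> borel_measurable M" "g \<in> borel_measurable M"
  shows "(%x. twist h (f x) (g x)) \<in> borel_measurable M"
  unfolding twist_def by measurable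

lemma level_rot [simp]: "level h (rot m w) = level h w"
  by (simp add: level_def)

text \<open>The plane is decomposed into the level sets; each is invariant under rotations, and on
  each the twist is one rotation.\<close>

lemma nn_integral_twist:
  fixes f :: "real \<times> real => ennreal"
  assumes [measurable]: "borel_fun f"
  shows "(NN w. f (twist h \<sigma> w)) = (NN w. f w)"
proof -
  define g where "g n w = f w * indicator {w. level h w = n} w" for n w
  have [measurable]: "borel_fun (g n)" for n unfolding g_def by measurable
  have 1: "(NN w. f w) = (\<Sum>n. NN w. g n w)"
  proof -
    have "f w = (\<Sum>n. g n w)" for w
      using sums_unique[OF sums_single[of "level h w" "%_. f w"]] by (simp add: g_def indicator_def eq_commute[of _ "level h w"] of_bool_def if_distrib cong: if_cong)
    then show ?thesis by (simp add: nn_integral_suminf)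
  qed
  have "f (twist h \<sigma> w) = (\<Sum>n. g n (rot (\<sigma> * (h\<^sup>2 * real n / 2)) w))" for w
    using sums_unique[OF sums_single[of "level h w" "%n. f (rot (\<sigma> * (h\<^sup>2 * real n / 2)) w)"]]
    by (simp add: g_def indicator_def twist_def eq_commute[of _ "level h w"] of_bool_def if_distrib cong: if_cong)
  then have "(NN w. f (twist h \<sigma> w)) = (\<Sum>n. NN w. g n (rot (\<sigma> * (h\<^sup>2 * real n / 2)) w))"
    by (simp add: nn_integral_suminf)
  also have "... = (NN w. f w)" unfolding 1 by (simp add: nn_integral_rot)
  finally show ?thesis .
qed

lemma twist_inverse [simp]: "twist h (- \<sigma>) (twist h \<sigma> w) = w"
  by (simp add: twist_def)

lemma level_bounds:
  assumes h: "h > 0"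
  shows "h * real (level h w) <= 1 / (2 * pi * (norm w)\<^sup>2)" "1 / (2 * pi * (norm w)\<^sup>2) - h <= h * real (level h w)"
proof -
  define x where "x = 1 / (2 * pi * (norm w)\<^sup>2 * h)"
  have x: "x >= 0" "h * x = 1 / (2 * pi * (norm w)\<^sup>2)" using h by (auto simp: x_def)
  have l: "real (level h w) = of_int \<lfloor>x\<rfloor>" using x(1) by (simp add: level_def x_def[symmetric])
  have "h * of_int \<lfloor>x\<rfloor> <= h * x" using h by (intro mult_left_mono) auto
  then show "h * real (level h w) <= 1 / (2 * pi * (norm w)\<^sup>2)" using x(2) l by simp
  have "h * (x - 1) <= h * of_int \<lfloor>x\<rfloor>" using h by (intro mult_left_mono) (linarith, simp)
  then show "1 / (2 * pi * (norm w)\<^sup>2) - h <= h * real (level h w)" using x(2) l by (simp add: right_diff_distrib)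
qed

lemma norm_twist_diff:
  assumes h: "h > 0" and s: "\<bar>\<sigma>\<bar> <= 1"
  shows "norm (twist h \<sigma> w - w) <= h / norm w"
proof (cases "w = 0")
  case True then show ?thesis by (simp add: twist_def rot_def zero_prod_def)
next
  case False
  have "norm (twist h \<sigma> w - w) <= 2 * \<bar>\<sigma> * (h\<^sup>2 * real (level h w) / 2)\<bar> * norm w"
    unfolding twist_def by (rule norm_rot_diff)
  also have "... = \<bar>\<sigma>\<bar> * (h * (h * real (level h w)) * norm w)" by (simp add: abs_mult power2_eq_square)
  also have "... <= 1 * (h * (1 / (2 * pi * (norm w)\<^sup>2)) * norm w)"
    using h s by (intro mult_mono mult_left_mono mult_right_mono level_bounds) auto
  also have "... = h / norm w / (2 * pi)" using False by (simp add: power2_eq_square)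
  also have "... <= h / norm w / 1" using h pi_gt3 by (intro divide_left_mono) auto
  finally show ?thesis by simp
qed

lemma norm_perp [simp]: "norm (perp w) = norm w"
  by (simp add: perp_def norm_prod_def add.commute)

lemma norm_bs_kernel: "norm (bs_kernel w) = 1 / (2 * pi * norm w)"
  by (cases "w = 0") (simp_all add: bs_kernel_def power2_eq_square)

lemma norm_bs_kernel_le: "norm (bs_kernel w) <= 1 / norm w"
proof -
  have "1 / norm w / (2 * pi) <= 1 / norm w / 1" using pi_gt3 by (intro divide_left_mono) auto
  then show ?thesis by (simp add: norm_bs_kernel mult.commute)
qed

text \<open>Two errors add up: the curvature of the rotation gives \<open>h / norm w ^ 3\<close>,
  the rounding of the angular velocity gives \<open>sqrt h\<close>.\<close>

lemma norm_twist_linearization: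
  assumes h: "h > 0" and s: "\<bar>\<sigma>\<bar> <= 1"
  shows "norm ((1 / h) *\<^sub>R (twist h \<sigma> w - w) - \<sigma> *\<^sub>R bs_kernel w) <= h / norm w ^ 3 + sqrt h"
proof (cases "w = 0")
  case True then show ?thesis using h by (simp add: twist_def rot_def zero_prod_def bs_kernel_def perp_def)
next
  case False
  define r where "r = norm w"
  define g where "g = 1 / (2 * pi * r\<^sup>2)"
  define l where "l = h * real (level h w)"
  define m where "m = \<sigma> * (h\<^sup>2 * real (level h w) / 2)"
  have r: "r > 0" using False by (simp add: r_def)
  have g: "g > 0" using r by (simp add: g_def)
  have l: "l <= g" "g - h <= l" "0 <= l" using level_bounds[OF h, of w] h by (auto simp: l_def g_def r_def)
  have m: "2 * m = \<sigma> * h * l" by (simp add: m_def l_def power2_eq_square)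
  have e: "(1 / h) *\<^sub>R (twist h \<sigma> w - w) - \<sigma> *\<^sub>R bs_kernel w
    = (1 / h) *\<^sub>R (rot m w - w - (2 * m) *\<^sub>R perp w) + (\<sigma> * (l - g)) *\<^sub>R perp w"
  proof -
    have 1: "(1 / h) *\<^sub>R ((2 * m) *\<^sub>R perp w) = (\<sigma> * l) *\<^sub>R perp w" using h by (simp only: m) simp
    have 2: "(\<sigma> * (l - g)) *\<^sub>R perp w = (\<sigma> * l) *\<^sub>R perp w - \<sigma> *\<^sub>R (g *\<^sub>R perp w)"
      by (simp add: right_diff_distrib scaleR_diff_left)
    have "twist h \<sigma> w = rot m w" by (simp add: twist_def m_def)
    moreover have "bs_kernel w = g *\<^sub>R perp w" by (simp add: bs_kernel_def g_def r_def)
    ultimately show ?thesis unfolding scaleR_diff_right[of "1 / h" "rot m w - w"] 1 2 by simp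
  qed
  have am: "\<bar>m\<bar> <= h * g / 2"
  proof -
    have "2 * \<bar>m\<bar> = \<bar>\<sigma>\<bar> * (h * l)" using h l m by (metis abs_mult abs_numeral abs_of_nonneg abs_of_pos mult.assoc)
    also have "... <= 1 * (h * g)" using h l s by (intro mult_mono mult_left_mono) auto
    finally show ?thesis by simp
  qed
  have 1: "norm ((1 / h) *\<^sub>R (rot m w - w - (2 * m) *\<^sub>R perp w)) <= h / r ^ 3"
  proof -
    have "norm ((1 / h) *\<^sub>R (rot m w - w - (2 * m) *\<^sub>R perp w)) <= (1 / h) * (2 * m\<^sup>2 * r)"
      using norm_rot_linearization[of m w] h by (simp add: r_def divide_right_mono)
    also have "m\<^sup>2 <= (h * g / 2)\<^sup>2" using power_mono[OF am, of 2] by simp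
    then have "(1 / h) * (2 * m\<^sup>2 * r) <= (1 / h) * (2 * (h * g / 2)\<^sup>2 * r)"
      using h r by (intro mult_left_mono mult_right_mono) auto
    also have "... = h * (g\<^sup>2 * r) / 2" using h by (simp add: power2_eq_square)
    also have "g\<^sup>2 * r = 1 / r ^ 3 / (4 * pi\<^sup>2)"
      using r by (simp add: g_def power2_eq_square power3_eq_cube)
    also have "h * (1 / r ^ 3 / (4 * pi\<^sup>2)) / 2 = h / r ^ 3 / (8 * pi\<^sup>2)" by simp
    also have "... <= h / r ^ 3 / 1"
    proof (intro divide_left_mono)
      have "1 <= pi\<^sup>2" using pi_gt3 by (intro one_le_power) simp
      then show "1 <= 8 * pi\<^sup>2" by linarith
    qed (use h r in auto)
    finally show ?thesis by simp
  qed
  have 2: "norm ((\<sigma> * (l - g)) *\<^sub>R perp w) <= sqrt h"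
  proof -
    \<comment> \<open>The rounding error is below both \<open>g\<close> and \<open>h\<close>. Their
      geometric mean times \<open>r\<close> is at most \<open>sqrt h\<close> for every radius,
      whereas \<open>h * r\<close> alone would grow at infinity.\<close>
    have "\<bar>l - g\<bar> <= g" "\<bar>l - g\<bar> <= h" using l by auto
    then have "\<bar>l - g\<bar> * \<bar>l - g\<bar> <= g * h" using g by (intro mult_mono) auto
    then have "(l - g)\<^sup>2 <= g * h" by (simp add: power2_eq_square)
    from mult_right_mono[OF this, of "r\<^sup>2"] have "(\<bar>l - g\<bar> * r)\<^sup>2 <= g * h * r\<^sup>2"
      by (simp only: power_mult_distrib power2_abs zero_le_power2)
    also have "... = h / (2 * pi)" using r by (simp add: g_def)
    also have "... <= h / 1" using h pi_gt3 by (intro divide_left_mono) auto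
    finally have "\<bar>l - g\<bar> * r <= sqrt h" by (simp add: real_le_rsqrt)
    moreover have "\<bar>\<sigma>\<bar> * (\<bar>l - g\<bar> * r) <= 1 * (\<bar>l - g\<bar> * r)" using s r by (intro mult_right_mono) auto
    ultimately show ?thesis by (simp add: abs_mult r_def)
  qed
  show ?thesis unfolding e r_def[symmetric] by (rule order_trans[OF norm_triangle_ineq add_mono[OF 1 2]])
qed

section \<open>Local integrability of the inverse distance, and its potentials\<close>

lemma nn_integral_powr:
  assumes "a > - 1" "c >= 0"
  shows "(NN x. ennreal (x powr a) * indicator {0<..<c} x) <= ennreal (c powr (a + 1) / (a + 1))"
proof -
  have "(NN x. ennreal (x powr a) * indicator {0<..<c} x) <= (NN x. ennreal (x powr a) * indicator {0..c} x)"
    by (intro nn_integral_mono mult_left_mono) (auto simp: indicator_def)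
  also have "... = ennreal (c powr (a + 1) / (a + 1))"
    by (rule nn_integral_has_integral_lebesgue'[OF _ has_integral_powr_from_0]) (use assms in auto)
  finally show ?thesis .
qed

text \<open>A majorant in product form, from
  \<open>2 * \<bar>x * y\<bar> <= x\<^sup>2 + y\<^sup>2\<close>. It reduces local integrability of
  \<open>1 / norm w\<close> in the plane to that of \<open>x powr (-1/2)\<close> on the
  line.\<close>

lemma inverse_norm_le: "1 / norm w <= \<bar>fst w\<bar> powr (-1/2) * \<bar>snd w\<bar> powr (-1/2)"
  if "fst w ~= 0" "snd w ~= 0" for w :: "real \<times> real"
proof -
  have pos: "\<bar>fst w\<bar> * \<bar>snd w\<bar> > 0" using that by simp
  have "\<bar>fst w\<bar> * \<bar>snd w\<bar> <= (norm w)\<^sup>2"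
  proof -
    have "0 <= (\<bar>fst w\<bar> - \<bar>snd w\<bar>)\<^sup>2" by simp
    then have "2 * (\<bar>fst w\<bar> * \<bar>snd w\<bar>) <= (norm w)\<^sup>2" by (simp add: norm_plane power2_diff)
    then show ?thesis using pos by linarith
  qed
  then have "sqrt (\<bar>fst w\<bar> * \<bar>snd w\<bar>) <= norm w" by (simp add: real_le_lsqrt)
  moreover have "norm w > 0" using that by auto
  ultimately have "1 / norm w <= 1 / sqrt (\<bar>fst w\<bar> * \<bar>snd w\<bar>)"
    by (intro divide_left_mono mult_pos_pos real_sqrt_gt_zero pos) auto
  also have "... = \<bar>fst w\<bar> powr (-1/2) * \<bar>snd w\<bar> powr (-1/2)"
  proof -
    have p: "a powr (-1/2) = 1 / sqrt a" if "a > 0" for a :: real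
      using powr_minus_divide[of a "1/2"] powr_half_sqrt[of a] that by simp
    have a: "\<bar>fst w\<bar> > 0" "\<bar>snd w\<bar> > 0" using that by auto
    show ?thesis unfolding p[OF a(1)] p[OF a(2)] real_sqrt_mult by simp
  qed
  finally show ?thesis .
qed

lemma nn_integral_abs_powr:
  assumes R: "R >= 0"
  shows "(NN x. ennreal (\<bar>x\<bar> powr (-1/2)) * indicator {x. \<bar>x\<bar> < R} x) <= ennreal (4 * sqrt R)"
proof -
  define f where "f x = ennreal (x powr (-1/2)) * indicator {0<..<R} x" for x :: real
  have [measurable]: "borel_fun f" unfolding f_def by measurable
  have "(NN x. ennreal (\<bar>x\<bar> powr (-1/2)) * indicator {x. \<bar>x\<bar> < R} x) <= (NN x. f x + f (0 - x))"
    by (intro nn_integral_mono) (auto simp: f_def indicator_def)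
  also have "... = (NN x. f x) + (NN x. f (0 - x))"
    by (rule nn_integral_add) measurable
  also have "(NN x. f (0 - x)) = (NN x. f x)" by (rule nn_integral_shift(3)) measurable
  also have "(NN x. f x) <= ennreal (R powr (-1/2 + 1) / (-1/2 + 1))"
    unfolding f_def using R by (intro nn_integral_powr) auto
  also have "R powr (-1/2 + 1) / (-1/2 + 1) = 2 * sqrt R" using R by (simp add: powr_half_sqrt)
  finally have "(NN x. ennreal (\<bar>x\<bar> powr (-1/2)) * indicator {x. \<bar>x\<bar> < R} x) <= ennreal (2 * sqrt R) + ennreal (2 * sqrt R)"
    by (simp add: add_mono)
  then show ?thesis using R by (simp add: ennreal_plus[symmetric] del: ennreal_plus)
qed

lemma nn_integral_inverse_norm_box:
  assumes R: "R >= 0"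
  shows "(\<integral>\<^sup>+ w. ennreal (1 / norm w) * indicator {w. \<bar>fst w\<bar> < R \<and> \<bar>snd w\<bar> < R} w \<partial>(lborel :: (real \<times> real) measure)) <= ennreal (16 * R)"
proof -
  define f where "f x = ennreal (\<bar>x\<bar> powr (-1/2)) * indicator {x. \<bar>x\<bar> < R} x" for x :: real
  have [measurable]: "borel_fun f" unfolding f_def by measurable
  have fx: "AE w in lborel. fst w ~= (0::real) \<and> snd w ~= (0::real)"
  proof -
    have n: "AE x in lborel. x ~= (0::real)" by (rule AE_lborel_singleton)
    have "AE x in lborel. AE y in lborel. fst (x, y) ~= (0::real) \<and> snd (x, y) ~= (0::real)"
      by (rule AE_mp[OF n], rule AE_I2, rule impI, rule AE_mp[OF n], rule AE_I2) simp
    then have "AE w in lborel \<Otimes>\<^sub>M lborel. fst w ~= (0::real) \<and> snd w ~= (0::real)"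
      by (rule lborel_pair.AE_pair_measure[rotated]) measurable
    then show ?thesis by (simp only: lborel_prod)
  qed
  have "(\<integral>\<^sup>+ w. ennreal (1 / norm w) * indicator {w. \<bar>fst w\<bar> < R \<and> \<bar>snd w\<bar> < R} w \<partial>(lborel :: (real \<times> real) measure))
    <= (NN w. f (fst w) * f (snd w))"
  proof (rule nn_integral_mono_AE, use fx in eventually_elim)
    case (elim w)
    show ?case
    proof (cases "\<bar>fst w\<bar> < R \<and> \<bar>snd w\<bar> < R")
      case True
      then show ?thesis using inverse_norm_le[of w] elim by (simp add: f_def ennreal_mult[symmetric] ennreal_leI)
    qed simp
  qed
  also have "... = (NN x. f x) * (NN x. f x)" by (rule nn_integral_product) measurable
  also have "... <= ennreal (4 * sqrt R) * ennreal (4 * sqrt R)"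
    unfolding f_def by (intro mult_mono nn_integral_abs_powr R) auto
  also have "... = ennreal (16 * R)" using R by (simp add: ennreal_mult[symmetric])
  finally show ?thesis .
qed

definition inv_pot :: "(real \<times> real => real) => real \<times> real => ennreal" where
  "inv_pot f z = (NN z'. ennreal (\<bar>f z'\<bar> / norm (z - z')))"

lemma borel_measurable_inv_pot [measurable (raw)]:
  assumes [measurable]: "joint_borel M F" "Z \<in> borel_measurable M"
  shows "(%x. inv_pot (F x) (Z x)) \<in> borel_measurable M"
  unfolding inv_pot_def by measurable

lemma nn_integral_translate_plane:
  fixes f :: "real \<times> real => ennreal"
  assumes [measurable]: "borel_fun f"
  shows "(NN w. f (w - z)) = (NN w. f w)"
  using nn_integral_shear(1)[OF assms, of 0 "- fst z" "- snd z"] by (simp add: minus_prod_def)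

lemma inv_pot_near:
  fixes f :: "real \<times> real => real"
  assumes [measurable]: "borel_fun f" and b: "AE z in lborel. \<bar>f z\<bar> <= b" "b >= 0" and R: "R >= 0"
  shows "(NN z'. ennreal (\<bar>f z'\<bar> / norm (z - z')) * indicator {z'. norm (z - z') < R} z') <= ennreal (16 * R * b)"
proof -
  define g where "g w = ennreal (1 / norm w) * indicator {w. \<bar>fst w\<bar> < R \<and> \<bar>snd w\<bar> < R} w" for w :: "real \<times> real"
  have [measurable]: "borel_fun g" unfolding g_def by measurable
  have "(NN z'. ennreal (\<bar>f z'\<bar> / norm (z - z')) * indicator {z'. norm (z - z') < R} z')
    <= (NN z'. ennreal b * g (z' - z))"
  proof (rule nn_integral_mono_AE, use b(1) in eventually_elim)
    case (elim z')
    show ?case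
    proof (cases "norm (z - z') < R")
      case True
      then have "norm (z' - z) < R" by (simp only: norm_minus_commute)
      then have "\<bar>fst (z' - z)\<bar> < R" "\<bar>snd (z' - z)\<bar> < R"
        using norm_fst_le[of "fst (z' - z)" "snd (z' - z)"] norm_snd_le[of "snd (z' - z)" "fst (z' - z)"]
        unfolding prod.collapse real_norm_def by linarith+
      then show ?thesis using True elim b(2)
        by (simp add: g_def norm_minus_commute ennreal_mult[symmetric] divide_right_mono ennreal_leI)
    qed simp
  qed
  also have "... = ennreal b * (NN w. g w)"
    by (simp add: nn_integral_cmult nn_integral_translate_plane)
  also have "... <= ennreal b * ennreal (16 * R)"
    unfolding g_def by (intro mult_left_mono nn_integral_inverse_norm_box R) auto
  also have "... = ennreal (16 * R * b)" using b R by (simp add: ennreal_mult[symmetric] mult_ac)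
  finally show ?thesis .
qed

text \<open>Split at distance \<open>R\<close>: the near part uses the bound \<open>b\<close>, the
  far part the mass \<open>a\<close>. The radius stays free; a choice proportional to
  \<open>sqrt s\<close> later yields potentials of order \<open>1 / sqrt s\<close>.\<close>

lemma inv_pot_bound:
  assumes [measurable]: "borel_fun f" and b: "AE z in lborel. \<bar>f z\<bar> <= b" "b >= 0" and R: "R > 0"
    and a: "L1n f <= ennreal a" "a >= 0"
  shows "inv_pot f z <= ennreal (16 * R * b + a / R)"
proof -
  have "inv_pot f z <= (NN z'. ennreal (\<bar>f z'\<bar> / norm (z - z')) * indicator {z'. norm (z - z') < R} z' + ennreal (1 / R) * ennreal \<bar>f z'\<bar>)"
    unfolding inv_pot_def
  proof (rule nn_integral_mono)
    fix z'
    show "ennreal (\<bar>f z'\<bar> / norm (z - z')) <= ennreal (\<bar>f z'\<bar> / norm (z - z')) * indicator {z'. norm (z - z') < R} z' + ennreal (1 / R) * ennreal \<bar>f z'\<bar>"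
    proof (cases "norm (z - z') < R")
      case False
      then have "norm (z - z') > 0" "R <= norm (z - z')" using R by linarith+
      then have "\<bar>f z'\<bar> / norm (z - z') <= \<bar>f z'\<bar> / R" using R by (intro divide_left_mono mult_pos_pos) auto
      then show ?thesis using False R by (simp add: ennreal_mult[symmetric] ennreal_leI)
    qed simp
  qed
  also have "... = (NN z'. ennreal (\<bar>f z'\<bar> / norm (z - z')) * indicator {z'. norm (z - z') < R} z') + ennreal (1 / R) * L1n f"
    unfolding L1n_def by (subst nn_integral_add) (measurable, simp add: nn_integral_cmult)
  also have "... <= ennreal (16 * R * b) + ennreal (1 / R) * ennreal a"
    using R a b by (intro add_mono mult_left_mono inv_pot_near) auto
  also have "... = ennreal (16 * R * b + a / R)"
    using R a b by (simp add: ennreal_mult[symmetric] ennreal_plus[symmetric] del: ennreal_plus)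
  finally show ?thesis .
qed

lemma inv_pot_add:
  assumes [measurable]: "borel_fun f" "borel_fun g"
    and le: "AE z in lborel. \<bar>h z\<bar> <= \<bar>f z\<bar> + \<bar>g z\<bar>"
  shows "inv_pot h z <= inv_pot f z + inv_pot g z"
proof -
  have "inv_pot h z <= (NN z'. ennreal (\<bar>f z'\<bar> / norm (z - z')) + ennreal (\<bar>g z'\<bar> / norm (z - z')))"
    unfolding inv_pot_def
    by (rule nn_integral_mono_AE, use le in eventually_elim)
      (simp add: ennreal_plus[symmetric] add_divide_distrib[symmetric] divide_right_mono ennreal_leI del: ennreal_plus)
  also have "... = inv_pot f z + inv_pot g z" unfolding inv_pot_def by (rule nn_integral_add) measurable
  finally show ?thesis .
qed

lemma biot_savart_eq: "biot_savart f z = (LINT z'|lborel. f z' *\<^sub>R bs_kernel (z - z'))"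
proof -
  have e: "(%z'. f z' *\<^sub>R bs_kernel (z - z')) = (%z'. (1 / (2 * pi)) *\<^sub>R ((f z' / (norm (z - z'))\<^sup>2) *\<^sub>R perp (z - z')))"
    by (simp add: bs_kernel_def fun_eq_iff)
  \<comment> \<open>A nonzero factor comes out in any case: if one of the two integrands is not
    integrable, neither is the other, and both integrals are 0.\<close>
  have sc: "(LINT z'|lborel. c *\<^sub>R g z') = c *\<^sub>R (LINT z'|lborel. g z')" if "c ~= 0"
    for c and g :: "real \<times> real => real \<times> real"
  proof (cases "integrable lborel g")
    case False
    then have "\<not> integrable lborel (%z'. c *\<^sub>R g z')"
      using integrable_scaleR_right[of "1 / c" lborel "%z'. c *\<^sub>R g z'"] that by auto
    then have "(LINT z'|lborel. c *\<^sub>R g z') = 0" by (rule not_integrable_integral_eq)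
    moreover have "(LINT z'|lborel. g z') = 0" using False by (rule not_integrable_integral_eq)
    ultimately show ?thesis by (simp only: scaleR_zero_right)
  qed simp
  have "1 / (2 * pi) ~= 0" by simp
  from sc[OF this] show ?thesis unfolding biot_savart_def e by (rule sym)
qed

lemma borel_measurable_biot_savart [measurable (raw)]:
  assumes [measurable]: "joint_borel M F" "Z \<in> borel_measurable M"
  shows "(%x. biot_savart (F x) (Z x)) \<in> borel_measurable M"
  unfolding biot_savart_eq by measurable

lemma biot_savart_le: "ennreal (norm (biot_savart f z)) <= inv_pot f z"
proof -
  have "ennreal (norm (biot_savart f z)) <= (NN z'. ennreal (norm (f z' *\<^sub>R bs_kernel (z - z'))))"
    unfolding biot_savart_eq by (rule norm_integral_le_nn_integral)
  also have "... <= inv_pot f z"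
    unfolding inv_pot_def
  proof (intro nn_integral_mono ennreal_leI)
    fix z'
    have "norm (f z' *\<^sub>R bs_kernel (z - z')) <= \<bar>f z'\<bar> * (1 / norm (z - z'))"
      by (simp only: norm_scaleR real_norm_def) (intro mult_left_mono norm_bs_kernel_le, simp)
    then show "norm (f z' *\<^sub>R bs_kernel (z - z')) <= \<bar>f z'\<bar> / norm (z - z')" by simp
  qed
  finally show ?thesis .
qed

lemma integrable_bs_kernel:
  assumes [measurable]: "borel_fun f" and "inv_pot f z < \<infinity>"
  shows "integrable lborel (%z'. f z' *\<^sub>R bs_kernel (z - z'))"
proof (rule integrableI_bounded)
  have "(NN z'. ennreal (norm (f z' *\<^sub>R bs_kernel (z - z')))) <= inv_pot f z"
    unfolding inv_pot_def
  proof (intro nn_integral_mono ennreal_leI)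
    fix z'
    have "norm (f z' *\<^sub>R bs_kernel (z - z')) <= \<bar>f z'\<bar> * (1 / norm (z - z'))"
      by (simp only: norm_scaleR real_norm_def) (intro mult_left_mono norm_bs_kernel_le, simp)
    then show "norm (f z' *\<^sub>R bs_kernel (z - z')) <= \<bar>f z'\<bar> / norm (z - z')" by simp
  qed
  also have "... < \<infinity>" by (rule assms)
  finally show "(NN z'. ennreal (norm (f z' *\<^sub>R bs_kernel (z - z')))) < \<infinity>" .
qed measurable

text \<open>Symmetry of \<open>norm (z - z')\<close>. In a difference of two transport terms, one
  term contains the potential of the difference; after the swap the difference enters through its
  L^1 norm, and the supremum of the potential is taken of a known function.\<close>

lemma nn_integral_inv_pot_swap:
  assumes [measurable]: "borel_fun f" "borel_fun g"
  shows "(NN z. ennreal \<bar>f z\<bar> * inv_pot g z) = (NN z. ennreal \<bar>g z\<bar> * inv_pot f z)"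
proof -
  have "(NN z. ennreal \<bar>f z\<bar> * inv_pot g z) = (NN z. NN z'. ennreal (\<bar>f z\<bar> * \<bar>g z'\<bar> / norm (z - z')))"
    unfolding inv_pot_def by (subst nn_integral_cmult[symmetric]) (simp_all add: ennreal_mult[symmetric])
  also have "... = (NN z'. NN z. ennreal (\<bar>f z\<bar> * \<bar>g z'\<bar> / norm (z - z')))"
    by (rule lborel_pair.Fubini') measurable
  also have "... = (NN z. ennreal \<bar>g z\<bar> * inv_pot f z)"
    unfolding inv_pot_def by (subst nn_integral_cmult[symmetric]) (simp_all add: ennreal_mult[symmetric] norm_minus_commute mult_ac)
  finally show ?thesis .
qed

lemma nn_integral_inv_pot_le:
  assumes [measurable]: "borel_fun f" and "!!z. inv_pot g z <= N"
  shows "(NN z. ennreal \<bar>f z\<bar> * inv_pot g z) <= N * L1n f"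
proof -
  have "(NN z. ennreal \<bar>f z\<bar> * inv_pot g z) <= (NN z. N * ennreal \<bar>f z\<bar>)"
    using assms(2) by (intro nn_integral_mono) (subst mult.commute, intro mult_right_mono, auto)
  also have "... = N * L1n f" unfolding L1n_def by (rule nn_integral_cmult) simp
  finally show ?thesis .
qed

section \<open>Vortex jumps\<close>

definition vjump :: "real => real => real \<times> real => real \<times> real => real \<times> real" where
  "vjump h \<sigma> z0 z = z0 + twist h \<sigma> (z - z0)"

lemma borel_measurable_vjump [measurable (raw)]:
  assumes [measurable]: "s \<in> borel_measurable M" "f \<in> borel_measurable M" "g \<in> borel_measurable M"
  shows "(%x. vjump h (s x) (f x) (g x)) \<in> borel_measurable M"
  unfolding vjump_def by measurable

lemma vjump_inverse [simp]: "vjump h (- \<sigma>) z0 (vjump h \<sigma> z0 z) = z" "vjump h \<sigma> z0 (vjump h (- \<sigma>) z0 z) = z"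
  using twist_inverse[of h \<sigma> "z - z0"] twist_inverse[of h "- \<sigma>" "z - z0"] by (simp_all add: vjump_def)

lemma nn_integral_vjump:
  fixes f :: "real \<times> real => ennreal"
  assumes [measurable]: "borel_fun f"
  shows "(NN z. f (vjump h \<sigma> z0 z)) = (NN z. f z)"
proof -
  define g where "g w = f (z0 + w)" for w
  have [measurable]: "borel_fun g" unfolding g_def by measurable
  have "(NN z. f (vjump h \<sigma> z0 z)) = (NN z. g (twist h \<sigma> (z - z0)))"
    unfolding g_def vjump_def ..
  also have "... = (NN w. g (twist h \<sigma> w))"
    by (rule nn_integral_translate_plane[of "%w. g (twist h \<sigma> w)"]) measurable
  also have "... = (NN w. g w)" by (rule nn_integral_twist) measurable
  also have "... = (NN z. f z)"
    using nn_integral_translate_plane[of f "- z0"] by (simp add: g_def add.commute)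
  finally show ?thesis .
qed

lemma distr_vjump: "distr lborel borel (vjump h \<sigma> z0) = lborel"
proof (rule measure_eqI)
  fix A assume "A \<in> sets (distr lborel borel (vjump h \<sigma> z0))"
  then have [measurable]: "A \<in> sets borel" by simp
  have "emeasure (distr lborel borel (vjump h \<sigma> z0)) A = (\<integral>\<^sup>+ z. indicator A z \<partial>distr lborel borel (vjump h \<sigma> z0))" by simp
  also have "... = (NN z. indicator A (vjump h \<sigma> z0 z))" by (rule nn_integral_distr) measurable
  also have "... = (NN z. indicator A z)" by (rule nn_integral_vjump) measurable
  finally show "emeasure (distr lborel borel (vjump h \<sigma> z0)) A = emeasure lborel A" by simp
qed simp

lemma integral_vjump:
  fixes f :: "real \<times> real => real"
  assumes [measurable]: "borel_fun f"
  shows "(LI z. f (vjump h \<sigma> z0 z)) = (LI z. f z)"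
proof -
  have "(\<integral>z. f z \<partial>distr lborel borel (vjump h \<sigma> z0)) = (LI z. f (vjump h \<sigma> z0 z))"
    by (rule integral_distr) measurable
  then show ?thesis unfolding distr_vjump by simp
qed

text \<open>The vortex at \<open>z0\<close> acts with intensity \<open>\<bar>g z0\<bar>\<close> and
  turns in the direction \<open>sgn (g z0)\<close>. Vorticity is transported by composition with the
  inverse map, hence the minus sign.\<close>

definition jump :: "real => (real \<times> real => real) => (real \<times> real => real) => real \<times> real => real" where
  "jump h g f z = (LINT z0|lborel. \<bar>g z0\<bar> * f (vjump h (- sgn (g z0)) z0 z))"

lemma borel_measurable_sgn_real [measurable (raw)]:
  fixes f :: "'a => real"
  assumes [measurable]: "f \<in> borel_measurable M"
  shows "(%x. sgn (f x)) \<in> borel_measurable M"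
  unfolding sgn_if by measurable

lemma borel_measurable_jump [measurable (raw)]:
  assumes [measurable]: "joint_borel M G"
    "joint_borel M F" "Z \<in> borel_measurable M"
  shows "(%x. jump h (G x) (F x) (Z x)) \<in> borel_measurable M"
  unfolding jump_def by measurable

lemma jump_abs_le: "ennreal \<bar>jump h g f z\<bar> <= (NN z0. ennreal (\<bar>g z0\<bar> * \<bar>f (vjump h (- sgn (g z0)) z0 z)\<bar>))"
  using norm_integral_le_nn_integral[of lborel "%z0. \<bar>g z0\<bar> * f (vjump h (- sgn (g z0)) z0 z)"]
  by (simp add: jump_def abs_mult)

lemma nn_integral_jump:
  assumes [measurable]: "borel_fun g" "borel_fun f" and p: "!!z. f z >= 0"
  shows "(NN z. NN z0. ennreal (\<bar>g z0\<bar> * f (vjump h (- sgn (g z0)) z0 z))) = L1n g * (NN z. ennreal (f z))"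
proof -
  have "(NN z. NN z0. ennreal (\<bar>g z0\<bar> * f (vjump h (- sgn (g z0)) z0 z)))
    = (NN z0. NN z. ennreal (\<bar>g z0\<bar> * f (vjump h (- sgn (g z0)) z0 z)))"
    by (rule lborel_pair.Fubini') measurable
  also have "... = (NN z0. ennreal \<bar>g z0\<bar> * (NN z. ennreal (f z)))"
  proof (intro nn_integral_cong)
    fix z0
    have "(NN z. ennreal (\<bar>g z0\<bar> * f (vjump h (- sgn (g z0)) z0 z))) = (NN z. ennreal (\<bar>g z0\<bar> * f z))"
      by (rule nn_integral_vjump[of "%z. ennreal (\<bar>g z0\<bar> * f z)"]) measurable
    also have "... = ennreal \<bar>g z0\<bar> * (NN z. ennreal (f z))"
      using p by (subst nn_integral_cmult[symmetric]) (auto simp: ennreal_mult)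
    finally show "(NN z. ennreal (\<bar>g z0\<bar> * f (vjump h (- sgn (g z0)) z0 z))) = ennreal \<bar>g z0\<bar> * (NN z. ennreal (f z))" .
  qed
  also have "... = L1n g * (NN z. ennreal (f z))" unfolding L1n_def by (rule nn_integral_multc) measurable
  finally show ?thesis .
qed

lemma jump_L1:
  assumes [measurable]: "borel_fun g" "borel_fun f"
  shows "L1n (jump h g f) <= L1n g * L1n f"
proof -
  have "L1n (jump h g f) <= (NN z. NN z0. ennreal (\<bar>g z0\<bar> * \<bar>f (vjump h (- sgn (g z0)) z0 z)\<bar>))"
    unfolding L1n_def[of "jump h g f"] by (intro nn_integral_mono jump_abs_le)
  also have "... = L1n g * L1n f"
    unfolding L1n_def[of f] by (rule nn_integral_jump[of g "%z. \<bar>f z\<bar>"]) auto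
  finally show ?thesis .
qed

lemma integrable_jump:
  assumes g: "integrable lborel g" and [measurable]: "borel_fun f" and b: "!!z. \<bar>f z\<bar> <= (b::real)"
  shows "integrable lborel (%z0. \<bar>g z0\<bar> * f (vjump h (- sgn (g z0)) z0 z))"
proof -
  have [measurable]: "borel_fun g" using g by simp
  have "b >= 0" using order_trans[OF abs_ge_zero b] .
  then show ?thesis
    by (intro Bochner_Integration.integrable_bound[OF integrable_mult_left[OF integrable_abs[OF g], of b]])
      (use b in \<open>simp_all add: abs_mult mult_left_mono\<close>)
qed

lemma jump_bound:
  assumes g: "integrable lborel g" and [measurable]: "borel_fun f" and b: "!!z. \<bar>f z\<bar> <= (b::real)"
  shows "\<bar>jump h g f z\<bar> <= (LI z. \<bar>g z\<bar>) * b"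
proof -
  have "\<bar>jump h g f z\<bar> <= (LI z0. \<bar>\<bar>g z0\<bar> * f (vjump h (- sgn (g z0)) z0 z)\<bar>)"
    unfolding jump_def by (rule integral_abs_bound)
  also have "... <= (LI z0. \<bar>g z0\<bar> * b)"
    using g b by (intro integral_mono integrable_abs integrable_jump[OF g _ b]) (auto simp: abs_mult mult_left_mono)
  finally show ?thesis by simp
qed

lemma vjump_disp:
  assumes h: "h > 0" "\<bar>\<sigma>\<bar> <= 1"
  shows "norm (vjump h \<sigma> z0 z - z) <= h / norm (z - z0)"
    "norm ((1 / h) *\<^sub>R (vjump h \<sigma> z0 z - z) - \<sigma> *\<^sub>R bs_kernel (z - z0)) <= h / norm (z - z0) ^ 3 + sqrt h"
proof -
  have e: "vjump h \<sigma> z0 z - z = twist h \<sigma> (z - z0) - (z - z0)" by (simp add: vjump_def)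
  show "norm (vjump h \<sigma> z0 z - z) <= h / norm (z - z0)" unfolding e by (rule norm_twist_diff[OF h])
  show "norm ((1 / h) *\<^sub>R (vjump h \<sigma> z0 z - z) - \<sigma> *\<^sub>R bs_kernel (z - z0)) <= h / norm (z - z0) ^ 3 + sqrt h"
    unfolding e by (rule norm_twist_linearization[OF h])
qed

section \<open>Consistency of vortex jumps with transport\<close>

context
  fixes nu :: real
  assumes nu: "nu > 0"
begin

definition cdisp :: "real => real" where
  "cdisp t = (2 + t / 2) / sqrt (2 * nu * t)"

lemma disp_size_eq: "disp_size nu t v = cdisp t * norm v"
  by (simp add: disp_size_def[OF nu] cdisp_def)

lemma cdisp_nonneg: "t > 0 ==> cdisp t >= 0"
  using nu by (simp add: cdisp_def)

text \<open>Error at a source \<open>z'\<close> due to one vortex \<open>z0\<close>: the jump acts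
  on the source argument of the kernel, and the norm is taken in the target \<open>z\<close>. Only
  the kernel is differentiated.\<close>

definition jump_err :: "real => real => real => real \<times> real => real \<times> real => ennreal" where
  "jump_err t h \<sigma> z0 z' = (NN z. ennreal \<bar>(kern nu t z (vjump h \<sigma> z0 z') - kern nu t z z') / h - \<sigma> * (kgrad nu t z z' \<bullet> bs_kernel (z' - z0))\<bar>)"

text \<open>A crude bound without cancellation. Close to the vortex the linearisation is useless,
  but the singularity is integrable, so a small disc contributes little.\<close>

lemma jump_err_near:
  assumes t: "t > 0" and h: "h > 0" "\<bar>\<sigma>\<bar> <= 1"
  shows "jump_err t h \<sigma> z0 z' <= ennreal (4 * cdisp t / norm (z' - z0))"
proof -
  let ?p = "vjump h \<sigma> z0 z'" let ?k = "bs_kernel (z' - z0)"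
  have c: "cdisp t >= 0" using cdisp_nonneg[OF t] .
  have "jump_err t h \<sigma> z0 z' <= (NN z. ennreal (1 / h) * ennreal \<bar>kern nu t z ?p - kern nu t z z'\<bar> + ennreal \<bar>kgrad nu t z z' \<bullet> ?k\<bar>)"
    unfolding jump_err_def
  proof (intro nn_integral_mono)
    fix z
    let ?A = "kern nu t z ?p - kern nu t z z'" let ?B = "kgrad nu t z z' \<bullet> ?k"
    have "\<bar>?A / h - \<sigma> * ?B\<bar> <= \<bar>?A / h\<bar> + \<bar>\<sigma> * ?B\<bar>" by (rule abs_triangle_ineq4)
    also have "\<bar>\<sigma> * ?B\<bar> <= 1 * \<bar>?B\<bar>" unfolding abs_mult using h by (intro mult_right_mono) auto
    also have "\<bar>?A / h\<bar> = 1 / h * \<bar>?A\<bar>" using h by simp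
    finally show "ennreal \<bar>?A / h - \<sigma> * ?B\<bar> <= ennreal (1 / h) * ennreal \<bar>?A\<bar> + ennreal \<bar>?B\<bar>"
      using h by (simp add: ennreal_mult[symmetric] ennreal_plus[symmetric] ennreal_leI del: ennreal_plus)
  qed
  also have "... = ennreal (1 / h) * (NN z. ennreal \<bar>kern nu t z ?p - kern nu t z z'\<bar>) + (NN z. ennreal \<bar>kgrad nu t z z' \<bullet> ?k\<bar>)"
    by (subst nn_integral_add) (simp_all add: nn_integral_cmult)
  also have "... <= ennreal (1 / h) * ennreal (2 * (cdisp t * norm (?p - z'))) + ennreal (2 * (cdisp t * norm ?k))"
    using kern_difference[OF nu t, of ?p z'] nn_integral_kgrad_inner[OF nu t, of z' ?k]
    unfolding disp_size_eq by (intro add_mono mult_left_mono) auto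
  also have "... = ennreal (2 * cdisp t * (norm (?p - z') / h + norm ?k))"
    using h c by (simp add: ennreal_mult[symmetric] ennreal_plus[symmetric] algebra_simps del: ennreal_plus)
  also have "... <= ennreal (2 * cdisp t * (1 / norm (z' - z0) + 1 / norm (z' - z0)))"
  proof (intro ennreal_leI mult_left_mono add_mono norm_bs_kernel_le)
    have "norm (?p - z') / h <= (h / norm (z' - z0)) / h"
      using h by (intro divide_right_mono vjump_disp) auto
    then show "norm (?p - z') / h <= 1 / norm (z' - z0)" using h by simp
  qed (use c in auto)
  also have "2 * cdisp t * (1 / norm (z' - z0) + 1 / norm (z' - z0)) = 4 * cdisp t / norm (z' - z0)" by simp
  finally show ?thesis .
qed

text \<open>Powers of \<open>\<delta>\<close> for \<open>h = \<delta> ^ 6\<close>: outside the disc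
  the displacement is at most \<open>\<delta> ^ 5\<close>, its power 3/2 is at most
  \<open>\<delta> ^ 7 = \<delta> * h\<close>, and \<open>h / \<delta> ^ 3\<close> and
  \<open>sqrt h\<close> both equal \<open>\<delta> ^ 3\<close>. After division by \<open>h\<close>
  all errors are at most of order \<open>\<delta>\<close>.\<close>

lemma jump_err_far:
  assumes t: "t > 0" and d: "\<delta> > 0" "\<delta> <= 1" "h = \<delta> ^ 6" "\<bar>\<sigma>\<bar> <= 1" and far: "norm (z' - z0) >= \<delta>"
  shows "jump_err t h \<sigma> z0 z' <= ennreal ((6 * (cdisp t * sqrt (cdisp t)) + 4 * cdisp t) * \<delta>)"
proof -
  let ?p = "vjump h \<sigma> z0 z'" let ?k = "bs_kernel (z' - z0)" let ?q = "(1 / h) *\<^sub>R (?p - z') - \<sigma> *\<^sub>R ?k"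
  have c: "cdisp t >= 0" using cdisp_nonneg[OF t] .
  have h: "h > 0" using d by simp
  have "jump_err t h \<sigma> z0 z' <= (NN z. ennreal (1 / h) * ennreal \<bar>kern nu t z ?p - kern nu t z z' - kgrad nu t z z' \<bullet> (?p - z')\<bar> + ennreal \<bar>kgrad nu t z z' \<bullet> ?q\<bar>)"
    unfolding jump_err_def
  proof (intro nn_integral_mono)
    fix z
    let ?A = "kern nu t z ?p - kern nu t z z'" let ?B = "kgrad nu t z z' \<bullet> ?k" let ?C = "kgrad nu t z z' \<bullet> (?p - z')"
    have "?A / h - \<sigma> * ?B = (1 / h) * (?A - ?C) + kgrad nu t z z' \<bullet> ?q"
      by (simp add: inner_diff_right right_diff_distrib diff_divide_distrib)
    then have "\<bar>?A / h - \<sigma> * ?B\<bar> <= \<bar>(1 / h) * (?A - ?C)\<bar> + \<bar>kgrad nu t z z' \<bullet> ?q\<bar>"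
      by (simp only: abs_triangle_ineq)
    also have "\<bar>(1 / h) * (?A - ?C)\<bar> = (1 / h) * \<bar>?A - ?C\<bar>" using h by (simp add: abs_mult)
    finally show "ennreal \<bar>?A / h - \<sigma> * ?B\<bar> <= ennreal (1 / h) * ennreal \<bar>?A - ?C\<bar> + ennreal \<bar>kgrad nu t z z' \<bullet> ?q\<bar>"
      using h by (subst ennreal_mult[symmetric]) (simp_all add: ennreal_plus[symmetric] ennreal_leI del: ennreal_plus)
  qed
  also have "... = ennreal (1 / h) * (NN z. ennreal \<bar>kern nu t z ?p - kern nu t z z' - kgrad nu t z z' \<bullet> (?p - z')\<bar>) + (NN z. ennreal \<bar>kgrad nu t z z' \<bullet> ?q\<bar>)"
    by (subst nn_integral_add) (simp_all add: nn_integral_cmult)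
  also have "... <= ennreal (1 / h) * ennreal (6 * (cdisp t * norm (?p - z') * sqrt (cdisp t * norm (?p - z')))) + ennreal (2 * (cdisp t * norm ?q))"
    using kern_difference_interpolated[OF nu t, of ?p z'] nn_integral_kgrad_inner[OF nu t, of z' ?q]
    unfolding disp_size_eq by (intro add_mono mult_left_mono) auto
  also have "... = ennreal (6 * (cdisp t * sqrt (cdisp t)) * (norm (?p - z') * sqrt (norm (?p - z')) / h) + 2 * cdisp t * norm ?q)"
    using h c by (simp add: ennreal_mult[symmetric] ennreal_plus[symmetric] real_sqrt_mult algebra_simps del: ennreal_plus)
  also have "... <= ennreal (6 * (cdisp t * sqrt (cdisp t)) * \<delta> + 2 * cdisp t * (2 * \<delta>))"
  proof (intro ennreal_leI add_mono mult_left_mono)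
    have p: "norm (?p - z') <= \<delta> ^ 5"
    proof -
      have "norm (?p - z') <= h / norm (z' - z0)" by (rule vjump_disp[OF h d(4)])
      also have "... <= h / \<delta>" using far d(1) h by (intro divide_left_mono mult_pos_pos) auto
      also have "... = \<delta> ^ 5" using d by (simp add: power_eq_if)
      finally show ?thesis .
    qed
    have "sqrt (norm (?p - z')) <= \<delta>\<^sup>2"
    proof (rule real_le_lsqrt)
      have "\<delta> ^ 5 <= \<delta> ^ 4" using d by (intro power_decreasing) auto
      then show "norm (?p - z') <= (\<delta>\<^sup>2)\<^sup>2" using p by simp
    qed simp
    then have "norm (?p - z') * sqrt (norm (?p - z')) <= \<delta> ^ 5 * \<delta>\<^sup>2" using p d by (intro mult_mono) auto
    also have "... = \<delta> * h" using d by (simp add: power_eq_if)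
    finally show "norm (?p - z') * sqrt (norm (?p - z')) / h <= \<delta>" using h by (simp add: pos_divide_le_eq)
    have "norm ?q <= h / norm (z' - z0) ^ 3 + sqrt h" by (rule vjump_disp[OF h d(4)])
    also have "h / norm (z' - z0) ^ 3 <= h / \<delta> ^ 3"
      using far d(1) h by (intro divide_left_mono power_mono mult_pos_pos zero_less_power) auto
    also have "h / \<delta> ^ 3 = \<delta> ^ 3" using d by (simp add: power_eq_if)
    also have "sqrt h = \<delta> ^ 3"
      using d by (intro real_sqrt_unique) (auto simp: power_mult[symmetric])
    also have "\<delta> ^ 3 <= \<delta> ^ 1" using d by (intro power_decreasing) auto
    finally show "norm ?q <= 2 * \<delta>" by simp
  qed (use c in auto)
  also have "6 * (cdisp t * sqrt (cdisp t)) * \<delta> + 2 * cdisp t * (2 * \<delta>) = (6 * (cdisp t * sqrt (cdisp t)) + 4 * cdisp t) * \<delta>"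
    by (simp add: algebra_simps)
  finally show ?thesis .
qed

lemma borel_measurable_jump_err [measurable (raw)]:
  assumes [measurable]: "s \<in> borel_measurable M" "f \<in> borel_measurable M" "g \<in> borel_measurable M"
  shows "(%x. jump_err t h (s x) (f x) (g x)) \<in> borel_measurable M"
  unfolding jump_err_def by measurable

text \<open>The disc of radius \<open>\<delta>\<close> costs the bound \<open>b\<close> of the
  vorticity, its complement costs the mass \<open>a\<close>. This is how the bound of the data
  enters the error of the scheme.\<close>

lemma jump_err_integral:
  assumes t: "t > 0" and d: "\<delta> > 0" "\<delta> <= 1" "h = \<delta> ^ 6" and [measurable]: "borel_fun g"
    and b: "!!z. \<bar>g z\<bar> <= b" and a: "L1n g <= ennreal a" "a >= 0"
  shows "(NN z0. ennreal \<bar>g z0\<bar> * jump_err t h (sgn (g z0)) z0 z')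
    <= ennreal (\<delta> * (64 * cdisp t * b + (6 * (cdisp t * sqrt (cdisp t)) + 4 * cdisp t) * a))"
proof -
  let ?C = "6 * (cdisp t * sqrt (cdisp t)) + 4 * cdisp t"
  have c: "cdisp t >= 0" using cdisp_nonneg[OF t] .
  have b0: "b >= 0" using order_trans[OF abs_ge_zero b] .
  have s: "\<bar>sgn (g z0)\<bar> <= 1" for z0 by (simp add: sgn_if)
  have h: "h > 0" using d by simp
  let ?n = "%z0. ennreal (\<bar>g z0\<bar> / norm (z' - z0)) * indicator {z0. norm (z' - z0) < \<delta>} z0"
  have "(NN z0. ennreal \<bar>g z0\<bar> * jump_err t h (sgn (g z0)) z0 z')
    <= (NN z0. ennreal (4 * cdisp t) * ?n z0 + ennreal (?C * \<delta>) * ennreal \<bar>g z0\<bar>)"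
  proof (intro nn_integral_mono)
    fix z0
    show "ennreal \<bar>g z0\<bar> * jump_err t h (sgn (g z0)) z0 z' <= ennreal (4 * cdisp t) * ?n z0 + ennreal (?C * \<delta>) * ennreal \<bar>g z0\<bar>"
    proof (cases "norm (z' - z0) < \<delta>")
      case True
      have "ennreal \<bar>g z0\<bar> * jump_err t h (sgn (g z0)) z0 z' <= ennreal \<bar>g z0\<bar> * ennreal (4 * cdisp t / norm (z' - z0))"
        by (intro mult_left_mono jump_err_near t h s) simp
      also have "... = ennreal (4 * cdisp t) * ?n z0" using True c by (simp add: ennreal_mult[symmetric] mult.commute)
      finally show ?thesis by (simp add: add_increasing2)
    next
      case False
      then have "ennreal \<bar>g z0\<bar> * jump_err t h (sgn (g z0)) z0 z' <= ennreal \<bar>g z0\<bar> * ennreal (?C * \<delta>)"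
        by (intro mult_left_mono jump_err_far t d s) simp_all
      then show ?thesis by (simp add: add_increasing mult.commute)
    qed
  qed
  also have "... = ennreal (4 * cdisp t) * (NN z0. ?n z0) + ennreal (?C * \<delta>) * L1n g"
    unfolding L1n_def by (subst nn_integral_add) (measurable, simp add: nn_integral_cmult)
  also have "... <= ennreal (4 * cdisp t) * ennreal (16 * \<delta> * b) + ennreal (?C * \<delta>) * ennreal a"
    using b b0 a d by (intro add_mono mult_left_mono inv_pot_near) auto
  also have "... = ennreal (4 * cdisp t * (16 * \<delta> * b) + ?C * \<delta> * a)"
    by (rule ennreal_lincomb[symmetric]) (use c d b0 a in auto)
  also have "4 * cdisp t * (16 * \<delta> * b) + ?C * \<delta> * a = \<delta> * (64 * cdisp t * b + ?C * a)" by (simp add: algebra_simps)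
  finally show ?thesis .
qed

lemma integrable_pairI:
  fixes F :: "(real \<times> real) \<times> (real \<times> real) => real"
  assumes [measurable]: "F \<in> borel_measurable (lborel \<Otimes>\<^sub>M lborel)"
    and le: "!!z'. (NN z0. ennreal \<bar>F (z', z0)\<bar>) <= G z'" and fin: "(NN z'. G z') < \<infinity>"
  shows "integrable (lborel \<Otimes>\<^sub>M lborel) F"
proof (rule integrableI_bounded)
  have "(\<integral>\<^sup>+ p. ennreal (norm (F p)) \<partial>(lborel \<Otimes>\<^sub>M lborel)) = (NN z'. NN z0. ennreal (norm (F (z', z0))))"
    by (rule lborel.nn_integral_fst[symmetric]) measurable
  also have "... <= (NN z'. G z')" using le by (intro nn_integral_mono) simp
  finally show "(\<integral>\<^sup>+ p. ennreal (norm (F p)) \<partial>(lborel \<Otimes>\<^sub>M lborel)) < \<infinity>" using fin by (rule le_less_trans)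
qed measurable

text \<open>The three ingredients of the consistency error as integrals over the same pairs (source,
  vortex), so that they combine under one integral. In the jump term Fubini and, for each
  \<open>z0\<close>, the area preserving substitution move the jump from \<open>f\<close> to the
  kernel and reverse its direction.\<close>

lemma S_jump_expansion:
  assumes t: "t > 0" and g: "integrable lborel g" and f: "integrable lborel f" and b: "!!z. \<bar>f z\<bar> <= (b::real)"
    and N: "!!z. inv_pot g z <= ennreal N"
  shows "S nu t (jump h g f) z = (\<integral>p. \<bar>g (snd p)\<bar> * (kern nu t z (vjump h (sgn (g (snd p))) (snd p) (fst p)) * f (fst p)) \<partial>(lborel \<Otimes>\<^sub>M lborel))" (is ?A)
    and "integrable (lborel \<Otimes>\<^sub>M lborel) (%p. \<bar>g (snd p)\<bar> * (kern nu t z (vjump h (sgn (g (snd p))) (snd p) (fst p)) * f (fst p)))" (is ?A')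
    and "(LI z. \<bar>g z\<bar>) * S nu t f z = (\<integral>p. \<bar>g (snd p)\<bar> * (kern nu t z (fst p) * f (fst p)) \<partial>(lborel \<Otimes>\<^sub>M lborel))" (is ?B)
    and "integrable (lborel \<Otimes>\<^sub>M lborel) (%p. \<bar>g (snd p)\<bar> * (kern nu t z (fst p) * f (fst p)))" (is ?B')
    and "- Sd nu t (%z'. f z' *\<^sub>R biot_savart g z') z = (\<integral>p. g (snd p) * ((kgrad nu t z (fst p) \<bullet> bs_kernel (fst p - snd p)) * f (fst p)) \<partial>(lborel \<Otimes>\<^sub>M lborel))" (is ?C)
    and "integrable (lborel \<Otimes>\<^sub>M lborel) (%p. g (snd p) * ((kgrad nu t z (fst p) \<bullet> bs_kernel (fst p - snd p)) * f (fst p)))" (is ?C')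
proof -
  have gm[measurable]: "borel_fun g" and fm[measurable]: "borel_fun f" using f g by simp_all
  have b0: "b >= 0" using order_trans[OF abs_ge_zero b] .
  define a where "a = (LI z. \<bar>g z\<bar>)"
  have a: "L1n g = ennreal a" "a >= 0" using L1n_integral[OF g] by (simp_all add: a_def)
  define \<kappa> where "\<kappa> = 1 / (4 * pi * nu * t)"
  have \<kappa>: "\<kappa> >= 0" "kern nu t z w <= \<kappa>" "kern nu t z w >= 0" for w
    using nu t kern_le[OF nu t] by (auto simp: \<kappa>_def)
  have Lf: "L1n f < \<infinity>" using f integrable_iff_L1n[OF fm] by simp
  have gen: "integrable (lborel \<Otimes>\<^sub>M lborel) (%p. \<bar>g (snd p)\<bar> * (k (fst p) (snd p) * f (fst p)))"
    if [measurable]: "(%p. k (fst p) (snd p)) \<in> borel_measurable (lborel \<Otimes>\<^sub>M lborel)" and k: "!!z' z0. \<bar>k z' z0\<bar> <= \<kappa>" for k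
  proof (rule integrable_pairI[where G = "%z'. ennreal (\<kappa> * \<bar>f z'\<bar>) * L1n g"])
    show "(NN z0. ennreal \<bar>\<bar>g (snd (z', z0))\<bar> * (k (fst (z', z0)) (snd (z', z0)) * f (fst (z', z0)))\<bar>) <= ennreal (\<kappa> * \<bar>f z'\<bar>) * L1n g" for z'
    proof -
      have "(NN z0. ennreal \<bar>\<bar>g (snd (z', z0))\<bar> * (k (fst (z', z0)) (snd (z', z0)) * f (fst (z', z0)))\<bar>)
        <= (NN z0. ennreal (\<kappa> * \<bar>f z'\<bar>) * ennreal \<bar>g z0\<bar>)"
      proof (intro nn_integral_mono)
        fix z0
        have "\<bar>\<bar>g z0\<bar> * (k z' z0 * f z')\<bar> <= \<bar>g z0\<bar> * (\<kappa> * \<bar>f z'\<bar>)"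
          unfolding abs_mult abs_abs using k by (intro mult_left_mono mult_right_mono) auto
        then show "ennreal \<bar>\<bar>g (snd (z', z0))\<bar> * (k (fst (z', z0)) (snd (z', z0)) * f (fst (z', z0)))\<bar> <= ennreal (\<kappa> * \<bar>f z'\<bar>) * ennreal \<bar>g z0\<bar>"
          using \<kappa>(1) by (simp add: ennreal_mult[symmetric] ennreal_leI mult.commute)
      qed
      then show ?thesis by (simp add: nn_integral_cmult L1n_def)
    qed
    have "(NN z'. ennreal (\<kappa> * \<bar>f z'\<bar>) * L1n g) = ennreal \<kappa> * L1n f * L1n g"
      using \<kappa>(1) by (simp add: nn_integral_multc nn_integral_cmult ennreal_mult L1n_def[of f])
    also have "... < \<infinity>" using Lf a by (simp add: ennreal_mult_less_top)
    finally show "(NN z'. ennreal (\<kappa> * \<bar>f z'\<bar>) * L1n g) < \<infinity>" .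
  qed measurable
  show A': ?A' by (rule gen[of "%z' z0. kern nu t z (vjump h (sgn (g z0)) z0 z')"]) (measurable, use \<kappa> in auto)
  show B': ?B' by (rule gen[of "%z' z0. kern nu t z z'"]) (measurable, use \<kappa> in auto)
  have "(\<integral>p. \<bar>g (snd p)\<bar> * (kern nu t z (fst p) * f (fst p)) \<partial>(lborel \<Otimes>\<^sub>M lborel))
    = (LI z'. (LI z0. \<bar>g z0\<bar> * (kern nu t z z' * f z')))"
    using lborel_pair.integral_fst'[OF B'] by simp
  then show ?B using t by (simp add: S_eq[OF nu])
  show ?A
  proof -
    have i: "integrable (lborel \<Otimes>\<^sub>M lborel) (%p. kern nu t z (fst p) * (\<bar>g (snd p)\<bar> * f (vjump h (- sgn (g (snd p))) (snd p) (fst p))))"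
    proof (rule integrable_pairI[where G = "%z'. ennreal (kern nu t z z') * (ennreal b * L1n g)"])
      show "(NN z0. ennreal \<bar>kern nu t z (fst (z', z0)) * (\<bar>g (snd (z', z0))\<bar> * f (vjump h (- sgn (g (snd (z', z0)))) (snd (z', z0)) (fst (z', z0))))\<bar>)
        <= ennreal (kern nu t z z') * (ennreal b * L1n g)" for z'
      proof -
        have "(NN z0. ennreal \<bar>kern nu t z (fst (z', z0)) * (\<bar>g (snd (z', z0))\<bar> * f (vjump h (- sgn (g (snd (z', z0)))) (snd (z', z0)) (fst (z', z0))))\<bar>)
          <= (NN z0. ennreal (kern nu t z z') * (ennreal b * ennreal \<bar>g z0\<bar>))"
        proof (intro nn_integral_mono)
          fix z0
          have "\<bar>kern nu t z z' * (\<bar>g z0\<bar> * f (vjump h (- sgn (g z0)) z0 z'))\<bar> <= kern nu t z z' * (\<bar>g z0\<bar> * b)"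
            unfolding abs_mult abs_abs abs_of_nonneg[OF \<kappa>(3)] using b \<kappa>(3) by (intro mult_left_mono) auto
          then show "ennreal \<bar>kern nu t z (fst (z', z0)) * (\<bar>g (snd (z', z0))\<bar> * f (vjump h (- sgn (g (snd (z', z0)))) (snd (z', z0)) (fst (z', z0))))\<bar>
            <= ennreal (kern nu t z z') * (ennreal b * ennreal \<bar>g z0\<bar>)"
            using b0 \<kappa>(3) by (simp add: ennreal_mult[symmetric] ennreal_leI mult.commute)
        qed
        then show ?thesis by (simp add: nn_integral_cmult L1n_def)
      qed
      have "(NN z'. ennreal (kern nu t z z') * (ennreal b * L1n g)) = ennreal b * L1n g"
        using nn_integral_kern(2)[OF nu t] by (simp add: nn_integral_multc)
      then show "(NN z'. ennreal (kern nu t z z') * (ennreal b * L1n g)) < \<infinity>" using a by (simp add: ennreal_mult_less_top)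
    qed measurable
    have "S nu t (jump h g f) z = (LI z'. (LI z0. kern nu t z z' * (\<bar>g z0\<bar> * f (vjump h (- sgn (g z0)) z0 z'))))"
      using t by (simp add: S_eq[OF nu] jump_def)
    also have "... = (LI z0. (LI z'. kern nu t z z' * (\<bar>g z0\<bar> * f (vjump h (- sgn (g z0)) z0 z'))))"
      by (rule lborel_pair.Fubini_integral[symmetric]) (use i in \<open>simp add: split_beta'\<close>)
    also have "... = (LI z0. (LI z'. \<bar>g z0\<bar> * (kern nu t z (vjump h (sgn (g z0)) z0 z') * f z')))"
    proof (rule Bochner_Integration.integral_cong[OF refl])
      fix z0
      have "(LI z'. kern nu t z z' * (\<bar>g z0\<bar> * f (vjump h (- sgn (g z0)) z0 z')))
        = (LI w. kern nu t z (vjump h (sgn (g z0)) z0 w) * (\<bar>g z0\<bar> * f (vjump h (- sgn (g z0)) z0 (vjump h (sgn (g z0)) z0 w))))"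
        by (rule integral_vjump[symmetric]) measurable
      also have "... = (LI z'. \<bar>g z0\<bar> * (kern nu t z (vjump h (sgn (g z0)) z0 z') * f z'))"
        by (simp only: vjump_inverse) (simp only: mult.left_commute)
      finally show "(LI z'. kern nu t z z' * (\<bar>g z0\<bar> * f (vjump h (- sgn (g z0)) z0 z')))
        = (LI z'. \<bar>g z0\<bar> * (kern nu t z (vjump h (sgn (g z0)) z0 z') * f z'))" .
    qed
    also have "... = (\<integral>p. \<bar>g (snd p)\<bar> * (kern nu t z (vjump h (sgn (g (snd p))) (snd p) (fst p)) * f (fst p)) \<partial>(lborel \<Otimes>\<^sub>M lborel))"
      using lborel_pair.integral_snd[of "%z' z0. \<bar>g z0\<bar> * (kern nu t z (vjump h (sgn (g z0)) z0 z') * f z')"] A' by (simp add: split_beta')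
    finally show ?thesis .
  qed
  have N0: "ennreal N < \<infinity>" by simp
  show C': ?C'
  proof (rule integrable_pairI[where G = "%z'. ennreal (grad_const nu t * kern2 nu t z z' * b) * ennreal N"])
    show "(NN z0. ennreal \<bar>g (snd (z', z0)) * ((kgrad nu t z (fst (z', z0)) \<bullet> bs_kernel (fst (z', z0) - snd (z', z0))) * f (fst (z', z0)))\<bar>)
      <= ennreal (grad_const nu t * kern2 nu t z z' * b) * ennreal N" for z'
    proof -
      have k: "grad_const nu t * kern2 nu t z z' * b >= 0" using grad_const_nonneg[OF nu t] b0 t nu by simp
      have "(NN z0. ennreal \<bar>g (snd (z', z0)) * ((kgrad nu t z (fst (z', z0)) \<bullet> bs_kernel (fst (z', z0) - snd (z', z0))) * f (fst (z', z0)))\<bar>)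
        <= (NN z0. ennreal (grad_const nu t * kern2 nu t z z' * b) * ennreal (\<bar>g z0\<bar> / norm (z' - z0)))"
      proof (intro nn_integral_mono)
        fix z0
        have "\<bar>kgrad nu t z z' \<bullet> bs_kernel (z' - z0)\<bar> <= norm (kgrad nu t z z') * norm (bs_kernel (z' - z0))" by (rule Cauchy_Schwarz_ineq2)
        also have "... <= (grad_const nu t * kern2 nu t z z') * (1 / norm (z' - z0))"
          by (intro mult_mono norm_kgrad_le nu t norm_bs_kernel_le) (use grad_const_nonneg[OF nu t] t nu in auto)
        finally have "\<bar>g z0\<bar> * (\<bar>kgrad nu t z z' \<bullet> bs_kernel (z' - z0)\<bar> * \<bar>f z'\<bar>) <= \<bar>g z0\<bar> * ((grad_const nu t * kern2 nu t z z') * (1 / norm (z' - z0)) * b)"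
          using b by (intro mult_left_mono mult_mono) (use grad_const_nonneg[OF nu t] t nu in auto)
        then show "ennreal \<bar>g (snd (z', z0)) * ((kgrad nu t z (fst (z', z0)) \<bullet> bs_kernel (fst (z', z0) - snd (z', z0))) * f (fst (z', z0)))\<bar>
          <= ennreal (grad_const nu t * kern2 nu t z z' * b) * ennreal (\<bar>g z0\<bar> / norm (z' - z0))"
          using k by (simp add: ennreal_mult[symmetric] ennreal_leI abs_mult mult_ac)
      qed
      also have "... = ennreal (grad_const nu t * kern2 nu t z z' * b) * inv_pot g z'" unfolding inv_pot_def by (rule nn_integral_cmult) measurable
      also have "... <= ennreal (grad_const nu t * kern2 nu t z z' * b) * ennreal N" by (intro mult_left_mono N) simp
      finally show ?thesis .
    qed
    have "(NN z'. ennreal (grad_const nu t * kern2 nu t z z' * b) * ennreal N)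
       = (NN z'. ennreal (grad_const nu t * b) * ennreal N * ennreal (kern2 nu t z z'))"
      by (intro nn_integral_cong) (use grad_const_nonneg[OF nu t] b0 t nu in \<open>simp add: ennreal_mult mult_ac\<close>)
    also have "... = ennreal (grad_const nu t * b) * ennreal N"
      using nn_integral_kern(4)[OF nu t] by (simp add: nn_integral_cmult)
    also have "... < \<infinity>" by (simp add: ennreal_mult_less_top)
    finally show "(NN z'. ennreal (grad_const nu t * kern2 nu t z z' * b) * ennreal N) < \<infinity>" .
  qed measurable
  show ?C
  proof -
    have "- Sd nu t (%z'. f z' *\<^sub>R biot_savart g z') z = (LI z'. f z' * (kgrad nu t z z' \<bullet> biot_savart g z'))"
      by (simp add: Sd_def)
    also have "... = (LI z'. (LI z0. g z0 * ((kgrad nu t z z' \<bullet> bs_kernel (z' - z0)) * f z')))"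
    proof (intro Bochner_Integration.integral_cong refl)
      fix z'
      have "integrable lborel (%z0. g z0 *\<^sub>R bs_kernel (z' - z0))"
        by (rule integrable_bs_kernel[OF gm le_less_trans[OF N N0]])
      then have "kgrad nu t z z' \<bullet> biot_savart g z' = (LI z0. kgrad nu t z z' \<bullet> (g z0 *\<^sub>R bs_kernel (z' - z0)))"
        unfolding biot_savart_eq by (intro integral_inner_right[symmetric])
      then have "f z' * (kgrad nu t z z' \<bullet> biot_savart g z') = f z' * (LI z0. g z0 * (kgrad nu t z z' \<bullet> bs_kernel (z' - z0)))"
        by simp
      also have "... = (LI z0. f z' * (g z0 * (kgrad nu t z z' \<bullet> bs_kernel (z' - z0))))" by simp
      finally show "f z' * (kgrad nu t z z' \<bullet> biot_savart g z') = (LI z0. g z0 * ((kgrad nu t z z' \<bullet> bs_kernel (z' - z0)) * f z'))"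
        by (simp only: mult_ac)
    qed
    also have "... = (\<integral>p. g (snd p) * ((kgrad nu t z (fst p) \<bullet> bs_kernel (fst p - snd p)) * f (fst p)) \<partial>(lborel \<Otimes>\<^sub>M lborel))"
      using lborel_pair.integral_fst'[OF C'] by simp
    finally show ?thesis .
  qed
qed

text \<open>The generator of the jump process approximates minus the divergence of the flux, hence
  the plus sign before \<open>Sd\<close>. Both act through the kernel, so
  \<open>jump_err_integral\<close> applies at each source, and the outer integral contributes the
  mass of \<open>f\<close>.\<close>

lemma jump_consistency:
  assumes t: "t > 0" and d: "\<delta> > 0" "\<delta> <= 1" "h = \<delta> ^ 6"
    and gm[measurable]: "borel_fun g" and fm[measurable]: "borel_fun f"
    and b: "!!z. \<bar>g z\<bar> <= b" "!!z. \<bar>f z\<bar> <= b" and a: "L1n g <= ennreal a" "L1n f <= ennreal a" "a >= 0"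
  shows "L1n (%z. (1 / h) * (S nu t (jump h g f) z - (LI z. \<bar>g z\<bar>) * S nu t f z) + Sd nu t (%z'. f z' *\<^sub>R biot_savart g z') z)
    <= ennreal (a * (\<delta> * (64 * cdisp t * b + (6 * (cdisp t * sqrt (cdisp t)) + 4 * cdisp t) * a)))" (is "L1n ?E <= _")
proof -
  have h: "h > 0" using d by simp
  have c: "cdisp t >= 0" using cdisp_nonneg[OF t] .
  have b0: "b >= 0" using order_trans[OF abs_ge_zero b(1)] .
  have fi: "integrable lborel f" and gi: "integrable lborel g"
    using a by (auto simp: integrable_iff_L1n intro: le_less_trans)
  have N: "inv_pot g z <= ennreal (16 * 1 * b + a / 1)" for z
    by (rule inv_pot_bound) (use b b0 a in auto)
  define W where "W z z' z0 = \<bar>g z0\<bar> * \<bar>f z'\<bar> * \<bar>(kern nu t z (vjump h (sgn (g z0)) z0 z') - kern nu t z z') / h - sgn (g z0) * (kgrad nu t z z' \<bullet> bs_kernel (z' - z0))\<bar>" for z z' z0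
  have [measurable]: "(%x. W (p x) (q x) (r x)) \<in> borel_measurable M"
    if [measurable]: "p \<in> borel_measurable M" "q \<in> borel_measurable M" "r \<in> borel_measurable M" for p q r and M :: "'x measure"
    unfolding W_def by measurable
  have "ennreal \<bar>?E z\<bar> <= (NN z'. NN z0. ennreal (W z z' z0))" for z
  proof -
    note ex = S_jump_expansion(1,2)[OF t gi fi b(2) N, where h = h and z = z]
      S_jump_expansion(3-6)[OF t gi fi b(2) N, where z = z]
    let ?F1 = "%p. \<bar>g (snd p)\<bar> * (kern nu t z (vjump h (sgn (g (snd p))) (snd p) (fst p)) * f (fst p))"
    let ?F2 = "%p. \<bar>g (snd p)\<bar> * (kern nu t z (fst p) * f (fst p))"
    let ?F3 = "%p. g (snd p) * ((kgrad nu t z (fst p) \<bullet> bs_kernel (fst p - snd p)) * f (fst p))"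
    have "?E z = (1 / h) * ((\<integral>p. ?F1 p \<partial>(lborel \<Otimes>\<^sub>M lborel)) - (\<integral>p. ?F2 p \<partial>(lborel \<Otimes>\<^sub>M lborel))) - (\<integral>p. ?F3 p \<partial>(lborel \<Otimes>\<^sub>M lborel))"
      unfolding ex(1,3) ex(5)[symmetric] by simp
    also have "... = (\<integral>p. (1 / h) * (?F1 p - ?F2 p) - ?F3 p \<partial>(lborel \<Otimes>\<^sub>M lborel))"
      using ex(2,4,6) by (simp del: times_divide_eq_left)
    finally have "ennreal \<bar>?E z\<bar> <= (\<integral>\<^sup>+ p. ennreal \<bar>(1 / h) * (?F1 p - ?F2 p) - ?F3 p\<bar> \<partial>(lborel \<Otimes>\<^sub>M lborel))"
      using norm_integral_le_nn_integral[of "lborel \<Otimes>\<^sub>M lborel" "%p. (1 / h) * (?F1 p - ?F2 p) - ?F3 p"] by (simp only: real_norm_def)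
    also have "... = (\<integral>\<^sup>+ p. ennreal (W z (fst p) (snd p)) \<partial>(lborel \<Otimes>\<^sub>M lborel))"
    proof (intro nn_integral_cong arg_cong[where f = ennreal])
      fix p
      let ?D = "(kern nu t z (vjump h (sgn (g (snd p))) (snd p) (fst p)) - kern nu t z (fst p)) / h" and ?k = "kgrad nu t z (fst p) \<bullet> bs_kernel (fst p - snd p)"
      have "(1 / h) * (?F1 p - ?F2 p) - ?F3 p = \<bar>g (snd p)\<bar> * f (fst p) * (?D - sgn (g (snd p)) * ?k)"
      proof -
        have "g (snd p) = \<bar>g (snd p)\<bar> * sgn (g (snd p))" by (simp add: abs_mult_sgn mult.commute)
        moreover have "(1 / h) * (x * (k1 * y) - x * (k2 * y)) - (x * s) * (k3 * y) = x * y * ((k1 - k2) / h - s * k3)" for x y k1 k2 k3 s :: real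
          by (simp add: algebra_simps diff_divide_distrib)
        ultimately show ?thesis by metis
      qed
      then show "\<bar>(1 / h) * (?F1 p - ?F2 p) - ?F3 p\<bar> = W z (fst p) (snd p)"
        unfolding W_def by (simp only: abs_mult abs_abs)
    qed
    also have "... = (NN z'. NN z0. ennreal (W z z' z0))"
    proof -
      have "(%p. ennreal (W z (fst p) (snd p))) \<in> borel_measurable (lborel \<Otimes>\<^sub>M lborel)"
        unfolding W_def by measurable
      from lborel.nn_integral_fst[OF this] show ?thesis by simp
    qed
    finally show ?thesis .
  qed
  then have "L1n ?E <= (NN z. NN z'. NN z0. ennreal (W z z' z0))"
    unfolding L1n_def by (intro nn_integral_mono)
  also have "... = (NN z'. NN z. NN z0. ennreal (W z z' z0))"
    by (rule lborel_pair.Fubini') measurable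
  also have "... = (NN z'. NN z0. NN z. ennreal (W z z' z0))"
    by (intro nn_integral_cong lborel_pair.Fubini') measurable
  also have "... = (NN z'. NN z0. ennreal \<bar>f z'\<bar> * (ennreal \<bar>g z0\<bar> * jump_err t h (sgn (g z0)) z0 z'))"
  proof (intro nn_integral_cong)
    fix z' z0
    have "(NN z. ennreal (W z z' z0)) = (NN z. ennreal (\<bar>f z'\<bar> * \<bar>g z0\<bar>) * ennreal \<bar>(kern nu t z (vjump h (sgn (g z0)) z0 z') - kern nu t z z') / h - sgn (g z0) * (kgrad nu t z z' \<bullet> bs_kernel (z' - z0))\<bar>)"
      unfolding W_def by (intro nn_integral_cong) (simp add: ennreal_mult[symmetric] mult_ac)
    also have "... = ennreal (\<bar>f z'\<bar> * \<bar>g z0\<bar>) * jump_err t h (sgn (g z0)) z0 z'"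
      unfolding jump_err_def by (rule nn_integral_cmult) measurable
    finally show "(NN z. ennreal (W z z' z0)) = ennreal \<bar>f z'\<bar> * (ennreal \<bar>g z0\<bar> * jump_err t h (sgn (g z0)) z0 z')"
      by (simp add: ennreal_mult mult.assoc)
  qed
  also have "... = (NN z'. ennreal \<bar>f z'\<bar> * (NN z0. ennreal \<bar>g z0\<bar> * jump_err t h (sgn (g z0)) z0 z'))"
    by (intro nn_integral_cong nn_integral_cmult) measurable
  also have "... <= (NN z'. ennreal \<bar>f z'\<bar> * ennreal (\<delta> * (64 * cdisp t * b + (6 * (cdisp t * sqrt (cdisp t)) + 4 * cdisp t) * a)))"
    by (intro nn_integral_mono mult_left_mono jump_err_integral t d gm b a) simp
  also have "... = L1n f * ennreal (\<delta> * (64 * cdisp t * b + (6 * (cdisp t * sqrt (cdisp t)) + 4 * cdisp t) * a))"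
    unfolding L1n_def by (rule nn_integral_multc) measurable
  also have "... <= ennreal a * ennreal (\<delta> * (64 * cdisp t * b + (6 * (cdisp t * sqrt (cdisp t)) + 4 * cdisp t) * a))"
    by (intro mult_right_mono a) simp
  also have "... = ennreal (a * (\<delta> * (64 * cdisp t * b + (6 * (cdisp t * sqrt (cdisp t)) + 4 * cdisp t) * a)))"
    using a(3) by (rule ennreal_mult'[symmetric])
  finally show ?thesis .
qed

end

section \<open>Convex functionals\<close>

text \<open>Convexity in the form that Jensen's inequality consumes: a supporting line at every
  point. Nonnegativity keeps the functionals in \<open>ennreal\<close>.\<close>

definition cvx :: "(real => real) => bool" where
  "cvx \<Phi> \<longleftrightarrow> \<Phi> \<in> borel_measurable borel \<and> (\<forall>x. 0 <= \<Phi> x) \<and> (\<forall>x. \<exists>c. \<forall>y. \<Phi> x + c * (y - x) <= \<Phi> y)"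

lemma cvx_measurable: "cvx \<Phi> ==> \<Phi> \<in> borel_measurable borel"
  and cvx_nonneg: "cvx \<Phi> ==> 0 <= \<Phi> x"
  by (auto simp: cvx_def)

lemma cvx_excess:
  assumes l: "l >= 0" shows "cvx (%x. max 0 (\<bar>x\<bar> - l))"
  unfolding cvx_def
proof (intro conjI allI)
  show "(%x. max 0 (\<bar>x\<bar> - l)) \<in> borel_measurable borel" by measurable
  fix x :: real
  show "0 <= max 0 (\<bar>x\<bar> - l)" by simp
  show "\<exists>c. \<forall>y. max 0 (\<bar>x\<bar> - l) + c * (y - x) <= max 0 (\<bar>y\<bar> - l)"
  proof (cases "\<bar>x\<bar> > l")
    case True
    then show ?thesis using l by (intro exI[of _ "sgn x"]) (auto simp: sgn_if abs_if max_def)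
  qed (intro exI[of _ 0], auto)
qed

lemma power_tangent:
  fixes x y :: real
  assumes "x >= 0" "y >= 0"
  shows "x ^ Suc n + real (Suc n) * x ^ n * (y - x) <= y ^ Suc n"
proof (induction n)
  case (Suc n)
  have "x ^ Suc (Suc n) + real (Suc (Suc n)) * x ^ Suc n * (y - x)
    = y * (x ^ Suc n + real (Suc n) * x ^ n * (y - x)) - real (Suc n) * x ^ n * (y - x)\<^sup>2"
    by (simp add: algebra_simps power2_eq_square)
  also have "... <= y * (x ^ Suc n + real (Suc n) * x ^ n * (y - x))" using assms by simp
  also have "... <= y * y ^ Suc n" by (intro mult_left_mono Suc assms)
  finally show ?case by simp
qed simp

lemma cvx_power: "cvx (%x. \<bar>x\<bar> ^ Suc n)"
  unfolding cvx_def
proof (intro conjI allI)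
  show "(%x. \<bar>x\<bar> ^ Suc n) \<in> borel_measurable (borel :: real measure)" by measurable
  fix x :: real
  show "0 <= \<bar>x\<bar> ^ Suc n" by simp
  show "\<exists>c. \<forall>y. \<bar>x\<bar> ^ Suc n + c * (y - x) <= \<bar>y\<bar> ^ Suc n"
  proof (intro exI allI)
    fix y
    have "sgn x * (y - x) <= \<bar>y\<bar> - \<bar>x\<bar>" by (auto simp: sgn_if abs_if)
    then have "real (Suc n) * \<bar>x\<bar> ^ n * (sgn x * (y - x)) <= real (Suc n) * \<bar>x\<bar> ^ n * (\<bar>y\<bar> - \<bar>x\<bar>)"
      by (intro mult_left_mono) auto
    from add_left_mono[OF this]
    have "\<bar>x\<bar> ^ Suc n + real (Suc n) * \<bar>x\<bar> ^ n * (sgn x * (y - x)) <= \<bar>x\<bar> ^ Suc n + real (Suc n) * \<bar>x\<bar> ^ n * (\<bar>y\<bar> - \<bar>x\<bar>)" .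
    also have "... <= \<bar>y\<bar> ^ Suc n" by (rule power_tangent) auto
    finally show "\<bar>x\<bar> ^ Suc n + (real (Suc n) * \<bar>x\<bar> ^ n * sgn x) * (y - x) <= \<bar>y\<bar> ^ Suc n" by (simp only: mult.assoc)
  qed
qed

text \<open>An average with an atom of mass \<open>p\<close> and a density \<open>w\<close>. All
  averages of the scheme are instances: \<open>S\<close> with \<open>p = 0\<close>,
  \<open>trans_op\<close> with its idle part as the atom, and \<open>evolve\<close> with the event
  of no jump as the atom.\<close>

lemma jensen_mix:
  fixes f w :: "'a => real"
  assumes \<Phi>: "cvx \<Phi>" and p: "p >= 0" and w: "!!x. w x >= 0" "integrable M w" and wf: "integrable M (%x. w x * f x)"
    and [measurable]: "f \<in> borel_measurable M" and one: "p + (\<integral>x. w x \<partial>M) = 1"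
  shows "ennreal (\<Phi> (p * A + (\<integral>x. w x * f x \<partial>M))) <= ennreal (p * \<Phi> A) + (\<integral>\<^sup>+ x. ennreal (w x * \<Phi> (f x)) \<partial>M)"
proof (cases "(\<integral>\<^sup>+ x. ennreal (w x * \<Phi> (f x)) \<partial>M) < \<infinity>")
  case True
  define m where "m = p * A + (\<integral>x. w x * f x \<partial>M)"
  have [measurable]: "\<Phi> \<in> borel_measurable borel" by (rule cvx_measurable[OF \<Phi>])
  have [measurable]: "w \<in> borel_measurable M" using w(2) by simp
  obtain c where c: "!!y. \<Phi> m + c * (y - m) <= \<Phi> y" using \<Phi> unfolding cvx_def by blast
  have pos: "0 <= w x * \<Phi> (f x)" for x using w(1) cvx_nonneg[OF \<Phi>] by simp
  have i: "integrable M (%x. w x * \<Phi> (f x))"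
    by (rule integrableI_nonneg) (use pos True in auto)
  have "\<Phi> m = p * (\<Phi> m + c * (A - m)) + (\<integral>x. w x * (\<Phi> m + c * (f x - m)) \<partial>M)"
  proof -
    have e: "w x * (\<Phi> m + c * (f x - m)) = (\<Phi> m - c * m) * w x + c * (w x * f x)" for x by (simp add: algebra_simps)
    have "(\<integral>x. w x * (\<Phi> m + c * (f x - m)) \<partial>M) = (\<Phi> m - c * m) * (\<integral>x. w x \<partial>M) + c * (\<integral>x. w x * f x \<partial>M)"
      unfolding e using w wf by simp
    also have "(\<integral>x. w x \<partial>M) = 1 - p" using one by simp
    also have "(\<integral>x. w x * f x \<partial>M) = m - p * A" by (simp add: m_def)
    finally show ?thesis by (simp add: algebra_simps)
  qed
  also have "... <= p * \<Phi> A + (\<integral>x. w x * \<Phi> (f x) \<partial>M)"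
  proof (intro add_mono mult_left_mono c p integral_mono i w)
    have e: "w x * (\<Phi> m + c * (f x - m)) = (\<Phi> m - c * m) * w x + c * (w x * f x)" for x by (simp add: algebra_simps)
    show "integrable M (%x. w x * (\<Phi> m + c * (f x - m)))" unfolding e using w wf by simp
  qed
  finally have "ennreal (\<Phi> m) <= ennreal (p * \<Phi> A + (\<integral>x. w x * \<Phi> (f x) \<partial>M))" by (rule ennreal_leI)
  also have "... = ennreal (p * \<Phi> A) + ennreal (\<integral>x. w x * \<Phi> (f x) \<partial>M)"
    using p cvx_nonneg[OF \<Phi>] pos by (intro ennreal_plus) (auto intro!: Bochner_Integration.integral_nonneg)
  also have "ennreal (\<integral>x. w x * \<Phi> (f x) \<partial>M) = (\<integral>\<^sup>+ x. ennreal (w x * \<Phi> (f x)) \<partial>M)"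
    using pos by (intro nn_integral_eq_integral[symmetric] i) auto
  finally show ?thesis unfolding m_def .
next
  case False
  then have "(\<integral>\<^sup>+ x. ennreal (w x * \<Phi> (f x)) \<partial>M) = top" by (simp add: less_top[symmetric])
  then show ?thesis by simp
qed

definition cvx_int :: "(real => real) => (real \<times> real => real) => ennreal" where
  "cvx_int \<Phi> f = (NN z. ennreal (\<Phi> (f z)))"

lemma L1n_cvx_int: "L1n f = cvx_int (%x. \<bar>x\<bar>) f"
  by (simp add: L1n_def cvx_int_def)

lemma S_cvx:
  assumes nu: "nu > 0" and t: "t > 0" and \<Phi>: "cvx \<Phi>" and [measurable]: "borel_fun f" and b: "!!z. \<bar>f z\<bar> <= (b::real)"
  shows "cvx_int \<Phi> (S nu t f) <= cvx_int \<Phi> f"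
proof -
  have [measurable]: "\<Phi> \<in> borel_measurable borel" by (rule cvx_measurable[OF \<Phi>])
  have "ennreal (\<Phi> (S nu t f z)) <= (NN z'. ennreal (kern nu t z z' * \<Phi> (f z')))" for z
    using jensen_mix[OF \<Phi>, of 0 "kern nu t z" lborel f 0] integrable_kern(1)[OF nu t] integral_kern[OF nu t]
      integrable_kern_mult_bdd[OF nu t _ b] kern_nonneg[OF nu t] by (simp add: S_eq[OF nu t])
  then have "cvx_int \<Phi> (S nu t f) <= (NN z. NN z'. ennreal (kern nu t z z' * \<Phi> (f z')))"
    unfolding cvx_int_def by (intro nn_integral_mono)
  also have "... = cvx_int \<Phi> f"
    unfolding cvx_int_def by (rule nn_integral_kern_mult[OF nu t]) (use cvx_nonneg[OF \<Phi>] in auto)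
  finally show ?thesis .
qed

text \<open>The sum of the increments has a finite integral, so it is finite almost everywhere and
  the sequence converges there; Fatou's lemma gives the rate, and the geometric tail doubles the
  constant.\<close>

lemma L1_fast_limit:
  fixes f :: "nat => real \<times> real => real"
  assumes [measurable]: "!!n. f n \<in> borel_measurable borel" and C: "C >= 0"
    and d: "!!n. L1n (%z. f (Suc n) z - f n z) <= ennreal (C * (1/2) ^ n)"
  shows "AE z in lborel. (%n. f n z) \<longlonglongrightarrow> lim (%n. f n z)"
    and "L1n (%z. f n z - lim (%n. f n z)) <= ennreal (2 * C * (1/2) ^ n)"
proof -
  have gs: "(%k. C * (1/2) ^ (n + k)) sums (2 * C * (1/2) ^ n)" for n
    using sums_mult[OF geometric_sums[of "1/2::real"], of "C * (1/2) ^ n"] by (simp add: power_add mult_ac)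
  have diff: "L1n (%z. f n z - f (n + m) z) <= ennreal (\<Sum>k<m. C * (1/2) ^ (n + k))" for n m
  proof (induction m)
    case 0 then show ?case by (simp add: L1n_def)
  next
    case (Suc m)
    have "L1n (%z. f n z - f (n + Suc m) z) <= L1n (%z. f n z - f (n + m) z) + L1n (%z. f (n + m) z - f (n + Suc m) z)"
      by (rule L1n_diff_triangle) measurable
    also have "L1n (%z. f (n + m) z - f (n + Suc m) z) <= ennreal (C * (1/2) ^ (n + m))"
      using d[of "n + m"] by (subst L1n_minus_commute) simp
    also have "L1n (%z. f n z - f (n + m) z) <= ennreal (\<Sum>k<m. C * (1/2) ^ (n + k))" by (rule Suc)
    also have "ennreal (\<Sum>k<m. C * (1/2) ^ (n + k)) + ennreal (C * (1/2) ^ (n + m)) = ennreal (\<Sum>k<Suc m. C * (1/2) ^ (n + k))"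
      using C by (subst ennreal_plus[symmetric]) (auto intro!: sum_nonneg)
    finally show ?case by (simp add: add_mono)
  qed
  have diff2: "L1n (%z. f n z - f (n + m) z) <= ennreal (2 * C * (1/2) ^ n)" for n m
  proof (rule order_trans[OF diff ennreal_leI])
    show "(\<Sum>k<m. C * (1/2) ^ (n + k)) <= 2 * C * (1/2) ^ n"
      using sum_le_suminf[OF sums_summable[OF gs[of n]], of "{..<m}"] sums_unique[OF gs[of n]] C by simp
  qed
  have "(NN z. (\<Sum>n. ennreal \<bar>f (Suc n) z - f n z\<bar>)) = (\<Sum>n. L1n (%z. f (Suc n) z - f n z))"
    unfolding L1n_def by (rule nn_integral_suminf) measurable
  also have "... <= (\<Sum>n. ennreal (C * (1/2) ^ n))" using d by (intro suminf_le) auto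
  also have "... = ennreal (2 * C)"
    using gs[of 0] C by (intro suminf_ennreal_eq) auto
  also have "... < \<infinity>" by simp
  finally have "AE z in lborel. (\<Sum>n. ennreal \<bar>f (Suc n) z - f n z\<bar>) ~= \<infinity>"
    by (intro nn_integral_PInf_AE) auto
  then show AE: "AE z in lborel. (%n. f n z) \<longlonglongrightarrow> lim (%n. f n z)"
  proof eventually_elim
    case (elim z)
    have "summable (%n. \<bar>f (Suc n) z - f n z\<bar>)" using elim by (intro summable_suminf_not_top) (auto simp: top_ennreal_def)
    then have "summable (%n. f (Suc n) z - f n z)" by (rule summable_rabs_cancel)
    then have "convergent (%n. \<Sum>i<n. f (Suc i) z - f i z)" by (simp add: summable_iff_convergent)
    then have "convergent (%n. f n z - f 0 z)" using sum_lessThan_telescope[of "%i. f i z"] by simp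
    then have "convergent (%n. (f n z - f 0 z) + f 0 z)" by (intro convergent_add convergent_const)
    then show ?case by (simp add: convergent_LIMSEQ_iff)
  qed
  let ?g = "%z. lim (%n. f n z)"
  have "L1n (%z. f n z - ?g z) <= (NN z. liminf (%m. ennreal \<bar>f n z - f (n + m) z\<bar>))"
    unfolding L1n_def
  proof (rule nn_integral_mono_AE, use AE in eventually_elim)
    case (elim z)
    have "(%m. f (n + m) z) \<longlonglongrightarrow> ?g z" using LIMSEQ_ignore_initial_segment[OF elim, of n] by (simp add: add.commute)
    then have "(%m. ennreal \<bar>f n z - f (n + m) z\<bar>) \<longlonglongrightarrow> ennreal \<bar>f n z - ?g z\<bar>"
      by (intro tendsto_ennrealI tendsto_rabs tendsto_diff tendsto_const)
    from lim_imp_Liminf[OF sequentially_bot this] show ?case by (rule eq_refl[OF sym])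
  qed
  also have "... <= liminf (%m. NN z. ennreal \<bar>f n z - f (n + m) z\<bar>)"
    by (rule nn_integral_liminf) measurable
  also have "... <= liminf (%m. ennreal (2 * C * (1/2) ^ n))"
    using diff2[of n] by (intro Liminf_mono) (simp add: L1n_def)
  also have "... = ennreal (2 * C * (1/2) ^ n)" by (simp add: Liminf_const)
  finally show "L1n (%z. f n z - ?g z) <= ennreal (2 * C * (1/2) ^ n)" .
qed

lemma cvx_int_lower_semicontinuous:
  fixes f :: "nat => real \<times> real => real"
  assumes \<Phi>: "continuous_on UNIV \<Phi>" and [measurable]: "!!n. f n \<in> borel_measurable borel"
    and lim: "AE z in lborel. (%n. f n z) \<longlonglongrightarrow> g z" and B: "!!n. cvx_int \<Phi> (f n) <= B"
  shows "cvx_int \<Phi> g <= B"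
proof -
  have [measurable]: "\<Phi> \<in> borel_measurable borel" using \<Phi> by (rule borel_measurable_continuous_onI)
  have "cvx_int \<Phi> g <= (NN z. liminf (%n. ennreal (\<Phi> (f n z))))"
    unfolding cvx_int_def
  proof (rule nn_integral_mono_AE, use lim in eventually_elim)
    case (elim z)
    have "(%n. \<Phi> (f n z)) \<longlonglongrightarrow> \<Phi> (g z)"
      using \<Phi> elim by (intro continuous_on_tendsto_compose[OF \<Phi>]) auto
    then have "(%n. ennreal (\<Phi> (f n z))) \<longlonglongrightarrow> ennreal (\<Phi> (g z))" by (rule tendsto_ennrealI)
    from lim_imp_Liminf[OF sequentially_bot this] show ?case by (rule eq_refl[OF sym])
  qed
  also have "... <= liminf (%n. cvx_int \<Phi> (f n))" unfolding cvx_int_def by (rule nn_integral_liminf) measurable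
  also have "... <= liminf (%n::nat. B)" using B by (intro Liminf_mono) simp
  also have "... = B" by (simp add: Liminf_const)
  finally show ?thesis .
qed

text \<open>Uniformisation: when the mass of \<open>g\<close> is at most \<open>a\<close>, idle
  jumps fill the total intensity up to \<open>a\<close>. This makes the operator an average and the
  jump rate independent of the state, so that waiting times are exponential with a fixed
  parameter.\<close>

definition trans_op :: "real => real => (real \<times> real => real) => (real \<times> real => real) => real \<times> real => real" where
  "trans_op a h g f z = ((a - (LI z. \<bar>g z\<bar>)) * f z + jump h g f z) / a"

lemma borel_measurable_trans_op [measurable (raw)]:
  assumes [measurable]: "joint_borel M G"
    "joint_borel M F" "Z \<in> borel_measurable M"
  shows "(%x. trans_op a h (G x) (F x) (Z x)) \<in> borel_measurable M"
  unfolding trans_op_def by measurable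

lemma integral_abs_le_L1n:
  assumes [measurable]: "borel_fun g" and a: "L1n g <= ennreal a" "a >= 0"
  shows "integrable lborel g" "(LI z. \<bar>g z\<bar>) <= a" "0 <= (LI z. \<bar>g z\<bar>)"
proof -
  show i: "integrable lborel g" using a by (auto simp: integrable_iff_L1n intro: le_less_trans)
  show "(LI z. \<bar>g z\<bar>) <= a" using a L1n_integral[OF i] by simp
  show "0 <= (LI z. \<bar>g z\<bar>)" by simp
qed

lemma trans_op_bound:
  assumes a: "a > 0" "L1n g <= ennreal a" and [measurable]: "borel_fun g" "borel_fun f"
    and b: "!!z. \<bar>f z\<bar> <= (b::real)"
  shows "\<bar>trans_op a h g f z\<bar> <= b"
proof -
  let ?n = "LI z. \<bar>g z\<bar>"
  have n: "integrable lborel g" "?n <= a" "0 <= ?n" using integral_abs_le_L1n[of g a] a by auto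
  have "\<bar>(a - ?n) * f z + jump h g f z\<bar> <= \<bar>(a - ?n) * f z\<bar> + \<bar>jump h g f z\<bar>" by (rule abs_triangle_ineq)
  also have "\<bar>(a - ?n) * f z\<bar> <= (a - ?n) * b"
    using n mult_left_mono[OF b, of "a - ?n" z] by (simp add: abs_mult)
  also have "\<bar>jump h g f z\<bar> <= ?n * b" by (rule jump_bound[OF n(1) _ b]) measurable
  also have "(a - ?n) * b + ?n * b = b * a" by (simp add: algebra_simps)
  finally show ?thesis using a by (simp add: trans_op_def abs_divide pos_divide_le_eq)
qed

lemma cvx_abs: "cvx (%x. \<bar>x\<bar>)"
  using cvx_power[of 0] by simp

text \<open>Jensen for the mixture of idling and jumping. Since jumps preserve area, integration
  over \<open>z\<close> returns the same integral for every vortex, and the weights add up to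
  1.\<close>

lemma trans_op_cvx:
  assumes a: "a > 0" "L1n g <= ennreal a" and [measurable]: "borel_fun g" "borel_fun f"
    and b: "!!z. \<bar>f z\<bar> <= (b::real)" and \<Phi>: "cvx \<Phi>"
  shows "cvx_int \<Phi> (trans_op a h g f) <= cvx_int \<Phi> f"
proof -
  let ?n = "LI z. \<bar>g z\<bar>"
  have [measurable]: "\<Phi> \<in> borel_measurable borel" by (rule cvx_measurable[OF \<Phi>])
  have n: "integrable lborel g" "?n <= a" "0 <= ?n" using integral_abs_le_L1n[of g a] a by auto
  have p0: "(a - ?n) / a >= 0" using n a by simp
  have "ennreal (\<Phi> (trans_op a h g f z)) <= ennreal ((a - ?n) / a) * ennreal (\<Phi> (f z)) + ennreal (1 / a) * (NN z0. ennreal (\<bar>g z0\<bar> * \<Phi> (f (vjump h (- sgn (g z0)) z0 z))))" for z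
  proof -
    have i: "integrable lborel (%z0. \<bar>g z0\<bar> * f (vjump h (- sgn (g z0)) z0 z))" by (rule integrable_jump[OF n(1) _ b]) measurable
    have "ennreal (\<Phi> ((a - ?n) / a * f z + (LI z0. \<bar>g z0\<bar> / a * f (vjump h (- sgn (g z0)) z0 z))))
      <= ennreal ((a - ?n) / a * \<Phi> (f z)) + (NN z0. ennreal (\<bar>g z0\<bar> / a * \<Phi> (f (vjump h (- sgn (g z0)) z0 z))))"
    proof (rule jensen_mix[OF \<Phi> p0])
      show "integrable lborel (%z0. \<bar>g z0\<bar> / a)" using n by simp
      show "integrable lborel (%z0. \<bar>g z0\<bar> / a * f (vjump h (- sgn (g z0)) z0 z))" using i by simp
      show "(a - ?n) / a + (LI z0. \<bar>g z0\<bar> / a) = 1" using a n by (simp add: diff_divide_distrib)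
    qed (use a in simp_all)
    also have "(a - ?n) / a * f z + (LI z0. \<bar>g z0\<bar> / a * f (vjump h (- sgn (g z0)) z0 z)) = trans_op a h g f z"
      using i by (simp add: trans_op_def jump_def add_divide_distrib)
    also have "(NN z0. ennreal (\<bar>g z0\<bar> / a * \<Phi> (f (vjump h (- sgn (g z0)) z0 z))))
        = ennreal (1 / a) * (NN z0. ennreal (\<bar>g z0\<bar> * \<Phi> (f (vjump h (- sgn (g z0)) z0 z))))"
    proof -
      have "ennreal (\<bar>g z0\<bar> / a * \<Phi> (f (vjump h (- sgn (g z0)) z0 z))) = ennreal (1 / a) * ennreal (\<bar>g z0\<bar> * \<Phi> (f (vjump h (- sgn (g z0)) z0 z)))" for z0
        using a by (subst ennreal_mult'[symmetric]) simp_all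
      then show ?thesis by (simp only:) (rule nn_integral_cmult, measurable)
    qed
    also have "ennreal ((a - ?n) / a * \<Phi> (f z)) = ennreal ((a - ?n) / a) * ennreal (\<Phi> (f z))" using p0 by (rule ennreal_mult')
    finally show ?thesis .
  qed
  then have "cvx_int \<Phi> (trans_op a h g f) <= (NN z. ennreal ((a - ?n) / a) * ennreal (\<Phi> (f z)) + ennreal (1 / a) * (NN z0. ennreal (\<bar>g z0\<bar> * \<Phi> (f (vjump h (- sgn (g z0)) z0 z)))))"
    unfolding cvx_int_def by (intro nn_integral_mono)
  also have "... = ennreal ((a - ?n) / a) * cvx_int \<Phi> f + ennreal (1 / a) * (NN z. NN z0. ennreal (\<bar>g z0\<bar> * \<Phi> (f (vjump h (- sgn (g z0)) z0 z))))"
    unfolding cvx_int_def by (subst nn_integral_add, measurable) (subst nn_integral_cmult, measurable, subst nn_integral_cmult, measurable)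
  also have "(NN z. NN z0. ennreal (\<bar>g z0\<bar> * \<Phi> (f (vjump h (- sgn (g z0)) z0 z)))) = L1n g * cvx_int \<Phi> f"
    unfolding cvx_int_def by (rule nn_integral_jump[of g "%z. \<Phi> (f z)"]) (use cvx_nonneg[OF \<Phi>] in auto)
  also have "ennreal ((a - ?n) / a) * cvx_int \<Phi> f + ennreal (1 / a) * (L1n g * cvx_int \<Phi> f) = (ennreal ((a - ?n) / a) + ennreal (1 / a) * ennreal ?n) * cvx_int \<Phi> f"
    unfolding L1n_integral[OF n(1)] by (simp add: distrib_right mult.assoc)
  also have "ennreal ((a - ?n) / a) + ennreal (1 / a) * ennreal ?n = ennreal 1"
    using a n p0 by (subst ennreal_mult[symmetric], simp, simp, subst ennreal_plus[symmetric]) (auto simp: add_divide_distrib[symmetric])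
  finally show ?thesis by simp
qed

text \<open>Written with \<open>sgn\<close>, the dependence on \<open>g\<close> looks discontinuous;
  written with positive and negative parts it is visibly Lipschitz, which is what
  \<open>jump_diff_left\<close> exploits.\<close>

lemma jump_split:
  assumes g: "integrable lborel g" and [measurable]: "borel_fun f" and b: "!!z. \<bar>f z\<bar> <= (b::real)"
  shows "jump h g f z = (LI z0. max 0 (g z0) * f (vjump h (- 1) z0 z) + max 0 (- g z0) * f (vjump h 1 z0 z))"
    and "integrable lborel (%z0. max 0 (g z0) * f (vjump h (- 1) z0 z) + max 0 (- g z0) * f (vjump h 1 z0 z))"
proof -
  have e: "max 0 (g z0) * f (vjump h (- 1) z0 z) + max 0 (- g z0) * f (vjump h 1 z0 z) = \<bar>g z0\<bar> * f (vjump h (- sgn (g z0)) z0 z)" for z0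
    by (cases "g z0 = 0") (auto simp: sgn_if max_def)
  show "jump h g f z = (LI z0. max 0 (g z0) * f (vjump h (- 1) z0 z) + max 0 (- g z0) * f (vjump h 1 z0 z))"
    unfolding e jump_def ..
  show "integrable lborel (%z0. max 0 (g z0) * f (vjump h (- 1) z0 z) + max 0 (- g z0) * f (vjump h 1 z0 z))"
    unfolding e by (rule integrable_jump[OF g _ b]) measurable
qed

lemma jump_diff_left:
  assumes g: "integrable lborel g" "integrable lborel g'" and [measurable]: "borel_fun f" and b: "!!z. \<bar>f z\<bar> <= (b::real)"
  shows "L1n (%z. jump h g f z - jump h g' f z) <= 2 * L1n (%z. g z - g' z) * L1n f"
proof -
  have [measurable]: "borel_fun g" "borel_fun g'" using g by simp_all
  let ?d = "%z0. \<bar>g z0 - g' z0\<bar>"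
  have "ennreal \<bar>jump h g f z - jump h g' f z\<bar> <= (NN z0. ennreal (?d z0) * ennreal \<bar>f (vjump h (- 1) z0 z)\<bar> + ennreal (?d z0) * ennreal \<bar>f (vjump h 1 z0 z)\<bar>)" for z
  proof -
    let ?F = "%g z0. max 0 (g z0) * f (vjump h (- 1) z0 z) + max 0 (- g z0) * f (vjump h 1 z0 z)"
    have "jump h g f z - jump h g' f z = (LI z0. ?F g z0 - ?F g' z0)"
      unfolding jump_split(1)[OF g(1) assms(3) b] jump_split(1)[OF g(2) assms(3) b]
      by (rule Bochner_Integration.integral_diff[symmetric]) (rule jump_split(2)[OF _ assms(3) b], rule g)+
    then have "ennreal \<bar>jump h g f z - jump h g' f z\<bar> <= (NN z0. ennreal \<bar>?F g z0 - ?F g' z0\<bar>)"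
      using norm_integral_le_nn_integral[of lborel "%z0. ?F g z0 - ?F g' z0"] by (simp only: real_norm_def)
    also have "... <= (NN z0. ennreal (?d z0) * ennreal \<bar>f (vjump h (- 1) z0 z)\<bar> + ennreal (?d z0) * ennreal \<bar>f (vjump h 1 z0 z)\<bar>)"
    proof (intro nn_integral_mono)
      fix z0
      let ?x = "f (vjump h (- 1) z0 z)" and ?y = "f (vjump h 1 z0 z)"
      have "?F g z0 - ?F g' z0 = (max 0 (g z0) - max 0 (g' z0)) * ?x + (max 0 (- g z0) - max 0 (- g' z0)) * ?y"
        by (simp add: algebra_simps)
      then have "\<bar>?F g z0 - ?F g' z0\<bar> <= \<bar>max 0 (g z0) - max 0 (g' z0)\<bar> * \<bar>?x\<bar> + \<bar>max 0 (- g z0) - max 0 (- g' z0)\<bar> * \<bar>?y\<bar>"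
        by (simp only: abs_mult[symmetric] abs_triangle_ineq)
      also have "... <= ?d z0 * \<bar>?x\<bar> + ?d z0 * \<bar>?y\<bar>" by (intro add_mono mult_right_mono) auto
      finally have "ennreal \<bar>?F g z0 - ?F g' z0\<bar> <= ennreal (?d z0 * \<bar>?x\<bar> + ?d z0 * \<bar>?y\<bar>)" by (rule ennreal_leI)
      then show "ennreal \<bar>?F g z0 - ?F g' z0\<bar> <= ennreal (?d z0) * ennreal \<bar>?x\<bar> + ennreal (?d z0) * ennreal \<bar>?y\<bar>"
        by (simp only: ennreal_lincomb abs_ge_zero)
    qed
    finally show ?thesis .
  qed
  then have "L1n (%z. jump h g f z - jump h g' f z) <= (NN z. NN z0. ennreal (?d z0) * ennreal \<bar>f (vjump h (- 1) z0 z)\<bar> + ennreal (?d z0) * ennreal \<bar>f (vjump h 1 z0 z)\<bar>)"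
    unfolding L1n_def by (intro nn_integral_mono)
  also have "... = (NN z0. NN z. ennreal (?d z0) * ennreal \<bar>f (vjump h (- 1) z0 z)\<bar> + ennreal (?d z0) * ennreal \<bar>f (vjump h 1 z0 z)\<bar>)"
    by (rule lborel_pair.Fubini') measurable
  also have "... = (NN z0. ennreal (?d z0) * (2 * L1n f))"
  proof (intro nn_integral_cong)
    fix z0
    have v: "(NN z. ennreal \<bar>f (vjump h s z0 z)\<bar>) = L1n f" for s
      unfolding L1n_def by (rule nn_integral_vjump[of "%z. ennreal \<bar>f z\<bar>"]) measurable
    have "(NN z. ennreal (?d z0) * ennreal \<bar>f (vjump h (- 1) z0 z)\<bar> + ennreal (?d z0) * ennreal \<bar>f (vjump h 1 z0 z)\<bar>)
      = (NN z. ennreal (?d z0) * ennreal \<bar>f (vjump h (- 1) z0 z)\<bar>) + (NN z. ennreal (?d z0) * ennreal \<bar>f (vjump h 1 z0 z)\<bar>)"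
      by (rule nn_integral_add) measurable
    also have "... = ennreal (?d z0) * L1n f + ennreal (?d z0) * L1n f"
      by (intro arg_cong2[where f = "(+)"]) (subst nn_integral_cmult, measurable, simp only: v)+
    finally show "(NN z. ennreal (?d z0) * ennreal \<bar>f (vjump h (- 1) z0 z)\<bar> + ennreal (?d z0) * ennreal \<bar>f (vjump h 1 z0 z)\<bar>) = ennreal (?d z0) * (2 * L1n f)"
      by (simp only: mult_2 distrib_left)
  qed
  also have "... = L1n (%z. g z - g' z) * (2 * L1n f)" unfolding L1n_def[of "%z. g z - g' z"] by (rule nn_integral_multc) measurable
  finally show ?thesis by (simp add: mult_ac)
qed

text \<open>Telescoping into four terms. The idle part contributes 1 through its argument and 1
  through its weight, the jump part 1 through its argument and 2 through its intensity, where the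
  two senses of rotation are estimated separately. The sum is 5.\<close>

lemma trans_op_lipschitz:
  assumes a: "a > 0" "L1n F <= ennreal a" "L1n G <= ennreal a" and [measurable]: "borel_fun F" "borel_fun G"
    and b: "!!z. \<bar>F z\<bar> <= (b::real)" "!!z. \<bar>G z\<bar> <= (b::real)"
  shows "L1n (%z. trans_op a h F F z - trans_op a h G G z) <= 5 * L1n (%z. F z - G z)"
proof -
  let ?F = "LI z. \<bar>F z\<bar>" and ?G = "LI z. \<bar>G z\<bar>"
  define d where "d = L1n (%z. F z - G z)"
  have n: "integrable lborel F" "?F <= a" "0 <= ?F" "integrable lborel G" "?G <= a" "0 <= ?G"
    using integral_abs_le_L1n[of F a] integral_abs_le_L1n[of G a] a by auto
  have d: "d = ennreal (LI z. \<bar>F z - G z\<bar>)" unfolding d_def using n by (intro L1n_integral) simp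
  have FG: "\<bar>?G - ?F\<bar> <= (LI z. \<bar>F z - G z\<bar>)"
  proof -
    have "?G - ?F = (LI z. \<bar>G z\<bar> - \<bar>F z\<bar>)" using n by simp
    also have "\<bar>...\<bar> <= (LI z. \<bar>\<bar>G z\<bar> - \<bar>F z\<bar>\<bar>)" by (rule integral_abs_bound)
    also have "... <= (LI z. \<bar>F z - G z\<bar>)" using n by (intro integral_mono) auto
    finally show ?thesis .
  qed
  let ?A = "%z. (a - ?F) * (F z - G z)" let ?B = "%z. (?G - ?F) * G z"
  let ?C = "%z. jump h F (%z. F z - G z) z" let ?D = "%z. jump h F G z - jump h G G z"
  have e: "trans_op a h F F z - trans_op a h G G z = ((?A z + ?B z) + (?C z + ?D z)) / a" for z
  proof -
    have "jump h F (%z. F z - G z) z = jump h F F z - jump h F G z"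
      unfolding jump_def right_diff_distrib
      by (rule Bochner_Integration.integral_diff) (rule integrable_jump[OF n(1) assms(4) b(1)], rule integrable_jump[OF n(1) assms(5) b(2)])
    then show ?thesis using a by (simp add: trans_op_def diff_divide_distrib[symmetric] algebra_simps)
  qed
  have A: "L1n ?A <= ennreal a * d"
  proof -
    have "L1n ?A = (NN z. ennreal (a - ?F) * ennreal \<bar>F z - G z\<bar>)"
      unfolding L1n_def using n by (intro nn_integral_cong) (simp add: abs_mult ennreal_mult)
    also have "... = ennreal (a - ?F) * d" unfolding d_def L1n_def by (rule nn_integral_cmult) measurable
    also have "... <= ennreal a * d" using n by (intro mult_right_mono ennreal_leI) auto
    finally show ?thesis .
  qed
  have B: "L1n ?B <= d * ennreal a"
  proof -
    have "L1n ?B = (NN z. ennreal \<bar>?G - ?F\<bar> * ennreal \<bar>G z\<bar>)"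
      unfolding L1n_def by (intro nn_integral_cong) (simp add: abs_mult ennreal_mult)
    also have "... = ennreal \<bar>?G - ?F\<bar> * L1n G" unfolding L1n_def by (rule nn_integral_cmult) measurable
    also have "... <= d * ennreal a" unfolding d using FG a by (intro mult_mono ennreal_leI) auto
    finally show ?thesis .
  qed
  have C: "L1n ?C <= ennreal a * d"
    unfolding d_def by (rule order_trans[OF jump_L1]) (measurable, intro mult_right_mono a, simp)
  have D: "L1n ?D <= 2 * d * ennreal a"
    unfolding d_def by (rule order_trans[OF jump_diff_left[OF n(1) n(4) _ b(2)]]) (measurable, intro mult_left_mono a, simp)
  have "L1n (%z. (?A z + ?B z) + (?C z + ?D z)) <= (L1n ?A + L1n ?B) + (L1n ?C + L1n ?D)"
    by (rule order_trans[OF L1n_triangle(1)], measurable, intro add_mono L1n_triangle(1), measurable)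
  also have "... <= (ennreal a * d + d * ennreal a) + (ennreal a * d + 2 * d * ennreal a)"
    by (intro add_mono A B C D)
  also have "... = ennreal a * (5 * d)"
  proof -
    have "(5::ennreal) = 1 + 1 + (1 + 2)" by simp
    then show ?thesis by (simp only: distrib_left distrib_right mult_1_left mult_1_right mult_ac)
  qed
  finally have X: "L1n (%z. (?A z + ?B z) + (?C z + ?D z)) <= ennreal a * (5 * d)" .
  have "L1n (%z. trans_op a h F F z - trans_op a h G G z) = (NN z. ennreal (1 / a) * ennreal \<bar>(?A z + ?B z) + (?C z + ?D z)\<bar>)"
    unfolding L1n_def e using a by (intro nn_integral_cong) (simp add: abs_divide ennreal_mult'[symmetric])
  also have "... = ennreal (1 / a) * L1n (%z. (?A z + ?B z) + (?C z + ?D z))" unfolding L1n_def by (rule nn_integral_cmult) measurable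
  also have "... <= ennreal (1 / a) * (ennreal a * (5 * d))" by (intro mult_left_mono X) simp
  also have "... = 5 * d" using a by (simp add: mult.assoc[symmetric] ennreal_mult[symmetric] del: ennreal_mult'')
  finally show ?thesis unfolding d_def .
qed

section \<open>Exponential relaxation\<close>

text \<open>Density of the last jump before \<open>t\<close> for a Poisson clock of rate
  \<open>l\<close> observed from \<open>t0\<close> on. Its mass falls short of 1 by the probability
  that no jump occurs.\<close>

definition twt :: "real => real => real => real => real" where
  "twt l t0 t s = indicator {t0<..<t} s * (l * exp (- l * (t - s)))"

lemma borel_measurable_twt [measurable (raw)]:
  assumes [measurable]: "f \<in> borel_measurable M" "g \<in> borel_measurable M" "k \<in> borel_measurable M"
  shows "(%x. twt l (f x) (g x) (k x)) \<in> borel_measurable M"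
proof -
  have "twt l (f x) (g x) (k x) = (if f x < k x \<and> k x < g x then l * exp (- l * (g x - k x)) else 0)" for x
    by (simp add: twt_def indicator_def)
  then show ?thesis by simp
qed

lemma twt_nonneg [simp]: "l > 0 ==> twt l t0 t s >= 0"
  by (simp add: twt_def)

lemma twt_abs_mult_le: "l > 0 ==> (t0 < s ==> s < t ==> \<bar>x\<bar> <= b) ==> \<bar>twt l t0 t s * x\<bar> <= twt l t0 t s * b"
  by (cases "t0 < s \<and> s < t") (auto simp: twt_def indicator_def abs_mult)

lemma nn_integral_twt:
  assumes l: "l > 0" and t: "t0 <= t"
  shows "(NN s. ennreal (twt l t0 t s)) = ennreal (1 - exp (- l * (t - t0)))"
proof -
  have "AE s in lborel. s ~= t0" "AE s in lborel. s ~= t" by (rule AE_lborel_singleton)+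
  then have "(NN s. ennreal (twt l t0 t s)) = (NN s. ennreal (l * exp (- l * (t - s))) * indicator {t0..t} s)"
    by (intro nn_integral_cong_AE, eventually_elim) (auto simp: twt_def indicator_def)
  also have "... = ennreal (exp (- l * (t - t)) - exp (- l * (t - t0)))"
  proof (rule nn_integral_FTC_Icc)
    show "((%s. exp (- l * (t - s))) has_real_derivative l * exp (- l * (t - s))) (at s)" for s
      by (auto intro!: derivative_eq_intros)
  qed (use l t in auto)
  finally show ?thesis by simp
qed

lemma integral_twt:
  assumes l: "l > 0" and t: "t0 <= t"
  shows "integrable lborel (twt l t0 t)" "(LI s. twt l t0 t s) = 1 - exp (- l * (t - t0))"
proof -
  have e: "exp (- l * (t - t0)) <= 1" using l t by simp
  show i: "integrable lborel (twt l t0 t)"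
    using nn_integral_twt[OF l t] l by (intro integrableI_nonneg) auto
  show "(LI s. twt l t0 t s) = 1 - exp (- l * (t - t0))"
    using nn_integral_twt[OF l t] l e by (subst integral_eq_nn_integral) auto
qed

text \<open>Conditioning on the last jump: \<open>A\<close> is the state at time \<open>t\<close> if
  there was none, \<open>B s\<close> the state at time \<open>t\<close> if the last one happened at
  \<open>s\<close>.\<close>

definition evolve :: "real => real => real => (real \<times> real => real) => (real => real \<times> real => real) => real \<times> real => real" where
  "evolve l t0 t A B z = exp (- l * (t - t0)) * A z + (LI s. twt l t0 t s * B s z)"

lemma borel_measurable_evolve [measurable (raw)]:
  assumes [measurable]: "f \<in> borel_measurable M" "g \<in> borel_measurable M" "joint_borel M A"
    "(%((x, s), z). B x s z) \<in> borel_measurable ((M \<Otimes>\<^sub>M lborel) \<Otimes>\<^sub>M lborel)" "Z \<in> borel_measurable M"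
  shows "(%x. evolve l (f x) (g x) (A x) (B x) (Z x)) \<in> borel_measurable M"
proof -
  have [measurable]: "(%(x, s). B x s (Z x)) \<in> borel_measurable (M \<Otimes>\<^sub>M lborel)"
    using measurable_compose[OF _ assms(4), of "%p. (p, Z (fst p))" "M \<Otimes>\<^sub>M lborel"] by (simp add: split_beta')
  have [measurable]: "(%x. A x (Z x)) \<in> borel_measurable M"
    using measurable_compose[OF _ assms(3), of "%x. (x, Z x)" M] by simp
  show ?thesis unfolding evolve_def by measurable
qed

context
  fixes l :: real
  assumes l: "l > 0"
begin

lemma integrable_twt_mult:
  assumes t: "t0 <= t" and [measurable]: "borel_fun g" and b: "!!s. t0 < s ==> s < t ==> \<bar>g s\<bar> <= b"
  shows "integrable lborel (%s. twt l t0 t s * g s)"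
proof (rule Bochner_Integration.integrable_bound[OF integrable_mult_left[OF integral_twt(1)[OF l t], of "\<bar>b\<bar>"]])
  show "AE s in lborel. norm (twt l t0 t s * g s) <= norm (twt l t0 t s * \<bar>b\<bar>)"
  proof (intro AE_I2)
    fix s
    show "norm (twt l t0 t s * g s) <= norm (twt l t0 t s * \<bar>b\<bar>)"
    proof (cases "t0 < s \<and> s < t")
      case True
      then have "\<bar>g s\<bar> <= \<bar>b\<bar>" using b[of s] by linarith
      then show ?thesis by (simp add: abs_mult mult_left_mono)
    qed (auto simp: twt_def)
  qed
qed measurable

lemma evolve_cvx:
  assumes t: "t0 <= t" and \<Phi>: "cvx \<Phi>" and [measurable]: "borel_fun A" "joint_borel lborel B"
    and b: "!!s z. t0 < s ==> s < t ==> \<bar>B s z\<bar> <= b"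
  shows "cvx_int \<Phi> (evolve l t0 t A B) <= ennreal (exp (- l * (t - t0))) * cvx_int \<Phi> A + (NN s. ennreal (twt l t0 t s) * cvx_int \<Phi> (B s))"
proof -
  have [measurable]: "\<Phi> \<in> borel_measurable borel" by (rule cvx_measurable[OF \<Phi>])
  have "ennreal (\<Phi> (evolve l t0 t A B z)) <= ennreal (exp (- l * (t - t0))) * ennreal (\<Phi> (A z)) + (NN s. ennreal (twt l t0 t s) * ennreal (\<Phi> (B s z)))" for z
  proof -
    have "ennreal (\<Phi> (evolve l t0 t A B z)) <= ennreal (exp (- l * (t - t0)) * \<Phi> (A z)) + (NN s. ennreal (twt l t0 t s * \<Phi> (B s z)))"
      unfolding evolve_def
    proof (rule jensen_mix[OF \<Phi>])
      show "integrable lborel (%s. twt l t0 t s * B s z)" by (rule integrable_twt_mult[OF t _ b]) measurable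
      show "integrable lborel (twt l t0 t)" by (rule integral_twt(1)[OF l t])
      show "exp (- l * (t - t0)) + (LI s. twt l t0 t s) = 1" using integral_twt(2)[OF l t] by simp
    qed (use l in simp_all)
    then show ?thesis using l cvx_nonneg[OF \<Phi>] by (simp add: ennreal_mult)
  qed
  then have "cvx_int \<Phi> (evolve l t0 t A B) <= (NN z. ennreal (exp (- l * (t - t0))) * ennreal (\<Phi> (A z)) + (NN s. ennreal (twt l t0 t s) * ennreal (\<Phi> (B s z))))"
    unfolding cvx_int_def by (intro nn_integral_mono)
  also have "... = ennreal (exp (- l * (t - t0))) * cvx_int \<Phi> A + (NN z. NN s. ennreal (twt l t0 t s) * ennreal (\<Phi> (B s z)))"
    unfolding cvx_int_def by (subst nn_integral_add, measurable) (subst nn_integral_cmult, measurable)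
  also have "(NN z. NN s. ennreal (twt l t0 t s) * ennreal (\<Phi> (B s z))) = (NN s. NN z. ennreal (twt l t0 t s) * ennreal (\<Phi> (B s z)))"
    by (rule lborel_pair.Fubini') measurable
  also have "... = (NN s. ennreal (twt l t0 t s) * cvx_int \<Phi> (B s))"
    unfolding cvx_int_def by (intro nn_integral_cong nn_integral_cmult) measurable
  finally show ?thesis .
qed

lemma evolve_bound:
  assumes t: "t0 <= t" and A: "\<bar>A z\<bar> <= b" and [measurable]: "(%s. B s z) \<in> borel_measurable borel"
    and b: "!!s. t0 < s ==> s < t ==> \<bar>B s z\<bar> <= b"
  shows "\<bar>evolve l t0 t A B z\<bar> <= b"
proof -
  have b0: "b >= 0" using A by linarith
  have "\<bar>(LI s. twt l t0 t s * B s z)\<bar> <= (LI s. \<bar>twt l t0 t s * B s z\<bar>)" by (rule integral_abs_bound)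
  also have "... <= (LI s. twt l t0 t s * b)"
  proof (intro integral_mono integrable_abs integrable_twt_mult[OF t _ b] integrable_mult_left integral_twt l t)
    show "\<bar>twt l t0 t s * B s z\<bar> <= twt l t0 t s * b" for s
      by (rule twt_abs_mult_le[OF l b])
  qed measurable
  also have "... = (1 - exp (- l * (t - t0))) * b" using integral_twt(2)[OF l t] by simp
  finally have 1: "\<bar>(LI s. twt l t0 t s * B s z)\<bar> <= (1 - exp (- l * (t - t0))) * b" .
  have "\<bar>exp (- l * (t - t0)) * A z\<bar> <= exp (- l * (t - t0)) * b" using A by (simp add: abs_mult)
  with 1 show ?thesis unfolding evolve_def by (simp add: algebra_simps)
qed

lemma evolve_diff:
  assumes t: "t0 <= t" and [measurable]: "joint_borel lborel B" "joint_borel lborel B'"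
    and b: "!!s z. t0 < s ==> s < t ==> \<bar>B s z\<bar> <= b" "!!s z. t0 < s ==> s < t ==> \<bar>B' s z\<bar> <= b"
  shows "L1n (%z. evolve l t0 t A B z - evolve l t0 t A B' z) <= (NN s. ennreal (twt l t0 t s) * L1n (%z. B s z - B' s z))"
proof -
  have "ennreal \<bar>evolve l t0 t A B z - evolve l t0 t A B' z\<bar> <= (NN s. ennreal (twt l t0 t s) * ennreal \<bar>B s z - B' s z\<bar>)" for z
  proof -
    have "integrable lborel (%s. twt l t0 t s * B s z)" "integrable lborel (%s. twt l t0 t s * B' s z)"
      by (rule integrable_twt_mult[OF t _ b(1)], measurable) (rule integrable_twt_mult[OF t _ b(2)], measurable)
    then have "evolve l t0 t A B z - evolve l t0 t A B' z = (LI s. twt l t0 t s * (B s z - B' s z))"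
      by (simp add: evolve_def right_diff_distrib)
    then have "ennreal \<bar>evolve l t0 t A B z - evolve l t0 t A B' z\<bar> <= (NN s. ennreal \<bar>twt l t0 t s * (B s z - B' s z)\<bar>)"
      using norm_integral_le_nn_integral[of lborel "%s. twt l t0 t s * (B s z - B' s z)"] by simp
    then show ?thesis using l by (simp add: abs_mult ennreal_mult)
  qed
  then have "L1n (%z. evolve l t0 t A B z - evolve l t0 t A B' z) <= (NN z. NN s. ennreal (twt l t0 t s) * ennreal \<bar>B s z - B' s z\<bar>)"
    unfolding L1n_def by (intro nn_integral_mono)
  also have "... = (NN s. NN z. ennreal (twt l t0 t s) * ennreal \<bar>B s z - B' s z\<bar>)"
    by (rule lborel_pair.Fubini') measurable
  also have "... = (NN s. ennreal (twt l t0 t s) * L1n (%z. B s z - B' s z))"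
    unfolding L1n_def by (intro nn_integral_cong nn_integral_cmult) measurable
  finally show ?thesis .
qed

lemma S_evolve:
  assumes nu: "nu > 0" and \<tau>: "\<tau> > 0" and t: "t0 <= t" and [measurable]: "borel_fun A" "joint_borel lborel B"
    and A: "!!z. \<bar>A z\<bar> <= b" and b: "!!s z. t0 < s ==> s < t ==> \<bar>B s z\<bar> <= b"
  shows "S nu \<tau> (evolve l t0 t A B) z = evolve l t0 t (S nu \<tau> A) (%s. S nu \<tau> (B s)) z"
proof -
  have b0: "b >= 0" using A[of 0] by linarith
  have i: "integrable (lborel \<Otimes>\<^sub>M lborel) (%(z', s). kern nu \<tau> z z' * (twt l t0 t s * B s z'))"
  proof (rule integrableI_bounded)
    have "(\<integral>\<^sup>+ p. ennreal (norm (case p of (z', s) => kern nu \<tau> z z' * (twt l t0 t s * B s z'))) \<partial>(lborel \<Otimes>\<^sub>M lborel))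
      <= (\<integral>\<^sup>+ p. ennreal (kern nu \<tau> z (fst p)) * (ennreal (twt l t0 t (snd p)) * ennreal b) \<partial>(lborel \<Otimes>\<^sub>M lborel))"
    proof (intro nn_integral_mono)
      fix p :: "(real \<times> real) \<times> real"
      obtain z' s where p: "p = (z', s)" by (cases p)
      have "\<bar>twt l t0 t s * B s z'\<bar> <= twt l t0 t s * b"
        by (rule twt_abs_mult_le[OF l b])
      then have "\<bar>kern nu \<tau> z z' * (twt l t0 t s * B s z')\<bar> <= kern nu \<tau> z z' * (twt l t0 t s * b)"
        unfolding abs_mult[of "kern nu \<tau> z z'"] using kern_nonneg[OF nu \<tau>] by (simp add: mult_left_mono)
      then show "ennreal (norm (case p of (z', s) => kern nu \<tau> z z' * (twt l t0 t s * B s z'))) <= ennreal (kern nu \<tau> z (fst p)) * (ennreal (twt l t0 t (snd p)) * ennreal b)"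
        using kern_nonneg[OF nu \<tau>] b0 l unfolding p by (simp add: ennreal_mult[symmetric] ennreal_leI)
    qed
    also have "... = (NN z'. NN s. ennreal (kern nu \<tau> z z') * (ennreal (twt l t0 t s) * ennreal b))"
      by (subst lborel.nn_integral_fst[symmetric]) simp_all
    also have "... = (NN z'. ennreal (kern nu \<tau> z z') * (ennreal (1 - exp (- l * (t - t0))) * ennreal b))"
      by (intro nn_integral_cong) (simp add: nn_integral_cmult nn_integral_multc nn_integral_twt[OF l t])
    also have "... = ennreal (1 - exp (- l * (t - t0))) * ennreal b"
      using nn_integral_kern(2)[OF nu \<tau>] by (simp add: nn_integral_multc)
    also have "... < \<infinity>" by (simp add: ennreal_mult_less_top)
    finally show "(\<integral>\<^sup>+ p. ennreal (norm (case p of (z', s) => kern nu \<tau> z z' * (twt l t0 t s * B s z'))) \<partial>(lborel \<Otimes>\<^sub>M lborel)) < \<infinity>" .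
  qed measurable
  have iz: "integrable lborel (%z'. LI s. kern nu \<tau> z z' * (twt l t0 t s * B s z'))"
    using lborel_pair.integrable_fst'[OF i] by simp
  have "S nu \<tau> (evolve l t0 t A B) z = (LI z'. exp (- l * (t - t0)) * (kern nu \<tau> z z' * A z') + (LI s. kern nu \<tau> z z' * (twt l t0 t s * B s z')))"
    unfolding S_eq[OF nu \<tau>] evolve_def by (intro Bochner_Integration.integral_cong refl) (simp add: distrib_left)
  also have "... = exp (- l * (t - t0)) * S nu \<tau> A z + (LI z'. LI s. kern nu \<tau> z z' * (twt l t0 t s * B s z'))"
    using integrable_kern_mult_bdd[OF nu \<tau> assms(4) A] iz by (simp add: S_eq[OF nu \<tau>])
  also have "(LI z'. LI s. kern nu \<tau> z z' * (twt l t0 t s * B s z')) = (LI s. LI z'. kern nu \<tau> z z' * (twt l t0 t s * B s z'))"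
    by (rule lborel_pair.Fubini_integral[symmetric]) (rule i)
  also have "... = (LI s. twt l t0 t s * S nu \<tau> (B s) z)"
  proof -
    have comm: "kern nu \<tau> z z' * (twt l t0 t s * B s z') = twt l t0 t s * (kern nu \<tau> z z' * B s z')" for z' s by simp
    show ?thesis unfolding S_eq[OF nu \<tau>] comm by simp
  qed
  finally show ?thesis unfolding evolve_def .
qed

text \<open>Two integral forms of \<open>v' = l * (P - v)\<close> with \<open>v t0 = X\<close>:
  solved by exponentials on the left, integrated once on the right. As \<open>P\<close> is merely
  bounded and measurable, the identity is derived by Fubini on the triangle \<open>r < s\<close>.
  With \<open>v s = S nu (t - s) (sol s) z\<close> it leads from the averaging form of the scheme to
  its Duhamel form.\<close>

lemma duhamel_exchange:
  fixes P :: "real => real"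
  assumes t: "t0 <= t" and [measurable]: "borel_fun P" and b: "!!s. t0 < s ==> s < t ==> \<bar>P s\<bar> <= b"
  shows "exp (- l * (t - t0)) * X + (LI s. twt l t0 t s * P s)
    = X + (LI s. indicator {t0<..<t} s * (l * (P s - (exp (- l * (s - t0)) * X + (LI r. twt l t0 s r * P r)))))"
proof -
  define I :: "real => real" where "I s = indicator {t0<..<t} s" for s :: real
  have [measurable]: "borel_fun I" unfolding I_def by measurable
  have fin: "emeasure lborel {t0<..<t} < \<infinity>" using t by simp
  have bdd: "integrable lborel (%s. I s * g s)" if [measurable]: "borel_fun g" and "!!s. t0 < s ==> s < t ==> \<bar>g s\<bar> <= c" for g c
  proof (rule Bochner_Integration.integrable_bound[of _ "%s. indicator {t0<..<t} s * \<bar>c\<bar>"])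
    show "integrable lborel (%s. indicator {t0<..<t} s * \<bar>c\<bar> :: real)" using fin by simp
    show "AE s in lborel. norm (I s * g s) <= norm (indicator {t0<..<t} s * \<bar>c\<bar> :: real)"
    proof (intro AE_I2)
      fix s show "norm (I s * g s) <= norm (indicator {t0<..<t} s * \<bar>c\<bar> :: real)"
        using that(2)[of s] by (auto simp: I_def indicator_def)
    qed
  qed measurable
  define b' where "b' = \<bar>b\<bar>"
  have b': "\<bar>I s * P s\<bar> <= b'" "b' >= 0" for s using b[of s] by (auto simp: I_def indicator_def b'_def)
  have F: "(LI s. I s * (l * (LI r. twt l t0 s r * P r))) = (LI r. I r * (l * (1 - exp (- l * (t - r))) * P r))"
  proof -
    have i: "integrable (lborel \<Otimes>\<^sub>M lborel) (%(s, r). I s * (l * (twt l t0 s r * P r)))"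
    proof (rule integrableI_bounded)
      have "(\<integral>\<^sup>+ p. ennreal (norm (case p of (s, r) => I s * (l * (twt l t0 s r * P r)))) \<partial>(lborel \<Otimes>\<^sub>M lborel))
        <= (\<integral>\<^sup>+ p. ennreal (I (fst p)) * (ennreal (twt l t0 (fst p) (snd p)) * ennreal (l * b')) \<partial>(lborel \<Otimes>\<^sub>M lborel))"
      proof (intro nn_integral_mono)
        fix p :: "real \<times> real"
        obtain s r where p: "p = (s, r)" by (cases p)
        have I0: "I s >= 0" by (simp add: I_def)
        have "\<bar>I s * (l * (twt l t0 s r * P r))\<bar> <= I s * (twt l t0 s r * (l * b'))"
        proof (cases "t0 < s \<and> s < t \<and> t0 < r \<and> r < s")
          case True
          then have "\<bar>P r\<bar> <= b'" using b[of r] by (simp add: b'_def)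
          then have "I s * (twt l t0 s r * (l * \<bar>P r\<bar>)) <= I s * (twt l t0 s r * (l * b'))"
            using l I0 by (intro mult_left_mono) auto
          then show ?thesis using l I0 by (simp add: abs_mult mult_ac)
        next
          case False
          then have "I s * twt l t0 s r = 0" by (auto simp: I_def twt_def)
          then show ?thesis by auto
        qed
        then show "ennreal (norm (case p of (s, r) => I s * (l * (twt l t0 s r * P r)))) <= ennreal (I (fst p)) * (ennreal (twt l t0 (fst p) (snd p)) * ennreal (l * b'))"
          using l I0 b' unfolding p by (simp add: ennreal_mult[symmetric] ennreal_leI)
      qed
      also have "... = (NN s. NN r. ennreal (I s) * (ennreal (twt l t0 s r) * ennreal (l * b')))"
        by (subst lborel.nn_integral_fst[symmetric]) simp_all
      also have "... <= (NN s. ennreal (I s) * ennreal (l * b'))"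
      proof (intro nn_integral_mono)
        fix s
        have "(NN r. ennreal (I s) * (ennreal (twt l t0 s r) * ennreal (l * b'))) = ennreal (I s) * ((NN r. ennreal (twt l t0 s r)) * ennreal (l * b'))"
          by (simp add: nn_integral_cmult nn_integral_multc)
        also have "... <= ennreal (I s) * (1 * ennreal (l * b'))"
        proof (cases "t0 < s")
          case True
          then have "(NN r. ennreal (twt l t0 s r)) <= 1"
            using nn_integral_twt[OF l, of t0 s] by (simp add: ennreal_le_1)
          then show ?thesis by (intro mult_left_mono mult_right_mono) auto
        qed (simp add: I_def)
        finally show "(NN r. ennreal (I s) * (ennreal (twt l t0 s r) * ennreal (l * b'))) <= ennreal (I s) * ennreal (l * b')" by simp
      qed
      also have "... = emeasure lborel {t0<..<t} * ennreal (l * b')"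
        by (simp add: nn_integral_multc I_def ennreal_indicator)
      also have "... < \<infinity>" using fin by (simp add: ennreal_mult_less_top)
      finally show "(\<integral>\<^sup>+ p. ennreal (norm (case p of (s, r) => I s * (l * (twt l t0 s r * P r)))) \<partial>(lborel \<Otimes>\<^sub>M lborel)) < \<infinity>" .
    qed measurable
    have "(LI s. I s * (l * (LI r. twt l t0 s r * P r))) = (LI s. LI r. I s * (l * (twt l t0 s r * P r)))" by simp
    also have "... = (LI r. LI s. I s * (l * (twt l t0 s r * P r)))"
      by (rule lborel_pair.Fubini_integral[symmetric]) (rule i)
    also have "... = (LI r. I r * (l * (1 - exp (- l * (t - r))) * P r))"
    proof (rule Bochner_Integration.integral_cong[OF refl])
      fix r
      show "(LI s. I s * (l * (twt l t0 s r * P r))) = I r * (l * (1 - exp (- l * (t - r))) * P r)"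
      proof (cases "t0 < r \<and> r < t")
        case True
        \<comment> \<open>the substitution s \<mapsto> t + r - s turns the increasing weight into the decreasing one\<close>
        have "(LI s. I s * (l * (twt l t0 s r * P r))) = (LI s. (l * P r) * twt l r t ((t + r) + (- 1) * s))"
          by (intro Bochner_Integration.integral_cong refl) (use True in \<open>auto simp: I_def twt_def indicator_def\<close>)
        also have "... = (l * P r) * (LI s. twt l r t ((t + r) + (- 1) * s))" by simp
        also have "(LI s. twt l r t ((t + r) + (- 1) * s)) = (LI s. twt l r t s)"
          using lborel_integral_real_affine[of "- 1" "twt l r t" "t + r"] by simp
        also have "... = 1 - exp (- l * (t - r))" using True by (intro integral_twt(2)[OF l]) simp
        finally show ?thesis using True by (simp add: I_def)
      next
        case False
        then have z: "I s * (l * (twt l t0 s r * P r)) = 0" for s by (auto simp: I_def twt_def indicator_def)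
        show ?thesis unfolding z using False by (auto simp: I_def)
      qed
    qed
    finally show ?thesis .
  qed
  have e1: "I s * exp (- l * (s - t0)) = twt l t0 t (t + t0 + (- 1) * s) / l" for s
    using l by (auto simp: I_def twt_def indicator_def)
  have E: "(LI s. I s * (l * (exp (- l * (s - t0)) * X))) = (1 - exp (- l * (t - t0))) * X"
  proof -
    have "(LI s. I s * (l * (exp (- l * (s - t0)) * X))) = (LI s. X * twt l t0 t ((t + t0) + (- 1) * s))"
    proof (intro Bochner_Integration.integral_cong refl)
      fix s
      have "I s * (l * (exp (- l * (s - t0)) * X)) = l * X * (I s * exp (- l * (s - t0)))" by simp
      then show "I s * (l * (exp (- l * (s - t0)) * X)) = X * twt l t0 t ((t + t0) + (- 1) * s)" unfolding e1 using l by simp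
    qed
    also have "... = X * (LI s. twt l t0 t ((t + t0) + (- 1) * s))" by simp
    also have "(LI s. twt l t0 t ((t + t0) + (- 1) * s)) = (LI s. twt l t0 t s)"
      using lborel_integral_real_affine[of "- 1" "twt l t0 t" "t + t0"] by simp
    also have "... = 1 - exp (- l * (t - t0))" by (rule integral_twt(2)[OF l t])
    finally show ?thesis by (simp add: mult.commute)
  qed
  have bI: "\<bar>(LI r. twt l t0 s r * P r)\<bar> <= b'" if s: "t0 < s" "s < t" for s
  proof -
    have "\<bar>evolve l t0 s (%_. 0) (%s _. P s) (0, 0)\<bar> <= b'"
      by (rule evolve_bound) (use s b b'(2) in \<open>auto simp: b'_def intro: order_trans[OF b]\<close>)
    then show ?thesis by (simp add: evolve_def)
  qed
  have i1: "integrable lborel (%s. I s * (l * P s))"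
    by (rule bdd[where c = "l * b'"]) (use l b in \<open>auto simp: abs_mult b'_def intro!: mult_left_mono order_trans[OF b]\<close>)
  have i2: "integrable lborel (%s. I s * (l * (exp (- l * (s - t0)) * X)))"
  proof (rule bdd[where c = "l * \<bar>X\<bar>"])
    show "\<bar>l * (exp (- l * (s - t0)) * X)\<bar> <= l * \<bar>X\<bar>" if "t0 < s" for s
      using l that mult_right_mono[of "exp (- l * (s - t0))" 1 "\<bar>X\<bar>"] by (simp add: abs_mult)
  qed measurable
  have i3: "integrable lborel (%s. I s * (l * (LI r. twt l t0 s r * P r)))"
    by (rule bdd[where c = "l * b'"]) (measurable, use l bI in \<open>simp add: abs_mult\<close>)
  have i4: "integrable lborel (%r. I r * (l * (1 - exp (- l * (t - r))) * P r))"
  proof (rule bdd[where c = "l * b'"])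
    show "\<bar>l * (1 - exp (- l * (t - r))) * P r\<bar> <= l * b'" if r: "t0 < r" "r < t" for r
    proof -
      have "\<bar>1 - exp (- l * (t - r))\<bar> <= 1" using l r by simp
      then have "\<bar>1 - exp (- l * (t - r))\<bar> * \<bar>P r\<bar> <= 1 * b'"
        using b[OF r] by (intro mult_mono) (auto simp: b'_def)
      then show ?thesis using l by (simp add: abs_mult mult.assoc)
    qed
  qed measurable
  have split: "I s * (l * (P s - (exp (- l * (s - t0)) * X + (LI r. twt l t0 s r * P r))))
    = I s * (l * P s) - (I s * (l * (exp (- l * (s - t0)) * X)) + I s * (l * (LI r. twt l t0 s r * P r)))" for s
    by (simp add: algebra_simps)
  have "(LI s. I s * (l * (P s - (exp (- l * (s - t0)) * X + (LI r. twt l t0 s r * P r)))))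
    = (LI s. I s * (l * P s)) - ((1 - exp (- l * (t - t0))) * X + (LI r. I r * (l * (1 - exp (- l * (t - r))) * P r)))"
    unfolding split E[symmetric] F[symmetric] using i1 i2 i3 by (subst Bochner_Integration.integral_diff) (auto intro!: Bochner_Integration.integral_add)
  moreover have "(LI s. twt l t0 t s * P s) = (LI s. I s * (l * P s) - I s * (l * (1 - exp (- l * (t - s))) * P s))"
    by (intro Bochner_Integration.integral_cong refl) (simp add: I_def twt_def algebra_simps)
  then have "(LI s. twt l t0 t s * P s) = (LI s. I s * (l * P s)) - (LI r. I r * (l * (1 - exp (- l * (t - r))) * P r))"
    using i1 i4 by simp
  ultimately show ?thesis unfolding I_def[symmetric] by (simp add: algebra_simps)
qed

end

section \<open>The vortex scheme\<close>

text \<open>The class in which the Picard iteration runs. The bound by \<open>b\<close> holds at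
  every point, so it passes through jumps and time integrals without exceptional sets.\<close>

definition adm :: "real => real => (real => real \<times> real => real) => bool" where
  "adm a b F \<longleftrightarrow> joint_borel lborel F \<and> (\<forall>t z. \<bar>F t z\<bar> <= b) \<and> (\<forall>t. L1n (F t) <= ennreal a)"

lemma admD:
  assumes "adm a b F"
  shows "joint_borel lborel F" "!!t z. \<bar>F t z\<bar> <= b" "!!t. L1n (F t) <= ennreal a"
    "!!t. F t \<in> borel_measurable borel"
proof -
  show m[measurable]: "joint_borel lborel F" using assms by (simp add: adm_def)
  show "borel_fun (F t)" for t
    using measurable_compose[OF _ m, of "%z. (t, z)" borel] by simp
qed (use assms in \<open>auto simp: adm_def\<close>)

text \<open>Let \<open>S\<close> be the supremum of \<open>G\<close> on the interval. The initial
  value always has weight at least \<open>e > 0\<close>, so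
  \<open>S <= e * G t0 + (1 - e) * S\<close>, and since \<open>S\<close> is finite it is at most
  \<open>G t0\<close>.\<close>

lemma nonincreasing_of_relaxation:
  fixes G :: "real => ennreal"
  assumes l: "l > 0" and M: "!!t. t0 <= t ==> t <= T ==> G t <= M" "M < \<infinity>"
    and rel: "!!t. t0 < t ==> t <= T ==> G t <= ennreal (exp (- l * (t - t0))) * G t0 + (NN s. ennreal (twt l t0 t s) * G s)"
    and T: "t0 <= T"
  shows "G T <= G t0"
proof -
  define S where "S = (SUP t\<in>{t0..T}. G t)"
  have S: "G t <= S" if "t0 <= t" "t <= T" for t unfolding S_def using that by (intro SUP_upper) auto
  have "S <= M" unfolding S_def using M by (intro SUP_least) auto
  then have "S < \<infinity>" using M(2) by (rule le_less_trans)
  then obtain s where s: "S = ennreal s" "s >= 0" by (cases S) auto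
  have "G t0 <= S" using T by (intro S) auto
  then obtain g where g: "G t0 = ennreal g" "g >= 0" "g <= s" using s by (cases "G t0") (auto simp: top_unique)
  define e where "e = exp (- l * (T - t0))"
  have e: "e > 0" "e <= 1" using l T by (auto simp: e_def)
  have "G t <= ennreal (e * g + (1 - e) * s)" if t: "t0 <= t" "t <= T" for t
  proof (cases "t = t0")
    case True
    have "(1 - e) * g <= (1 - e) * s" using e g by (intro mult_left_mono) auto
    then have "g <= e * g + (1 - e) * s" by (simp add: algebra_simps)
    then show ?thesis using True g by (simp add: ennreal_leI)
  next
    case False
    then have t': "t0 < t" using t by simp
    define d where "d = exp (- l * (t - t0))"
    have d: "e <= d" "d <= 1" using l t t' by (auto simp: d_def e_def)
    have "(NN r. ennreal (twt l t0 t r) * G r) <= (NN r. ennreal (twt l t0 t r) * S)"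
    proof (intro nn_integral_mono)
      fix r show "ennreal (twt l t0 t r) * G r <= ennreal (twt l t0 t r) * S"
        using S[of r] t by (cases "t0 < r \<and> r < t") (auto intro!: mult_left_mono simp: twt_def)
    qed
    also have "... = ennreal (1 - d) * S" using nn_integral_twt[OF l t(1)] by (simp add: nn_integral_multc d_def)
    finally have "G t <= ennreal d * ennreal g + ennreal (1 - d) * ennreal s"
      using rel[OF t' t(2)] g(1) s(1) unfolding d_def[symmetric] by (metis add_left_mono order_trans)
    also have "... = ennreal (d * g + (1 - d) * s)" using d e g s by (intro ennreal_lincomb[symmetric]) auto
    also have "... <= ennreal (e * g + (1 - e) * s)"
    proof (rule ennreal_leI)
      have "(d - e) * g <= (d - e) * s" using d g by (intro mult_left_mono) auto
      then show "d * g + (1 - d) * s <= e * g + (1 - e) * s" by (simp add: algebra_simps)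
    qed
    finally show ?thesis .
  qed
  then have "S <= ennreal (e * g + (1 - e) * s)" unfolding S_def by (intro SUP_least) auto
  then have "s <= e * g + (1 - e) * s" using s g e by (metis add_nonneg_nonneg diff_ge_0_iff_ge ennreal_le_iff less_imp_le mult_nonneg_nonneg)
  then have "e * s <= e * g" by (simp add: algebra_simps)
  then have "s <= g" using e by simp
  then have "S <= G t0" using s g by (simp add: ennreal_leI)
  then show ?thesis using S[of T] T by (meson order_refl order_trans)
qed

locale vortex_scheme =
  fixes nu h a b :: real and f0 :: "real \<times> real => real"
  assumes nu: "nu > 0" and h: "h > 0" and a: "a > 0" and f0m: "borel_fun f0"
    and f0b: "!!z. \<bar>f0 z\<bar> <= b" and f0a: "L1n f0 <= ennreal a"
begin

text \<open>A jump displaces by an amount of order \<open>h\<close>, so the rate is of order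
  \<open>1 / h\<close> to produce a drift of order 1; the factor \<open>a\<close> undoes the
  normalisation in \<open>trans_op\<close>.\<close>

definition l :: real where "l = a / h"

lemma l: "l > 0" using a h by (simp add: l_def)

definition src :: "(real \<times> real => real) => real \<times> real => real" where
  "src f = trans_op a h f f"

lemma borel_measurable_src [measurable (raw)]:
  assumes [measurable]: "joint_borel M F" "Z \<in> borel_measurable M"
  shows "(%x. src (F x) (Z x)) \<in> borel_measurable M"
  unfolding src_def by measurable

text \<open>The last-jump formula with the semigroup running between jumps. Intensity and argument
  of the jump are both \<open>F s\<close>, which makes the fixed point equation nonlinear. The value
  at negative times merely makes \<open>F\<close> total in time.\<close>

definition pic :: "(real => real \<times> real => real) => real => real \<times> real => real" where
  "pic F t z = (if t <= 0 then f0 z else evolve l 0 t (S nu t f0) (%s. S nu (t - s) (src (F s))) z)"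

lemma src_props:
  assumes F: "adm a b F"
  shows "\<bar>src (F s) z\<bar> <= b" "src (F s) \<in> borel_measurable borel" "cvx \<Phi> ==> cvx_int \<Phi> (src (F s)) <= cvx_int \<Phi> (F s)"
    "L1n (src (F s)) <= ennreal a"
proof -
  note [measurable] = admD(4)[OF F] admD(1)[OF F]
  show "\<bar>src (F s) z\<bar> <= b" unfolding src_def by (rule trans_op_bound[OF a admD(3)[OF F]]) (use admD(2)[OF F] in auto)
  show "src (F s) \<in> borel_measurable borel" by measurable
  show *: "cvx_int \<Phi> (src (F s)) <= cvx_int \<Phi> (F s)" if "cvx \<Phi>" for \<Phi>
    unfolding src_def by (rule trans_op_cvx[OF a admD(3)[OF F] _ _ admD(2)[OF F] that]) measurable
  show "L1n (src (F s)) <= ennreal a" using order_trans[OF *[OF cvx_abs] admD(3)[OF F, of s, unfolded L1n_cvx_int]] by (simp add: L1n_cvx_int)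
qed

lemma source_measurable:
  assumes F: "adm a b F"
  shows "(%(s, z). S nu (t - s) (src (F s)) z) \<in> borel_measurable (lborel \<Otimes>\<^sub>M lborel)"
proof -
  note [measurable] = admD(1)[OF F]
  show ?thesis by measurable
qed

lemma source_bound:
  assumes F: "adm a b F" and "s < t"
  shows "\<bar>S nu (t - s) (src (F s)) z\<bar> <= b"
  using S_bound[OF nu _ src_props(2)[OF F] src_props(1)[OF F]] assms by simp

lemma pic_adm:
  assumes F: "adm a b F" shows "adm a b (pic F)"
  unfolding adm_def
proof (intro conjI allI)
  note [measurable] = admD(1)[OF F] f0m
  show "(%(t, z). pic F t z) \<in> borel_measurable (lborel \<Otimes>\<^sub>M lborel)"
    unfolding pic_def evolve_def by measurable
next
  note [measurable] = admD(1)[OF F] f0m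
  fix t z
  show "\<bar>pic F t z\<bar> <= b"
  proof (cases "t <= 0")
    case False
    have "\<bar>evolve l 0 t (S nu t f0) (%s. S nu (t - s) (src (F s))) z\<bar> <= b"
    proof (rule evolve_bound[OF l])
      show "\<bar>S nu t f0 z\<bar> <= b" using False by (intro S_bound[OF nu _ f0m f0b]) simp
      show "(%s. S nu (t - s) (src (F s)) z) \<in> borel_measurable borel" by measurable
    qed (use False source_bound[OF F] in auto)
    then show ?thesis using False by (simp add: pic_def)
  qed (simp add: pic_def f0b)
next
  note [measurable] = admD(1)[OF F] f0m
  fix t
  show "L1n (pic F t) <= ennreal a"
  proof (cases "t <= 0")
    case False
    have "L1n (evolve l 0 t (S nu t f0) (%s. S nu (t - s) (src (F s)))) <= ennreal (exp (- l * (t - 0))) * L1n (S nu t f0) + (NN s. ennreal (twt l 0 t s) * L1n (S nu (t - s) (src (F s))))"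
      unfolding L1n_cvx_int by (rule evolve_cvx[OF l _ cvx_abs _ source_measurable[OF F] source_bound[OF F]]) (use False in auto)
    also have "... <= ennreal (exp (- l * (t - 0))) * ennreal a + (NN s. ennreal (twt l 0 t s) * ennreal a)"
    proof (intro add_mono nn_integral_mono)
      show "ennreal (exp (- l * (t - 0))) * L1n (S nu t f0) <= ennreal (exp (- l * (t - 0))) * ennreal a"
        using False by (intro mult_left_mono order_trans[OF S_L1[OF nu _ f0m] f0a]) simp_all
      show "ennreal (twt l 0 t s) * L1n (S nu (t - s) (src (F s))) <= ennreal (twt l 0 t s) * ennreal a" for s
      proof (cases "0 < s \<and> s < t")
        case True
        then show ?thesis by (intro mult_left_mono order_trans[OF S_L1[OF nu _ src_props(2)[OF F]] src_props(4)[OF F]]) auto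
      qed (auto simp: twt_def)
    qed
    also have "... = (ennreal (exp (- l * (t - 0))) + ennreal (1 - exp (- l * (t - 0)))) * ennreal a"
      using nn_integral_twt[OF l, of 0 t] False by (simp add: nn_integral_multc distrib_right)
    also have "ennreal (exp (- l * (t - 0))) + ennreal (1 - exp (- l * (t - 0))) = 1"
      using l False by (subst ennreal_plus[symmetric]) auto
    finally show ?thesis using False by (simp add: pic_def[abs_def])
  qed (simp add: pic_def[abs_def] f0a)
qed

lemma pic_diff:
  assumes F: "adm a b F" and G: "adm a b G" and t: "t > 0"
  shows "L1n (%z. pic F t z - pic G t z) <= (NN s. ennreal (indicator {0<..<t} s * (5 * l)) * L1n (%z. F s z - G s z))"
proof -
  note [measurable] = admD(4)[OF F] admD(4)[OF G] admD(1)[OF F] admD(1)[OF G]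
  have "L1n (%z. pic F t z - pic G t z) = L1n (%z. evolve l 0 t (S nu t f0) (%s. S nu (t - s) (src (F s))) z - evolve l 0 t (S nu t f0) (%s. S nu (t - s) (src (G s))) z)"
    using t by (simp add: pic_def)
  also have "... <= (NN s. ennreal (twt l 0 t s) * L1n (%z. S nu (t - s) (src (F s)) z - S nu (t - s) (src (G s)) z))"
    by (rule evolve_diff[OF l _ source_measurable[OF F] source_measurable[OF G] source_bound[OF F] source_bound[OF G]]) (use t in auto)
  also have "... <= (NN s. ennreal (indicator {0<..<t} s * (5 * l)) * L1n (%z. F s z - G s z))"
  proof (intro nn_integral_mono)
    fix s
    show "ennreal (twt l 0 t s) * L1n (%z. S nu (t - s) (src (F s)) z - S nu (t - s) (src (G s)) z) <= ennreal (indicator {0<..<t} s * (5 * l)) * L1n (%z. F s z - G s z)"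
    proof (cases "0 < s \<and> s < t")
      case True
      then have ts: "t - s > 0" by simp
      have i: "integrable lborel (src (F s))" "integrable lborel (src (G s))"
        using integral_abs_le_L1n(1)[OF src_props(2)[OF F] src_props(4)[OF F]] integral_abs_le_L1n(1)[OF src_props(2)[OF G] src_props(4)[OF G]] a by auto
      have "(%z. S nu (t - s) (src (F s)) z - S nu (t - s) (src (G s)) z) = S nu (t - s) (%z. src (F s) z - src (G s) z)"
        by (rule ext) (rule S_diff_L1[OF nu ts i, symmetric])
      then have "L1n (%z. S nu (t - s) (src (F s)) z - S nu (t - s) (src (G s)) z) <= L1n (%z. src (F s) z - src (G s) z)"
        using S_L1[OF nu ts, of "%z. src (F s) z - src (G s) z"] i by simp
      also have "... <= 5 * L1n (%z. F s z - G s z)"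
        unfolding src_def by (rule trans_op_lipschitz[OF a admD(3)[OF F] admD(3)[OF G] _ _ admD(2)[OF F] admD(2)[OF G]]) measurable
      finally have 1: "L1n (%z. S nu (t - s) (src (F s)) z - S nu (t - s) (src (G s)) z) <= 5 * L1n (%z. F s z - G s z)" .
      have "twt l 0 t s <= l" using True l by (simp add: twt_def mult_left_le)
      then have "ennreal (twt l 0 t s) * L1n (%z. S nu (t - s) (src (F s)) z - S nu (t - s) (src (G s)) z) <= ennreal l * (5 * L1n (%z. F s z - G s z))"
        using 1 by (intro mult_mono ennreal_leI) auto
      also have "... = ennreal (5 * l) * L1n (%z. F s z - G s z)"
        using l by (subst ennreal_mult) (auto simp: mult_ac)
      finally show ?thesis using True by simp
    qed (auto simp: twt_def)
  qed
  finally show ?thesis .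
qed

primrec iter :: "nat => real => real \<times> real => real" where
  "iter 0 = (%_. f0)"
| "iter (Suc n) = pic (iter n)"

lemma iter_adm: "adm a b (iter n)"
proof (induction n)
  case 0
  note [measurable] = f0m
  show ?case using f0b f0a by (simp add: adm_def)
next
  case (Suc n) then show ?case by (simp add: pic_adm)
qed

text \<open>Against the weight \<open>exp (10 * l * t)\<close> the Lipschitz rate
  \<open>5 * l\<close> contracts by the factor 1/2, on time intervals of any length.\<close>

lemma exp_int:
  assumes t: "t > 0" and C: "C >= 0"
  shows "(NN s. ennreal (indicator {0<..<t} s * (5 * l)) * ennreal (C * exp (10 * l * s))) <= ennreal (C * (1 / 2) * exp (10 * l * t))"
proof -
  have "(NN s. ennreal (indicator {0<..<t} s * (5 * l)) * ennreal (C * exp (10 * l * s)))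
    <= (NN s. ennreal (5 * l * C * exp (10 * l * s)) * indicator {0..t} s)"
    using l C by (intro nn_integral_mono) (auto simp: indicator_def ennreal_mult[symmetric] mult_ac)
  also have "... = ennreal (C / 2 * exp (10 * l * t) - C / 2 * exp (10 * l * 0))"
  proof (rule nn_integral_FTC_Icc)
    show "((%s. C / 2 * exp (10 * l * s)) has_real_derivative 5 * l * C * exp (10 * l * s)) (at s)" for s
      by (auto intro!: derivative_eq_intros)
  qed (use l C t in auto)
  also have "... <= ennreal (C * (1 / 2) * exp (10 * l * t))" using C by (intro ennreal_leI) simp
  finally show ?thesis .
qed

lemma iter_diff:
  "t >= 0 ==> L1n (%z. iter (Suc n) t z - iter n t z) <= ennreal (2 * a * exp (10 * l * t) * (1 / 2) ^ n)"
proof (induction n arbitrary: t)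
  case 0
  have "L1n (%z. iter (Suc 0) t z - iter 0 t z) <= L1n (iter (Suc 0) t) + L1n (iter 0 t)"
    by (rule L1n_triangle(2)) (rule admD(4)[OF iter_adm])+
  also have "... <= ennreal a + ennreal a" by (intro add_mono admD(3)[OF iter_adm])
  also have "... <= ennreal (2 * a * exp (10 * l * t) * (1 / 2) ^ 0)"
    using a 0 l by (subst ennreal_plus[symmetric]) (auto intro!: ennreal_leI)
  finally show ?case .
next
  case (Suc n)
  show ?case
  proof (cases "t = 0")
    case True
    then show ?thesis by (cases n) (simp_all add: pic_def L1n_def)
  next
    case False
    then have t: "t > 0" using Suc.prems by simp
    have "L1n (%z. iter (Suc (Suc n)) t z - iter (Suc n) t z) = L1n (%z. pic (iter (Suc n)) t z - pic (iter n) t z)" by simp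
    also have "... <= (NN s. ennreal (indicator {0<..<t} s * (5 * l)) * L1n (%z. iter (Suc n) s z - iter n s z))"
      by (rule pic_diff[OF iter_adm iter_adm t])
    also have "... <= (NN s. ennreal (indicator {0<..<t} s * (5 * l)) * ennreal ((2 * a * (1 / 2) ^ n) * exp (10 * l * s)))"
    proof (intro nn_integral_mono)
      fix s show "ennreal (indicator {0<..<t} s * (5 * l)) * L1n (%z. iter (Suc n) s z - iter n s z) <= ennreal (indicator {0<..<t} s * (5 * l)) * ennreal ((2 * a * (1 / 2) ^ n) * exp (10 * l * s))"
      proof (cases "0 < s \<and> s < t")
        case True
        then show ?thesis using Suc.IH[of s] by (intro mult_left_mono) (auto simp: mult_ac simp del: iter.simps)
      qed auto
    qed
    also have "... <= ennreal ((2 * a * (1 / 2) ^ n) * (1 / 2) * exp (10 * l * t))" using a by (intro exp_int t) simp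
    finally show ?thesis by (simp add: mult_ac)
  qed
qed

text \<open>The limit is known to exist almost everywhere only. Clipping at \<open>b\<close> secures
  the bound at every point and changes nothing where the limit exists, since the iterates obey the
  same bound.\<close>

definition sol :: "real => real \<times> real => real" where
  "sol t z = (if t <= 0 then f0 z else max (- b) (min b (lim (%n. iter n t z))))"

lemma sol_limit:
  assumes t: "t >= 0"
  shows "AE z in lborel. (%n. iter n t z) \<longlonglongrightarrow> sol t z"
    and "L1n (%z. iter n t z - sol t z) <= ennreal (4 * a * exp (10 * l * t) * (1 / 2) ^ n)"
proof -
  have m: "iter n t \<in> borel_measurable borel" for n by (rule admD(4)[OF iter_adm])
  have d: "L1n (%z. iter (Suc n) t z - iter n t z) <= ennreal ((2 * a * exp (10 * l * t)) * (1 / 2) ^ n)" for n using iter_diff[OF t] .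
  have C: "2 * a * exp (10 * l * t) >= 0" using a by simp
  note L = L1_fast_limit[OF m C d]
  have e: "AE z in lborel. lim (%n. iter n t z) = sol t z"
    using L(1)
  proof eventually_elim
    case (elim z)
    show ?case
    proof (cases "t <= 0")
      case True
      then have "t = 0" using t by simp
      then have "iter n t z = f0 z" for n by (cases n) (simp_all add: pic_def)
      then show ?thesis using True by (simp add: sol_def)
    next
      case False
      have "lim (%n. iter n t z) <= b" using admD(2)[OF iter_adm, of _ t z]
        by (intro LIMSEQ_le_const2[OF elim]) (auto intro!: exI[of _ 0] simp: abs_le_iff)
      moreover have "- b <= lim (%n. iter n t z)" using admD(2)[OF iter_adm, of _ t z]
        by (intro LIMSEQ_le_const[OF elim]) (auto intro!: exI[of _ 0] simp: abs_le_iff minus_le_iff)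
      ultimately show ?thesis using False by (simp add: sol_def)
    qed
  qed
  show "AE z in lborel. (%n. iter n t z) \<longlonglongrightarrow> sol t z" using L(1) e by eventually_elim simp
  have "L1n (%z. iter n t z - sol t z) = L1n (%z. iter n t z - lim (%n. iter n t z))"
    by (rule L1n_cong_AE) (use e in eventually_elim, simp)
  then show "L1n (%z. iter n t z - sol t z) <= ennreal (4 * a * exp (10 * l * t) * (1 / 2) ^ n)"
    using L(2)[of n] by (simp add: mult_ac)
qed

lemma b_nonneg: "b >= 0" using order_trans[OF abs_ge_zero f0b[of 0]] .

lemma sol_adm: "adm a b sol"
  unfolding adm_def
proof (intro conjI allI)
  have [measurable]: "(%(t, z). iter n t z) \<in> borel_measurable (lborel \<Otimes>\<^sub>M lborel)" for n by (rule admD(1)[OF iter_adm])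
  note [measurable] = f0m
  show "joint_borel lborel sol" unfolding sol_def by measurable
next
  fix t z
  show "\<bar>sol t z\<bar> <= b" using f0b[of z] b_nonneg by (auto simp: sol_def)
next
  note [measurable] = f0m
  fix t
  show "L1n (sol t) <= ennreal a"
  proof (cases "t <= 0")
    case True then show ?thesis by (simp add: sol_def[abs_def] f0a)
  next
    case False
    show ?thesis unfolding L1n_cvx_int
      by (rule cvx_int_lower_semicontinuous[OF _ admD(4)[OF iter_adm] sol_limit(1)])
        (use False admD(3)[OF iter_adm] in \<open>auto simp: L1n_cvx_int[symmetric] intro!: continuous_intros\<close>)
  qed
qed

lemma sol_0: "sol 0 = f0" by (simp add: sol_def[abs_def])

lemma sol_pic:
  assumes t: "t > 0"
  shows "AE z in lborel. sol t z = pic sol t z"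
proof -
  note [measurable] = admD(4)[OF sol_adm] admD(4)[OF pic_adm[OF sol_adm]] admD(4)[OF iter_adm]
  have le: "L1n (%z. sol t z - pic sol t z) <= ennreal (6 * a * exp (10 * l * t) * (1 / 2) ^ n)" for n
  proof -
    have "L1n (%z. sol t z - pic sol t z) <= L1n (%z. sol t z - iter (Suc n) t z) + L1n (%z. iter (Suc n) t z - pic sol t z)"
      by (rule L1n_diff_triangle) measurable
    also have "L1n (%z. iter (Suc n) t z - pic sol t z) <= (NN s. ennreal (indicator {0<..<t} s * (5 * l)) * L1n (%z. iter n s z - sol s z))"
      using pic_diff[OF iter_adm sol_adm t] by simp
    also have "... <= (NN s. ennreal (indicator {0<..<t} s * (5 * l)) * ennreal ((4 * a * (1 / 2) ^ n) * exp (10 * l * s)))"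
    proof (intro nn_integral_mono)
      fix s show "ennreal (indicator {0<..<t} s * (5 * l)) * L1n (%z. iter n s z - sol s z) <= ennreal (indicator {0<..<t} s * (5 * l)) * ennreal ((4 * a * (1 / 2) ^ n) * exp (10 * l * s))"
      proof (cases "0 < s \<and> s < t")
        case True
        then show ?thesis using sol_limit(2)[of s n] by (intro mult_left_mono) (auto simp: mult_ac)
      qed auto
    qed
    also have "... <= ennreal ((4 * a * (1 / 2) ^ n) * (1 / 2) * exp (10 * l * t))" using a by (intro exp_int t) simp
    also have "L1n (%z. sol t z - iter (Suc n) t z) <= ennreal (4 * a * exp (10 * l * t) * (1 / 2) ^ Suc n)"
      using sol_limit(2)[of t "Suc n"] t by (subst L1n_minus_commute) simp
    finally have "L1n (%z. sol t z - pic sol t z) <= ennreal (4 * a * exp (10 * l * t) * (1 / 2) ^ Suc n) + ennreal ((4 * a * (1 / 2) ^ n) * (1 / 2) * exp (10 * l * t))"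
      by (simp add: add_mono)
    also have "... <= ennreal (6 * a * exp (10 * l * t) * (1 / 2) ^ n)"
      using a by (subst ennreal_plus[symmetric]) (auto intro!: ennreal_leI simp: field_simps)
    finally show ?thesis .
  qed
  have "(%n. ennreal (6 * a * exp (10 * l * t) * (1 / 2) ^ n)) \<longlonglongrightarrow> ennreal (6 * a * exp (10 * l * t) * 0)"
    by (intro tendsto_ennrealI tendsto_mult tendsto_const LIMSEQ_power_zero) simp
  from LIMSEQ_le_const[OF this, of "L1n (%z. sol t z - pic sol t z)"] le
  have "L1n (%z. sol t z - pic sol t z) = 0" by simp
  then have "AE z in lborel. sol t z - pic sol t z = 0" by (subst (asm) L1n_0_iff) auto
  then show ?thesis by eventually_elim simp
qed

end

lemma S_jensen:
  assumes nu: "nu > 0" and t: "t > 0" and \<Phi>: "cvx \<Phi>" and [measurable]: "borel_fun f"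
    and b: "!!z. \<bar>f z\<bar> <= (b::real)" and \<Phi>b: "!!z. \<Phi> (f z) <= c"
  shows "\<Phi> (S nu t f z) <= S nu t (%z. \<Phi> (f z)) z"
proof -
  have [measurable]: "\<Phi> \<in> borel_measurable borel" by (rule cvx_measurable[OF \<Phi>])
  have i: "integrable lborel (%z'. kern nu t z z' * \<Phi> (f z'))"
    by (rule integrable_kern_mult_bdd[OF nu t, where b = c]) (use \<Phi>b cvx_nonneg[OF \<Phi>] in auto)
  have "ennreal (\<Phi> (0 * 0 + (LI z'. kern nu t z z' * f z'))) <= ennreal (0 * \<Phi> 0) + (NN z'. ennreal (kern nu t z z' * \<Phi> (f z')))"
    by (rule jensen_mix[OF \<Phi>]) (use integrable_kern[OF nu t] integral_kern[OF nu t] kern_nonneg[OF nu t] integrable_kern_mult_bdd[OF nu t _ b] in auto)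
  also have "... = ennreal (LI z'. kern nu t z z' * \<Phi> (f z'))"
    using i kern_nonneg[OF nu t] cvx_nonneg[OF \<Phi>] by (simp add: nn_integral_eq_integral)
  finally have "\<Phi> (LI z'. kern nu t z z' * f z') <= (LI z'. kern nu t z z' * \<Phi> (f z'))"
    using kern_nonneg[OF nu t] cvx_nonneg[OF \<Phi>] by (subst (asm) ennreal_le_iff) auto
  then show ?thesis using t by (simp add: S_eq[OF nu])
qed

text \<open>Chebyshev's inequality at a level \<open>c > A\<close> bounds the measure by
  \<open>C * (A / c) ^ (2 ^ k)\<close>, which tends to 0. The exponents are those produced by
  iterating Nash's inequality.\<close>

lemma AE_le_of_power_bounds:
  fixes f :: "real \<times> real => real"
  assumes [measurable]: "borel_fun f" and A: "A > 0" and C: "C >= 0"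
    and le: "!!k. cvx_int (%x. \<bar>x\<bar> ^ (2 ^ k)) f <= ennreal (C * A ^ (2 ^ k))"
  shows "AE z in lborel. \<bar>f z\<bar> <= A"
proof -
  have "AE z in lborel. \<not> A + 1 / real (Suc n) <= \<bar>f z\<bar>" for n
  proof -
    define c where "c = A + 1 / real (Suc n)"
    have c: "c > 0" "A < c" using A by (auto simp: c_def add_pos_pos)
    have "emeasure lborel {z. c <= \<bar>f z\<bar>} <= ennreal (C * (A / c) ^ k)" for k
    proof -
      have "emeasure lborel {z. c <= \<bar>f z\<bar>} = (NN z. indicator {z. c <= \<bar>f z\<bar>} z)" by simp
      also have "... <= (NN z. ennreal (1 / c ^ (2 ^ k)) * ennreal (\<bar>f z\<bar> ^ (2 ^ k)))"
      proof (intro nn_integral_mono)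
        fix z show "indicator {z. c <= \<bar>f z\<bar>} z <= ennreal (1 / c ^ (2 ^ k)) * ennreal (\<bar>f z\<bar> ^ (2 ^ k))"
        proof (cases "c <= \<bar>f z\<bar>")
          case True
          then have "c ^ (2 ^ k) <= \<bar>f z\<bar> ^ (2 ^ k)" using c by (intro power_mono) auto
          then have "1 <= 1 / c ^ (2 ^ k) * \<bar>f z\<bar> ^ (2 ^ k)" using c by simp
          then show ?thesis using True c by (simp add: ennreal_mult[symmetric] del: ennreal_1 flip: ennreal_1)
        qed simp
      qed
      also have "... = ennreal (1 / c ^ (2 ^ k)) * cvx_int (%x. \<bar>x\<bar> ^ (2 ^ k)) f" unfolding cvx_int_def by (rule nn_integral_cmult) simp
      also have "... <= ennreal (1 / c ^ (2 ^ k)) * ennreal (C * A ^ (2 ^ k))" by (intro mult_left_mono le) simp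
      also have "... = ennreal (C * (A / c) ^ (2 ^ k))" using c C A by (simp add: ennreal_mult[symmetric] power_divide)
      also have "... <= ennreal (C * (A / c) ^ k)"
        using c C A less_exp[of k] by (intro ennreal_leI mult_left_mono power_decreasing) auto
      finally show ?thesis .
    qed
    moreover have "(%k. ennreal (C * (A / c) ^ k)) \<longlonglongrightarrow> ennreal (C * 0)"
      using c A by (intro tendsto_ennrealI tendsto_mult tendsto_const LIMSEQ_power_zero) simp
    ultimately have "emeasure lborel {z. c <= \<bar>f z\<bar>} <= ennreal (C * 0)" by (intro LIMSEQ_le_const) auto
    then show ?thesis by (intro AE_I[of _ _ "{z. c <= \<bar>f z\<bar>}"]) (auto simp: c_def)
  qed
  then have "AE z in lborel. \<forall>n. \<not> A + 1 / real (Suc n) <= \<bar>f z\<bar>" by (simp add: AE_all_countable)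
  then show ?thesis
  proof eventually_elim
    case (elim z)
    have "(%n. A + 1 / real (Suc n)) \<longlonglongrightarrow> A + 0" by (intro tendsto_add tendsto_const LIMSEQ_Suc[OF lim_1_over_n])
    then show ?case using elim by (intro LIMSEQ_le_const[of _ A]) (auto intro!: exI[of _ 0] less_imp_le simp: not_le)
  qed
qed

context vortex_scheme
begin

section \<open>Restart formulas and a priori bounds of the scheme\<close>

lemma sol_measurable: "joint_borel lborel sol" "borel_fun (sol t)"
  and sol_bound: "\<bar>sol t z\<bar> <= b" and sol_L1: "L1n (sol t) <= ennreal a"
  using admD[OF sol_adm] by auto

text \<open>Applying \<open>S nu (t - s)\<close> to the formula for \<open>sol s\<close> merges the
  semigroup factors, while the weights still refer to \<open>s\<close>. The result holds at every
  \<open>z\<close> because \<open>S\<close> does not see null sets.\<close>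

lemma S_sol_restart:
  assumes t: "t0 < s" "s < t" and form: "AE z in lborel. sol s z = evolve l t0 s (S nu (s - t0) (sol t0)) (%r. S nu (s - r) (src (sol r))) z"
  shows "S nu (t - s) (sol s) z = evolve l t0 s (S nu (t - t0) (sol t0)) (%r. S nu (t - r) (src (sol r))) z"
proof -
  note [measurable] = sol_measurable
  have ts: "t - s > 0" using t by simp
  have sm: "src (sol r) \<in> borel_measurable borel" and sb: "\<bar>src (sol r) z\<bar> <= b" for r z using src_props[OF sol_adm] by auto
  have "S nu (t - s) (sol s) z = S nu (t - s) (evolve l t0 s (S nu (s - t0) (sol t0)) (%r. S nu (s - r) (src (sol r)))) z"
    by (rule S_cong_AE[OF nu ts form]) (unfold evolve_def[abs_def], measurable)
  also have "... = evolve l t0 s (S nu (t - s) (S nu (s - t0) (sol t0))) (%r. S nu (t - s) (S nu (s - r) (src (sol r)))) z"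
  proof (rule S_evolve[OF l nu ts _ _ source_measurable[OF sol_adm] _ source_bound[OF sol_adm]])
    show "\<bar>S nu (s - t0) (sol t0) z\<bar> <= b" for z using t by (intro S_bound[OF nu _ _ sol_bound]) auto
  qed (use t in auto)
  also have "... = evolve l t0 s (S nu (t - t0) (sol t0)) (%r. S nu (t - r) (src (sol r))) z"
  proof -
    have "S nu (t - s) (S nu (s - t0) (sol t0)) z = S nu (t - t0) (sol t0) z"
      using S_semigroup[OF nu ts _ sol_measurable(2) sol_bound, of "s - t0"] t by simp
    moreover have "twt l t0 s r * S nu (t - s) (S nu (s - r) (src (sol r))) z = twt l t0 s r * S nu (t - r) (src (sol r)) z" for r
      using S_semigroup[OF nu ts _ sm sb, of "s - r"] by (cases "t0 < r \<and> r < s") (auto simp: twt_def)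
    ultimately show ?thesis by (simp only: evolve_def)
  qed
  finally show ?thesis .
qed

text \<open>The Markov property. Before \<open>t0\<close> the weight for \<open>t\<close> is the
  weight for \<open>t0\<close> times \<open>exp (- l * (t - t0))\<close>, so the history up to
  \<open>t0\<close> recombines into \<open>S nu (t - t0) (sol t0)\<close>. It gives access to
  monotonicity between arbitrary times.\<close>

lemma sol_evolve:
  assumes t: "0 <= t0" "t0 < t"
  shows "AE z in lborel. sol t z = evolve l t0 t (S nu (t - t0) (sol t0)) (%s. S nu (t - s) (src (sol s))) z"
proof -
  note [measurable] = sol_measurable
  have 0: "AE z in lborel. sol t z = evolve l 0 t (S nu (t - 0) (sol 0)) (%s. S nu (t - s) (src (sol s))) z" if "t > 0" for t
    using sol_pic[OF that] that by (simp add: pic_def sol_0)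
  show ?thesis
  proof (cases "t0 = 0")
    case False
    then have t0: "t0 > 0" using t by simp
    show ?thesis using 0[of t]
    proof (rule eventually_mono)
      show "t > 0" using t by simp
      fix z
      define X where "X = S nu t (sol 0) z"
      define P where "P s = S nu (t - s) (src (sol s)) z" for s
      have [measurable]: "borel_fun P" unfolding P_def by measurable
      have Pb: "\<bar>P s\<bar> <= b" if "s < t" for s unfolding P_def by (rule source_bound[OF sol_adm that])
      assume "sol t z = evolve l 0 t (S nu (t - 0) (sol 0)) (%s. S nu (t - s) (src (sol s))) z"
      then have 1: "sol t z = exp (- l * t) * X + (LI s. twt l 0 t s * P s)" by (simp add: evolve_def X_def P_def)
      have 2: "S nu (t - t0) (sol t0) z = exp (- l * t0) * X + (LI s. twt l 0 t0 s * P s)"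
        using S_sol_restart[OF t0 t(2) 0[OF t0], of z] by (simp add: evolve_def X_def P_def)
      have i: "integrable lborel (%s. twt l 0 t0 s * P s)" "integrable lborel (%s. twt l t0 t s * P s)"
        by (rule integrable_twt_mult[OF l, where b = b]; use t t0 Pb in simp)+
      have "AE s in lborel. s ~= t0" by (rule AE_lborel_singleton)
      then have "(LI s. twt l 0 t s * P s) = (LI s. exp (- l * (t - t0)) * (twt l 0 t0 s * P s) + twt l t0 t s * P s)"
      proof (intro integral_cong_AE, goal_cases)
        case 3
        then show ?case
        proof eventually_elim
          case (elim s)
          have "exp (- l * (t - s)) = exp (- l * (t - t0)) * exp (- l * (t0 - s))" by (simp add: exp_add[symmetric] algebra_simps)
          then show ?case using elim t t0 by (auto simp: twt_def indicator_def)
        qed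
      qed measurable
      also have "... = exp (- l * (t - t0)) * (LI s. twt l 0 t0 s * P s) + (LI s. twt l t0 t s * P s)"
        using i by simp
      finally have 3: "(LI s. twt l 0 t s * P s) = exp (- l * (t - t0)) * (LI s. twt l 0 t0 s * P s) + (LI s. twt l t0 t s * P s)" .
      have "exp (- l * t) = exp (- l * (t - t0)) * exp (- l * t0)" by (simp add: exp_add[symmetric] algebra_simps)
      then show "sol t z = evolve l t0 t (S nu (t - t0) (sol t0)) (%s. S nu (t - s) (src (sol s))) z"
        unfolding evolve_def P_def[symmetric] 1 2 3 by (simp add: distrib_left)
    qed
  qed (use 0 t in simp)
qed

lemma S_src:
  assumes t: "t > 0"
  shows "l * (S nu t (src (sol s)) z - S nu t (sol s) z) = (1 / h) * (S nu t (jump h (sol s) (sol s)) z - (LI z. \<bar>sol s z\<bar>) * S nu t (sol s) z)"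
proof -
  note [measurable] = sol_measurable
  define n where "n = (LI z. \<bar>sol s z\<bar>)"
  have n: "integrable lborel (sol s)" using integral_abs_le_L1n[OF sol_measurable(2) sol_L1] a by auto
  have i: "integrable lborel (%z'. kern nu t z z' * sol s z')" "integrable lborel (%z'. kern nu t z z' * jump h (sol s) (sol s) z')"
    by (rule integrable_kern_mult_bdd[OF nu t _ sol_bound], measurable) (rule integrable_kern_mult_bdd[OF nu t _ jump_bound[OF n _ sol_bound]], measurable)
  have "S nu t (src (sol s)) z = (LI z'. (a - n) / a * (kern nu t z z' * sol s z') + (1 / a) * (kern nu t z z' * jump h (sol s) (sol s) z'))"
  proof -
    have "kern nu t z z' * src (sol s) z' = (a - n) / a * (kern nu t z z' * sol s z') + (1 / a) * (kern nu t z z' * jump h (sol s) (sol s) z')" for z'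
      using a by (simp add: src_def trans_op_def n_def[symmetric] field_simps)
    then show ?thesis using t by (simp add: S_eq[OF nu])
  qed
  also have "... = (a - n) / a * S nu t (sol s) z + (1 / a) * S nu t (jump h (sol s) (sol s)) z"
    using i t by (simp add: S_eq[OF nu])
  finally show ?thesis using a h unfolding n_def[symmetric] l_def by (simp add: field_simps)
qed

text \<open>\<open>duhamel_exchange\<close> at a fixed \<open>z\<close>: by
  \<open>S_sol_restart\<close> the bracket subtracted from \<open>P s\<close> is
  \<open>S nu (t - s) (sol s) z\<close>, and by \<open>S_src\<close> the integrand is the semigroup
  applied to the generator of the jumps.\<close>

lemma sol_duhamel:
  assumes t: "0 <= t0" "t0 < t"
  shows "AE z in lborel. sol t z = S nu (t - t0) (sol t0) z + (LI s. indicator {t0<..<t} s *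
    ((1 / h) * (S nu (t - s) (jump h (sol s) (sol s)) z - (LI z. \<bar>sol s z\<bar>) * S nu (t - s) (sol s) z)))"
  using sol_evolve[OF t]
proof eventually_elim
  case (elim z)
  note [measurable] = sol_measurable
  define X where "X = S nu (t - t0) (sol t0) z"
  define P where "P s = S nu (t - s) (src (sol s)) z" for s
  have [measurable]: "borel_fun P" unfolding P_def by measurable
  have Pb: "\<bar>P s\<bar> <= b" if "s < t" for s unfolding P_def by (rule source_bound[OF sol_adm that])
  have "sol t z = exp (- l * (t - t0)) * X + (LI s. twt l t0 t s * P s)" using elim by (simp add: evolve_def X_def P_def)
  also have "... = X + (LI s. indicator {t0<..<t} s * (l * (P s - (exp (- l * (s - t0)) * X + (LI r. twt l t0 s r * P r)))))"
    by (rule duhamel_exchange[OF l _ _ Pb]) (use t in auto)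
  also have "(LI s. indicator {t0<..<t} s * (l * (P s - (exp (- l * (s - t0)) * X + (LI r. twt l t0 s r * P r)))))
    = (LI s. indicator {t0<..<t} s * ((1 / h) * (S nu (t - s) (jump h (sol s) (sol s)) z - (LI z. \<bar>sol s z\<bar>) * S nu (t - s) (sol s) z)))"
  proof (rule Bochner_Integration.integral_cong[OF refl])
    fix s
    show "indicator {t0<..<t} s * (l * (P s - (exp (- l * (s - t0)) * X + (LI r. twt l t0 s r * P r))))
      = indicator {t0<..<t} s * ((1 / h) * (S nu (t - s) (jump h (sol s) (sol s)) z - (LI z. \<bar>sol s z\<bar>) * S nu (t - s) (sol s) z))"
    proof (cases "t0 < s \<and> s < t")
      case True
      then have "exp (- l * (s - t0)) * X + (LI r. twt l t0 s r * P r) = S nu (t - s) (sol s) z"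
        using S_sol_restart[OF _ _ sol_evolve, of t0 s t z] t by (simp add: evolve_def X_def P_def)
      then show ?thesis using True S_src[of "t - s" s z] by (simp add: P_def)
    qed auto
  qed
  finally show ?case by (simp add: X_def)
qed

lemma sol_cvx_step:
  assumes t: "0 <= t0" "t0 < t" and \<Phi>: "cvx \<Phi>"
  shows "cvx_int \<Phi> (sol t) <= ennreal (exp (- l * (t - t0))) * cvx_int \<Phi> (S nu (t - t0) (sol t0)) + (NN s. ennreal (twt l t0 t s) * cvx_int \<Phi> (S nu (t - s) (src (sol s))))"
proof -
  note [measurable] = sol_measurable
  have "cvx_int \<Phi> (sol t) = cvx_int \<Phi> (evolve l t0 t (S nu (t - t0) (sol t0)) (%s. S nu (t - s) (src (sol s))))"
    unfolding cvx_int_def by (rule nn_integral_cong_AE) (use sol_evolve[OF t] in eventually_elim, simp)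
  also have "... <= ennreal (exp (- l * (t - t0))) * cvx_int \<Phi> (S nu (t - t0) (sol t0)) + (NN s. ennreal (twt l t0 t s) * cvx_int \<Phi> (S nu (t - s) (src (sol s))))"
    by (rule evolve_cvx[OF l _ \<Phi> _ source_measurable[OF sol_adm] source_bound[OF sol_adm]]) (use t in auto)
  finally show ?thesis .
qed

text \<open>Jump and semigroup are averages, so the functional satisfies the inequality of
  \<open>nonincreasing_of_relaxation\<close>. The linear bound by \<open>M\<close> on the range of
  \<open>sol\<close> provides the finiteness required there.\<close>

lemma sol_cvx_antimono:
  assumes t: "0 <= t0" "t0 <= t" and \<Phi>: "cvx \<Phi>" and M: "!!x. \<bar>x\<bar> <= b ==> \<Phi> x <= M * \<bar>x\<bar>" "M >= 0"
  shows "cvx_int \<Phi> (sol t) <= cvx_int \<Phi> (sol t0)"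
    and "cvx_int \<Phi> (sol t) <= ennreal (M * a)"
proof -
  note [measurable] = sol_measurable
  show fin: "cvx_int \<Phi> (sol t) <= ennreal (M * a)" for t
  proof -
    have "cvx_int \<Phi> (sol t) <= (NN z. ennreal M * ennreal \<bar>sol t z\<bar>)"
      unfolding cvx_int_def using M sol_bound by (intro nn_integral_mono) (simp add: ennreal_mult[symmetric] ennreal_leI)
    also have "... = ennreal M * L1n (sol t)" unfolding L1n_def by (rule nn_integral_cmult) measurable
    also have "... <= ennreal M * ennreal a" by (intro mult_left_mono sol_L1) simp
    finally show ?thesis using M(2) a by (simp add: ennreal_mult)
  qed
  show "cvx_int \<Phi> (sol t) <= cvx_int \<Phi> (sol t0)"
  proof (rule nonincreasing_of_relaxation[OF l fin _ _ t(2)])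
    fix r assume r: "t0 < r" "r <= t"
    have "cvx_int \<Phi> (S nu (r - t0) (sol t0)) <= cvx_int \<Phi> (sol t0)" using r by (intro S_cvx[OF nu _ \<Phi> _ sol_bound]) auto
    moreover have "ennreal (twt l t0 r s) * cvx_int \<Phi> (S nu (r - s) (src (sol s))) <= ennreal (twt l t0 r s) * cvx_int \<Phi> (sol s)" for s
    proof (cases "t0 < s \<and> s < r")
      case True
      then have "cvx_int \<Phi> (S nu (r - s) (src (sol s))) <= cvx_int \<Phi> (src (sol s))"
        by (intro S_cvx[OF nu _ \<Phi> src_props(2,1)[OF sol_adm]]) auto
      also have "... <= cvx_int \<Phi> (sol s)" by (rule src_props(3)[OF sol_adm \<Phi>])
      finally show ?thesis by (rule mult_left_mono) simp
    qed (auto simp: twt_def)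
    ultimately show "cvx_int \<Phi> (sol r) <= ennreal (exp (- l * (r - t0))) * cvx_int \<Phi> (sol t0) + (NN s. ennreal (twt l t0 r s) * cvx_int \<Phi> (sol s))"
      by (intro order_trans[OF sol_cvx_step[OF t(1) r(1) \<Phi>]] add_mono nn_integral_mono) (simp_all add: mult_left_mono)
  qed simp
qed

lemma power_growth: "\<bar>x\<bar> <= b ==> \<bar>x\<bar> ^ Suc n <= b ^ n * \<bar>x\<bar>"
  using mult_right_mono[OF power_mono[of "\<bar>x\<bar>" b n], of "\<bar>x\<bar>"] by (simp add: mult.commute)

text \<open>Jensen lets the power \<open>Suc m\<close> pass inside \<open>S\<close>, and Nash's
  inequality is applied to \<open>\<bar>f z\<bar> ^ Suc m\<close>. This controls a power by the
  power of half its degree.\<close>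

lemma S_power_decay:
  assumes t: "t > 0" and [measurable]: "borel_fun f" and fb: "!!z. \<bar>f z\<bar> <= b"
    and Y: "cvx_int (%x. \<bar>x\<bar> ^ (2 * Suc m)) f <= ennreal Y" "Y > 0" and P: "cvx_int (%x. \<bar>x\<bar> ^ Suc m) f <= ennreal P" "P > 0"
  shows "cvx_int (%x. \<bar>x\<bar> ^ (2 * Suc m)) (S nu t f) <= ennreal (Y / (1 + nu * t * Y / P\<^sup>2))"
proof -
  have "\<bar>S nu t f z\<bar> ^ (2 * Suc m) <= (S nu t (%z. \<bar>f z\<bar> ^ Suc m) z)\<^sup>2" for z
  proof -
    have "\<bar>S nu t f z\<bar> ^ Suc m <= S nu t (%z. \<bar>f z\<bar> ^ Suc m) z"
      by (rule S_jensen[OF nu t cvx_power _ fb, where c = "b ^ Suc m"]) (use fb in \<open>auto intro!: power_mono simp del: power_Suc\<close>)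
    then have "(\<bar>S nu t f z\<bar> ^ Suc m)\<^sup>2 <= (S nu t (%z. \<bar>f z\<bar> ^ Suc m) z)\<^sup>2" by (intro power_mono) auto
    then show ?thesis by (simp only: power_mult[symmetric] mult.commute)
  qed
  then have "cvx_int (%x. \<bar>x\<bar> ^ (2 * Suc m)) (S nu t f) <= (NN z. ennreal ((S nu t (%z. \<bar>f z\<bar> ^ Suc m) z)\<^sup>2))"
    unfolding cvx_int_def by (intro nn_integral_mono ennreal_leI)
  also have "... <= ennreal (Y / (1 + nu * t * Y / P\<^sup>2))"
  proof (rule S_nash[OF nu t _ _ _ Y(2) _ P(2)])
    show "(NN z. ennreal ((\<bar>f z\<bar> ^ Suc m)\<^sup>2)) <= ennreal Y"
      using Y(1) unfolding cvx_int_def power_mult[symmetric] by (simp only: mult.commute)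
  qed (use P(1) in \<open>auto simp: cvx_int_def simp del: power_Suc\<close>)
  finally show ?thesis .
qed

text \<open>With \<open>q\<close> the current value and \<open>1 / y\<close> the comparison value,
  both reciprocals grow by \<open>\<kappa> * \<tau>\<close> in one step, so a ratio
  \<open>q * y\<close> of at least 1 does not increase.\<close>

lemma nash_comparison:
  fixes \<kappa> \<tau> q y :: real
  assumes "\<kappa> > 0" "\<tau> > 0" "q > 0" "y > 0" "1 <= q * y"
  shows "q / (1 + \<kappa> * \<tau> * q) * (\<kappa> * \<tau> + y) <= q * y"
proof -
  have "\<kappa> * \<tau> * 1 <= \<kappa> * \<tau> * (q * y)" using assms by (intro mult_left_mono) auto
  then have "q * (\<kappa> * \<tau> + y) <= q * (y * (1 + \<kappa> * \<tau> * q))" using assms by (intro mult_left_mono) (auto simp: algebra_simps)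
  moreover have "1 + \<kappa> * \<tau> * q > 0" using assms by (simp add: add_pos_pos)
  ultimately show ?thesis by (simp add: pos_divide_le_eq mult.assoc)
qed

text \<open>Nash's inequality in integrated form: with \<open>Y\<close> the integral of the power \<open>2p\<close>, the comparison function
  \<open>y = P\<^sup>2/(nu(t - t0) + P\<^sup>2/Y0)\<close> is a fixed point of the one-step bound, so \<open>max 1 (Y/y)\<close> does not grow.\<close>
lemma sol_nash:
  assumes t: "0 <= t0" "t0 < T" and P: "cvx_int (%x. \<bar>x\<bar> ^ Suc m) (sol t0) <= ennreal P" "P > 0"
  shows "cvx_int (%x. \<bar>x\<bar> ^ (2 * Suc m)) (sol T) <= ennreal (P\<^sup>2 / (nu * (T - t0)))"
proof -
  note [measurable] = sol_measurable
  define \<Phi> where "\<Phi> x = \<bar>x\<bar> ^ (2 * Suc m)" for x :: real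
  have \<Phi>_Suc: "\<Phi> = (%x. \<bar>x\<bar> ^ Suc (2 * m + 1))" by (simp add: \<Phi>_def[abs_def])
  have \<Phi>: "cvx \<Phi>" unfolding \<Phi>_Suc by (rule cvx_power)
  have \<Phi>M: "!!x. \<bar>x\<bar> <= b ==> \<Phi> x <= b ^ (2 * m + 1) * \<bar>x\<bar>" "b ^ (2 * m + 1) >= 0"
    unfolding \<Phi>_Suc using power_growth b_nonneg by (auto simp del: power_Suc)
  define Y where "Y s = cvx_int \<Phi> (sol s)" for s
  \<comment> \<open>A positive bound for the functional at all nonnegative times. It enters through
    the term \<open>1 / Y0\<close> of \<open>y\<close>, which is dropped in the final
    estimate.\<close>
  define Y0 where "Y0 = b ^ (2 * m + 1) * a + 1"
  have Y0: "Y0 > 0" using a b_nonneg by (simp add: Y0_def add_nonneg_pos)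
  have YY0: "Y s <= ennreal Y0" if "0 <= s" for s
  proof -
    have "Y s <= ennreal (b ^ (2 * m + 1) * a)" unfolding Y_def using that by (intro sol_cvx_antimono(2)[OF that order_refl \<Phi>] \<Phi>M)
    also have "... <= ennreal Y0" by (rule ennreal_leI) (simp add: Y0_def)
    finally show ?thesis .
  qed
  have Ps: "cvx_int (%x. \<bar>x\<bar> ^ Suc m) (sol s) <= ennreal P" if "t0 <= s" for s
    by (rule order_trans[OF sol_cvx_antimono(1)[OF t(1) that cvx_power power_growth] P(1)]) (use b_nonneg in auto)
  define \<kappa> where "\<kappa> = nu / P\<^sup>2"
  have k: "\<kappa> > 0" using nu P by (simp add: \<kappa>_def)
  define y where "y s = \<kappa> * (s - t0) + 1 / Y0" for s
  have y: "y s > 0" if "t0 <= s" for s using that k Y0 by (simp add: y_def add_nonneg_pos)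
  define G where "G s = max 1 (Y s * ennreal (y s))" for s
  have step: "cvx_int \<Phi> (S nu (t - s) f) * ennreal (y t) <= G s"
    if s: "t0 <= s" "s < t" and [measurable]: "borel_fun f" and f: "!!z. \<bar>f z\<bar> <= b" "cvx_int \<Phi> f <= Y s" "cvx_int (%x. \<bar>x\<bar> ^ Suc m) f <= ennreal P" for s t f
  proof -
    obtain r where r: "Y s = ennreal r" "r >= 0" using YY0[of s] s t by (cases "Y s") (auto simp: top_unique)
    \<comment> \<open>Raising the value to at least \<open>1 / y s\<close> secures
      \<open>1 <= q * y s\<close> for \<open>nash_comparison\<close>; this is the reason for the
      maximum with 1 in \<open>G\<close>.\<close>
    define q where "q = max r (1 / y s)"
    have ys: "y s > 0" using y s by simp
    have q: "q > 0" "1 <= q * y s"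
      using ys mult_right_mono[of "1 / y s" q "y s"] by (auto simp: q_def less_max_iff_disj)
    have "cvx_int \<Phi> (S nu (t - s) f) <= ennreal (q / (1 + nu * (t - s) * q / P\<^sup>2))"
      unfolding \<Phi>_def
    proof (rule S_power_decay[OF _ _ f(1) _ q(1) f(3) P(2)])
      have "ennreal r <= ennreal q" by (rule ennreal_leI) (simp add: q_def)
      then show "cvx_int (%x. \<bar>x\<bar> ^ (2 * Suc m)) f <= ennreal q" using f(2) r(1) unfolding \<Phi>_def by (metis order_trans)
    qed (use s in auto)
    then have "cvx_int \<Phi> (S nu (t - s) f) * ennreal (y t) <= ennreal (q / (1 + nu * (t - s) * q / P\<^sup>2)) * ennreal (y t)" by (rule mult_right_mono) simp
    also have "... = ennreal (q / (1 + \<kappa> * (t - s) * q) * (\<kappa> * (t - s) + y s))"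
    proof -
      have "nu * (t - s) * q / P\<^sup>2 = \<kappa> * (t - s) * q" by (simp add: \<kappa>_def)
      moreover have "y t = \<kappa> * (t - s) + y s" by (simp add: y_def right_diff_distrib)
      ultimately show ?thesis using q k s y[of t] by (subst ennreal_mult[symmetric]) auto
    qed
    also have "... <= ennreal (q * y s)" using nash_comparison[OF k _ q(1) ys q(2), of "t - s"] s by (intro ennreal_leI) simp
    also have "q * y s = max (r * y s) 1" using ys by (simp add: q_def max_mult_distrib_right)
    also have "ennreal (max (r * y s) 1) = G s"
      using r(2) ys unfolding G_def r(1) by (simp add: ennreal_mult[symmetric] max_def ennreal_le_1 del: ennreal_1 flip: ennreal_1)
    finally show ?thesis .
  qed
  have "G T <= G t0"
  proof (rule nonincreasing_of_relaxation[OF l])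
    show "t0 <= T" using t by simp
    show "G s <= max 1 (ennreal (Y0 * y T))" if "t0 <= s" "s <= T" for s
    proof -
      have "Y s * ennreal (y s) <= ennreal Y0 * ennreal (y T)"
        using that t k YY0[of s] by (intro mult_mono ennreal_leI) (auto simp: y_def)
      then show ?thesis using Y0 y[of T] t unfolding G_def by (intro max.mono) (auto simp: ennreal_mult)
    qed
    show "max 1 (ennreal (Y0 * y T)) < \<infinity>" by (simp add: max_def)
    fix r assume r: "t0 < r" "r <= T"
    let ?e = "ennreal (exp (- l * (r - t0)))"
    have G1: "1 <= G s" for s by (simp add: G_def)
    have "1 = ?e + ennreal (1 - exp (- l * (r - t0)))" using l r by (subst ennreal_plus[symmetric]) auto
    also have "... = ?e * 1 + (NN s. ennreal (twt l t0 r s) * 1)" using nn_integral_twt[OF l, of t0 r] r by simp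
    also have "... <= ?e * G t0 + (NN s. ennreal (twt l t0 r s) * G s)"
      by (intro add_mono mult_left_mono nn_integral_mono G1) auto
    finally have 1: "1 <= ?e * G t0 + (NN s. ennreal (twt l t0 r s) * G s)" .
    have "Y r * ennreal (y r) <= (?e * cvx_int \<Phi> (S nu (r - t0) (sol t0)) + (NN s. ennreal (twt l t0 r s) * cvx_int \<Phi> (S nu (r - s) (src (sol s))))) * ennreal (y r)"
      unfolding Y_def by (intro mult_right_mono sol_cvx_step[OF t(1) r(1) \<Phi>]) simp
    also have "... = ?e * (cvx_int \<Phi> (S nu (r - t0) (sol t0)) * ennreal (y r)) + (NN s. ennreal (twt l t0 r s) * (cvx_int \<Phi> (S nu (r - s) (src (sol s))) * ennreal (y r)))"
    proof -
      have [measurable]: "\<Phi> \<in> borel_measurable borel" by (rule cvx_measurable[OF \<Phi>])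
      have [measurable]: "(%s. cvx_int \<Phi> (S nu (r - s) (src (sol s)))) \<in> borel_measurable lborel" unfolding cvx_int_def by measurable
      have m: "(%s. ennreal (twt l t0 r s) * cvx_int \<Phi> (S nu (r - s) (src (sol s)))) \<in> borel_measurable lborel" by measurable
      show ?thesis by (simp only: distrib_right mult.assoc[symmetric] nn_integral_multc[OF m])
    qed
    also have "... <= ?e * G t0 + (NN s. ennreal (twt l t0 r s) * G s)"
    proof (intro add_mono nn_integral_mono)
      show "?e * (cvx_int \<Phi> (S nu (r - t0) (sol t0)) * ennreal (y r)) <= ?e * G t0"
        by (intro mult_left_mono step) (use r Ps in \<open>auto simp: Y_def sol_bound\<close>)
      fix s
      show "ennreal (twt l t0 r s) * (cvx_int \<Phi> (S nu (r - s) (src (sol s))) * ennreal (y r)) <= ennreal (twt l t0 r s) * G s"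
      proof (cases "t0 < s \<and> s < r")
        case True
        have "cvx_int (%x. \<bar>x\<bar> ^ Suc m) (src (sol s)) <= ennreal P"
          by (rule order_trans[OF src_props(3)[OF sol_adm cvx_power] Ps]) (use True in simp)
        then show ?thesis
          by (intro mult_left_mono step) (use True src_props(1,2)[OF sol_adm] src_props(3)[OF sol_adm \<Phi>] in \<open>auto simp: Y_def\<close>)
      qed (auto simp: twt_def)
    qed
    finally show "G r <= ?e * G t0 + (NN s. ennreal (twt l t0 r s) * G s)" using 1 unfolding G_def[of r] by simp
  qed
  also have "G t0 = 1"
  proof -
    have "Y t0 * ennreal (y t0) <= ennreal Y0 * ennreal (1 / Y0)" using YY0[OF t(1)] by (intro mult_mono) (auto simp: y_def)
    also have "... = 1" using Y0 by (simp add: ennreal_mult[symmetric])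
    finally show ?thesis by (simp add: G_def max_def)
  qed
  finally have 1: "Y T * ennreal (y T) <= 1" by (simp add: G_def)
  have "Y T * ennreal (\<kappa> * (T - t0)) <= Y T * ennreal (y T)" using Y0 by (intro mult_left_mono ennreal_leI) (simp_all add: y_def)
  then have "Y T * ennreal (\<kappa> * (T - t0)) <= 1" using 1 by (rule order_trans)
  then have "Y T * ennreal (\<kappa> * (T - t0)) * ennreal (1 / (\<kappa> * (T - t0))) <= 1 * ennreal (1 / (\<kappa> * (T - t0)))" by (rule mult_right_mono) simp
  moreover have "ennreal (\<kappa> * (T - t0)) * ennreal (1 / (\<kappa> * (T - t0))) = 1" using k t by (subst ennreal_mult[symmetric]) auto
  ultimately have "Y T <= ennreal (1 / (\<kappa> * (T - t0)))" by (simp add: mult.assoc)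
  then show ?thesis by (simp add: Y_def \<kappa>_def \<Phi>_def[abs_def])
qed

text \<open>Iteration of \<open>sol_nash\<close> along the times \<open>t * (1 - 1 / 2 ^ k)\<close>.
  The step length \<open>t / 2 ^ Suc k\<close> gives the recursion
  \<open>P (Suc k) = (P k)\<^sup>2 * 2 ^ Suc k / (nu * t)\<close>, which the given \<open>P\<close>
  solves. The initial value \<open>P 0 = a\<close> forces \<open>A = 4 * a / (nu * t)\<close>, the
  origin of the constant 4 in the theorem.\<close>

lemma sol_decay:
  assumes t: "t > 0"
  shows "AE z in lborel. \<bar>sol t z\<bar> <= 4 * a / (nu * t)"
proof -
  define A where "A = 4 * a / (nu * t)"
  have A: "A > 0" using a nu t by (simp add: A_def)
  define P where "P k = nu * t * A ^ (2 ^ k) / 2 ^ (k + 2)" for k :: nat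
  have P: "P k > 0" for k using nu t A by (simp add: P_def)
  have iter: "cvx_int (%x. \<bar>x\<bar> ^ (2 ^ k)) (sol (t * (1 - 1 / 2 ^ k))) <= ennreal (P k)" for k
  proof (induction k)
    case 0
    have "P 0 = a" using nu t by (simp add: P_def A_def)
    then show ?case using sol_L1[of 0] by (simp add: L1n_cvx_int)
  next
    case (Suc k)
    obtain m where m: "2 ^ k = Suc m" using not0_implies_Suc[of "2 ^ k"] by auto
    have d: "t * (1 - 1 / 2 ^ Suc k) - t * (1 - 1 / 2 ^ k) = t / 2 ^ Suc k" by (simp add: field_simps)
    have "cvx_int (%x. \<bar>x\<bar> ^ (2 * Suc m)) (sol (t * (1 - 1 / 2 ^ Suc k))) <= ennreal ((P k)\<^sup>2 / (nu * (t * (1 - 1 / 2 ^ Suc k) - t * (1 - 1 / 2 ^ k))))"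
    proof (rule sol_nash[OF _ _ _ P])
      show "0 <= t * (1 - 1 / 2 ^ k)" using t by simp
      show "t * (1 - 1 / 2 ^ k) < t * (1 - 1 / 2 ^ Suc k)" 
      proof -
        have "t / 2 ^ Suc k > 0" using t by simp
        then show ?thesis using d by linarith
      qed
      show "cvx_int (%x. \<bar>x\<bar> ^ Suc m) (sol (t * (1 - 1 / 2 ^ k))) <= ennreal (P k)" using Suc unfolding m .
    qed
    also have "(P k)\<^sup>2 / (nu * (t * (1 - 1 / 2 ^ Suc k) - t * (1 - 1 / 2 ^ k))) = P (Suc k)"
    proof -
      have "(A ^ (2 ^ k))\<^sup>2 = A ^ (2 ^ Suc k)" by (simp add: power_mult[symmetric] mult.commute)
      moreover have "(2 ^ (k + 2))\<^sup>2 = 2 ^ Suc k * (2 ^ (Suc k + 2) :: real)" by (simp add: power2_eq_square power_add)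
      ultimately have "(P k)\<^sup>2 = (nu * t) * (nu * t) * A ^ (2 ^ Suc k) / (2 ^ Suc k * 2 ^ (Suc k + 2))"
        by (simp only: P_def power_divide power_mult_distrib) (simp only: power2_eq_square mult_ac)
      then show ?thesis unfolding d P_def using nu t by simp
    qed
    finally show ?case by (simp add: m[symmetric])
  qed
  show ?thesis unfolding A_def[symmetric]
  proof (rule AE_le_of_power_bounds[OF sol_measurable(2) A, of "nu * t"])
    fix k
    obtain m where m: "2 ^ k = Suc m" using not0_implies_Suc[of "2 ^ k"] by auto
    have "cvx_int (%x. \<bar>x\<bar> ^ Suc m) (sol t) <= cvx_int (%x. \<bar>x\<bar> ^ Suc m) (sol (t * (1 - 1 / 2 ^ k)))"
      by (rule sol_cvx_antimono(1)[OF _ _ cvx_power power_growth]) (use t b_nonneg in \<open>auto simp: mult_left_le\<close>)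
    also have "... <= ennreal (P k)" using iter[of k] unfolding m .
    also have "... <= ennreal (nu * t * A ^ (2 ^ k))"
      using nu t A divide_left_mono[of 1 "2 ^ (k + 2)" "nu * t * A ^ (2 ^ k)"] one_le_power[of "2::real" "k + 2"]
      by (intro ennreal_leI) (simp add: P_def)
    finally show "cvx_int (%x. \<bar>x\<bar> ^ (2 ^ k)) (sol t) <= ennreal (nu * t * A ^ (2 ^ k))" by (simp add: m)
  qed (use nu t in simp)
qed

end

section \<open>Stability of the Duhamel formula\<close>

lemma nn_integral_inverse_sqrt:
  assumes "c >= 0"
  shows "(NN x. ennreal (1 / sqrt x) * indicator {0<..<c} x) <= ennreal (2 * sqrt c)"
proof -
  have "(NN x. ennreal (1 / sqrt x) * indicator {0<..<c} x) = (NN x. ennreal (x powr (-1/2)) * indicator {0<..<c} x)"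
    by (intro nn_integral_cong) (auto simp: indicator_def powr_minus powr_half_sqrt inverse_eq_divide)
  also have "... <= ennreal (c powr (-1/2 + 1) / (-1/2 + 1))" by (rule nn_integral_powr) (use assms in auto)
  also have "c powr (-1/2 + 1) / (-1/2 + 1) = 2 * sqrt c" using assms by (simp add: powr_half_sqrt)
  finally show ?thesis .
qed

definition gradc :: "real => real => real" where
  "gradc nu T = 3 * (2 + T / 2) / sqrt (2 * nu)"

lemma gradc_nonneg: "nu > 0 ==> T > 0 ==> gradc nu T >= 0"
  by (simp add: gradc_def)

text \<open>Integrand of the Gronwall inequality: kernel gradient times velocity bound, singular at
  both ends \<open>s = t\<close> and \<open>s = t0\<close>.\<close>

abbreviation drift_rate :: "real => real => real => real => real => real => real"
  where "drift_rate nu A e t0 t s \<equiv> grad_const nu (t - s) * (A + e / sqrt (s - t0))"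

lemma grad_const_le:
  assumes "nu > 0" "0 < \<tau>" "\<tau> <= T"
  shows "grad_const nu \<tau> <= gradc nu T * (1 / sqrt \<tau>)"
proof -
  have "3 * (2 + \<tau> / 2) / (sqrt (2 * nu) * sqrt \<tau>) <= 3 * (2 + T / 2) / (sqrt (2 * nu) * sqrt \<tau>)"
    using assms by (intro divide_right_mono) auto
  then show ?thesis by (simp add: grad_const_def gradc_def real_sqrt_mult)
qed

text \<open>The weight makes the \<open>A\<close> part small, of order
  \<open>1 / sqrt \<mu>\<close>. The integral of \<open>1 / sqrt ((t - s) * (s - t0))\<close> is the
  same for all intervals, so for \<open>t\<close> close to \<open>t0\<close> no weight reduces the
  \<open>e\<close> part, and its coefficient itself has to be small.\<close>

lemma grad_const_weighted:
  assumes nu: "nu > 0" and A: "A >= 0" "e >= 0" and \<mu>: "\<mu> > 0" and t: "t0 < t" "t - t0 <= T"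
  shows "(NN s. ennreal (indicator {t0<..<t} s * (exp (- \<mu> * (t - s)) * (drift_rate nu A e t0 t s))))
    <= ennreal (gradc nu T * (3 * A / sqrt \<mu> + 4 * e))"
proof -
  define c where "c = gradc nu T"
  define L where "L = t - t0"
  have L: "L > 0" using t by (simp add: L_def)
  have c: "c >= 0" using gradc_nonneg[OF nu, of T] t by (simp add: c_def)
  define H where "H r x = ennreal (1 / sqrt x) * indicator {0<..<r} x" for r x :: real
  define X where "X x = ennreal (exp (- \<mu> * x)) * indicator {0..} x" for x :: real
  have [measurable]: "borel_fun (H r)" "borel_fun X" for r unfolding H_def X_def by measurable
  have IH: "(NN x. H r x) <= ennreal (2 * sqrt r)" if "r >= 0" for r
    unfolding H_def by (rule nn_integral_inverse_sqrt[OF that])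
  have IX: "(NN x. X x) = ennreal (1 / \<mu>)"
  proof -
    have "(NN x. X x) = ennreal (0 - (- exp (- \<mu> * 0) / \<mu>))"
      unfolding X_def
    proof (rule nn_integral_FTC_atLeast)
      show "((%x. - exp (- \<mu> * x) / \<mu>) has_real_derivative exp (- \<mu> * x)) (at x)" for x
        using \<mu> by (auto intro!: derivative_eq_intros)
      have "((%x. exp (- (\<mu> * x))) \<longlongrightarrow> 0) at_top"
        using \<mu> by (intro filterlim_compose[OF exp_at_bot] filterlim_uminus_at_bot_at_top[THEN filterlim_compose] filterlim_tendsto_pos_mult_at_top[OF tendsto_const]) (auto simp: filterlim_ident)
      from tendsto_divide[OF tendsto_minus[OF this] tendsto_const[of \<mu>]] \<mu> show "((%x. - exp (- \<mu> * x) / \<mu>) \<longlongrightarrow> 0) at_top" by simp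
    qed auto
    then show ?thesis by simp
  qed
  have pw: "exp (- \<mu> * (t - s)) * (drift_rate nu A e t0 t s)
      <= c * A * (1 / sqrt (t - s) * indicator {0<..<1 / \<mu>} (t - s) + sqrt \<mu> * exp (- \<mu> * (t - s))) + c * e / sqrt L * (1 / sqrt (t - s) + 1 / sqrt (s - t0))"
    if s: "t0 < s" "s < t" for s
  proof -
    define x where "x = t - s" define y where "y = s - t0"
    have xy: "x > 0" "y > 0" "x + y = L" using s by (auto simp: x_def y_def L_def)
    have "exp (- \<mu> * x) * (grad_const nu x * (A + e / sqrt y)) <= exp (- \<mu> * x) * ((c * (1 / sqrt x)) * (A + e / sqrt y))"
      using grad_const_le[OF nu, of x T] xy A t s unfolding c_def by (intro mult_left_mono mult_right_mono) (auto simp: x_def)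
    also have "... = c * A * (exp (- \<mu> * x) * (1 / sqrt x)) + c * e * (exp (- \<mu> * x) * (1 / (sqrt x * sqrt y)))" by (simp add: algebra_simps)
    also have "... <= c * A * (1 / sqrt x * indicator {0<..<1 / \<mu>} x + sqrt \<mu> * exp (- \<mu> * x)) + c * e * (1 / sqrt L * (1 / sqrt x + 1 / sqrt y))"
    proof (intro add_mono mult_left_mono)
      \<comment> \<open>Split at \<open>x = 1 / \<mu>\<close>: below it the weight is dropped, above
        it \<open>1 / sqrt x\<close> is at most \<open>sqrt \<mu>\<close>.\<close>
      show "exp (- \<mu> * x) * (1 / sqrt x) <= 1 / sqrt x * indicator {0<..<1 / \<mu>} x + sqrt \<mu> * exp (- \<mu> * x)"
      proof (cases "x < 1 / \<mu>")
        case True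
        have "exp (- \<mu> * x) * (1 / sqrt x) <= 1 * (1 / sqrt x)" using \<mu> xy by (intro mult_right_mono) auto
        moreover have "0 <= sqrt \<mu> * exp (- \<mu> * x)" using \<mu> by simp
        ultimately show ?thesis using True xy by simp
      next
        case False
        then have "1 <= x * \<mu>" using \<mu> by (simp add: pos_divide_le_eq not_less)
        then have "1 <= sqrt x * sqrt \<mu>" by (simp add: real_sqrt_mult[symmetric])
        then have "1 / sqrt x <= sqrt \<mu>" using xy by (simp add: pos_divide_le_eq mult.commute)
        from mult_left_mono[OF this, of "exp (- \<mu> * x)"] False show ?thesis by (simp add: mult.commute)
      qed
      \<comment> \<open>This separates the two endpoint singularities. Each integrates to at most
        \<open>2 * sqrt L\<close>, which cancels the prefactor and leaves
        \<open>4 * e\<close>.\<close>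
      have "sqrt L <= sqrt x + sqrt y" using sqrt_add_le_add_sqrt[of x y] xy by simp
      then have "1 / (sqrt x * sqrt y) <= 1 / sqrt L * (1 / sqrt x + 1 / sqrt y)"
        using xy L by (simp add: field_simps)
      moreover have "exp (- \<mu> * x) * (1 / (sqrt x * sqrt y)) <= 1 * (1 / (sqrt x * sqrt y))" using \<mu> xy by (intro mult_right_mono) auto
      ultimately show "exp (- \<mu> * x) * (1 / (sqrt x * sqrt y)) <= 1 / sqrt L * (1 / sqrt x + 1 / sqrt y)" by simp
    qed (use c A in auto)
    finally show ?thesis by (simp add: x_def y_def mult.assoc)
  qed
  have "(NN s. ennreal (indicator {t0<..<t} s * (exp (- \<mu> * (t - s)) * (drift_rate nu A e t0 t s))))
    <= (NN s. (ennreal (c * A) * H (1 / \<mu>) (t - s) + ennreal (c * A * sqrt \<mu>) * X (t - s)) + (ennreal (c * e / sqrt L) * H L (t - s) + ennreal (c * e / sqrt L) * H L (s - t0)))"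
  proof (intro nn_integral_mono)
    fix s
    show "ennreal (indicator {t0<..<t} s * (exp (- \<mu> * (t - s)) * (drift_rate nu A e t0 t s)))
      <= (ennreal (c * A) * H (1 / \<mu>) (t - s) + ennreal (c * A * sqrt \<mu>) * X (t - s)) + (ennreal (c * e / sqrt L) * H L (t - s) + ennreal (c * e / sqrt L) * H L (s - t0))"
    proof (cases "t0 < s \<and> s < t")
      case True
      have "ennreal (exp (- \<mu> * (t - s)) * (drift_rate nu A e t0 t s))
        <= ennreal (c * A * (1 / sqrt (t - s) * indicator {0<..<1 / \<mu>} (t - s) + sqrt \<mu> * exp (- \<mu> * (t - s))) + c * e / sqrt L * (1 / sqrt (t - s) + 1 / sqrt (s - t0)))"
        using pw True by (intro ennreal_leI) auto
      also have "... = (ennreal (c * A) * H (1 / \<mu>) (t - s) + ennreal (c * A * sqrt \<mu>) * X (t - s)) + (ennreal (c * e / sqrt L) * H L (t - s) + ennreal (c * e / sqrt L) * H L (s - t0))"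
        using True c A \<mu> L unfolding H_def X_def L_def
        by (auto simp: distrib_left ennreal_mult[symmetric] ennreal_plus[symmetric] mult.assoc indicator_def simp del: ennreal_plus)
      finally show ?thesis using True by simp
    qed auto
  qed
  also have "... = (ennreal (c * A) * (NN x. H (1 / \<mu>) x) + ennreal (c * A * sqrt \<mu>) * (NN x. X x)) + (ennreal (c * e / sqrt L) * (NN x. H L x) + ennreal (c * e / sqrt L) * (NN x. H L x))"
    by (simp add: nn_integral_add nn_integral_cmult nn_integral_shift(2,3))
  also have "... <= (ennreal (c * A) * ennreal (2 * sqrt (1 / \<mu>)) + ennreal (c * A * sqrt \<mu>) * ennreal (1 / \<mu>)) + (ennreal (c * e / sqrt L) * ennreal (2 * sqrt L) + ennreal (c * e / sqrt L) * ennreal (2 * sqrt L))"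
    unfolding IX using \<mu> L by (intro add_mono mult_left_mono IH) auto
  also have "... = ennreal ((c * A * (2 * sqrt (1 / \<mu>)) + c * A * sqrt \<mu> * (1 / \<mu>)) + (c * e / sqrt L * (2 * sqrt L) + c * e / sqrt L * (2 * sqrt L)))"
    using c A \<mu> L by (simp add: ennreal_mult[symmetric] ennreal_plus[symmetric] del: ennreal_plus)
  also have "(c * A * (2 * sqrt (1 / \<mu>)) + c * A * sqrt \<mu> * (1 / \<mu>)) + (c * e / sqrt L * (2 * sqrt L) + c * e / sqrt L * (2 * sqrt L)) = c * (3 * A / sqrt \<mu> + 4 * e)"
  proof -
    have "sqrt \<mu> * (1 / \<mu>) = 1 / sqrt \<mu>" using \<mu> by (simp add: real_div_sqrt field_simps)
    then have "c * A * sqrt \<mu> * (1 / \<mu>) = c * A * (1 / sqrt \<mu>)" by (simp only: mult.assoc)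
    then show ?thesis using L by (simp add: real_sqrt_divide algebra_simps)
  qed
  finally show ?thesis unfolding c_def .
qed

text \<open>The weighted bound with \<open>\<mu> = 1 / (t - t0)\<close>: on the interval the weight
  is at least \<open>exp (- 1)\<close>, which costs the factor 3.\<close>

lemma grad_const_integral:
  assumes nu: "nu > 0" and A: "A >= 0" "e >= 0" and t: "t0 < t" "t - t0 <= T"
  shows "(NN s. ennreal (indicator {t0<..<t} s * (drift_rate nu A e t0 t s)))
    <= ennreal (3 * (gradc nu T * (3 * A * sqrt (t - t0) + 4 * e)))"
proof -
  define \<mu> where "\<mu> = 1 / (t - t0)"
  have \<mu>: "\<mu> > 0" using t by (simp add: \<mu>_def)
  have "(NN s. ennreal (indicator {t0<..<t} s * (drift_rate nu A e t0 t s)))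
    <= (NN s. ennreal 3 * ennreal (indicator {t0<..<t} s * (exp (- \<mu> * (t - s)) * (drift_rate nu A e t0 t s))))"
  proof (intro nn_integral_mono)
    fix s
    show "ennreal (indicator {t0<..<t} s * (drift_rate nu A e t0 t s))
      <= ennreal 3 * ennreal (indicator {t0<..<t} s * (exp (- \<mu> * (t - s)) * (drift_rate nu A e t0 t s)))"
    proof (cases "t0 < s \<and> s < t")
      case True
      have g: "drift_rate nu A e t0 t s >= 0" using True A grad_const_nonneg[OF nu, of "t - s"] by simp
      have "\<mu> * (t - s) <= 1" using True t by (simp add: \<mu>_def pos_divide_le_eq)
      then have "exp (- 1) <= exp (- \<mu> * (t - s))" by simp
      moreover have "1 <= 3 * exp (- 1 :: real)" using exp_le by (simp add: exp_minus field_simps)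
      ultimately have "1 <= 3 * exp (- \<mu> * (t - s))" by linarith
      from mult_right_mono[OF this g] True show ?thesis
        by (subst ennreal_mult'[symmetric]) (auto intro!: ennreal_leI simp: mult.assoc)
    qed auto
  qed
  also have "... = ennreal 3 * (NN s. ennreal (indicator {t0<..<t} s * (exp (- \<mu> * (t - s)) * (drift_rate nu A e t0 t s))))"
    unfolding grad_const_def by (rule nn_integral_cmult) measurable
  also have "... <= ennreal 3 * ennreal (gradc nu T * (3 * A / sqrt \<mu> + 4 * e))" by (intro mult_left_mono grad_const_weighted nu A \<mu> t) simp
  also have "... = ennreal (3 * (gradc nu T * (3 * A * sqrt (t - t0) + 4 * e)))"
    by (subst ennreal_mult'[symmetric]) (auto simp: \<mu>_def real_sqrt_divide)
  finally show ?thesis .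
qed

definition adv :: "(real \<times> real => real) => real \<times> real => real \<times> real" where
  "adv f z = f z *\<^sub>R biot_savart f z"

lemma borel_measurable_adv [measurable (raw)]:
  assumes [measurable]: "joint_borel M F" "Z \<in> borel_measurable M"
  shows "(%x. adv (F x) (Z x)) \<in> borel_measurable M"
proof -
  have [measurable]: "(%x. F x (Z x)) \<in> borel_measurable M"
    using measurable_compose[OF _ assms(1), of "%x. (x, Z x)" M] by simp
  show ?thesis unfolding adv_def by measurable
qed

text \<open>The difference splits into the difference times a velocity plus \<open>g\<close> times
  the velocity of the difference. \<open>nn_integral_inv_pot_swap\<close> puts the second term on
  the same footing as the first, whence the factor 2.\<close>

lemma adv_diff:
  assumes [measurable]: "borel_fun f" "borel_fun g"
    and N: "!!z. inv_pot f z <= ennreal N" "!!z. inv_pot g z <= ennreal N"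
  shows "L1n (%z. norm (adv f z - adv g z)) <= ennreal N * (2 * L1n (%z. f z - g z))"
proof -
  let ?d = "%z. f z - g z"
  have "ennreal (norm (adv f z - adv g z)) <= ennreal \<bar>?d z\<bar> * inv_pot f z + ennreal \<bar>g z\<bar> * inv_pot ?d z" for z
  proof -
    have i: "integrable lborel (%z'. f z' *\<^sub>R bs_kernel (z - z'))" "integrable lborel (%z'. g z' *\<^sub>R bs_kernel (z - z'))"
      using N[of z] by (auto intro!: integrable_bs_kernel simp: le_less_trans)
    have bs: "biot_savart f z - biot_savart g z = biot_savart ?d z"
      using i by (simp add: biot_savart_eq scaleR_diff_left)
    have "adv f z - adv g z = ?d z *\<^sub>R biot_savart f z + g z *\<^sub>R biot_savart ?d z"
      unfolding adv_def bs[symmetric] by (simp add: scaleR_diff_left scaleR_diff_right)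
    then have "norm (adv f z - adv g z) <= \<bar>?d z\<bar> * norm (biot_savart f z) + \<bar>g z\<bar> * norm (biot_savart ?d z)"
      using norm_triangle_ineq[of "?d z *\<^sub>R biot_savart f z" "g z *\<^sub>R biot_savart ?d z"] by (simp only: norm_scaleR real_norm_def)
    then have "ennreal (norm (adv f z - adv g z)) <= ennreal \<bar>?d z\<bar> * ennreal (norm (biot_savart f z)) + ennreal \<bar>g z\<bar> * ennreal (norm (biot_savart ?d z))"
      by (subst ennreal_lincomb[symmetric]) (simp_all add: ennreal_leI del: ennreal_plus)
    also have "... <= ennreal \<bar>?d z\<bar> * inv_pot f z + ennreal \<bar>g z\<bar> * inv_pot ?d z" by (intro add_mono mult_left_mono biot_savart_le) auto
    finally show ?thesis .
  qed
  then have "L1n (%z. norm (adv f z - adv g z)) <= (NN z. ennreal \<bar>?d z\<bar> * inv_pot f z + ennreal \<bar>g z\<bar> * inv_pot ?d z)"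
    unfolding L1n_def by (intro nn_integral_mono) simp
  also have "... = (NN z. ennreal \<bar>?d z\<bar> * inv_pot f z) + (NN z. ennreal \<bar>?d z\<bar> * inv_pot g z)"
    by (subst nn_integral_add, measurable) (subst nn_integral_inv_pot_swap[of g], simp_all)
  also have "... <= ennreal N * L1n ?d + ennreal N * L1n ?d"
    by (intro add_mono nn_integral_inv_pot_le N) measurable
  finally show ?thesis by (simp add: mult_2 distrib_left)
qed

text \<open>With the zero function as partner, bounds for a single function are instances of the
  difference bounds.\<close>

lemma inv_pot_0 [simp]: "inv_pot (%z. 0) z = 0" and adv_0 [simp]: "adv (%z. 0) z = 0"
  and L1n_zero [simp]: "L1n (%z. 0) = 0" and Sd_0 [simp]: "Sd nu t (%z. 0) z = 0"
  by (simp_all add: inv_pot_def adv_def L1n_def Sd_def)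

lemma adv_L1:
  assumes "borel_fun f" "!!z. inv_pot f z <= ennreal N"
  shows "L1n (%z. norm (adv f z)) <= ennreal N * (2 * L1n f)"
  using adv_diff[of f "%z. 0" N] assms by simp

lemma Sd_diff_L1:
  assumes nu: "nu > 0" and t: "t > 0" and [measurable]: "borel_fun F" "borel_fun G"
    and i: "L1n (%z. norm (F z)) < \<infinity>" "L1n (%z. norm (G z)) < \<infinity>"
  shows "Sd nu t F z - Sd nu t G z = Sd nu t (%z. F z - G z) z"
proof -
  have I: "integrable lborel (%z'. kgrad nu t z z' \<bullet> F z')"
    if [measurable]: "borel_fun F" and f: "L1n (%z. norm (F z)) < \<infinity>" for F :: "real \<times> real => real \<times> real"
  proof -
    define m where "m = grad_const nu t * (1 / sqrt (2 * pi * (2 * xvar nu t)) * (1 / sqrt (2 * pi * (2 * (2 * nu * t)))))"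
    have g: "grad_const nu t >= 0" by (rule grad_const_nonneg[OF nu t])
    have "kern2 nu t z z' <= 1 / sqrt (2 * pi * (2 * xvar nu t)) * (1 / sqrt (2 * pi * (2 * (2 * nu * t))))" for z'
      unfolding kern2_def using xvar_pos[OF nu t] nu t by (intro mult_mono gauss_le) auto
    then have m: "norm (kgrad nu t z z') <= m" for z'
      unfolding m_def by (intro order_trans[OF norm_kgrad_le[OF nu t]] mult_left_mono g)
    have "m >= 0" using order_trans[OF norm_ge_zero m] .
    have le: "norm (kgrad nu t z z' \<bullet> F z') <= norm (m * norm (F z'))" for z'
      using order_trans[OF Cauchy_Schwarz_ineq2 mult_right_mono[OF m norm_ge_zero]] \<open>m >= 0\<close> by simp
    have "integrable lborel (%z'. m * norm (F z'))"
      using f integrable_iff_L1n[of "%z. norm (F z)"] by simp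
    then show ?thesis by (rule Bochner_Integration.integrable_bound) (measurable, rule AE_I2, rule le)
  qed
  show ?thesis using I[OF assms(3) i(1)] I[OF assms(4) i(2)] by (simp add: Sd_def inner_diff_right)
qed

definition drift :: "real => (real => real \<times> real => real) => real => real => real \<times> real => real" where
  "drift nu F t0 t z = (LI s. indicator {t0<..<t} s * Sd nu (t - s) (adv (F s)) z)"

text \<open>The potential may blow up at \<open>t0\<close> like \<open>e / sqrt (s - t0)\<close>.
  The regular and the singular coefficient are recorded separately because \<open>stability\<close>
  asks for smallness of \<open>e\<close> and accepts any \<open>A\<close>.\<close>

definition tame :: "real => real => real => real => real => (real => real \<times> real => real) => bool" where
  "tame A e a t0 T F \<longleftrightarrow> joint_borel lborel F \<and>
    (\<forall>s. t0 < s --> s <= T --> L1n (F s) <= ennreal a \<and> (\<forall>z. inv_pot (F s) z <= ennreal (A + e / sqrt (s - t0))))"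

lemma tameD:
  assumes "tame A e a t0 T F"
  shows "joint_borel lborel F" "borel_fun (F t)"
    "t0 < s ==> s <= T ==> L1n (F s) <= ennreal a" "t0 < s ==> s <= T ==> inv_pot (F s) z <= ennreal (A + e / sqrt (s - t0))"
proof -
  show m: "joint_borel lborel F" using assms by (simp add: tame_def)
  show "borel_fun (F t)"
    using measurable_compose[OF _ m, of "%z. (t, z)" borel] by simp
qed (use assms[unfolded tame_def] in blast)+

lemma tame_zero: "tame A e a t0 T (%t z. 0)"
  by (simp add: tame_def)

lemma borel_measurable_drift:
  assumes "joint_borel lborel F"
  shows "(%(s, z). Sd nu (t - s) (adv (F s)) z) \<in> borel_measurable (lborel \<Otimes>\<^sub>M lborel)" "drift nu F t0 t \<in> borel_measurable borel"
proof -
  note [measurable] = assms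
  show "(%(s, z). Sd nu (t - s) (adv (F s)) z) \<in> borel_measurable (lborel \<Otimes>\<^sub>M lborel)" by measurable
  show "drift nu F t0 t \<in> borel_measurable borel" unfolding drift_def[abs_def] by measurable
qed

lemma Sd_adv_diff:
  assumes nu: "nu > 0" and F: "tame A e a t0 T F" and G: "tame A e a t0 T G" and A: "A >= 0" "e >= 0" and s: "t0 < s" "s < t" "t <= T"
  shows "L1n (%z. Sd nu (t - s) (adv (F s)) z - Sd nu (t - s) (adv (G s)) z)
    <= ennreal (drift_rate nu (2 * A) (2 * e) t0 t s) * L1n (%z. F s z - G s z)"
proof -
  note [measurable] = tameD(2)[OF F] tameD(2)[OF G]
  define N where "N = A + e / sqrt (s - t0)"
  have N: "N >= 0" "!!z. inv_pot (F s) z <= ennreal N" "!!z. inv_pot (G s) z <= ennreal N"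
    using A s tameD(4)[OF F] tameD(4)[OF G] by (auto simp: N_def)
  have fin: "L1n (%z. norm (adv (F s) z)) < \<infinity>" "L1n (%z. norm (adv (G s) z)) < \<infinity>"
    using adv_L1[OF _ N(2)] adv_L1[OF _ N(3)] tameD(3)[OF F s(1)] tameD(3)[OF G s(1)] s
    by (auto intro!: le_less_trans[OF adv_L1[OF _ N(2)]] le_less_trans[OF adv_L1[OF _ N(3)]] ennreal_mult_less_top[THEN iffD2] simp: less_top[symmetric] top_unique ennreal_mult_eq_top_iff)
  have ts: "t - s > 0" using s by simp
  have "L1n (%z. Sd nu (t - s) (adv (F s)) z - Sd nu (t - s) (adv (G s)) z) = L1n (Sd nu (t - s) (%z. adv (F s) z - adv (G s) z))"
    by (subst Sd_diff_L1[OF nu ts _ _ fin]) simp_all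
  also have "... <= ennreal (grad_const nu (t - s)) * L1n (%z. norm (adv (F s) z - adv (G s) z))" by (rule Sd_L1[OF nu ts]) measurable
  also have "... <= ennreal (grad_const nu (t - s)) * (ennreal N * (2 * L1n (%z. F s z - G s z)))"
    by (intro mult_left_mono adv_diff N) auto
  also have "... = ennreal (grad_const nu (t - s)) * (ennreal (2 * N)) * L1n (%z. F s z - G s z)"
    using N by (simp add: ennreal_mult mult_ac)
  also have "... = ennreal (grad_const nu (t - s) * (2 * N)) * L1n (%z. F s z - G s z)"
    using N grad_const_nonneg[OF nu ts] by (simp add: ennreal_mult)
  finally show ?thesis by (simp add: N_def distrib_left)
qed

text \<open>Absolute convergence of the time integral is obtained for almost every \<open>z\<close>:
  by Tonelli the double integral is finite, thanks to the L^1 bound of \<open>Sd\<close>.\<close>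

lemma drift_integrable:
  assumes nu: "nu > 0" and F: "tame A e a t0 T F" and A: "A >= 0" "e >= 0" and t: "t0 < t" "t <= T"
  shows "AE z in lborel. integrable lborel (%s. indicator {t0<..<t} s * Sd nu (t - s) (adv (F s)) z)"
proof -
  note m[measurable] = borel_measurable_drift(1)[OF tameD(1)[OF F]]
  have "(NN z. (NN s. ennreal \<bar>indicator {t0<..<t} s * Sd nu (t - s) (adv (F s)) z\<bar>))
    = (NN s. (NN z. ennreal \<bar>indicator {t0<..<t} s * Sd nu (t - s) (adv (F s)) z\<bar>))"
    by (rule lborel_pair.Fubini') measurable
  also have "... <= (NN s. ennreal (indicator {t0<..<t} s * (drift_rate nu (2 * A) (2 * e) t0 t s)) * ennreal a)"
  proof (intro nn_integral_mono)
    fix s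
    show "(NN z. ennreal \<bar>indicator {t0<..<t} s * Sd nu (t - s) (adv (F s)) z\<bar>) <= ennreal (indicator {t0<..<t} s * (drift_rate nu (2 * A) (2 * e) t0 t s)) * ennreal a"
    proof (cases "t0 < s \<and> s < t")
      case True
      then have "L1n (Sd nu (t - s) (adv (F s))) <= ennreal (drift_rate nu (2 * A) (2 * e) t0 t s) * L1n (F s)"
        using Sd_adv_diff[OF nu F tame_zero A, of s t] t by (simp add: adv_0[abs_def])
      also have "... <= ennreal (drift_rate nu (2 * A) (2 * e) t0 t s) * ennreal a"
        using True t by (intro mult_left_mono tameD(3)[OF F]) auto
      finally show ?thesis using True by (simp add: L1n_def)
    qed auto
  qed
  also have "... = (NN s. ennreal (indicator {t0<..<t} s * (drift_rate nu (2 * A) (2 * e) t0 t s))) * ennreal a"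
    unfolding grad_const_def by (rule nn_integral_multc) measurable
  also have "... < \<infinity>"
    using grad_const_integral[OF nu, of "2 * A" "2 * e" t0 t "t - t0"] A t
    by (auto intro!: ennreal_mult_less_top[THEN iffD2] simp: le_less_trans)
  finally have "AE z in lborel. (NN s. ennreal \<bar>indicator {t0<..<t} s * Sd nu (t - s) (adv (F s)) z\<bar>) ~= \<infinity>"
    by (intro nn_integral_PInf_AE) auto
  then show ?thesis
  proof eventually_elim
    case (elim z)
    then show ?case by (intro integrableI_bounded) (auto simp: less_top)
  qed
qed

lemma drift_diff:
  assumes nu: "nu > 0" and F: "tame A e a t0 T F" and G: "tame A e a t0 T G" and A: "A >= 0" "e >= 0" and t: "t0 < t" "t <= T"
  shows "L1n (%z. drift nu F t0 t z - drift nu G t0 t z)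
    <= (NN s. ennreal (indicator {t0<..<t} s * (drift_rate nu (2 * A) (2 * e) t0 t s)) * L1n (%z. F s z - G s z))"
proof -
  note [measurable] = borel_measurable_drift(1)[OF tameD(1)[OF F]] borel_measurable_drift(1)[OF tameD(1)[OF G]]
  let ?d = "%s z. indicator {t0<..<t} s * (Sd nu (t - s) (adv (F s)) z - Sd nu (t - s) (adv (G s)) z)"
  have "AE z in lborel. ennreal \<bar>drift nu F t0 t z - drift nu G t0 t z\<bar> <= (NN s. ennreal \<bar>?d s z\<bar>)"
    using drift_integrable[OF nu F A t] drift_integrable[OF nu G A t]
  proof eventually_elim
    case (elim z)
    then have "drift nu F t0 t z - drift nu G t0 t z = (LI s. ?d s z)" by (simp add: drift_def right_diff_distrib)
    then show ?case using norm_integral_le_nn_integral[of lborel "%s. ?d s z"] by simp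
  qed
  then have "L1n (%z. drift nu F t0 t z - drift nu G t0 t z) <= (NN z. (NN s. ennreal \<bar>?d s z\<bar>))"
    unfolding L1n_def by (rule nn_integral_mono_AE)
  also have "... = (NN s. (NN z. ennreal \<bar>?d s z\<bar>))"
    by (rule lborel_pair.Fubini') measurable
  also have "... <= (NN s. ennreal (indicator {t0<..<t} s * (drift_rate nu (2 * A) (2 * e) t0 t s)) * L1n (%z. F s z - G s z))"
  proof (intro nn_integral_mono)
    fix s
    show "(NN z. ennreal \<bar>?d s z\<bar>) <= ennreal (indicator {t0<..<t} s * (drift_rate nu (2 * A) (2 * e) t0 t s)) * L1n (%z. F s z - G s z)"
      using Sd_adv_diff[OF nu F G A, of s t] t by (cases "t0 < s \<and> s < t") (auto simp: L1n_def)
  qed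
  finally show ?thesis .
qed

lemma drift_diff_uniform:
  assumes nu: "nu > 0" and F: "tame A e a t0 T F" and G: "tame A e a t0 T G" and A: "A >= 0" "e >= 0" and t: "t0 < t" "t <= T"
    and d: "!!s. t0 < s ==> s < t ==> L1n (%z. F s z - G s z) <= d"
  shows "L1n (%z. drift nu F t0 t z - drift nu G t0 t z) <= ennreal (3 * (gradc nu (T - t0) * (6 * A * sqrt (t - t0) + 8 * e))) * d"
proof -
  have "L1n (%z. drift nu F t0 t z - drift nu G t0 t z)
    <= (NN s. ennreal (indicator {t0<..<t} s * (drift_rate nu (2 * A) (2 * e) t0 t s)) * L1n (%z. F s z - G s z))"
    by (rule drift_diff[OF nu F G A t])
  also have "... <= (NN s. ennreal (indicator {t0<..<t} s * (drift_rate nu (2 * A) (2 * e) t0 t s)) * d)"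
  proof (intro nn_integral_mono)
    fix s
    show "ennreal (indicator {t0<..<t} s * (drift_rate nu (2 * A) (2 * e) t0 t s)) * L1n (%z. F s z - G s z)
      <= ennreal (indicator {t0<..<t} s * (drift_rate nu (2 * A) (2 * e) t0 t s)) * d"
      using d[of s] by (cases "t0 < s \<and> s < t") (auto intro!: mult_left_mono)
  qed
  also have "... = (NN s. ennreal (indicator {t0<..<t} s * (drift_rate nu (2 * A) (2 * e) t0 t s))) * d"
    unfolding grad_const_def by (rule nn_integral_multc) measurable
  also have "... <= ennreal (3 * (gradc nu (T - t0) * (3 * (2 * A) * sqrt (t - t0) + 4 * (2 * e)))) * d"
    by (intro mult_right_mono grad_const_integral) (use nu A t in auto)
  finally show ?thesis by simp
qed

text \<open>\<open>E\<close> bounds the difference of the residuals of the Duhamel formula.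
  \<open>K\<close> does not depend on the mass, the initial time or the functions; this uniformity
  lets one constant serve a whole sequence of schemes and a shrinking initial time.\<close>

definition stable_const :: "real => real => real => real => real => bool" where
  "stable_const nu L e A K \<longleftrightarrow> K >= 0 \<and> (\<forall>a t0 T F G E. T - t0 <= L --> tame A e a t0 T F --> tame A e a t0 T G -->
    (\<forall>t. t0 < t --> t <= T --> L1n (%z. (F t z + drift nu F t0 t z) - (G t z + drift nu G t0 t z)) <= E) -->
    (\<forall>t. t0 < t --> t <= T --> L1n (%z. F t z - G t z) <= ennreal K * E))"

lemma stable_constD:
  assumes "stable_const nu L e A K" "tame A e a t0 T F" "tame A e a t0 T G" "T - t0 <= L" "t0 < t" "t <= T"
    and "!!t. t0 < t ==> t <= T ==> L1n (%z. (F t z + drift nu F t0 t z) - (G t z + drift nu G t0 t z)) <= E"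
  shows "L1n (%z. F t z - G t z) <= ennreal K * E"
  by (rule assms(1)[unfolded stable_const_def, THEN conjunct2, rule_format, OF assms(4,2,3) assms(7) assms(5,6)])

text \<open>The order of quantifiers matters: \<open>e\<close> depends on \<open>nu\<close> and
  \<open>L\<close> alone, because the \<open>A\<close> of given data is found only after
  \<open>e\<close> has been chosen. In the weighted supremum \<open>D\<close> the drift difference
  takes at most half of \<open>D\<close>, and \<open>D\<close> is finite by the mass bounds, so it
  can be absorbed.\<close>

lemma stability:
  assumes nu: "nu > 0" and L: "L > 0"
  shows "\<exists>e>0. \<forall>A\<ge>0. \<exists>K. stable_const nu L e A K"
proof -
  define c where "c = gradc nu L + 1"
  have c: "c > 0" "gradc nu L <= c" "gradc nu L >= 0" using gradc_nonneg[OF nu L] by (auto simp: c_def)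
  \<comment> \<open>The difference estimate carries \<open>2 * A\<close> and \<open>2 * e\<close>.
    This choice gives \<open>c * (4 * (2 * e)) = 1 / 4\<close>, and the later choice of
    \<open>\<mu>\<close> bounds the \<open>A\<close> part by another 1/4.\<close>
  define e where "e = 1 / (32 * c)"
  have e: "e > 0" using c by (simp add: e_def)
  show ?thesis
  proof (rule exI[of _ e], intro conjI e allI impI)
    fix A :: real assume A: "A >= 0"
    define \<mu> where "\<mu> = (24 * c * A + 1)\<^sup>2"
    have cA: "24 * c * A + 1 > 0" using c A by (simp add: add_nonneg_pos)
    have \<mu>: "\<mu> > 0" "sqrt \<mu> = 24 * c * A + 1" using cA by (auto simp: \<mu>_def)
    have small: "gradc nu L * (3 * (2 * A) / sqrt \<mu> + 4 * (2 * e)) <= 1 / 2"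
    proof -
      have "gradc nu L * (3 * (2 * A) / sqrt \<mu> + 4 * (2 * e)) <= c * (3 * (2 * A) / sqrt \<mu> + 4 * (2 * e))"
        using c e A \<mu> by (intro mult_right_mono) auto
      also have "... = 6 * c * A / (24 * c * A + 1) + 1 / 4" unfolding \<mu>(2) e_def using c by (simp add: field_simps)
      also have "6 * c * A / (24 * c * A + 1) <= 1 / 4" using cA by (simp add: pos_divide_le_eq)
      finally show ?thesis by simp
    qed
    show "\<exists>K. stable_const nu L e A K"
      unfolding stable_const_def
    proof (rule exI[of _ "exp (\<mu> * L) * 2"], intro conjI allI impI)
      fix a t0 T F G E t
      assume TL: "T - t0 <= L" and F: "tame A e a t0 T F" and G: "tame A e a t0 T G"
        and E: "\<forall>t. t0 < t --> t <= T --> L1n (%z. (F t z + drift nu F t0 t z) - (G t z + drift nu G t0 t z)) <= E"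
        and t: "t0 < t" "t <= T"
      have [measurable]: "borel_fun (F t)" "borel_fun (G t)" "drift nu F t0 t \<in> borel_measurable borel" "drift nu G t0 t \<in> borel_measurable borel" for t
        using tameD(2)[OF F] tameD(2)[OF G] borel_measurable_drift(2) tameD(1)[OF F] tameD(1)[OF G] by auto
      have [measurable]: "joint_borel lborel F" "joint_borel lborel G"
        by (rule tameD(1)[OF F] tameD(1)[OF G])+
      define d where "d r = L1n (%z. F r z - G r z)" for r
      have [measurable]: "borel_fun d" unfolding d_def by measurable
      define w where "w r = exp (- \<mu> * (r - t0))" for r
      define D where "D = (SUP r\<in>{t0<..T}. ennreal (w r) * d r)"
      have D: "ennreal (w r) * d r <= D" if "t0 < r" "r <= T" for r unfolding D_def using that by (intro SUP_upper) auto
      have "D <= ennreal 1 * (ennreal a + ennreal a)" unfolding D_def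
      proof (intro SUP_least mult_mono)
        fix r assume r: "r \<in> {t0<..T}"
        show "d r <= ennreal a + ennreal a"
          unfolding d_def using r by (intro order_trans[OF L1n_triangle(2)] add_mono tameD(3)[OF F] tameD(3)[OF G]) auto
        show "ennreal (w r) <= ennreal 1" using r \<mu> by (intro ennreal_leI) (auto simp: w_def)
      qed auto
      then have Dfin: "D < \<infinity>" by (rule le_less_trans) (simp add: ennreal_mult_less_top)
      have "D <= E + ennreal (1 / 2) * D" unfolding D_def[symmetric]
      proof (subst (1) D_def, intro SUP_least)
        fix r assume "r \<in> {t0<..T}"
        then have r: "t0 < r" "r <= T" by auto
        have "d r <= L1n (%z. (F r z + drift nu F t0 r z) - (G r z + drift nu G t0 r z)) + L1n (%z. drift nu F t0 r z - drift nu G t0 r z)"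
          using L1n_triangle(2)[of "%z. (F r z + drift nu F t0 r z) - (G r z + drift nu G t0 r z)" "%z. drift nu F t0 r z - drift nu G t0 r z"]
          by (simp add: d_def algebra_simps)
        also have "... <= E + (NN s. ennreal (indicator {t0<..<r} s * (drift_rate nu (2 * A) (2 * e) t0 r s)) * d s)"
          unfolding d_def using E r e by (intro add_mono drift_diff[OF nu F G A]) auto
        finally have "ennreal (w r) * d r <= ennreal (w r) * (E + (NN s. ennreal (indicator {t0<..<r} s * (drift_rate nu (2 * A) (2 * e) t0 r s)) * d s))"
          by (rule mult_left_mono) simp
        also have "... = ennreal (w r) * E + (NN s. ennreal (w r) * (ennreal (indicator {t0<..<r} s * (drift_rate nu (2 * A) (2 * e) t0 r s)) * d s))"
          unfolding grad_const_def by (subst nn_integral_cmult) (measurable, simp add: distrib_left)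
        also have "... <= 1 * E + (NN s. ennreal (indicator {t0<..<r} s * (exp (- \<mu> * (r - s)) * (drift_rate nu (2 * A) (2 * e) t0 r s))) * D)"
        proof (intro add_mono mult_right_mono nn_integral_mono)
          show "ennreal (w r) <= 1" using r \<mu> by (subst ennreal_1[symmetric], intro ennreal_leI) (auto simp: w_def)
          fix s
          show "ennreal (w r) * (ennreal (indicator {t0<..<r} s * (drift_rate nu (2 * A) (2 * e) t0 r s)) * d s)
            <= ennreal (indicator {t0<..<r} s * (exp (- \<mu> * (r - s)) * (drift_rate nu (2 * A) (2 * e) t0 r s))) * D"
          proof (cases "t0 < s \<and> s < r")
            case True
            have g: "drift_rate nu (2 * A) (2 * e) t0 r s >= 0" using True A e grad_const_nonneg[OF nu, of "r - s"] by simp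
            have "w r = exp (- \<mu> * (r - s)) * w s" by (simp add: w_def exp_add[symmetric] algebra_simps)
            have swap: "ennreal (x * y) * (ennreal q * D) = ennreal (x * q) * (ennreal y * D)" if "x >= 0" "y >= 0" "q >= 0" for x y q D
              by (simp add: that ennreal_mult mult_ac)
            have "ennreal (w r) * (ennreal (drift_rate nu (2 * A) (2 * e) t0 r s) * d s)
              = ennreal (exp (- \<mu> * (r - s)) * (drift_rate nu (2 * A) (2 * e) t0 r s)) * (ennreal (w s) * d s)"
              unfolding \<open>w r = exp (- \<mu> * (r - s)) * w s\<close> by (rule swap) (use g in \<open>auto simp: w_def\<close>)
            also have "... <= ennreal (exp (- \<mu> * (r - s)) * (drift_rate nu (2 * A) (2 * e) t0 r s)) * D"
              using True r by (intro mult_left_mono D) auto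
            finally show ?thesis using True by simp
          qed auto
        qed simp
        also have "(NN s. ennreal (indicator {t0<..<r} s * (exp (- \<mu> * (r - s)) * (drift_rate nu (2 * A) (2 * e) t0 r s))) * D)
          = (NN s. ennreal (indicator {t0<..<r} s * (exp (- \<mu> * (r - s)) * (drift_rate nu (2 * A) (2 * e) t0 r s)))) * D"
          unfolding grad_const_def by (rule nn_integral_multc) measurable
        also have "1 * E + ... <= 1 * E + ennreal (1 / 2) * D"
        proof (intro add_left_mono mult_right_mono)
          have "(NN s. ennreal (indicator {t0<..<r} s * (exp (- \<mu> * (r - s)) * (drift_rate nu (2 * A) (2 * e) t0 r s))))
            <= ennreal (gradc nu L * (3 * (2 * A) / sqrt \<mu> + 4 * (2 * e)))"
            by (rule grad_const_weighted) (use nu A e \<mu> r TL in auto)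
          also have "... <= ennreal (1 / 2)" by (rule ennreal_leI[OF small])
          finally show "(NN s. ennreal (indicator {t0<..<r} s * (exp (- \<mu> * (r - s)) * (drift_rate nu (2 * A) (2 * e) t0 r s)))) <= ennreal (1 / 2)" .
        qed simp
        finally show "ennreal (w r) * d r <= E + ennreal (1 / 2) * D" by simp
      qed
      then have D2: "D <= 2 * E"
      proof (cases E)
        case (real x)
        obtain y where y: "D = ennreal y" "y >= 0" using Dfin by (cases D) auto
        have "ennreal (1 * x + 1 / 2 * y) = ennreal 1 * ennreal x + ennreal (1 / 2) * ennreal y"
          by (rule ennreal_lincomb) (use real y in auto)
        with \<open>D <= E + ennreal (1 / 2) * D\<close> have "ennreal y <= ennreal (1 * x + 1 / 2 * y)"
          by (simp only: y(1) real ennreal_1 mult_1_left)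
        then have "y <= 1 * x + 1 / 2 * y" using real y by (subst (asm) ennreal_le_iff) auto
        then have "ennreal y <= ennreal (2 * x)" by (intro ennreal_leI) simp
        then show ?thesis by (simp add: y(1) real ennreal_mult')
      qed simp
      have "d t = ennreal (exp (\<mu> * (t - t0))) * (ennreal (w t) * d t)"
        by (simp add: w_def mult.assoc[symmetric] ennreal_mult[symmetric] exp_add[symmetric])
      also have "... <= ennreal (exp (\<mu> * L)) * (2 * E)"
        using t TL \<mu> by (intro mult_mono ennreal_leI order_trans[OF D D2]) auto
      also have "... = ennreal (exp (\<mu> * L) * 2) * E" by (simp add: ennreal_mult mult.assoc)
      finally show "L1n (%z. F t z - G t z) <= ennreal (exp (\<mu> * L) * 2) * E" by (simp add: d_def)
    qed simp
  qed
qed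

section \<open>Existence\<close>

definition excess :: "real => (real \<times> real => real) => ennreal" where
  "excess k f = cvx_int (%x. max 0 (\<bar>x\<bar> - k)) f"

lemma excess_0: "excess 0 f = L1n f"
  by (simp add: excess_def L1n_cvx_int)

lemma excess_lipschitz:
  assumes [measurable]: "borel_fun f" "borel_fun g"
  shows "excess k f <= excess k g + L1n (%z. f z - g z)"
proof -
  have "excess k f <= (NN z. ennreal (max 0 (\<bar>g z\<bar> - k)) + ennreal \<bar>f z - g z\<bar>)"
    unfolding excess_def cvx_int_def
  proof (intro nn_integral_mono)
    fix z
    have "max 0 (\<bar>f z\<bar> - k) <= max 0 (\<bar>g z\<bar> - k) + \<bar>f z - g z\<bar>" by (auto simp: max_def abs_if)
    then show "ennreal (max 0 (\<bar>f z\<bar> - k)) <= ennreal (max 0 (\<bar>g z\<bar> - k)) + ennreal \<bar>f z - g z\<bar>"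
      by (subst ennreal_plus[symmetric]) (auto intro: ennreal_leI simp del: ennreal_plus)
  qed
  also have "... = excess k g + L1n (%z. f z - g z)" unfolding excess_def cvx_int_def L1n_def by (rule nn_integral_add) measurable
  finally show ?thesis .
qed

lemma excess_small:
  assumes [measurable]: "borel_fun w" and w: "L1n w < \<infinity>" and e: "e > 0"
  shows "\<exists>k\<ge>1. excess k w <= ennreal e"
proof -
  have "(%n. NN z. ennreal (max 0 (\<bar>w z\<bar> - real n))) \<longlonglongrightarrow> (\<integral>\<^sup>+ z. 0 \<partial>(lborel :: (real \<times> real) measure))"
  proof (rule nn_integral_dominated_convergence[where w = "%z. ennreal \<bar>w z\<bar>"])
    show "(NN z. ennreal \<bar>w z\<bar>) < \<infinity>" using w by (simp add: L1n_def)
    show "AE z in lborel. (%n. ennreal (max 0 (\<bar>w z\<bar> - real n))) \<longlonglongrightarrow> 0"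
    proof (intro AE_I2 tendsto_eventually)
      fix z
      obtain m where "\<bar>w z\<bar> <= real m" using real_arch_simple by blast
      then show "\<forall>\<^sub>F n in sequentially. ennreal (max 0 (\<bar>w z\<bar> - real n)) = 0"
        by (intro eventually_sequentiallyI[of m]) (auto simp: max_def)
    qed
  qed (auto intro!: AE_I2 ennreal_leI)
  then have "\<forall>\<^sub>F n in sequentially. excess (real n) w < ennreal e"
    using e by (intro order_tendstoD) (auto simp: excess_def cvx_int_def)
  then have "\<forall>\<^sub>F n in sequentially. 1 <= n \<and> excess (real n) w < ennreal e"
    using eventually_ge_at_top[of 1] by eventually_elim simp
  from eventually_happens'[OF sequentially_bot this] obtain n where "1 <= n" "excess (real n) w < ennreal e" by blast
  then show ?thesis by (intro exI[of _ "real n"]) auto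
qed

definition clip :: "real => (real \<times> real => real) => real \<times> real => real" where
  "clip k w z = max (- k) (min k (w z))"

lemma borel_measurable_clip [measurable]:
  assumes [measurable]: "borel_fun w"
  shows "clip k w \<in> borel_measurable borel"
  unfolding clip_def[abs_def] by measurable

lemma clip_le: "k >= 0 ==> \<bar>clip k w z\<bar> <= k" "k >= 0 ==> \<bar>clip k w z\<bar> <= \<bar>w z\<bar>"
  by (auto simp: clip_def)

lemma clip_diff: "k >= 0 ==> \<bar>clip k w z - w z\<bar> = max 0 (\<bar>w z\<bar> - k)"
  by (auto simp: clip_def max_def min_def)

lemma L1n_clip_diff: "k >= 0 ==> L1n (%z. clip k w z - w z) = excess k w"
  by (simp add: L1n_def excess_def cvx_int_def clip_diff)

lemma excess_clip: "k >= 0 ==> excess j (clip k w) <= excess j w"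
  unfolding excess_def cvx_int_def
proof (intro nn_integral_mono ennreal_leI)
  fix z assume "k >= 0"
  from clip_le(2)[OF this, of w z] show "max 0 (\<bar>clip k w z\<bar> - j) <= max 0 (\<bar>w z\<bar> - j)" by linarith
qed

text \<open>The part below the level \<open>k\<close> is bounded; the part above has small mass
  \<open>e\<close> and size \<open>M / s\<close>. Cutting the potential of the latter at radius
  \<open>\<rho> * sqrt s\<close> makes both its contributions scale like \<open>1 / sqrt s\<close>,
  with coefficients made small by choosing first \<open>\<rho>\<close> and then
  \<open>e\<close>.\<close>

lemma inv_pot_split:
  assumes [measurable]: "borel_fun f" and k: "k >= 0" and a: "L1n f <= ennreal a" "a >= 0" and s: "s > 0"
    and M: "AE z in lborel. \<bar>f z\<bar> <= M / s" "M >= 0" and e: "excess k f <= ennreal e" "e >= 0" and \<rho>: "\<rho> > 0"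
  shows "inv_pot f z <= ennreal ((16 * k + a) + (16 * \<rho> * M + e / \<rho>) / sqrt s)"
proof -
  let ?g = "%z. max 0 (\<bar>f z\<bar> - k)"
  have "inv_pot f z <= inv_pot (clip k f) z + inv_pot ?g z"
    by (rule inv_pot_add) (auto simp: clip_def k intro!: AE_I2)
  also have "... <= ennreal (16 * 1 * k + a / 1) + ennreal (16 * (\<rho> * sqrt s) * (M / s) + e / (\<rho> * sqrt s))"
  proof (intro add_mono inv_pot_bound)
    show "L1n (clip k f) <= ennreal a" by (rule order_trans[OF L1n_mono_AE a(1)]) (simp add: clip_le k)
    show "AE z in lborel. \<bar>max 0 (\<bar>f z\<bar> - k)\<bar> <= M / s"
      using M(1) by eventually_elim (use M(2) s k in \<open>auto simp: max_def\<close>)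
    show "L1n ?g <= ennreal e" using e(1) by (simp add: excess_def cvx_int_def L1n_def)
  qed (use k s M e \<rho> a in \<open>auto simp: clip_le\<close>)
  also have "... = ennreal ((16 * k + a) + (16 * (\<rho> * sqrt s) * (M / s) + e / (\<rho> * sqrt s)))"
    using k a s M e \<rho> by (subst ennreal_plus[symmetric]) auto
  also have "16 * (\<rho> * sqrt s) * (M / s) + e / (\<rho> * sqrt s) = (16 * \<rho> * M + e / \<rho>) / sqrt s"
  proof -
    have "sqrt s * (M / s) = M * (sqrt s / s)" by simp
    also have "... = M / sqrt s" using s by (subst sqrt_divide_self_eq) (auto simp: inverse_eq_divide)
    finally have "sqrt s * (M / s) = M / sqrt s" .
    have "16 * (\<rho> * sqrt s) * (M / s) = 16 * \<rho> * (sqrt s * (M / s))" by simp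
    also have "... = 16 * \<rho> * M / sqrt s" unfolding \<open>sqrt s * (M / s) = M / sqrt s\<close> by simp
    finally show ?thesis by (simp add: add_divide_distrib divide_divide_eq_left)
  qed
  finally show ?thesis .
qed

text \<open>The bounds that pass to limits and to restarted solutions. Time 0 is excluded, as there
  the pointwise bound would read 0 by the convention for division.\<close>

definition decaying :: "real => real => (real \<times> real => real) => (real => real \<times> real => real) => bool" where
  "decaying nu a w F \<longleftrightarrow> joint_borel lborel F \<and>
    (\<forall>s>0. L1n (F s) <= ennreal a \<and> (AE z in lborel. \<bar>F s z\<bar> <= 4 * a / (nu * s)) \<and> (\<forall>k\<ge>0. excess k (F s) <= excess k w))"

lemma decaying_measurable:
  assumes "decaying nu a w F"
  shows "joint_borel lborel F" "borel_fun (F t)"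
proof -
  show m: "joint_borel lborel F" using assms by (simp add: decaying_def)
  show "borel_fun (F t)"
    using measurable_compose[OF _ m, of "%z. (t, z)" borel] by simp
qed

text \<open>Since the excess of \<open>w\<close> vanishes at high levels, the singular part of the potential has an
  arbitrarily small coefficient \<open>e\<close>, at the price of the constant \<open>A\<close>.\<close>
lemma decaying_tame:
  assumes nu: "nu > 0" and a: "a > 0" and w: "borel_fun w" "L1n w < \<infinity>" and e: "e > 0"
  shows "\<exists>A\<ge>0. \<forall>F t0 T. decaying nu a w F --> 0 <= t0 --> tame A e a t0 T F"
proof -
  define M where "M = 4 * a / nu"
  have M: "M > 0" using a nu by (simp add: M_def)
  \<comment> \<open>Then \<open>16 * \<rho> * M = e / 2\<close>. The level \<open>k\<close> below
    brings the excess down to \<open>e * \<rho> / 2\<close>, which accounts for the other half of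
    \<open>e\<close>.\<close>
  define \<rho> where "\<rho> = e / (32 * M)"
  have \<rho>: "\<rho> > 0" using e M by (simp add: \<rho>_def)
  have "e * \<rho> / 2 > 0" using e \<rho> by simp
  then obtain k where k: "k >= 1" "excess k w <= ennreal (e * \<rho> / 2)" using excess_small[OF w] by blast
  have ee: "16 * \<rho> * M + (e * \<rho> / 2) / \<rho> = e" using \<rho> M by (simp add: \<rho>_def)
  show ?thesis
  proof (intro exI[of _ "16 * k + a"] conjI allI impI)
    fix F t0 T assume F: "decaying nu a w F" and t0: "(0::real) <= t0"
    show "tame (16 * k + a) e a t0 T F" unfolding tame_def
    proof (intro conjI allI impI)
      show "joint_borel lborel F" by (rule decaying_measurable[OF F])
      fix s assume s: "t0 < s" "s <= T"
      then have s0: "s > 0" using t0 by simp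
      then have D: "L1n (F s) <= ennreal a" "AE z in lborel. \<bar>F s z\<bar> <= M / s" "excess k (F s) <= excess k w"
        using F k by (auto simp: decaying_def M_def)
      show "L1n (F s) <= ennreal a" by (rule D)
      fix z
      have "inv_pot (F s) z <= ennreal ((16 * k + a) + (16 * \<rho> * M + (e * \<rho> / 2) / \<rho>) / sqrt s)"
        by (rule inv_pot_split[OF decaying_measurable(2)[OF F] _ D(1) _ s0 D(2) _ order_trans[OF D(3) k(2)]]) (use k a M e \<rho> in auto)
      also have "... <= ennreal ((16 * k + a) + e / sqrt (s - t0))"
        unfolding ee using e s t0 by (intro ennreal_leI add_left_mono divide_left_mono) auto
      finally show "inv_pot (F s) z <= ennreal (16 * k + a + e / sqrt (s - t0))" .
    qed
  qed (use k a in auto)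
qed

lemma ennreal_le_geometric:
  assumes "!!n. x <= y + ennreal (C * (1 / 2) ^ n)"
  shows "x <= y"
proof -
  have "(%n. y + ennreal (C * (1 / 2) ^ n)) \<longlonglongrightarrow> y + ennreal (C * 0)"
    by (intro tendsto_add tendsto_ennrealI tendsto_mult tendsto_const LIMSEQ_power_zero) simp
  from LIMSEQ_le_const[OF this, of x] assms show ?thesis by simp
qed

text \<open>\<open>k\<close> times the integral of \<open>x powr (-1/2)\<close> over (0, T) plus
  \<open>k * sqrt k\<close> times that of \<open>x powr (-3/4)\<close>. The second term is due to
  the exponent 3/2 in the kernel expansion.\<close>

definition cdisp_mass :: "real => real => real" where
  "cdisp_mass nu T = (let k = (2 + T / 2) / sqrt (2 * nu) in k * (2 * sqrt T) + k * sqrt k * (4 * T powr (1 / 4)))"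

lemma nn_integral_cdisp:
  assumes nu: "nu > 0" and t: "t0 < t" "t - t0 <= T"
  shows "(NN s. ennreal (indicator {t0<..<t} s * (cdisp nu (t - s) + cdisp nu (t - s) * sqrt (cdisp nu (t - s))))) <= ennreal (cdisp_mass nu T)"
proof -
  define k where "k = (2 + T / 2) / sqrt (2 * nu)"
  have k: "k > 0" using t nu by (simp add: k_def add_pos_nonneg)
  have T: "T > 0" using t by simp
  define H1 where "H1 x = ennreal (1 / sqrt x) * indicator {0<..<T} x" for x
  define H2 where "H2 x = ennreal (x powr (-3/4)) * indicator {0<..<T} x" for x
  have [measurable]: "borel_fun H1" "borel_fun H2" unfolding H1_def H2_def by measurable
  have "(NN s. ennreal (indicator {t0<..<t} s * (cdisp nu (t - s) + cdisp nu (t - s) * sqrt (cdisp nu (t - s)))))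
    <= (NN s. ennreal k * H1 (t - s) + ennreal (k * sqrt k) * H2 (t - s))"
  proof (intro nn_integral_mono)
    fix s
    show "ennreal (indicator {t0<..<t} s * (cdisp nu (t - s) + cdisp nu (t - s) * sqrt (cdisp nu (t - s)))) <= ennreal k * H1 (t - s) + ennreal (k * sqrt k) * H2 (t - s)"
    proof (cases "t0 < s \<and> s < t")
      case True
      define x where "x = t - s"
      have x: "0 < x" "x < T" using True t by (auto simp: x_def)
      have c: "cdisp nu x <= k * (1 / sqrt x)"
        using x nu by (simp add: cdisp_def[OF nu] k_def real_sqrt_mult divide_right_mono)
      have q: "1 / sqrt x * sqrt (1 / sqrt x) = x powr (-3/4)"
      proof -
        have "1 / sqrt x = x powr (-1/2)" using x by (simp add: powr_minus powr_half_sqrt inverse_eq_divide)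
        moreover have "sqrt (x powr (-1/2)) = x powr (-1/4)" using x by (simp add: powr_half_sqrt[symmetric] powr_powr)
        ultimately show ?thesis by (simp add: powr_add[symmetric])
      qed
      have "cdisp nu x * sqrt (cdisp nu x) <= (k * (1 / sqrt x)) * sqrt (k * (1 / sqrt x))"
        using c cdisp_nonneg[OF nu, of x] x k by (intro mult_mono real_sqrt_le_mono) auto
      also have "... = k * sqrt k * x powr (-3/4)" unfolding q[symmetric] real_sqrt_mult by simp
      finally have "cdisp nu x + cdisp nu x * sqrt (cdisp nu x) <= k * (1 / sqrt x) + k * sqrt k * x powr (-3/4)" using c by simp
      then have "ennreal (cdisp nu x + cdisp nu x * sqrt (cdisp nu x)) <= ennreal k * ennreal (1 / sqrt x) + ennreal (k * sqrt k) * ennreal (x powr (-3/4))"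
        using k x by (subst ennreal_lincomb[symmetric]) (auto intro!: ennreal_leI simp del: ennreal_plus)
      then show ?thesis using True x by (simp add: x_def H1_def H2_def)
    qed auto
  qed
  also have "... = ennreal k * (NN x. H1 x) + ennreal (k * sqrt k) * (NN x. H2 x)"
    by (simp add: nn_integral_add nn_integral_cmult nn_integral_shift(3))
  also have "... <= ennreal k * ennreal (2 * sqrt T) + ennreal (k * sqrt k) * ennreal (4 * T powr (1 / 4))"
  proof (intro add_mono mult_left_mono)
    show "(NN x. H1 x) <= ennreal (2 * sqrt T)" unfolding H1_def using T by (intro nn_integral_inverse_sqrt) simp
    show "(NN x. H2 x) <= ennreal (4 * T powr (1 / 4))" unfolding H2_def using nn_integral_powr[of "-3/4" T] T by (simp add: mult.commute)
  qed simp_all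
  also have "... = ennreal (k * (2 * sqrt T) + k * sqrt k * (4 * T powr (1 / 4)))"
    using k T by (intro ennreal_lincomb[symmetric]) auto
  finally show ?thesis by (simp add: cdisp_mass_def k_def Let_def)
qed

context vortex_scheme
begin

lemma sol_tame: "tame (16 * b + a) 0 a t0 T sol"
  unfolding tame_def
proof (intro conjI allI impI)
  show "inv_pot (sol s) z <= ennreal (16 * b + a + 0 / sqrt (s - t0))" for s z
    using inv_pot_bound[OF sol_measurable(2) _ b_nonneg, of s 1 a z] sol_bound sol_L1 a by simp
qed (use sol_measurable sol_L1 in auto)

text \<open>The Duhamel formulas of the scheme and of the equation differ by the time integral of
  the consistency error. The bound is linear in \<open>\<delta> * b\<close>, so unbounded data are
  reached when \<open>b\<close> grows more slowly than \<open>1 / \<delta>\<close>.\<close>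

lemma sol_residual:
  assumes t: "0 <= t0" "t0 < t" "t - t0 <= T" and d: "0 < \<delta>" "\<delta> <= 1" "h = \<delta> ^ 6" and b: "1 <= b"
  shows "L1n (%z. (sol t z + drift nu sol t0 t z) - S nu (t - t0) (sol t0) z) <= ennreal (\<delta> * b * (a * (64 + 10 * a) * cdisp_mass nu T))"
proof -
  note [measurable] = sol_measurable
  define J where "J s z = (1 / h) * (S nu (t - s) (jump h (sol s) (sol s)) z - (LI z. \<bar>sol s z\<bar>) * S nu (t - s) (sol s) z)" for s z
  define D where "D s z = Sd nu (t - s) (adv (sol s)) z" for s z
  have Jm[measurable]: "joint_borel lborel J" unfolding J_def by measurable
  have Dm[measurable]: "joint_borel lborel D" unfolding D_def by measurable
  have iJ: "integrable lborel (%s. indicator {t0<..<t} s * J s z)" for z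
  proof (rule Bochner_Integration.integrable_bound[of lborel "%s. indicator {t0<..<t} s * (2 * l * b) :: real"])
    show "integrable lborel (%s. indicator {t0<..<t} s * (2 * l * b) :: real)" using t by (intro integrable_mult_left integrable_real_indicator) auto
    show "AE s in lborel. norm (indicator {t0<..<t} s * J s z) <= norm (indicator {t0<..<t} s * (2 * l * b))"
    proof (intro AE_I2)
      fix s
      show "norm (indicator {t0<..<t} s * J s z) <= norm (indicator {t0<..<t} s * (2 * l * b))"
      proof (cases "t0 < s \<and> s < t")
        case True
        have "\<bar>S nu (t - s) (sol s) z\<bar> <= b" using True by (intro S_bound[OF nu _ _ sol_bound]) auto
        moreover have "\<bar>S nu (t - s) (src (sol s)) z\<bar> <= b" using True by (intro source_bound[OF sol_adm]) auto
        ultimately have "\<bar>S nu (t - s) (src (sol s)) z - S nu (t - s) (sol s) z\<bar> <= 2 * b" by linarith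
        then have "l * \<bar>S nu (t - s) (src (sol s)) z - S nu (t - s) (sol s) z\<bar> <= l * (2 * b)" using l by (intro mult_left_mono) auto
        moreover have "J s z = l * (S nu (t - s) (src (sol s)) z - S nu (t - s) (sol s) z)"
          unfolding J_def using S_src[of "t - s" s z] True by simp
        ultimately show ?thesis using True l b by (simp add: abs_mult)
      qed auto
    qed
  qed measurable
  have iD: "AE z in lborel. integrable lborel (%s. indicator {t0<..<t} s * D s z)"
    unfolding D_def by (rule drift_integrable[OF nu sol_tame _ _ t(2) order_refl]) (use a b in auto)
  have "AE z in lborel. ennreal \<bar>(sol t z + drift nu sol t0 t z) - S nu (t - t0) (sol t0) z\<bar> <= (NN s. ennreal \<bar>indicator {t0<..<t} s * (J s z + D s z)\<bar>)"
    using sol_duhamel[OF t(1,2)] iD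
  proof eventually_elim
    case (elim z)
    have "(sol t z + drift nu sol t0 t z) - S nu (t - t0) (sol t0) z = (LI s. indicator {t0<..<t} s * (J s z + D s z))"
      using elim iJ[of z] unfolding drift_def J_def[symmetric] D_def[symmetric] by (simp add: distrib_left)
    then show ?case using norm_integral_le_nn_integral[of lborel "%s. indicator {t0<..<t} s * (J s z + D s z)"] by simp
  qed
  then have "L1n (%z. (sol t z + drift nu sol t0 t z) - S nu (t - t0) (sol t0) z) <= (NN z. (NN s. ennreal \<bar>indicator {t0<..<t} s * (J s z + D s z)\<bar>))"
    unfolding L1n_def by (rule nn_integral_mono_AE)
  also have "... = (NN s. (NN z. ennreal \<bar>indicator {t0<..<t} s * (J s z + D s z)\<bar>))"
    by (rule lborel_pair.Fubini') measurable
  also have "... <= (NN s. ennreal (\<delta> * b * (a * (64 + 10 * a))) * ennreal (indicator {t0<..<t} s * (cdisp nu (t - s) + cdisp nu (t - s) * sqrt (cdisp nu (t - s)))))"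
  proof (intro nn_integral_mono)
    fix s
    show "(NN z. ennreal \<bar>indicator {t0<..<t} s * (J s z + D s z)\<bar>)
      <= ennreal (\<delta> * b * (a * (64 + 10 * a))) * ennreal (indicator {t0<..<t} s * (cdisp nu (t - s) + cdisp nu (t - s) * sqrt (cdisp nu (t - s))))"
    proof (cases "t0 < s \<and> s < t")
      case True
      define c where "c = cdisp nu (t - s)"
      have c: "c >= 0" using cdisp_nonneg[OF nu, of "t - s"] True by (simp add: c_def)
      have "L1n (%z. J s z + D s z) <= ennreal (a * (\<delta> * (64 * c * b + (6 * (c * sqrt c) + 4 * c) * a)))"
        unfolding J_def D_def adv_def[abs_def] c_def
        by (rule jump_consistency[OF nu _ d]) (use True sol_bound sol_L1 a in auto)
      also have "... <= ennreal (\<delta> * b * (a * (64 + 10 * a)) * (c + c * sqrt c))"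
      proof (rule ennreal_leI)
        have cs: "c * sqrt c >= 0" using c by simp
        have "64 * c * b <= 64 * b * (c + c * sqrt c)" using b cs by (simp add: algebra_simps)
        moreover have "(6 * (c * sqrt c) + 4 * c) * a <= (10 * a) * (c + c * sqrt c)" using a c cs by (simp add: algebra_simps)
        moreover have "1 * ((10 * a) * (c + c * sqrt c)) <= b * ((10 * a) * (c + c * sqrt c))" using b a c cs by (intro mult_right_mono) auto
        ultimately have "64 * c * b + (6 * (c * sqrt c) + 4 * c) * a <= b * ((64 + 10 * a) * (c + c * sqrt c))" by (simp add: algebra_simps)
        from mult_left_mono[OF this, of "a * \<delta>"] show "a * (\<delta> * (64 * c * b + (6 * (c * sqrt c) + 4 * c) * a)) <= \<delta> * b * (a * (64 + 10 * a)) * (c + c * sqrt c)"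
          using a d by (simp add: mult_ac)
      qed
      also have "... = ennreal (\<delta> * b * (a * (64 + 10 * a))) * ennreal (c + c * sqrt c)"
        using d b a by (intro ennreal_mult') simp
      finally show ?thesis using True by (simp add: L1n_def c_def)
    qed auto
  qed
  also have "... = ennreal (\<delta> * b * (a * (64 + 10 * a))) * (NN s. ennreal (indicator {t0<..<t} s * (cdisp nu (t - s) + cdisp nu (t - s) * sqrt (cdisp nu (t - s)))))"
    unfolding cdisp_def[OF nu] by (rule nn_integral_cmult) measurable
  also have "... <= ennreal (\<delta> * b * (a * (64 + 10 * a))) * ennreal (cdisp_mass nu T)"
    by (intro mult_left_mono nn_integral_cdisp nu t) simp
  also have "... = ennreal (\<delta> * b * (a * (64 + 10 * a) * cdisp_mass nu T))"
    using d b a by (subst ennreal_mult'[symmetric]) (auto simp: mult_ac)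
  finally show ?thesis .
qed

lemma sol_L1_antimono: "0 <= s ==> s <= t ==> L1n (sol t) <= L1n (sol s)"
  unfolding L1n_cvx_int by (rule sol_cvx_antimono(1)[OF _ _ cvx_abs, of _ _ 1]) auto

lemma sol_decaying: "decaying nu a f0 sol"
  unfolding decaying_def
proof (intro conjI allI impI)
  fix s k :: real assume s: "s > 0" and k: "k >= 0"
  show "excess k (sol s) <= excess k f0"
    using sol_cvx_antimono(1)[OF order_refl _ cvx_excess[OF k], of s 1] s k by (auto simp: excess_def sol_0)
qed (use sol_measurable sol_L1 sol_decay in auto)

end

text \<open>The facts about the scheme outside of the locale, so that a sequence of schemes with
  varying parameters can be chosen.\<close>

lemma scheme_exists:
  assumes "nu > 0" "a > 0" "1 <= b" "borel_fun f0" "!!z. \<bar>f0 z\<bar> <= b" "L1n f0 <= ennreal a" "0 < \<delta>" "\<delta> <= 1"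
  shows "\<exists>G. decaying nu a f0 G \<and> G 0 = f0 \<and> (\<forall>s t. 0 <= s --> s <= t --> L1n (G t) <= L1n (G s)) \<and>
    (\<forall>t0 t T. 0 <= t0 --> t0 < t --> t - t0 <= T -->
      L1n (%z. (G t z + drift nu G t0 t z) - S nu (t - t0) (G t0) z) <= ennreal (\<delta> * b * (a * (64 + 10 * a) * cdisp_mass nu T)))"
proof -
  interpret vortex_scheme nu "\<delta> ^ 6" a b f0 by unfold_locales (use assms in auto)
  show ?thesis
    by (rule exI[of _ sol]) (use sol_decaying sol_0 sol_L1_antimono sol_residual[OF _ _ _ assms(7,8) refl assms(3)] in auto)
qed

lemma integrable_of_L1n: "f \<in> borel_measurable borel ==> L1n f <= ennreal a ==> integrable lborel f"
  using le_less_trans[of "L1n f" "ennreal a" \<infinity>] by (simp add: integrable_iff_L1n)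

lemma S_diff_L1n:
  assumes "nu > 0" "t > 0" "integrable lborel f" "integrable lborel g"
  shows "L1n (%z. S nu t f z - S nu t g z) <= L1n (%z. f z - g z)"
proof -
  have "(%z. S nu t f z - S nu t g z) = S nu t (%z. f z - g z)" using S_diff_L1[OF assms] by auto
  then show ?thesis using S_L1[OF assms(1,2), of "%z. f z - g z"] assms by simp
qed

text \<open>Data and scheme parameter are refined together: truncation at a level \<open>c n\<close> with error \<open>2\<^sup>-\<^sup>n\<close>,
  and \<open>\<delta> = 2\<^sup>-\<^sup>n/c n\<close>, so that the residual of the \<open>n\<close>-th scheme is of order \<open>2\<^sup>-\<^sup>n\<close> as well.\<close>
theorem existence:
  assumes nu: "nu > 0" and a: "a > 0" and w[measurable]: "borel_fun w" and wa: "L1n w <= ennreal a"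
  shows "\<exists>F. decaying nu a w F \<and> F 0 = w \<and> (\<forall>t>0. \<forall>z. \<bar>F t z\<bar> <= 4 * a / (nu * t)) \<and> (\<forall>s t. 0 <= s --> s <= t --> L1n (F t) <= L1n (F s)) \<and>
    (\<forall>t0 t. 0 <= t0 --> t0 < t --> (AE z in lborel. F t z = S nu (t - t0) (F t0) z - drift nu F t0 t z))"
proof -
  have wfin: "L1n w < \<infinity>" using wa by (rule le_less_trans) simp
  have "\<forall>n. \<exists>k\<ge>1. excess k w <= ennreal ((1 / 2) ^ n)" using excess_small[OF w wfin] by simp
  then obtain c where c: "!!n. c n >= (1::real)" "!!n. excess (c n) w <= ennreal ((1 / 2) ^ n)" by metis
  define f where "f n = clip (c n) w" for n :: nat
  have [measurable]: "borel_fun (f n)" for n unfolding f_def by measurable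
  have fw: "L1n (%z. f n z - w z) <= ennreal ((1 / 2) ^ n)" for n
    using c[of n] L1n_clip_diff[of "c n" w] by (simp add: f_def)
  have c0: "c n >= 0" for n using c(1)[of n] by simp
  have fL: "L1n (f n) <= ennreal a" for n
    unfolding f_def by (rule order_trans[OF L1n_mono_AE wa]) (simp add: clip_le c0)
  define \<delta> where "\<delta> n = (1 / 2) ^ n / c n" for n
  have \<delta>: "0 < \<delta> n" "\<delta> n <= 1" "\<delta> n * c n = (1 / 2) ^ n" for n
  proof -
    have "c n > 0" using c(1)[of n] by simp
    then show "0 < \<delta> n" "\<delta> n * c n = (1 / 2) ^ n" by (auto simp: \<delta>_def)
    have "(1 / 2) ^ n <= (1::real)" by (rule power_le_one) auto
    then show "\<delta> n <= 1" using c(1)[of n] by (simp add: \<delta>_def divide_le_eq)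
  qed
  define P where "P T = a * (64 + 10 * a) * cdisp_mass nu T" for T
  have P0: "P T >= 0" if "T > 0" for T using a that nu by (auto simp: P_def cdisp_mass_def Let_def)
  define Q where "Q n G \<longleftrightarrow> decaying nu a (f n) G \<and> G 0 = f n \<and> (\<forall>s t. 0 <= s --> s <= t --> L1n (G t) <= L1n (G s)) \<and>
    (\<forall>t0 t T. 0 <= t0 --> t0 < t --> t - t0 <= T -->
      L1n (%z. (G t z + drift nu G t0 t z) - S nu (t - t0) (G t0) z) <= ennreal (\<delta> n * c n * (a * (64 + 10 * a) * cdisp_mass nu T)))" for n G
  have "\<exists>G. Q n G" for n
    unfolding Q_def by (rule scheme_exists[OF nu a c(1)]) (use fL \<delta> clip_le(1)[OF c0] in \<open>auto simp: f_def\<close>)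
  then obtain G where Q: "!!n. Q n (G n)" using choice[of Q] by blast
  have Gd0: "decaying nu a (f n) (G n)" and G0: "G n 0 = f n" for n using Q[of n] by (auto simp: Q_def)
  have Gmono: "L1n (G n t) <= L1n (G n s)" if "0 <= s" "s <= t" for n s t using Q[of n] that by (auto simp: Q_def)
  have Gres: "L1n (%z. (G n t z + drift nu (G n) t0 t z) - S nu (t - t0) (G n t0) z) <= ennreal (P T * (1 / 2) ^ n)"
    if "0 <= t0" "t0 < t" "t - t0 <= T" for n t0 t T
  proof -
    have "L1n (%z. (G n t z + drift nu (G n) t0 t z) - S nu (t - t0) (G n t0) z) <= ennreal (\<delta> n * c n * (a * (64 + 10 * a) * cdisp_mass nu T))"
      using Q[of n] that unfolding Q_def by blast
    then show ?thesis unfolding \<delta>(3) P_def by (simp only: mult.commute)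
  qed
  \<comment> \<open>Clipping does not raise the excess, so all schemes are decaying with respect to
    the same \<open>w\<close>; one \<open>A\<close> and one stability constant then serve all
    \<open>n\<close>.\<close>
  have Gd: "decaying nu a w (G n)" for n
    using Gd0[of n] excess_clip[OF c0, of _ n w] unfolding decaying_def f_def by (blast intro: order_trans)
  note Gm[measurable] = decaying_measurable[OF Gd]
  have dm[measurable]: "drift nu (G n) t0 t \<in> borel_measurable borel" for n t0 t by (rule borel_measurable_drift(2)[OF Gm(1)])
  have Gi: "integrable lborel (G n t)" "L1n (G n t) <= ennreal a" if "t >= 0" for n t
  proof -
    show "L1n (G n t) <= ennreal a" using Gmono[OF order_refl that, of n] fL[of n] G0[of n] by simp
    then show "integrable lborel (G n t)" by (intro integrable_of_L1n[OF Gm(2)])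
  qed
  have step: "\<exists>C\<ge>0. \<forall>t n. 0 < t --> t <= T --> L1n (%z. G (Suc n) t z - G n t z) <= ennreal (C * (1 / 2) ^ n)" if T: "T > 0" for T
  proof -
    obtain e where e: "e > 0" "!!A. A >= 0 ==> \<exists>K. stable_const nu T e A K"
      using stability[OF nu T] by blast
    obtain A where A: "A >= 0" "!!F t0 T. decaying nu a w F ==> 0 <= t0 ==> tame A e a t0 T F"
      using decaying_tame[OF nu a w wfin e(1)] by blast
    obtain K where K: "stable_const nu T e A K" using e(2)[OF A(1)] by blast
    then have K0: "K >= 0" by (simp add: stable_const_def)
    have E: "L1n (%z. (G (Suc n) t z + drift nu (G (Suc n)) 0 t z) - (G n t z + drift nu (G n) 0 t z)) <= ennreal ((2 * P T + 2) * (1 / 2) ^ n)"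
      if t: "0 < t" "t <= T" for t n
    proof -
      let ?X = "%m z. G m t z + drift nu (G m) 0 t z" let ?Y = "%m. S nu (t - 0) (G m 0)"
      have "L1n (%z. ?X (Suc n) z - ?X n z) <= L1n (%z. ?X (Suc n) z - ?Y (Suc n) z) + L1n (%z. ?Y (Suc n) z - ?X n z)"
        by (rule L1n_diff_triangle) measurable
      also have "... <= L1n (%z. ?X (Suc n) z - ?Y (Suc n) z) + (L1n (%z. ?Y (Suc n) z - ?Y n z) + L1n (%z. ?Y n z - ?X n z))"
        by (intro add_left_mono L1n_diff_triangle) measurable
      also have "... <= ennreal (P T * (1 / 2) ^ n) + ((ennreal ((1 / 2) ^ n) + ennreal ((1 / 2) ^ n)) + ennreal (P T * (1 / 2) ^ n))"
      proof (intro add_mono)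
        have half: "(1 / 2 :: real) ^ Suc n <= (1 / 2) ^ n" by simp
        show "L1n (%z. ?X (Suc n) z - ?Y (Suc n) z) <= ennreal (P T * (1 / 2) ^ n)"
          by (rule order_trans[OF Gres[of 0 t T]]) (use t P0[OF T] half in \<open>auto intro!: ennreal_leI mult_left_mono simp del: power_Suc\<close>)
        show "L1n (%z. ?Y n z - ?X n z) <= ennreal (P T * (1 / 2) ^ n)" using Gres[of 0 t T n] t by (subst L1n_minus_commute) simp
        have "L1n (%z. ?Y (Suc n) z - ?Y n z) <= L1n (%z. f (Suc n) z - f n z)"
          using S_diff_L1n[OF nu, of "t - 0" "G (Suc n) 0" "G n 0"] Gi[of 0] t by (simp add: G0)
        also have "... <= L1n (%z. f (Suc n) z - w z) + L1n (%z. w z - f n z)" by (rule L1n_diff_triangle) measurable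
        also have "... <= ennreal ((1 / 2) ^ n) + ennreal ((1 / 2) ^ n)"
          using order_trans[OF fw[of "Suc n"] ennreal_leI[OF half]] fw[of n] by (intro add_mono) (simp_all add: L1n_minus_commute[of w])
        finally show "L1n (%z. ?Y (Suc n) z - ?Y n z) <= ennreal ((1 / 2) ^ n) + ennreal ((1 / 2) ^ n)" .
      qed
      also have "... = ennreal ((2 * P T + 2) * (1 / 2) ^ n)"
        using P0[OF T] by (simp add: ennreal_plus[symmetric] algebra_simps del: ennreal_plus)
      finally show ?thesis .
    qed
    show ?thesis
    proof (intro exI[of _ "K * (2 * P T + 2)"] conjI allI impI)
      show "K * (2 * P T + 2) >= 0" using K0 P0[OF T] by simp
      fix t n assume t: "0 < t" "t <= T"
      have "L1n (%z. G (Suc n) t z - G n t z) <= ennreal K * ennreal ((2 * P T + 2) * (1 / 2) ^ n)"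
        by (rule stable_constD[OF K A(2)[OF Gd] A(2)[OF Gd] _ t E]) auto
      also have "... = ennreal (K * (2 * P T + 2) * (1 / 2) ^ n)" using K0 P0[OF T] by (simp add: ennreal_mult'[symmetric] mult.assoc)
      finally show "L1n (%z. G (Suc n) t z - G n t z) <= ennreal (K * (2 * P T + 2) * (1 / 2) ^ n)" .
    qed
  qed
  \<comment> \<open>For positive times, clipping at the decay bound makes that bound hold at every
    point and alters the limit on a null set only.\<close>
  define F where "F t z = (if t <= 0 then w z else clip (4 * a / (nu * t)) (%z. lim (%n. G n t z)) z)" for t z
  have Fm[measurable]: "joint_borel lborel F" unfolding F_def clip_def by measurable
  have Fm2[measurable]: "borel_fun (F t)" for t
    using measurable_compose[OF _ Fm, of "%z. (t, z)" borel] by simp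
  have conv: "\<exists>C\<ge>0. \<forall>t n. 0 <= t --> t <= T --> L1n (%z. G n t z - F t z) <= ennreal (C * (1 / 2) ^ n)" if T: "T > 0" for T
  proof -
    obtain C where C: "C >= 0" "!!t n. 0 < t ==> t <= T ==> L1n (%z. G (Suc n) t z - G n t z) <= ennreal (C * (1 / 2) ^ n)" using step[OF T] by blast
    show ?thesis
    proof (intro exI[of _ "2 * C + 1"] conjI allI impI)
      fix t n assume t: "(0::real) <= t" "t <= T"
      show "L1n (%z. G n t z - F t z) <= ennreal ((2 * C + 1) * (1 / 2) ^ n)"
      proof (cases "t = 0")
        case True
        have "L1n (%z. G n t z - F t z) <= ennreal (1 * (1 / 2) ^ n)" using fw[of n] True by (simp add: F_def G0)
        also have "... <= ennreal ((2 * C + 1) * (1 / 2) ^ n)" using C by (intro ennreal_leI mult_right_mono) auto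
        finally show ?thesis .
      next
        case False
        then have t0: "t > 0" using t by simp
        note lim = L1_fast_limit[OF Gm(2) C(1) C(2)[OF t0 t(2)]]
        have "AE z in lborel. \<bar>G n t z\<bar> <= 4 * a / (nu * t)" for n using Gd[of n] t0 by (simp add: decaying_def)
        then have "AE z in lborel. \<forall>n. \<bar>G n t z\<bar> <= 4 * a / (nu * t)" by (simp add: AE_all_countable)
        then have e: "AE z in lborel. lim (%n. G n t z) = F t z"
          using lim(1)
        proof eventually_elim
          case (elim z)
          have "lim (%n. G n t z) <= 4 * a / (nu * t)" using elim(1) by (intro LIMSEQ_le_const2[OF elim(2)]) (auto simp: abs_le_iff)
          moreover have "- (4 * a / (nu * t)) <= lim (%n. G n t z)" using elim(1) by (intro LIMSEQ_le_const[OF elim(2)]) (auto simp: abs_le_iff minus_le_iff)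
          ultimately show ?case using t0 by (simp add: F_def clip_def)
        qed
        have "L1n (%z. G n t z - F t z) = L1n (%z. G n t z - lim (%n. G n t z))"
          by (rule L1n_cong_AE) (use e in eventually_elim, simp)
        also have "... <= ennreal (2 * C * (1 / 2) ^ n)" by (rule lim(2))
        also have "... <= ennreal ((2 * C + 1) * (1 / 2) ^ n)" by (intro ennreal_leI mult_right_mono) auto
        finally show ?thesis .
      qed
    qed (use C in auto)
  qed
  have conv1: "\<exists>C\<ge>0. \<forall>n. L1n (%z. G n t z - F t z) <= ennreal (C * (1 / 2) ^ n)" if "t >= 0" for t
    using conv[of "t + 1"] that by (metis add_nonneg_pos less_add_one less_imp_le zero_less_one)
  \<comment> \<open>Level 0 is the mass, so one passage to the limit covers the L^1 bound and the
    excess.\<close>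
  have F_le: "excess k (F t) <= B" if t: "t >= 0" and B: "!!n. excess k (G n t) <= B" for k t B
  proof -
    obtain C where C: "!!n. L1n (%z. G n t z - F t z) <= ennreal (C * (1 / 2) ^ n)" using conv1[OF t] by blast
    show ?thesis
    proof (rule ennreal_le_geometric)
      fix n
      have "excess k (F t) <= excess k (G n t) + L1n (%z. F t z - G n t z)" by (rule excess_lipschitz) measurable
      also have "... <= B + ennreal (C * (1 / 2) ^ n)" by (intro add_mono B) (subst L1n_minus_commute, rule C)
      finally show "excess k (F t) <= B + ennreal (C * (1 / 2) ^ n)" .
    qed
  qed
  have FL: "L1n (F t) <= ennreal a" if "t >= 0" for t using F_le[OF that, of 0] Gi(2)[OF that] by (simp add: excess_0)
  have Fb: "\<bar>F t z\<bar> <= 4 * a / (nu * t)" if "t > 0" for t z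
    using that a nu by (simp add: F_def clip_le)
  have Fd: "decaying nu a w F"
    unfolding decaying_def
  proof (intro conjI allI impI)
    fix s k :: real assume s: "s > 0" and k: "k >= 0"
    show "excess k (F s) <= excess k w" by (rule F_le) (use s k Gd in \<open>auto simp: decaying_def\<close>)
  qed (use Fm FL Fb in auto)
  have Fi: "integrable lborel (F t)" if "t >= 0" for t by (rule integrable_of_L1n[OF Fm2 FL[OF that]])
  have mono: "L1n (F t) <= L1n (F s)" if st: "0 <= s" "s <= t" for s t
  proof -
    obtain C where C: "!!n. L1n (%z. G n s z - F s z) <= ennreal (C * (1 / 2) ^ n)" using conv1[OF st(1)] by blast
    obtain C' where C': "!!n. L1n (%z. G n t z - F t z) <= ennreal (C' * (1 / 2) ^ n)" "C' >= 0" using conv1[of t] st by auto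
    have "L1n (F t) <= L1n (F s) + ennreal ((max 0 C + C') * (1 / 2) ^ n)" for n
    proof -
      have "L1n (F t) <= L1n (G n t) + L1n (%z. F t z - G n t z)" by (rule L1n_le_add) measurable
      also have "... <= L1n (G n s) + ennreal (C' * (1 / 2) ^ n)" by (intro add_mono Gmono st) (subst L1n_minus_commute, rule C')
      also have "L1n (G n s) <= L1n (F s) + L1n (%z. G n s z - F s z)" by (rule L1n_le_add) measurable
      also have "L1n (%z. G n s z - F s z) <= ennreal (max 0 C * (1 / 2) ^ n)"
        by (rule order_trans[OF C]) (auto intro!: ennreal_leI mult_right_mono)
      finally have "L1n (F t) <= L1n (F s) + ennreal (max 0 C * (1 / 2) ^ n) + ennreal (C' * (1 / 2) ^ n)" by (simp add: add_mono)
      then show ?thesis using C'(2) by (simp add: ennreal_plus[symmetric] distrib_right add.assoc del: ennreal_plus)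
    qed
    then show ?thesis by (rule ennreal_le_geometric)
  qed
  have mild: "AE z in lborel. F t z = S nu (t - t0) (F t0) z - drift nu F t0 t z" if t: "0 <= t0" "t0 < t" for t0 t
  proof -
    \<comment> \<open>Convergence of the schemes is already known and nothing is absorbed here, so
      \<open>e = 1\<close> suffices; \<open>drift_diff_uniform\<close> then gives convergence of the
      drifts.\<close>
    obtain A where A: "A >= 0" "!!F t0 T. decaying nu a w F ==> 0 <= t0 ==> tame A 1 a t0 T F"
      using decaying_tame[OF nu a w wfin, of 1] by auto
    have [measurable]: "drift nu F t0 t \<in> borel_measurable borel" by (rule borel_measurable_drift(2)[OF Fm])
    obtain C where C: "C >= 0" "!!r n. 0 <= r ==> r <= t ==> L1n (%z. G n r z - F r z) <= ennreal (C * (1 / 2) ^ n)" using conv[of t] t by auto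
    define B where "B = 3 * (gradc nu (t - t0) * (6 * A * sqrt (t - t0) + 8 * 1))"
    have B: "B >= 0" using gradc_nonneg[OF nu, of "t - t0"] A t by (simp add: B_def)
    define R where "R z = (F t z + drift nu F t0 t z) - S nu (t - t0) (F t0) z" for z
    have Rm[measurable]: "borel_fun R" unfolding R_def by measurable
    have "L1n R <= 0 + ennreal ((C + B * C + P (t - t0) + C) * (1 / 2) ^ n)" for n
    proof -
      let ?C = "ennreal (C * (1 / 2) ^ n)"
      let ?X = "%z. G n t z + drift nu (G n) t0 t z" let ?Y = "S nu (t - t0) (G n t0)"
      have "L1n R <= L1n (%z. (F t z + drift nu F t0 t z) - ?X z) + L1n (%z. ?X z - S nu (t - t0) (F t0) z)"
        unfolding R_def by (rule L1n_diff_triangle) measurable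
      also have "... <= (L1n (%z. F t z - G n t z) + L1n (%z. drift nu F t0 t z - drift nu (G n) t0 t z)) + (L1n (%z. ?X z - ?Y z) + L1n (%z. ?Y z - S nu (t - t0) (F t0) z))"
        using L1n_triangle(1)[of "%z. F t z - G n t z" "%z. drift nu F t0 t z - drift nu (G n) t0 t z"]
        by (intro add_mono L1n_diff_triangle) (simp_all add: algebra_simps)
      also have "... <= (?C + ennreal B * ?C) + (ennreal (P (t - t0) * (1 / 2) ^ n) + ?C)"
      proof (intro add_mono)
        show "L1n (%z. F t z - G n t z) <= ?C" using C(2)[of t n] t by (subst L1n_minus_commute) simp
        show "L1n (%z. drift nu F t0 t z - drift nu (G n) t0 t z) <= ennreal B * ?C"
          unfolding B_def by (rule drift_diff_uniform[OF nu A(2)[OF Fd t(1)] A(2)[OF Gd t(1)] A(1) _ t(2) order_refl])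
            (use C(2) t in \<open>auto simp: L1n_minus_commute[of "F _"]\<close>)
        show "L1n (%z. ?X z - ?Y z) <= ennreal (P (t - t0) * (1 / 2) ^ n)" by (rule Gres) (use t in auto)
        show "L1n (%z. ?Y z - S nu (t - t0) (F t0) z) <= ?C"
          by (rule order_trans[OF S_diff_L1n[OF nu _ Gi(1)[OF t(1)] Fi[OF t(1)]] C(2)]) (use t in auto)
      qed
      also have "... = 0 + ennreal ((C + B * C + P (t - t0) + C) * (1 / 2) ^ n)"
        using C B P0[of "t - t0"] t by (simp add: ennreal_plus[symmetric] ennreal_mult'[symmetric] algebra_simps del: ennreal_plus)
      finally show ?thesis .
    qed
    then have "L1n R <= 0" by (rule ennreal_le_geometric)
    then have "AE z in lborel. R z = 0" using L1n_0_iff[OF Rm] by simp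
    then show ?thesis by eventually_elim (simp add: R_def algebra_simps)
  qed
  have "F 0 = w" by (simp add: F_def fun_eq_iff)
  with Fd Fb mono mild show ?thesis by (intro exI[of _ F]) simp
qed

section \<open>Continuity in time\<close>

lemma Lp_norm_1: "Lp_norm 1 f = L1n f"
proof -
  have "(NN z. ennreal (\<bar>f z\<bar> powr enn2real 1)) = L1n f" by (simp add: L1n_def)
  then show ?thesis by (cases "L1n f = \<infinity>") (simp_all add: Lp_norm_def Let_def ennreal_enn2real less_top)
qed

lemma Lp_norm_inf: "Lp_norm \<infinity> f = esssup lborel (%z. ennreal \<bar>f z\<bar>)"
  by (simp add: Lp_norm_def)

lemma Lp_norm_inf_le_iff:
  assumes [measurable]: "borel_fun f"
  shows "Lp_norm \<infinity> f <= ennreal c \<longleftrightarrow> (AE z in lborel. ennreal \<bar>f z\<bar> <= ennreal c)"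
proof
  assume le: "Lp_norm \<infinity> f <= ennreal c"
  have "AE z in lborel. ennreal \<bar>f z\<bar> <= Lp_norm \<infinity> f" unfolding Lp_norm_inf by (rule esssup_AE)
  then show "AE z in lborel. ennreal \<bar>f z\<bar> <= ennreal c" by eventually_elim (rule order_trans[OF _ le])
next
  assume "AE z in lborel. ennreal \<bar>f z\<bar> <= ennreal c"
  then show "Lp_norm \<infinity> f <= ennreal c" unfolding Lp_norm_inf by (intro esssup_I) auto
qed

lemma tendsto_0_ennrealI:
  fixes f :: "'a => ennreal"
  assumes "!!e. e > 0 ==> \<forall>\<^sub>F x in F. f x <= ennreal e"
  shows "(f \<longlongrightarrow> 0) F"
proof (rule order_tendstoI)
  fix y :: ennreal assume "0 < y"
  then obtain x where x: "0 < x" "x < y" using dense by blast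
  then obtain e where e: "x = ennreal e" "e > 0" by (cases x) (auto simp: top_unique)
  from assms[OF e(2)] show "\<forall>\<^sub>F x in F. f x < y" by eventually_elim (use x e in auto)
qed simp

lemma S_small_time:
  assumes nu: "nu > 0" and f: "integrable lborel f" and e: "e > 0"
  shows "\<exists>d>0. \<forall>x. 0 < x --> x < d --> L1n (%z. S nu x f z - f z) <= ennreal e"
proof (rule ccontr)
  assume n: "\<not> ?thesis"
  have "\<exists>x. 0 < x \<and> x < 1 / real (Suc n) \<and> ennreal e < L1n (%z. S nu x f z - f z)" for n
  proof -
    have "1 / real (Suc n) > 0" by simp
    then show ?thesis using n by (meson not_le)
  qed
  then obtain X where X: "!!n. 0 < X n" "!!n. X n < 1 / real (Suc n)" "!!n. ennreal e < L1n (%z. S nu (X n) f z - f z)" by metis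
  have "X \<longlonglongrightarrow> 0"
  proof (rule tendsto_sandwich[OF _ _ tendsto_const LIMSEQ_Suc[OF lim_1_over_n]])
    show "\<forall>\<^sub>F n in sequentially. 0 <= X n" "\<forall>\<^sub>F n in sequentially. X n <= 1 / real (Suc n)"
      by (intro always_eventually allI less_imp_le X)+
  qed
  from S_continuity_seq[OF nu X(1) this f] have "\<forall>\<^sub>F n in sequentially. L1n (%z. S nu (X n) f z - f z) < ennreal e"
    using e by (intro order_tendstoD) auto
  from eventually_happens'[OF sequentially_bot this] X(3) show False by (blast dest: less_asym)
qed

text \<open>For \<open>p < q\<close> the difference is \<open>S nu p\<close> applied to
  \<open>S nu (q - p) f - f\<close>, which is small in L^1. Since \<open>p\<close> stays above
  \<open>r\<close>, smoothing turns this into smallness at every point.\<close>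

lemma S_uniform:
  assumes nu: "nu > 0" and f: "integrable lborel f" and b: "!!z. \<bar>f z\<bar> <= (b::real)" and e: "e > 0" and r: "r > 0"
  shows "\<exists>d>0. \<forall>p q. r <= p --> r <= q --> \<bar>p - q\<bar> < d --> L1n (%z. S nu p f z - S nu q f z) <= ennreal e \<and> (\<forall>z. \<bar>S nu p f z - S nu q f z\<bar> <= e)"
proof -
  define e' where "e' = min e (4 * pi * nu * r * e)"
  have e': "e' > 0" "e' <= e" "1 / (4 * pi * nu * r) * e' <= e"
    using e nu r by (auto simp: e'_def pos_divide_le_eq mult.commute)
  obtain d where d: "d > 0" "!!x. 0 < x ==> x < d ==> L1n (%z. S nu x f z - f z) <= ennreal e'"
    using S_small_time[OF nu f e'(1)] by blast
  have [measurable]: "borel_fun f" using f by simp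
  have *: "L1n (%z. S nu q f z - S nu p f z) <= ennreal e \<and> (\<forall>z. \<bar>S nu q f z - S nu p f z\<bar> <= e)"
    if pq: "r <= p" "p < q" "q - p < d" for p q
  proof -
    define g where "g z = S nu (q - p) f z - f z" for z
    have [measurable]: "borel_fun g" unfolding g_def by measurable
    have g: "L1n g <= ennreal e'" unfolding g_def using pq by (intro d) auto
    have p: "p > 0" "q - p > 0" using pq r by auto
    have i: "integrable lborel (S nu (q - p) f)"
      using S_L1[OF nu p(2), of f] f by (simp add: integrable_iff_L1n le_less_trans)
    have eq: "S nu q f z - S nu p f z = S nu p g z" for z
      unfolding g_def using S_diff_L1[OF nu p(1) i f] S_semigroup[OF nu p _ b] by simp
    have "L1n (S nu p g) <= ennreal e" using order_trans[OF S_L1[OF nu p(1)] g] e' by (auto intro: order_trans ennreal_leI)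
    moreover have "\<bar>S nu p g z\<bar> <= e" for z
    proof -
      have "ennreal \<bar>S nu p g z\<bar> <= ennreal (1 / (4 * pi * nu * p)) * L1n g" by (rule S_smoothing[OF nu p(1)]) measurable
      also have "... <= ennreal (1 / (4 * pi * nu * r)) * ennreal e'"
        using pq r nu by (intro mult_mono g ennreal_leI divide_left_mono) auto
      also have "... <= ennreal e" using e' r nu by (subst ennreal_mult[symmetric]) (auto intro!: ennreal_leI)
      finally show ?thesis using e by simp
    qed
    ultimately show ?thesis unfolding eq by simp
  qed
  show ?thesis
  proof (intro exI[of _ d] conjI d(1) allI impI)
    fix p q assume pq: "r <= p" "r <= q" "\<bar>p - q\<bar> < d"
    consider "p = q" | "p < q" | "q < p" by linarith
    then show "L1n (%z. S nu p f z - S nu q f z) <= ennreal e" "!!z. \<bar>S nu p f z - S nu q f z\<bar> <= e"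
      using *[of p q] *[of q p] pq e by (cases; auto simp: L1n_minus_commute[of "S nu p f"] abs_minus_commute[of "S nu p f _"])+
  qed
qed

lemma gradc_mono: "nu > 0 ==> T <= T' ==> gradc nu T <= gradc nu T'"
  unfolding gradc_def by (intro divide_right_mono) auto

text \<open>The output of \<open>existence\<close>. That \<open>mild\<close> includes
  \<open>t0 = 0\<close> gives continuity at the initial time.\<close>

locale flow =
  fixes nu a :: real and w :: "real \<times> real => real" and F :: "real => real \<times> real => real"
  assumes nu: "nu > 0" and a: "a > 0" and w: "borel_fun w" and wa: "L1n w <= ennreal a"
    and dec: "decaying nu a w F" and F0: "F 0 = w" and bnd: "!!t z. t > 0 ==> \<bar>F t z\<bar> <= 4 * a / (nu * t)"
    and mono: "!!s t. 0 <= s ==> s <= t ==> L1n (F t) <= L1n (F s)"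
    and mild: "!!t0 t. 0 <= t0 ==> t0 < t ==> AE z in lborel. F t z = S nu (t - t0) (F t0) z - drift nu F t0 t z"
begin

lemma L1: "t >= 0 ==> L1n (F t) <= ennreal a"
  using mono[of 0 t] wa by (simp add: F0)

lemmas measurable_flow = decaying_measurable[OF dec]

lemma drift_measurable: "drift nu F t0 t \<in> borel_measurable borel"
  by (rule borel_measurable_drift(2)[OF measurable_flow(1)])

lemma integrable_flow: "t >= 0 ==> integrable lborel (F t)"
  by (rule integrable_of_L1n[OF measurable_flow(2) L1])

text \<open>\<open>k\<close> is chosen first: it makes the scale invariant part at most
  \<open>e / 2\<close> and determines \<open>A\<close>. The length of the interval is chosen
  afterwards to bring the \<open>A\<close> part below \<open>e / 2\<close>. The estimate covers
  \<open>t0 = 0\<close>.\<close>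

lemma drift_L1_small:
  assumes e: "e > 0"
  shows "\<exists>\<tau>>0. \<forall>t0 t. 0 <= t0 --> t0 < t --> t <= t0 + \<tau> --> L1n (drift nu F t0 t) <= ennreal e"
proof -
  define c where "c = gradc nu 1 + 1"
  have c: "c > 0" using gradc_nonneg[OF nu, of 1] by (simp add: c_def)
  define k where "k = e / (48 * c * a)"
  have k: "k > 0" using e c a by (simp add: k_def)
  obtain A where A: "A >= 0" "!!t0 T. 0 <= t0 ==> tame A k a t0 T F"
    using decaying_tame[OF nu a w _ k] wa dec by (metis ennreal_less_top le_less_trans infinity_ennreal_def)
  define u where "u = e / (36 * c * (A + 1) * a)"
  have u: "u > 0" using e c a A by (simp add: u_def)
  have small: "3 * (c * (6 * A * u + 8 * k)) * a <= e"
  proof -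
    have "36 * c * (A + 1) * a * u = e" using c a A by (simp add: u_def)
    moreover have "36 * c * A * a * u <= 36 * c * (A + 1) * a * u" using c a u by (simp add: mult_right_mono)
    moreover have "48 * c * a * k = e" using c a by (simp add: k_def)
    ultimately show ?thesis by (simp add: algebra_simps)
  qed
  show ?thesis
  proof (intro exI[of _ "min 1 (u\<^sup>2)"] conjI allI impI)
    show "min 1 (u\<^sup>2) > 0" using u by simp
    fix t0 t assume t: "0 <= t0" "t0 < t" "t <= t0 + min 1 (u\<^sup>2)"
    have "t - t0 <= u\<^sup>2" using t by simp
    then have sq: "sqrt (t - t0) <= u" using u by (simp add: real_le_lsqrt)
    have g: "gradc nu (t - t0) <= c" "gradc nu (t - t0) >= 0"
    proof -
      have "t - t0 <= 1" "t - t0 > 0" using t by auto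
      then show "gradc nu (t - t0) <= c" "gradc nu (t - t0) >= 0"
        using gradc_nonneg[OF nu, of "t - t0"] gradc_mono[OF nu, of "t - t0" 1] by (auto simp: c_def)
    qed
    have "L1n (drift nu F t0 t) = L1n (%z. drift nu F t0 t z - drift nu (%t z. 0) t0 t z)"
      by (simp add: drift_def[abs_def] adv_0[abs_def])
    also have "... <= ennreal (3 * (gradc nu (t - t0) * (6 * A * sqrt (t - t0) + 8 * k))) * ennreal a"
      by (rule drift_diff_uniform[OF nu A(2) tame_zero A(1) _ t(2) order_refl]) (use t k L1 in auto)
    also have "... = ennreal (3 * (gradc nu (t - t0) * (6 * A * sqrt (t - t0) + 8 * k)) * a)"
      using a by (intro ennreal_mult''[symmetric]) simp
    also have "... <= ennreal (3 * (c * (6 * A * u + 8 * k)) * a)"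
      using g sq A k a c t u by (intro ennreal_leI mult_right_mono mult_left_mono mult_mono add_mono) auto
    also have "... <= ennreal e" by (rule ennreal_leI[OF small])
    finally show "L1n (drift nu F t0 t) <= ennreal e" .
  qed
qed

text \<open>From time \<open>r\<close> on, the flow and its velocity are bounded, so the integral is
  that of \<open>grad_const_integral\<close> with \<open>e = 0\<close>, and its factor
  \<open>sqrt (t - t0)\<close> makes it small.\<close>

lemma drift_sup_small:
  assumes e: "e > 0" and r: "r > 0"
  shows "\<exists>\<tau>>0. \<forall>t0 t z. r <= t0 --> t0 < t --> t <= t0 + \<tau> --> \<bar>drift nu F t0 t z\<bar> <= e"
proof -
  define c where "c = gradc nu 1 + 1"
  have c: "c > 0" using gradc_nonneg[OF nu, of 1] by (simp add: c_def)
  define m where "m = 4 * a / (nu * r)"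
  define N where "N = 16 * m + a"
  have m: "m > 0" "N > 0" using a nu r by (auto simp: m_def N_def add_pos_pos)
  have mb: "\<bar>F s z\<bar> <= m" if "r <= s" for s z
    using that a nu r by (intro order_trans[OF bnd]) (auto simp: m_def divide_left_mono)
  have adv_b: "norm (adv (F s) z) <= m * N" if s: "r <= s" for s z
  proof -
    have "ennreal (norm (biot_savart (F s) z)) <= ennreal (16 * 1 * m + a / 1)"
      by (rule order_trans[OF biot_savart_le inv_pot_bound[OF measurable_flow(2)]]) (use mb[OF s] m a L1[of s] s r in auto)
    then have "norm (biot_savart (F s) z) <= N" using m a by (subst (asm) ennreal_le_iff) (auto simp: N_def)
    then show ?thesis unfolding adv_def norm_scaleR using mb[OF s, of z] m by (intro mult_mono) auto
  qed
  define u where "u = e / (9 * c * (m * N))"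
  have u: "u > 0" using e c m by (simp add: u_def)
  show ?thesis
  proof (intro exI[of _ "min 1 (u\<^sup>2)"] conjI allI impI)
    show "min 1 (u\<^sup>2) > 0" using u by simp
    fix t0 t z assume t: "r <= t0" "t0 < t" "t <= t0 + min 1 (u\<^sup>2)"
    have "t - t0 <= u\<^sup>2" using t by simp
    then have sq: "sqrt (t - t0) <= u" using u by (simp add: real_le_lsqrt)
    have g: "gradc nu (t - t0) <= c" "gradc nu (t - t0) >= 0"
    proof -
      have "t - t0 <= 1" "t - t0 > 0" using t by auto
      then show "gradc nu (t - t0) <= c" "gradc nu (t - t0) >= 0"
        using gradc_nonneg[OF nu, of "t - t0"] gradc_mono[OF nu, of "t - t0" 1] by (auto simp: c_def)
    qed
    have "ennreal \<bar>drift nu F t0 t z\<bar> <= (NN s. ennreal \<bar>indicator {t0<..<t} s * Sd nu (t - s) (adv (F s)) z\<bar>)"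
      unfolding drift_def using norm_integral_le_nn_integral[of lborel "%s. indicator {t0<..<t} s * Sd nu (t - s) (adv (F s)) z"] by simp
    also have "... <= (NN s. ennreal (indicator {t0<..<t} s * (grad_const nu (t - s) * (m * N + 0 / sqrt (s - t0)))))"
    proof (intro nn_integral_mono ennreal_leI)
      fix s
      show "\<bar>indicator {t0<..<t} s * Sd nu (t - s) (adv (F s)) z\<bar> <= indicator {t0<..<t} s * (grad_const nu (t - s) * (m * N + 0 / sqrt (s - t0)))"
        using Sd_bound[OF nu, of "t - s" "adv (F s)" "m * N" z] adv_b[of s] t by (cases "t0 < s \<and> s < t") auto
    qed
    also have "... <= ennreal (3 * (gradc nu (t - t0) * (3 * (m * N) * sqrt (t - t0) + 4 * 0)))"
      by (rule grad_const_integral[OF nu]) (use m t in auto)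
    also have "... <= ennreal (3 * (c * (3 * (m * N) * u + 4 * 0)))"
      using g sq c m u t by (intro ennreal_leI mult_left_mono mult_mono add_mono) auto
    also have "3 * (c * (3 * (m * N) * u + 4 * 0)) = e" using c m by (simp add: u_def)
    finally show "\<bar>drift nu F t0 t z\<bar> <= e" using e by simp
  qed
qed

lemma near:
  assumes t: "t > 0" and e: "e > 0"
  shows "\<exists>d>0. \<forall>s. \<bar>s - t\<bar> < d --> L1n (%z. F s z - F t z) <= ennreal (3 * e) \<and> (AE z in lborel. \<bar>F s z - F t z\<bar> <= 3 * e)"
proof -
  note [measurable] = measurable_flow drift_measurable
  obtain \<tau>1 where \<tau>1: "\<tau>1 > 0" "!!t0 t. 0 <= t0 ==> t0 < t ==> t <= t0 + \<tau>1 ==> L1n (drift nu F t0 t) <= ennreal e"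
    using drift_L1_small[OF e] by blast
  obtain \<tau>2 where \<tau>2: "\<tau>2 > 0" "!!t0 r z. t / 2 <= t0 ==> t0 < r ==> r <= t0 + \<tau>2 ==> \<bar>drift nu F t0 r z\<bar> <= e"
    using drift_sup_small[OF e, of "t / 2"] t by (meson half_gt_zero)
  \<comment> \<open>Both times are reached from the common restart time \<open>t - r\<close>, hence
    compared through one function \<open>F t0\<close>. \<open>r\<close> is so small that both drifts
    are below \<open>e\<close>, while the elapsed times stay above \<open>r / 2\<close>, where
    \<open>S_uniform\<close> applies.\<close>
  define r where "r = min (t / 2) (min \<tau>1 \<tau>2 / 2)"
  have r: "r > 0" "r <= t / 2" "2 * r <= \<tau>1" "2 * r <= \<tau>2" using t \<tau>1 \<tau>2 by (auto simp: r_def)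
  define t0 where "t0 = t - r"
  have t0: "t0 > 0" "t / 2 <= t0" using r t by (auto simp: t0_def)
  have i: "integrable lborel (F t0)" using t0 by (intro integrable_flow) simp
  obtain d where d: "d > 0" "!!p q. r / 2 <= p ==> r / 2 <= q ==> \<bar>p - q\<bar> < d ==> L1n (%z. S nu p (F t0) z - S nu q (F t0) z) <= ennreal e"
    "!!p q z. r / 2 <= p ==> r / 2 <= q ==> \<bar>p - q\<bar> < d ==> \<bar>S nu p (F t0) z - S nu q (F t0) z\<bar> <= e"
    using S_uniform[OF nu i bnd[OF t0(1)] e, of "r / 2"] r by (meson half_gt_zero)
  show ?thesis
  proof (intro exI[of _ "min d (r / 2)"] conjI allI impI)
    fix s assume s: "\<bar>s - t\<bar> < min d (r / 2)"
    define p where "p = s - t0" define q where "q = t - t0"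
    have pq: "r / 2 <= p" "r / 2 <= q" "\<bar>p - q\<bar> < d" "t0 < s" "t0 < t" "s <= t0 + 2 * r" "t <= t0 + 2 * r"
    proof -
      have "s - t < r / 2" "t - s < r / 2" "\<bar>s - t\<bar> < d" using s by linarith+
      then show "r / 2 <= p" "r / 2 <= q" "\<bar>p - q\<bar> < d" "t0 < s" "t0 < t" "s <= t0 + 2 * r" "t <= t0 + 2 * r"
        using r by (auto simp: p_def q_def t0_def)
    qed
    define D where "D z = S nu p (F t0) z - S nu q (F t0) z" for z
    have ae: "AE z in lborel. F s z - F t z = D z - (drift nu F t0 s z - drift nu F t0 t z)"
      using mild[of t0 s] mild[of t0 t] t0 pq by (auto simp: D_def p_def q_def elim!: eventually_elim2)
    have [measurable]: "borel_fun D" unfolding D_def by measurable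
    have "L1n (%z. F s z - F t z) = L1n (%z. D z - (drift nu F t0 s z - drift nu F t0 t z))" by (rule L1n_cong_AE[OF ae])
    also have "... <= L1n D + L1n (%z. drift nu F t0 s z - drift nu F t0 t z)" by (rule L1n_triangle(2)) measurable
    also have "... <= L1n D + (L1n (drift nu F t0 s) + L1n (drift nu F t0 t))" by (intro add_left_mono L1n_triangle(2)) measurable
    also have "... <= ennreal e + (ennreal e + ennreal e)"
      unfolding D_def using t0 r pq by (intro add_mono d(2) \<tau>1(2)) auto
    also have "... = ennreal (3 * e)" using e by (simp add: ennreal_plus[symmetric] del: ennreal_plus)
    finally show "L1n (%z. F s z - F t z) <= ennreal (3 * e)" .
    show "AE z in lborel. \<bar>F s z - F t z\<bar> <= 3 * e"
      using ae
    proof eventually_elim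
      case (elim z)
      have "\<bar>D z\<bar> <= e" "\<bar>drift nu F t0 s z\<bar> <= e" "\<bar>drift nu F t0 t z\<bar> <= e"
        unfolding D_def using t0 r pq by (auto intro!: d(3) \<tau>2(2))
      then show ?case unfolding elim by linarith
    qed
  qed (use d r in auto)
qed

lemma near_0:
  assumes e: "e > 0"
  shows "\<exists>d>0. \<forall>s. 0 < s --> s < d --> L1n (%z. F s z - w z) <= ennreal (2 * e)"
proof -
  note [measurable] = measurable_flow drift_measurable w
  obtain \<tau> where \<tau>: "\<tau> > 0" "!!t0 t. 0 <= t0 ==> t0 < t ==> t <= t0 + \<tau> ==> L1n (drift nu F t0 t) <= ennreal e"
    using drift_L1_small[OF e] by blast
  obtain d where d: "d > 0" "!!x. 0 < x ==> x < d ==> L1n (%z. S nu x w z - w z) <= ennreal e"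
    using S_small_time[OF nu integrable_of_L1n[OF w wa] e] by blast
  show ?thesis
  proof (intro exI[of _ "min d \<tau>"] conjI allI impI)
    fix s assume s: "0 < s" "s < min d \<tau>"
    have "L1n (%z. F s z - w z) = L1n (%z. (S nu s w z - w z) - drift nu F 0 s z)"
      by (rule L1n_cong_AE) (use mild[OF order_refl s(1)] in eventually_elim, simp add: F0)
    also have "... <= L1n (%z. S nu s w z - w z) + L1n (drift nu F 0 s)" by (rule L1n_triangle(2)) measurable
    also have "... <= ennreal e + ennreal e" using s by (intro add_mono d(2) \<tau>(2)) auto
    also have "... = ennreal (2 * e)" using e by (simp add: ennreal_plus[symmetric] del: ennreal_plus)
    finally show "L1n (%z. F s z - w z) <= ennreal (2 * e)" .
  qed (use d \<tau> in auto)
qed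

lemma continuous_L1: "continuous_on_Lp 1 {0..} F"
  unfolding continuous_on_Lp_def in_Lp_def Lp_norm_1
proof (intro ballI conjI tendsto_0_ennrealI)
  fix t :: real assume t: "t \<in> {0..}"
  show "F t \<in> borel_measurable lborel" using measurable_flow(2) by simp
  show "L1n (F t) < \<infinity>" using L1[of t] t by (auto simp: le_less_trans)
  fix e :: real assume e: "e > 0"
  show "\<forall>\<^sub>F s in at t within {0..}. L1n (%z. F s z - F t z) <= ennreal e"
  proof (cases "t = 0")
    case True
    then show ?thesis using near_0[of "e / 2"] e by (auto simp: eventually_at dist_real_def F0)
  next
    case False
    then show ?thesis using near[of t "e / 3"] e t by (fastforce simp: eventually_at dist_real_def)
  qed
qed

lemma continuous_Linf: "continuous_on_Lp \<infinity> {0<..} F"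
  unfolding continuous_on_Lp_def in_Lp_def
proof (intro ballI conjI tendsto_0_ennrealI)
  note [measurable] = measurable_flow(2)
  fix t :: real assume "t \<in> {0<..}"
  then have t: "t > 0" by simp
  show "F t \<in> borel_measurable lborel" by simp
  have "Lp_norm \<infinity> (F t) <= ennreal (4 * a / (nu * t))"
    by (subst Lp_norm_inf_le_iff) (auto intro!: AE_I2 ennreal_leI bnd t)
  then show "Lp_norm \<infinity> (F t) < \<infinity>" by (rule le_less_trans) simp
  fix e :: real assume e: "e > 0"
  obtain d where d: "d > 0" "!!s. \<bar>s - t\<bar> < d ==> AE z in lborel. \<bar>F s z - F t z\<bar> <= 3 * (e / 3)"
    using near[OF t, of "e / 3"] e by (meson divide_pos_pos zero_less_numeral)
  show "\<forall>\<^sub>F s in at t within {0<..}. Lp_norm \<infinity> (%z. F s z - F t z) <= ennreal e"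
    unfolding eventually_at
  proof (intro exI[of _ d] conjI ballI impI d(1))
    fix s assume "s ~= t \<and> dist s t < d"
    then have "AE z in lborel. \<bar>F s z - F t z\<bar> <= e" using d(2)[of s] by (simp add: dist_real_def)
    then show "Lp_norm \<infinity> (%z. F s z - F t z) <= ennreal e"
      by (subst Lp_norm_inf_le_iff) (measurable, auto elim!: eventually_mono intro!: ennreal_leI)
  qed
qed

lemma mild_solution_flow: "mild_solution nu \<infinity> F"
  unfolding mild_solution_def
proof (intro allI impI, elim conjE)
  fix t0 t :: real assume t: "0 < t0" "t0 < t"
  have eq: "(LINT s:{t0<..<t}|lborel. S_div nu (t - s) (%z'. F s z' *\<^sub>R biot_savart (F s) z') z) = drift nu F t0 t z" for z
    unfolding drift_def set_lebesgue_integral_def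
  proof (rule Bochner_Integration.integral_cong[OF refl])
    fix s
    show "indicator {t0<..<t} s *\<^sub>R S_div nu (t - s) (%z'. F s z' *\<^sub>R biot_savart (F s) z') z = indicator {t0<..<t} s * Sd nu (t - s) (adv (F s)) z"
      using S_div_eq_Sd[OF nu, of "t - s"] by (cases "t0 < s \<and> s < t") (auto simp: adv_def[abs_def])
  qed
  show "AE z in lborel. F t z = S nu (t - t0) (F t0) z - (LINT s:{t0<..<t}|lborel. S_div nu (t - s) (%z'. F s z' *\<^sub>R biot_savart (F s) z') z)"
    unfolding eq using mild[of t0 t] t by simp
qed

end

text \<open>Interpolation between the mass and the pointwise bound produces the constant
  \<open>4 powr (1 - 1 / p)\<close>, estimated by 4 for all \<open>p\<close>. The formula includes
  \<open>p = \<infinity>\<close>, where \<open>1 / p\<close> is 0.\<close>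

lemma Lp_norm_interpolation:
  assumes [measurable]: "borel_fun f" and q: "q > 0" and a: "a > 0" "L1n f <= ennreal a" and b: "!!z. \<bar>f z\<bar> <= 4 * a / q" and p: "1 <= p"
  shows "Lp_norm p f <= ennreal (4 * q powr (enn2real (1 / p) - 1)) * ennreal a"
proof (cases "p = \<infinity>")
  case True
  have "Lp_norm \<infinity> f <= ennreal (4 * a / q)" by (subst Lp_norm_inf_le_iff) (auto intro!: AE_I2 ennreal_leI b)
  also have "... = ennreal (4 * q powr (- 1)) * ennreal a" using a q by (simp add: ennreal_mult[symmetric] powr_minus divide_inverse mult_ac)
  finally show ?thesis using True by simp
next
  case False
  then obtain r where r: "p = ennreal r" "r >= 1" using p by (cases p) (auto simp flip: ennreal_1)
  have pr: "enn2real p = r" "enn2real (1 / p) = 1 / r"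
    using r by (auto simp: divide_ennreal simp flip: ennreal_1)
  define m where "m = 4 * a / q"
  have m: "m > 0" using a q by (simp add: m_def)
  define I where "I = (NN z. ennreal (\<bar>f z\<bar> powr r))"
  have "I <= (NN z. ennreal (m powr (r - 1)) * ennreal \<bar>f z\<bar>)"
    unfolding I_def
  proof (intro nn_integral_mono)
    fix z
    have "\<bar>f z\<bar> powr r <= m powr (r - 1) * \<bar>f z\<bar>"
    proof (cases "f z = 0")
      case False
      then have "\<bar>f z\<bar> powr r = \<bar>f z\<bar> powr (r - 1) * \<bar>f z\<bar>" by (simp add: powr_diff)
      also have "... <= m powr (r - 1) * \<bar>f z\<bar>" using b[of z] r by (intro mult_right_mono powr_mono2) (auto simp: m_def)
      finally show ?thesis .
    qed simp
    then show "ennreal (\<bar>f z\<bar> powr r) <= ennreal (m powr (r - 1)) * ennreal \<bar>f z\<bar>"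
      by (simp add: ennreal_mult[symmetric] ennreal_leI)
  qed
  also have "... = ennreal (m powr (r - 1)) * L1n f" unfolding L1n_def by (rule nn_integral_cmult) measurable
  also have "... <= ennreal (m powr (r - 1)) * ennreal a" by (intro mult_left_mono a) simp
  also have "... = ennreal (m powr (r - 1) * a)" using a by (simp add: ennreal_mult)
  finally have I: "I <= ennreal (m powr (r - 1) * a)" .
  then have "I ~= \<infinity>" by (auto simp: top_unique)
  have "enn2real I <= m powr (r - 1) * a" using I a m by (intro enn2real_leI) auto
  then have "enn2real I powr (1 / r) <= (m powr (r - 1) * a) powr (1 / r)" using r by (intro powr_mono2) auto
  also have "... = m powr (1 - 1 / r) * a powr (1 / r)"
    using r a by (simp add: powr_mult powr_powr diff_divide_distrib)
  also have "... = 4 powr (1 - 1 / r) * (q powr (1 / r - 1) * a)"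
  proof -
    have "m powr (1 - 1 / r) = 4 powr (1 - 1 / r) * a powr (1 - 1 / r) / q powr (1 - 1 / r)"
      using a q by (simp add: m_def powr_divide powr_mult)
    also have "... = 4 powr (1 - 1 / r) * a powr (1 - 1 / r) * q powr (1 / r - 1)"
      by (simp add: powr_minus_divide[symmetric] divide_powr_uminus)
    finally show ?thesis using a by (simp add: powr_add[symmetric])
  qed
  also have "... <= 4 powr 1 * (q powr (1 / r - 1) * a)" using r a by (intro mult_right_mono powr_mono) auto
  finally have "ennreal (enn2real I powr (1 / r)) <= ennreal (4 * q powr (1 / r - 1) * a)" by (intro ennreal_leI) simp
  then show ?thesis using \<open>I ~= \<infinity>\<close> a False unfolding pr(2) by (simp add: Lp_norm_def Let_def pr(1) I_def[symmetric] ennreal_mult)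
qed

section \<open>Uniqueness\<close>

text \<open>Compactness by bisection: continuity bounds the norm near each point. The form with
  abstract \<open>g\<close> and \<open>N\<close> covers both the L^1 and the L^infinity
  norm.\<close>

lemma locally_bounded_on_interval:
  fixes g :: "real => ennreal" and N :: "real => real => ennreal"
  assumes fin: "!!s. s \<in> J ==> g s < \<infinity>" and tri: "!!s t. s \<in> J ==> t \<in> J ==> g s <= g t + N s t"
    and conv: "!!t. t \<in> J ==> ((%s. N s t) \<longlongrightarrow> 0) (at t within J)" and J: "{u..v} \<subseteq> J" and uv: "u <= v"
  shows "\<exists>m\<ge>0. \<forall>s\<in>{u..v}. g s <= ennreal m"
proof -
  define P where "P x y \<longleftrightarrow> (\<exists>m\<ge>0. \<forall>s\<in>{x..y} \<inter> {u..v}. g s <= ennreal m)" for x y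
  have "P u v"
  proof (rule Bolzano[OF uv, of P])
    fix x y z assume "P x y" "P y z"
    then obtain m m' where m: "m >= 0" "\<forall>s\<in>{x..y} \<inter> {u..v}. g s <= ennreal m" "m' >= 0" "\<forall>s\<in>{y..z} \<inter> {u..v}. g s <= ennreal m'" by (auto simp: P_def)
    have "g s <= ennreal (max m m')" if s: "s \<in> {x..z} \<inter> {u..v}" for s
    proof (cases "s <= y")
      case True
      then have "g s <= ennreal m" using m s by auto
      also have "... <= ennreal (max m m')" by (rule ennreal_leI) simp
      finally show ?thesis .
    next
      case False
      then have "g s <= ennreal m'" using m s by auto
      also have "... <= ennreal (max m m')" by (rule ennreal_leI) simp
      finally show ?thesis .
    qed
    then show "P x z" using m by (auto simp: P_def intro!: exI[of _ "max m m'"])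
  next
    fix x assume "u <= x" "x <= v"
    then have x: "x \<in> J" using J by auto
    have "\<forall>\<^sub>F s in at x within J. N s x < 1" by (rule order_tendstoD(2)[OF conv[OF x]]) simp
    then obtain d where d: "d > 0" "!!s. s \<in> J ==> s ~= x ==> dist s x < d ==> N s x < 1" by (auto simp: eventually_at)
    obtain m where m: "g x = ennreal m" "m >= 0" using fin[OF x] by (cases "g x") auto
    have "g s <= ennreal (m + 1)" if s: "s \<in> J" "\<bar>s - x\<bar> < d" for s
    proof (cases "s = x")
      case True then show ?thesis using m by (simp add: ennreal_leI del: ennreal_plus)
    next
      case False
      then have "N s x <= 1" using d(2)[of s] s by (simp add: dist_real_def less_imp_le)
      then have "g s <= ennreal m + 1" using tri[OF s(1) x] unfolding m(1) by (meson add_left_mono order_trans)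
      then show ?thesis using m by simp
    qed
    then have "P p q" if "p <= x" "x <= q" "q - p < d" for p q
      unfolding P_def
    proof (intro exI[of _ "m + 1"] conjI ballI)
      fix s assume "s \<in> {p..q} \<inter> {u..v}"
      then have "s \<in> J" "\<bar>s - x\<bar> < d" using that J by auto
      then show "g s <= ennreal (m + 1)" by fact
    qed (use m in simp)
    then show "\<exists>d>0. \<forall>a b. a <= x \<and> x <= b \<and> b - a < d --> P a b" using d(1) by blast
  qed
  then show ?thesis by (auto simp: P_def)
qed

lemma Lp_norm_inf_triangle:
  assumes [measurable]: "borel_fun f" "borel_fun g"
  shows "Lp_norm \<infinity> f <= Lp_norm \<infinity> g + Lp_norm \<infinity> (%z. f z - g z)"
proof -
  have "AE z in lborel. ennreal \<bar>g z\<bar> <= Lp_norm \<infinity> g" "AE z in lborel. ennreal \<bar>f z - g z\<bar> <= Lp_norm \<infinity> (%z. f z - g z)"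
    unfolding Lp_norm_inf by (rule esssup_AE)+
  then have "AE z in lborel. ennreal \<bar>f z\<bar> <= Lp_norm \<infinity> g + Lp_norm \<infinity> (%z. f z - g z)"
  proof eventually_elim
    case (elim z)
    have "ennreal \<bar>f z\<bar> <= ennreal (\<bar>g z\<bar> + \<bar>f z - g z\<bar>)" by (rule ennreal_leI) linarith
    also have "... = ennreal \<bar>g z\<bar> + ennreal \<bar>f z - g z\<bar>" by simp
    also have "... <= Lp_norm \<infinity> g + Lp_norm \<infinity> (%z. f z - g z)" using elim by (rule add_mono)
    finally show ?case .
  qed
  then show ?thesis by (subst (1) Lp_norm_inf) (intro esssup_I, auto)
qed

text \<open>A mild solution is known to be measurable at each time separately, whereas Fubini
  requires joint measurability. Sampling at grid times near \<open>t\<close> gives jointly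
  measurable approximations, and continuity in L^infinity makes them converge almost everywhere
  along the full sequence.\<close>

lemma measurable_version:
  assumes c: "continuous_on_Lp \<infinity> {0<..} \<omega>"
  shows "\<exists>W. joint_borel lborel W \<and> (\<forall>t>0. AE z in lborel. \<omega> t z = W t z)"
proof -
  have m[measurable]: "\<omega> t \<in> borel_measurable borel" if "t > 0" for t using c that by (simp add: continuous_on_Lp_def in_Lp_def)
  \<comment> \<open>\<open>max 1 k\<close> keeps the sampling times positive for every integer
    \<open>k\<close>, as measurability of \<open>\<omega>\<close> is available there; for
    \<open>t > 0\<close> the index in use is at least 1.\<close>
  define q where "q n k = real_of_int (max 1 k) / real (Suc n)" for n k
  have q0: "q n k > 0" for n k by (simp add: q_def)
  define V where "V n t z = \<omega> (q n \<lceil>real (Suc n) * t\<rceil>) z" for n t z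
  have Vm[measurable]: "(%p. V n (fst p) (snd p)) \<in> borel_measurable (lborel \<Otimes>\<^sub>M lborel)" for n
    unfolding V_def
  proof (rule measurable_compose_countable[where f = "%k p. \<omega> (q n k) (snd p)"])
    show "(%p. \<omega> (q n k) (snd p)) \<in> borel_measurable (lborel \<Otimes>\<^sub>M lborel)" for k
      by (rule measurable_compose[OF measurable_snd]) (simp add: m q0)
    show "(%p. \<lceil>real (Suc n) * fst p\<rceil>) \<in> measurable (lborel \<Otimes>\<^sub>M lborel) (count_space UNIV)" by measurable
  qed
  show ?thesis
  proof (intro exI[of _ "%t z. lim (%n. V n t z)"] conjI allI impI)
    show "(%(t, z). lim (%n. V n t z)) \<in> borel_measurable (lborel \<Otimes>\<^sub>M lborel)" unfolding split_beta' by measurable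
    fix t :: real assume t: "t > 0"
    define p where "p n = q n \<lceil>real (Suc n) * t\<rceil>" for n
    have p: "p n > 0" "\<bar>p n - t\<bar> <= 1 / real (Suc n)" for n
    proof -
      have "\<lceil>real (Suc n) * t\<rceil> >= 1" using t by simp
      then have pn: "p n = real_of_int \<lceil>real (Suc n) * t\<rceil> / real (Suc n)" by (simp add: p_def q_def max_def)
      have "t <= k / N \<and> k / N <= t + 1 / N" if "N > 0" "N * t <= k" "k <= N * t + 1" for k N :: real
        using that by (simp add: field_simps)
      from this[of "real (Suc n)" "real_of_int \<lceil>real (Suc n) * t\<rceil>"] have "t <= p n \<and> p n <= t + 1 / real (Suc n)"
        unfolding pn by linarith
      then show "\<bar>p n - t\<bar> <= 1 / real (Suc n)" by simp
    qed (simp add: p_def q0)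
    have lim: "(%n. Lp_norm \<infinity> (%z. \<omega> (p n) z - \<omega> t z)) \<longlonglongrightarrow> 0"
    proof (rule tendsto_0_ennrealI)
      fix e :: real assume e: "e > 0"
      have "((%s. Lp_norm \<infinity> (%z. \<omega> s z - \<omega> t z)) \<longlongrightarrow> 0) (at t within {0<..})" using c t by (simp add: continuous_on_Lp_def)
      then have "\<forall>\<^sub>F s in at t within {0<..}. Lp_norm \<infinity> (%z. \<omega> s z - \<omega> t z) < ennreal e" using e by (intro order_tendstoD) auto
      then obtain d where d: "d > 0" "!!s. s > 0 ==> s ~= t ==> dist s t < d ==> Lp_norm \<infinity> (%z. \<omega> s z - \<omega> t z) < ennreal e"
        by (auto simp: eventually_at)
      have "\<forall>\<^sub>F n in sequentially. 1 / real (Suc n) < d"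
        by (rule order_tendstoD(2)[OF LIMSEQ_Suc[OF lim_1_over_n] d(1)])
      then show "\<forall>\<^sub>F n in sequentially. Lp_norm \<infinity> (%z. \<omega> (p n) z - \<omega> t z) <= ennreal e"
      proof eventually_elim
        case (elim n)
        show ?case
        proof (cases "p n = t")
          case True
          then show ?thesis using Lp_norm_inf_le_iff[of "%z. 0" e] by simp
        next
          case False
          then show ?thesis using d(2)[of "p n"] p[of n] elim by (simp add: dist_real_def less_imp_le)
        qed
      qed
    qed
    have "AE z in lborel. \<forall>n. ennreal \<bar>\<omega> (p n) z - \<omega> t z\<bar> <= Lp_norm \<infinity> (%z. \<omega> (p n) z - \<omega> t z)"
      unfolding AE_all_countable Lp_norm_inf by (intro allI esssup_AE)
    then show "AE z in lborel. \<omega> t z = lim (%n. V n t z)"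
    proof eventually_elim
      case (elim z)
      have "(%n. ennreal \<bar>\<omega> (p n) z - \<omega> t z\<bar>) \<longlonglongrightarrow> 0" by (rule tendsto_0_le_ennreal[OF _ lim]) (use elim in blast)
      then have "(%n. \<bar>\<omega> (p n) z - \<omega> t z\<bar>) \<longlonglongrightarrow> 0" by (subst (asm) ennreal_tendsto_0_iff) auto
      then have "(%n. V n t z) \<longlonglongrightarrow> \<omega> t z" unfolding V_def p_def[symmetric] by (simp add: LIM_zero_cancel tendsto_rabs_zero_iff)
      then show ?case by (simp add: limI)
    qed
  qed
qed

lemma tame_shift:
  assumes F: "tame A e a t0 T F" and "A <= A'" "a <= a'" "T' <= T - c" "s0 = t0 - c"
  shows "tame A' e a' s0 T' (%s. F (s + c))"
  unfolding tame_def
proof (intro conjI allI impI)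
  note [measurable] = tameD(1)[OF F]
  show "(%(t, z). F (t + c) z) \<in> borel_measurable (lborel \<Otimes>\<^sub>M lborel)"
    using measurable_compose[OF _ tameD(1)[OF F], of "%p. (fst p + c, snd p)"] by (simp add: split_beta')
  fix s assume s: "s0 < s" "s <= T'"
  have sc: "t0 < s + c" "s + c <= T" using s assms by auto
  show "L1n (F (s + c)) <= ennreal a'" using tameD(3)[OF F sc] assms(3) by (meson ennreal_leI order_trans)
  show "inv_pot (F (s + c)) z <= ennreal (A' + e / sqrt (s - s0))" for z
    by (rule order_trans[OF tameD(4)[OF F sc]]) (use assms in \<open>auto intro!: ennreal_leI simp: algebra_simps\<close>)
qed

lemma drift_shift: "drift nu (%s. F (s + c)) (t0 - c) (t - c) z = drift nu F t0 t z"
proof -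
  have "drift nu F t0 t z = (LI s. indicator {t0<..<t} (c + 1 * s) * Sd nu (t - (c + 1 * s)) (adv (F (c + 1 * s))) z)"
    unfolding drift_def by (subst lborel_integral_real_affine[where c = 1 and t = c]) simp_all
  also have "... = drift nu (%s. F (s + c)) (t0 - c) (t - c) z"
    unfolding drift_def by (intro Bochner_Integration.integral_cong[OF refl]) (auto simp: indicator_def algebra_simps)
  finally show ?thesis ..
qed

lemma excess_cong_AE: "AE z in lborel. f z = g z ==> excess k f = excess k g"
  unfolding excess_def cvx_int_def by (rule nn_integral_cong_AE) (elim eventually_mono, simp)

context flow
begin

text \<open>The difficulty sits at time 0: continuity gives no rate at which the supremum norm of
  \<open>\<omega>\<close> may blow up, so \<open>\<omega>\<close> is not known to be tame from time
  0 on. The rate is borrowed from solutions constructed with initial values at positive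
  times.\<close>

lemma mild_unique:
  assumes sol: "global_mild_solution nu w \<omega>" and t: "t >= 0"
  shows "AE z in lborel. \<omega> t z = F t z"
proof -
  have c1: "continuous_on_Lp 1 {0..} \<omega>" and ci: "continuous_on_Lp \<infinity> {0<..} \<omega>" and w0: "AE z in lborel. \<omega> 0 z = w z"
    and ms: "mild_solution nu \<infinity> \<omega>" using sol by (auto simp: global_mild_solution_def)
  obtain W where Wm[measurable]: "joint_borel lborel W" and \<omega>W: "!!t. t > 0 ==> AE z in lborel. \<omega> t z = W t z"
    using measurable_version[OF ci] by blast
  have Wm2[measurable]: "borel_fun (W t)" for t
    using measurable_compose[OF _ Wm, of "%z. (t, z)" borel] by simp
  have \<omega>m[measurable]: "\<omega> t \<in> borel_measurable borel" if "t >= 0" for t using c1 that by (simp add: continuous_on_Lp_def in_Lp_def)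
  note [measurable] = w measurable_flow(2)
  \<comment> \<open>The spatial integrals depend on classes only, so at each fixed \<open>s\<close>
    the solution can be replaced by its jointly measurable version.\<close>
  have mildW: "AE z in lborel. W t z = S nu (t - t0) (W t0) z - drift nu W t0 t z" if t: "0 < t0" "t0 < t" for t0 t
  proof -
    have t': "t - t0 > 0" "t > 0" using t by auto
    have S: "S nu (t - t0) (\<omega> t0) z = S nu (t - t0) (W t0) z" for z
      using S_cong_AE[OF nu t'(1) \<omega>W[OF t(1)] \<omega>m Wm2] t by simp
    have D: "(LINT s:{t0<..<t}|lborel. S_div nu (t - s) (%z'. \<omega> s z' *\<^sub>R biot_savart (\<omega> s) z') z) = drift nu W t0 t z" for z
      unfolding drift_def set_lebesgue_integral_def
    proof (rule Bochner_Integration.integral_cong[OF refl])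
      fix s
      show "indicator {t0<..<t} s *\<^sub>R S_div nu (t - s) (%z'. \<omega> s z' *\<^sub>R biot_savart (\<omega> s) z') z = indicator {t0<..<t} s * Sd nu (t - s) (adv (W s)) z"
      proof (cases "t0 < s \<and> s < t")
        case True
        then have s: "s > 0" "t - s > 0" using t by auto
        have [measurable]: "\<omega> s \<in> borel_measurable borel" using s by (intro \<omega>m) simp
        have bs: "biot_savart (\<omega> s) z' = biot_savart (W s) z'" for z'
          unfolding biot_savart_eq
        proof (rule integral_cong_AE)
          show "AE y in lborel. \<omega> s y *\<^sub>R bs_kernel (z' - y) = W s y *\<^sub>R bs_kernel (z' - y)"
            using \<omega>W[OF s(1)] by eventually_elim simp
        qed measurable
        have ae: "AE z' in lborel. \<omega> s z' *\<^sub>R biot_savart (W s) z' = adv (W s) z'"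
          using \<omega>W[OF s(1)] by eventually_elim (simp add: adv_def)
        have "Sd nu (t - s) (%z'. \<omega> s z' *\<^sub>R biot_savart (\<omega> s) z') z = Sd nu (t - s) (adv (W s)) z"
          unfolding bs by (rule Sd_cong_AE[OF nu ae]) measurable
        then show ?thesis using True S_div_eq_Sd[OF nu s(2)] by simp
      qed auto
    qed
    have "AE z in lborel. \<omega> t z = S nu (t - t0) (\<omega> t0) z - (LINT s:{t0<..<t}|lborel. S_div nu (t - s) (%z'. \<omega> s z' *\<^sub>R biot_savart (\<omega> s) z') z)"
      using ms t unfolding mild_solution_def by simp
    then show ?thesis using \<omega>W[OF t'(2)] unfolding S D by eventually_elim simp
  qed
  have L1\<omega>: "\<exists>m\<ge>0. \<forall>s\<in>{0..v}. L1n (\<omega> s) <= ennreal m" if "v >= 0" for v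
  proof (rule locally_bounded_on_interval[where J = "{0..}" and N = "%s t. L1n (%z. \<omega> s z - \<omega> t z)"])
    show "L1n (\<omega> s) <= L1n (\<omega> t) + L1n (%z. \<omega> s z - \<omega> t z)" if "s \<in> {0..}" "t \<in> {0..}" for s t
      using that by (intro L1n_le_add) auto
  qed (use c1 that in \<open>auto simp: continuous_on_Lp_def in_Lp_def Lp_norm_1\<close>)
  have Linf\<omega>: "\<exists>m\<ge>0. \<forall>s\<in>{u..v}. Lp_norm \<infinity> (\<omega> s) <= ennreal m" if "0 < u" "u <= v" for u v
  proof (rule locally_bounded_on_interval[where J = "{0<..}" and N = "%s t. Lp_norm \<infinity> (%z. \<omega> s z - \<omega> t z)"])
    show "Lp_norm \<infinity> (\<omega> s) <= Lp_norm \<infinity> (\<omega> t) + Lp_norm \<infinity> (%z. \<omega> s z - \<omega> t z)" if "s \<in> {0<..}" "t \<in> {0<..}" for s t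
      using that by (intro Lp_norm_inf_triangle \<omega>m) auto
  qed (use ci that in \<open>auto simp: continuous_on_Lp_def in_Lp_def\<close>)
  \<comment> \<open>On compact intervals of positive times both norms are bounded by continuity, so
    \<open>W\<close> is tame with any \<open>e\<close>. The constants obtained here enter the
    argument through the stability constant only.\<close>
  have tameW: "\<exists>A\<ge>0. \<exists>a2. \<forall>e\<ge>0. tame A e a2 t0 T W" if t0: "0 < t0" "t0 <= T" for t0 T
  proof -
    obtain a2 where a2: "a2 >= 0" "!!s. 0 <= s ==> s <= T ==> L1n (\<omega> s) <= ennreal a2" using L1\<omega>[of T] t0 by auto
    obtain m where m: "m >= 0" "!!s. t0 <= s ==> s <= T ==> Lp_norm \<infinity> (\<omega> s) <= ennreal m" using Linf\<omega>[OF t0] by auto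
    show ?thesis
    proof (rule exI[of _ "16 * m + a2"], rule conjI[rotated], rule exI[of _ a2], intro allI impI)
      fix e :: real assume e: "e >= 0"
      show "tame (16 * m + a2) e a2 t0 T W" unfolding tame_def
      proof (intro conjI allI impI)
        fix s assume s: "t0 < s" "s <= T"
        then have s0: "s > 0" using t0 by simp
        show L: "L1n (W s) <= ennreal a2" using a2(2)[of s] s s0 L1n_cong_AE[OF \<omega>W[OF s0]] by simp
        have "AE z in lborel. ennreal \<bar>\<omega> s z\<bar> <= ennreal m" using m(2)[of s] s s0 by (subst Lp_norm_inf_le_iff[symmetric]) auto
        then have b: "AE z in lborel. \<bar>W s z\<bar> <= m" using \<omega>W[OF s0] by eventually_elim (use m(1) in simp)
        show "inv_pot (W s) z <= ennreal (16 * m + a2 + e / sqrt (s - t0))" for z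
        proof -
          have "inv_pot (W s) z <= ennreal (16 * 1 * m + a2 / 1)" by (rule inv_pot_bound[OF Wm2 b m(1) _ L a2(1)]) simp
          also have "... <= ennreal (16 * m + a2 + e / sqrt (s - t0))" using e s by (intro ennreal_leI) simp
          finally show ?thesis .
        qed
      qed (rule Wm)
    qed (use m a2 in simp)
  qed
  \<comment> \<open>\<open>G\<close> is constructed from the value \<open>W t0\<close>. The shift of
    \<open>W\<close> by \<open>t0\<close> solves the same Duhamel formula, so the residual
    difference vanishes, stability identifies the two, and \<open>W\<close> inherits the bounds of
    \<open>G\<close>.\<close>
  have restart: "L1n (W (t0 + \<tau>)) <= ennreal a1 \<and> (AE z in lborel. \<bar>W (t0 + \<tau>) z\<bar> <= 4 * a1 / (nu * \<tau>)) \<and> (\<forall>k\<ge>0. excess k (W (t0 + \<tau>)) <= excess k (W t0))"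
    if t0: "t0 > 0" and \<tau>: "\<tau> > 0" and a1: "a1 > 0" "L1n (W t0) <= ennreal a1" for t0 \<tau> a1
  proof -
    obtain G where G: "decaying nu a1 (W t0) G" "G 0 = W t0" and Gmild: "!!t0 t. 0 <= t0 ==> t0 < t ==> AE z in lborel. G t z = S nu (t - t0) (G t0) z - drift nu G t0 t z"
      using existence[OF nu a1(1) Wm2 a1(2)] by blast
    obtain e where e: "e > 0" "!!A. A >= 0 ==> \<exists>K. stable_const nu \<tau> e A K" using stability[OF nu \<tau>] by blast
    have "L1n (W t0) < \<infinity>" using a1(2) by (rule le_less_trans) simp
    from decaying_tame[OF nu a1(1) Wm2 this e(1)] obtain A1 where A1: "A1 >= 0" "tame A1 e a1 0 \<tau> G" using G(1) by blast
    have "t0 <= t0 + \<tau>" using \<tau> by simp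
    then obtain A2 a2 where A2': "A2 >= 0" "\<forall>e\<ge>0. tame A2 e a2 t0 (t0 + \<tau>) W" using tameW[OF t0] by blast
    then have A2: "A2 >= 0" "tame A2 e a2 t0 (t0 + \<tau>) W" using e(1) by auto
    define V where "V s = W (s + t0)" for s
    have tV: "tame (max A1 A2) e (max a1 a2) 0 \<tau> V" unfolding V_def by (rule tame_shift[OF A2(2)]) auto
    have tG: "tame (max A1 A2) e (max a1 a2) 0 \<tau> G" using tame_shift[OF A1(2), of "max A1 A2" "max a1 a2" \<tau> 0 0] by simp
    obtain K where K: "stable_const nu \<tau> e (max A1 A2) K" using e(2)[of "max A1 A2"] A1(1) by (auto simp: le_max_iff_disj)
    have "L1n (%z. V \<tau> z - G \<tau> z) <= ennreal K * 0"
    proof (rule stable_constD[OF K tV tG])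
      fix s assume s: "0 < s" "s <= \<tau>"
      have "drift nu V 0 s z = drift nu W t0 (s + t0) z" for z using drift_shift[of nu W t0 t0 "s + t0" z] by (simp add: V_def[abs_def])
      then have "AE z in lborel. (V s z + drift nu V 0 s z) - (G s z + drift nu G 0 s z) = 0"
        using mildW[of t0 "s + t0"] Gmild[OF order_refl s(1)] t0 s by (auto simp: V_def G(2) elim!: eventually_elim2)
      from L1n_cong_AE[OF this] show "L1n (%z. (V s z + drift nu V 0 s z) - (G s z + drift nu G 0 s z)) <= 0" by simp
    qed (use \<tau> in auto)
    then have "AE z in lborel. V \<tau> z - G \<tau> z = 0" using decaying_measurable(2)[OF G(1)] by (subst L1n_0_iff[symmetric]) (auto simp: V_def)
    then have eq: "AE z in lborel. W (t0 + \<tau>) z = G \<tau> z" by eventually_elim (simp add: V_def add.commute)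
    have "AE z in lborel. \<bar>G \<tau> z\<bar> <= 4 * a1 / (nu * \<tau>)" using G(1) \<tau> by (simp add: decaying_def)
    then have "AE z in lborel. \<bar>W (t0 + \<tau>) z\<bar> <= 4 * a1 / (nu * \<tau>)" using eq by eventually_elim simp
    then show ?thesis using G(1) \<tau> by (simp add: decaying_def L1n_cong_AE[OF eq] excess_cong_AE[OF eq])
  qed
  have W0: "\<exists>d>0. \<forall>s. 0 < s --> s < d --> L1n (%z. W s z - w z) <= ennreal e" if e: "e > 0" for e
  proof -
    have "((%s. L1n (%z. \<omega> s z - \<omega> 0 z)) \<longlongrightarrow> 0) (at 0 within {0..})" using c1 by (simp add: continuous_on_Lp_def Lp_norm_1)
    then have "\<forall>\<^sub>F s in at 0 within {0..}. L1n (%z. \<omega> s z - \<omega> 0 z) < ennreal e" using e by (intro order_tendstoD) auto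
    then obtain d where d: "d > 0" "!!s. 0 < s ==> s < d ==> L1n (%z. \<omega> s z - \<omega> 0 z) < ennreal e"
      by (auto simp: eventually_at dist_real_def)
    have "L1n (%z. W s z - w z) <= ennreal e" if s: "0 < s" "s < d" for s
    proof -
      have "AE z in lborel. W s z - w z = \<omega> s z - \<omega> 0 z" using \<omega>W[OF s(1)] w0 by eventually_elim simp
      from L1n_cong_AE[OF this] show ?thesis using d(2)[OF s] by simp
    qed
    then show ?thesis using d(1) by blast
  qed
  \<comment> \<open>A restart at some \<open>t0 <= t / 2\<close> with mass at most
    \<open>a + 1\<close> bounds \<open>4 * (a + 1) / (nu * (t - t0))\<close> by
    \<open>4 * a' / (nu * t)\<close>.\<close>
  define a' where "a' = 2 * (a + 1)"
  have a': "a' > 0" "a <= a'" "a + 1 <= a'" using a by (auto simp: a'_def)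
  have Wdec: "decaying nu a' w W"
    unfolding decaying_def
  proof (intro conjI allI impI Wm)
    fix t :: real assume t: "t > 0"
    have *: "\<exists>t0>0. t0 <= t / 2 \<and> L1n (%z. W t0 z - w z) <= ennreal e \<and> L1n (W t0) <= ennreal (a + 1)" if e: "0 < e" "e <= 1" for e
    proof -
      obtain d where d: "d > 0" "!!s. 0 < s ==> s < d ==> L1n (%z. W s z - w z) <= ennreal e" using W0[OF e(1)] by blast
      define t0 where "t0 = min (d / 2) (t / 2)"
      have t0: "0 < t0" "t0 < d" "t0 <= t / 2" using d t by (auto simp: t0_def)
      have "L1n (W t0) <= L1n w + L1n (%z. W t0 z - w z)" by (rule L1n_le_add) measurable
      also have "... <= ennreal a + ennreal 1" using d(2)[OF t0(1,2)] e by (intro add_mono wa) (auto intro: order_trans ennreal_leI)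
      also have "... = ennreal (a + 1)" using a by simp
      finally show ?thesis using d(2)[OF t0(1,2)] t0 by blast
    qed
    obtain t0 where t0: "t0 > 0" "t0 <= t / 2" "L1n (W t0) <= ennreal (a + 1)" using *[of 1] by auto
    have R: "L1n (W t) <= ennreal (a + 1)" "AE z in lborel. \<bar>W t z\<bar> <= 4 * (a + 1) / (nu * (t - t0))"
      using restart[OF t0(1) _ _ t0(3), of "t - t0"] a t t0 by auto
    show "L1n (W t) <= ennreal a'" using R(1) a' by (meson ennreal_leI order_trans)
    have "4 * (a + 1) / (nu * (t - t0)) <= 4 * (a + 1) / (nu * (t / 2))" using a nu t t0 by (intro divide_left_mono mult_left_mono) auto
    also have "... = 4 * a' / (nu * t)" by (simp add: a'_def)
    finally have "4 * (a + 1) / (nu * (t - t0)) <= 4 * a' / (nu * t)" .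
    then show "AE z in lborel. \<bar>W t z\<bar> <= 4 * a' / (nu * t)" using R(2) by (auto elim!: eventually_mono)
    fix k :: real assume k: "k >= 0"
    \<comment> \<open>The restart time now depends on \<open>n\<close>: after \<open>t1\<close> the
      excess does not grow, and at \<open>t1\<close> it exceeds that of \<open>w\<close> by at most
      the L^1 distance to \<open>w\<close>.\<close>
    show "excess k (W t) <= excess k w"
    proof (rule ennreal_le_geometric)
      fix n
      have "(1 / 2) ^ n <= (1::real)" by (rule power_le_one) auto
      then obtain t1 where t1: "t1 > 0" "t1 <= t / 2" "L1n (%z. W t1 z - w z) <= ennreal ((1 / 2) ^ n)" "L1n (W t1) <= ennreal (a + 1)"
        using *[of "(1 / 2) ^ n"] by auto
      have "excess k (W t) <= excess k (W t1)" using restart[OF t1(1) _ _ t1(4), of "t - t1"] a t t1 k by auto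
      also have "... <= excess k w + L1n (%z. W t1 z - w z)" by (rule excess_lipschitz) measurable
      also have "... <= excess k w + ennreal (1 * (1 / 2) ^ n)" using t1(3) by (simp add: add_left_mono)
      finally show "excess k (W t) <= excess k w + ennreal (1 * (1 / 2) ^ n)" .
    qed
  qed
  have Fdec: "decaying nu a' w F"
    unfolding decaying_def
  proof (intro conjI allI impI)
    fix s :: real assume s: "s > 0"
    show "L1n (F s) <= ennreal a'" using L1[of s] s a' by (meson ennreal_leI less_imp_le order_trans)
    have "\<bar>F s z\<bar> <= 4 * a' / (nu * s)" for z
      using bnd[OF s, of z] a' nu s by (elim order_trans) (auto intro!: divide_right_mono)
    then show "AE z in lborel. \<bar>F s z\<bar> <= 4 * a' / (nu * s)" by simp
    show "excess k (F s) <= excess k w" if "k >= 0" for k using dec s that by (simp add: decaying_def)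
  qed (rule measurable_flow)
  show ?thesis
  proof (cases "t = 0")
    case False
    then have t: "t > 0" using t by simp
    obtain e where e: "e > 0" "!!A. A >= 0 ==> \<exists>K. stable_const nu t e A K" using stability[OF nu t] by blast
    have "L1n w < \<infinity>" using wa by (rule le_less_trans) simp
    from decaying_tame[OF nu a'(1) w this e(1)] obtain A where A: "A >= 0" "!!F t0 T. decaying nu a' w F ==> 0 <= t0 ==> tame A e a' t0 T F" by blast
    obtain K where K: "stable_const nu t e A K" using e(2)[OF A(1)] by blast
    then have K0: "K >= 0" by (simp add: stable_const_def)
    \<comment> \<open>\<open>K\<close> does not depend on the starting time, so the distance at time
      \<open>t\<close> is controlled by the distance at arbitrarily small times, where both
      solutions are close to \<open>w\<close>.\<close>
    have "L1n (%z. W t z - F t z) <= 0"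
    proof (rule ennreal_le_geometric)
      fix n
      define \<eta> where "\<eta> = (1 / 2 :: real) ^ n"
      have \<eta>: "\<eta> > 0" by (simp add: \<eta>_def)
      obtain d1 where d1: "d1 > 0" "!!s. 0 < s ==> s < d1 ==> L1n (%z. W s z - w z) <= ennreal \<eta>" using W0[OF \<eta>] by blast
      obtain d2 where d2: "d2 > 0" "!!s. 0 < s ==> s < d2 ==> L1n (%z. F s z - w z) <= ennreal (2 * \<eta>)" using near_0[OF \<eta>] by blast
      define t0 where "t0 = min (t / 2) (min d1 d2 / 2)"
      have t0: "0 < t0" "t0 < d1" "t0 < d2" "t0 < t" using d1(1) d2(1) t by (auto simp: t0_def)
      have i: "integrable lborel (W t0)" "integrable lborel (F t0)"
        using Wdec t0 integrable_of_L1n[OF Wm2] integrable_flow by (auto simp: decaying_def)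
      have "L1n (%z. W t z - F t z) <= ennreal K * L1n (%z. W t0 z - F t0 z)"
      proof (rule stable_constD[OF K A(2)[OF Wdec] A(2)[OF Fdec]])
        fix r assume r: "t0 < r" "r <= t"
        have "AE z in lborel. (W r z + drift nu W t0 r z) - (F r z + drift nu F t0 r z) = S nu (r - t0) (W t0) z - S nu (r - t0) (F t0) z"
          using mildW[OF t0(1) r(1)] mild[of t0 r] t0 r by (auto elim!: eventually_elim2)
        from L1n_cong_AE[OF this] show "L1n (%z. (W r z + drift nu W t0 r z) - (F r z + drift nu F t0 r z)) <= L1n (%z. W t0 z - F t0 z)"
          using S_diff_L1n[OF nu _ i, of "r - t0"] r by simp
      qed (use t0 in auto)
      also have "... <= ennreal K * (L1n (%z. W t0 z - w z) + L1n (%z. w z - F t0 z))"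
        by (intro mult_left_mono L1n_diff_triangle) simp_all
      also have "... <= ennreal K * (ennreal \<eta> + ennreal (2 * \<eta>))"
        using d1(2)[OF t0(1,2)] d2(2)[OF t0(1,3)] by (intro mult_left_mono add_mono) (simp_all add: L1n_minus_commute[of w])
      also have "... = 0 + ennreal (3 * K * (1 / 2) ^ n)"
        using K0 \<eta> by (simp add: ennreal_plus[symmetric] ennreal_mult[symmetric] \<eta>_def[symmetric] mult_ac del: ennreal_plus)
      finally show "L1n (%z. W t z - F t z) <= 0 + ennreal (3 * K * (1 / 2) ^ n)" .
    qed
    then have "AE z in lborel. W t z - F t z = 0" by (subst L1n_0_iff[symmetric]) auto
    then show ?thesis using \<omega>W[OF t] by eventually_elim simp
  qed (use w0 in \<open>simp add: F0\<close>)
qed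

end

theorem theorem1p1:
  shows "\<exists>C>0. \<forall>\<nu>>0. \<forall>\<omega>0. in_Lp 1 \<omega>0 \<longrightarrow>
    (\<exists>\<omega>. global_mild_solution \<nu> \<omega>0 \<omega> \<and>
      (\<forall>\<omega>'. global_mild_solution \<nu> \<omega>0 \<omega>' \<longrightarrow>
        (\<forall>t\<ge>0. AE z in lborel. \<omega>' t z = \<omega> t z)) \<and>
      antimono_on {0..} (\<lambda>t. Lp_norm 1 (\<omega> t)) \<and>
      (\<forall>p t. 1 \<le> p \<and> 0 < t \<longrightarrow>
        Lp_norm p (\<omega> t) \<le> ennreal (C * (\<nu> * t) powr (enn2real (1 / p) - 1)) * Lp_norm 1 \<omega>0))"
proof (rule exI[of _ 4], intro conjI allI impI)
  fix nu :: real and \<omega>0 :: "real \<times> real => real"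
  assume nu: "nu > 0" and "in_Lp 1 \<omega>0"
  then have m: "\<omega>0 \<in> borel_measurable borel" and fin: "L1n \<omega>0 < \<infinity>" by (auto simp: in_Lp_def Lp_norm_1)
  obtain x where x: "L1n \<omega>0 = ennreal x" "x >= 0" using fin by (cases "L1n \<omega>0") auto
  \<comment> \<open>\<open>existence\<close> asks for \<open>a > 0\<close>, so zero data get
    \<open>a = 1\<close>. The estimate then has right-hand side 0 and is recovered from the
    monotonicity of the mass.\<close>
  define a where "a = (if x = 0 then 1 else x)"
  have a: "a > 0" "L1n \<omega>0 <= ennreal a" using x by (auto simp: a_def)
  obtain F where F: "decaying nu a \<omega>0 F \<and> F 0 = \<omega>0 \<and> (\<forall>t>0. \<forall>z. \<bar>F t z\<bar> <= 4 * a / (nu * t)) \<and> (\<forall>s t. 0 <= s --> s <= t --> L1n (F t) <= L1n (F s)) \<and>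
    (\<forall>t0 t. 0 <= t0 --> t0 < t --> (AE z in lborel. F t z = S nu (t - t0) (F t0) z - drift nu F t0 t z))"
    using existence[OF nu a(1) m a(2)] by blast
  interpret flow nu a \<omega>0 F by unfold_locales (use nu a m F in auto)
  note [measurable] = measurable_flow(2)
  show "\<exists>\<omega>. global_mild_solution nu \<omega>0 \<omega> \<and>
      (\<forall>\<omega>'. global_mild_solution nu \<omega>0 \<omega>' --> (\<forall>t\<ge>0. AE z in lborel. \<omega>' t z = \<omega> t z)) \<and>
      antimono_on {0..} (%t. Lp_norm 1 (\<omega> t)) \<and>
      (\<forall>p t. 1 <= p \<and> 0 < t -->
        Lp_norm p (\<omega> t) <= ennreal (4 * (nu * t) powr (enn2real (1 / p) - 1)) * Lp_norm 1 \<omega>0)"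
  proof (intro exI[of _ F] conjI allI impI; (elim conjE)?)
    show "global_mild_solution nu \<omega>0 F"
      using continuous_L1 continuous_Linf mild_solution_flow by (simp add: global_mild_solution_def F0)
    show "AE z in lborel. \<omega>' t z = F t z" if "global_mild_solution nu \<omega>0 \<omega>'" "t >= 0" for \<omega>' t
      using that by (rule mild_unique)
    show "antimono_on {0..} (%t. Lp_norm 1 (F t))" by (auto simp: monotone_on_def Lp_norm_1 mono)
    fix p t assume p: "(1::ennreal) <= p" and t: "(0::real) < t"
    show "Lp_norm p (F t) <= ennreal (4 * (nu * t) powr (enn2real (1 / p) - 1)) * Lp_norm 1 \<omega>0"
    proof (cases "x = 0")
      case True
      then have "L1n (F t) = 0" using mono[of 0 t] t x by (simp add: F0)
      then have z: "AE z in lborel. F t z = 0" by (simp add: L1n_0_iff)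
      have "Lp_norm p (F t) <= 0"
      proof (cases "p = \<infinity>")
        case True
        have "AE z in lborel. ennreal \<bar>F t z\<bar> <= ennreal 0" using z by eventually_elim simp
        then show ?thesis using True Lp_norm_inf_le_iff[of "F t" 0] by simp
      next
        case False
        have "(NN z. ennreal (\<bar>F t z\<bar> powr enn2real p)) = (\<integral>\<^sup>+ z. 0 \<partial>(lborel :: (real \<times> real) measure))"
          by (rule nn_integral_cong_AE) (use z in eventually_elim, simp)
        then show ?thesis using False by (simp add: Lp_norm_def Let_def)
      qed
      then show ?thesis by simp
    next
      case False
      then have "Lp_norm 1 \<omega>0 = ennreal a" using x by (simp add: a_def Lp_norm_1)
      moreover have "Lp_norm p (F t) <= ennreal (4 * (nu * t) powr (enn2real (1 / p) - 1)) * ennreal a"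
        by (rule Lp_norm_interpolation) (use nu t a L1[of t] bnd[OF t] p in auto)
      ultimately show ?thesis by simp
    qed
  qed
qed simp

end
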